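(* Let $p,q,r\in\mathbb{N}_0$ with $p\ge0$ and $r>1$, let $a\in\mathbb{C}\setminus\{0\}$ with a fixed argument $\arg a$, let $z_0\in\mathbb{C}\setminus\{0\}$, and let $\varphi\in\mathcal{O}(D)$ satisfy $\varphi\in\mathcal{O}^{\frac{r}{p-1+r}}\bigl(\widetilde{\mathbb{C}\setminus\{z_0\}}\bigr)$. Let $\widehat u(t,z)=\sum_{n\ge0}u_n(z)t^n$, $u_n\in\mathcal{O}(D)$, be the unique formal power series solution of the Cauchy problem $$\partial_t u(t,z)=a(\partial_t t)^p\,t^q\,\partial_z^r u(t,z),\qquad u(0,z)=\varphi(z).$$ Let $m(u)=\Gamma\bigl(1+\tfrac{ru}{q+1}\bigr)\bigl(\Gamma(1+\tfrac{u}{q+1})\bigr)^{p-1}$ and let $e_m$ be the corresponding kernel function of order $\frac{q+1}{p-1+r}$. Then for every nonsingular direction $d$, $\widehat u(t,z)$ is $\frac{q+1}{p-1+r}$-summable in the direction $d$, and for every $\varepsilon>0$ there exists $\tilde r>0$ such that its $\frac{q+1}{p-1+r}$-sum $u\in\mathcal{O}\bigl(S_d(\pi\tfrac{p-1+r}{q+1}-\varepsilon,\tilde r)\times D\bigr)$ is given by $$u(t,z)=u^d(t,z)=(T_{m,d}\,\widehat{\mathcal{B}}_m\widehat u)(t,z)=\frac1r\int_{e^{id}\mathbb{R}_+}e_m(s/t)\sum_{j=0}^{r-1}\varphi\Bigl(z+e^{\frac{2\pi j}{r}i}a^{\frac1r}(q+1)^{\frac{p-1}{r}}s^{\frac{q+1}{r}}\Bigr)\frac{ds}{s}.$$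 Moreover, if $\theta_z:=\arg(z_0-z)$ and $\delta_l:=\frac{r\theta_z-2\pi l-\arg a}{q+1}$ for $l=0,1,\ldots,r-1$, then the sets $\mathcal{L}_{\delta_l}$ are Stokes lines for $\widehat u(t,z)$, and for every sufficiently small $\varepsilon>0$ there exists $\tilde r>0$ such that for every fixed $z\in D_{\tilde r}$ the jump $J_{\mathcal{L}_{\delta_l}}\widehat u(t,z)=u^{\delta_l+\varepsilon}(t,z)-u^{\delta_l-\varepsilon}(t,z)$ is given by $$J_{\mathcal{L}_{\delta_l}}\widehat u(t,z)=\Bigl[\varphi\bigl(z+e^{\frac{2\pi l}{r}i}a^{\frac1r}(q+1)^{\frac{p-1}{r}}s^{\frac{q+1}{r}}\bigr)\Bigr]_{\delta_l}\Bigl[\frac{e_m(s/t)}{rs}\Bigr].$$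
   Context: Sectors and discs. $\tilde{\mathbb{C}}$ is the universal covering space of $\mathbb{C}\setminus\{0\}$. For $d\in\mathbb{R}$, $\alpha>0$, $R>0$, $S_d(\alpha,R)=\{z\in\tilde{\mathbb{C}}: z=\rho e^{i\phi},\ \rho\in(0,R),\ \phi\in(d-\alpha/2,d+\alpha/2)\}$; $S_d(\alpha)$ is the same with $R=+\infty$ (unbounded sector), abbreviated $S_d$ when the opening is inessential. $D_\rho=\{z\in\mathbb{C}:|z|<\rho\}$, and $D$ denotes such a disc whose radius is not essential (it may be different at different occurrences). $\widehat S_d(\alpha)=S_d(\alpha)\cup D$, abbreviated $\widehat S_d$. $\mathcal{O}(G)$ (resp. $\mathcal{O}(G,\mathbb{E})$) is the set of holomorphic functions on $G$ with values in $\mathbb{C}$ (resp. in a complex Banach space $\mathbb{E}$). Growth. For $\kappa\in\mathbb{R}$ and an unbounded sector $S$, $v\in\mathcal{O}^{\kappa}(S,\mathbb{E})$ means that $v\in\mathcal{O}(S,\mathbb{E})$ and for every proper subsector $S^*$ of $S$ (i.e. $\overline{S^*}\setminus\{0\}\subseteq S$) there are $C_1,C_2>0$ with $\|v(x)\|_{\mathbb{E}}\le C_1e^{C_2|x|^{\kappa}}$ on $S^*$; similarly for disc-sectors and for $D\cup(S_d\setminus\mathcal{L}_d)$. For a function $\varphi$ holomorphic near $0$, $\varphi\in\mathcal{O}^{\kappa}(\widetilde{\mathbb{C}\setminus\{z_0\}})$ means that $\varphi$ extends analytically to the universal covering space of $\mathbb{C}\setminus\{z_0\}$ and has exponential growth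 of order at most $\kappa$ at infinity there: for every bounded range of $\arg(z-z_0)$ and every $R>0$ there are $C_1,C_2>0$ with $|\varphi(z)|\le C_1e^{C_2|z|^{\kappa}}$ for $|z-z_0|\ge R$ and $\arg(z-z_0)$ in that range. Kernel function. With $\kappa=\frac{q+1}{p-1+r}$, the function $m(u)=\Gamma(1+\frac{ru}{q+1})(\Gamma(1+\frac{u}{q+1}))^{p-1}$ is a moment function of order $1/\kappa$. Its kernel function $e_m$ (uniquely determined by $m$) is the function $e_m\in\mathcal{O}(S_0(\pi/\kappa))$, positive on $\mathbb{R}_+$, with $e_m(z)/z$ integrable at the origin, exponentially flat of order $\kappa$ (for every $\varepsilon>0$ there are $A,B>0$ with $|e_m(z)|\le Ae^{-(|z|/B)^{\kappa}}$ on $S_0(\pi/\kappa-\varepsilon)$), and satisfying $m(u)=\int_0^\infty x^{u-1}e_m(x)\,dx$ for $\operatorname{Re}u\ge0$. Moment Borel and Laplace transforms. For a moment function $m$, $\widehat{\mathcal{B}}_m\bigl(\sum_j u_jt^j\bigr)=\sum_j\frac{u_j}{m(j)}t^j$. For $v\in\mathcal{O}^{\kappa}(\widehat S_d,\mathbb{E})$, $(T_{m,d}v)(t)=\int_{e^{id}\mathbb{R}_+}e_m(s/t)\,v(s)\,\frac{ds}{s}$. The convergent series $\widehat{\mathcal{B}}_m\widehat u$ is identified with its sum and analytic continuation. Summability. For $\kappa>0$ put $\Gamma_{1/\kappa}(u)=\Gamma(1+u/\kappa)$. A formal series $\widehat u\in\mathbb{E}[[t]]$ is $\kappa$-summable in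 a direction $d$ if there are $\varepsilon>0$ and a disc-sector $\widehat S_d(\varepsilon)$ such that $v=\widehat{\mathcal{B}}_{\Gamma_{1/\kappa}}\widehat u\in\mathcal{O}^{\kappa}(\widehat S_d(\varepsilon),\mathbb{E})$; its $\kappa$-sum in the direction $d$ is $u^d(t)=(T_{\Gamma_{1/\kappa},\theta}v)(t)$ for $\theta\in(d-\varepsilon/2,d+\varepsilon/2)$. Here $\widehat u(t,z)$ is regarded as a power series in $t$ with coefficients in a Banach space $\mathbb{E}$ of functions holomorphic on a (sufficiently small) disc $D$ (e.g. holomorphic on $D$ and continuous on $\overline D$, with the sup norm); when $z$ is fixed, $\mathbb{E}=\mathbb{C}$. "Nonsingular direction" $d$ means $d\ne\frac{r\arg z_0-2\pi l-\arg a}{q+1}$ for all $l\in\mathbb{Z}$. Stokes lines and jumps. $\widehat u$ is $\kappa$-summable if it is $\kappa$-summable in all directions except, modulo $2\pi$, finitely many, called the singular directions. For a singular direction $d$, $\mathcal{L}_d=\{t\in\tilde{\mathbb{C}}:\arg t=d\}$ is called a Stokes line for $\widehat u$, and $J_{\mathcal{L}_d}\widehat u:=u^{d^+}-u^{d^-}$ is the jump across it, where $d^+$ (resp. $d^-$) is a direction close to $d$ and greater (resp. less) than $d$, and $u^{d^\pm}$ are the $\kappa$-sums in the directions $d^\pm$. In this theorem Stokes lines and jumps are considered for each fixed $z$ near $0$ and depend on $z$ through $\theta_z$. Hyperfunctions. $[g(s)]_d$ denotes the Laplace type hyperfunction supported by $\mathcal{L}_d$ with defining function $g$, i.e. the class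 of $g$ in $\mathcal{O}^{\kappa}(D\cup(S_d\setminus\mathcal{L}_d))/\mathcal{O}^{\kappa}(\widehat S_d)$. It acts on a sufficiently rapidly decaying function $\psi$ by $[g(s)]_d[\psi(s)]:=\int_{\gamma_d}g(s)\psi(s)\,ds$, where $\gamma_d$ is the path consisting of the half-line from $e^{id^-}\infty$ to $0$ followed by the half-line from $0$ to $e^{id^+}\infty$. In the jump formula $t$ ranges over $S_{\delta_l}(\pi/\kappa,\rho)$ with $\rho>0$ sufficiently small. Branches. $(\partial_t t)$ is the operator $f\mapsto\partial_t(tf)$. $a^{1/r}=|a|^{1/r}e^{i\arg a/r}$, and $s^{\frac{q+1}{r}}=|s|^{\frac{q+1}{r}}e^{i\frac{q+1}{r}\arg s}$ with $\arg s$ equal to the direction of the ray of integration (close to $\delta_l$ in the jump formula); $\varphi$ is continued analytically from the neighbourhood of $0$ along these rays.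
   Formalization: Stokes lines are claimed only when φ has no entire extension; the jump integral is asserted on S_{δ_l}(π/κ−η,ρ_η) for every η>0, with the jump holomorphic on S_{δ_l}(π/κ,ρ); defining functions are taken on D∩S_d, bounded near 0. *)

theory Defs
  imports "HOL-Complex_Analysis.Complex_Analysis"
begin

section \<open>The covering space of the punctured plane\<close>

text \<open>
  A point of the universal covering space of the punctured plane is represented by its logarithm
  \<open>w\<close>, i.e. by the point with modulus \<open>exp (Re w)\<close> and argument \<open>Im w\<close>. A quotient \<open>s / t\<close>
  becomes a difference, the projection to the plane is \<open>exp\<close>, and since \<open>exp\<close> is locally
  biholomorphic, holomorphy on the covering space is holomorphy in \<open>w\<close>.
\<close>

definition sector :: "real \<Rightarrow> real \<Rightarrow> complex set" where
  "sector d \<alpha> = {w. \<bar>Im w - d\<bar> < \<alpha> / 2}"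

definition bounded_sector :: "real \<Rightarrow> real \<Rightarrow> real \<Rightarrow> complex set" where
  "bounded_sector d \<alpha> R = {w \<in> sector d \<alpha>. exp (Re w) < R}"

definition half_line :: "real \<Rightarrow> complex set" where
  "half_line d = {w. Im w = d}"

text \<open>The point of the covering space with modulus \<open>x\<close> and argument \<open>d\<close>, and the integral
  \<open>\<integral> f(s) ds\<close> over the half-line from \<open>0\<close> to infinity in direction \<open>d\<close>, where \<open>ds = e^(i d) dx\<close>.\<close>

definition ray_point :: "real \<Rightarrow> real \<Rightarrow> complex" where
  "ray_point d x = Complex (ln x) d"

definition ray_integrable :: "real \<Rightarrow> (complex \<Rightarrow> complex) \<Rightarrow> bool" where
  "ray_integrable d f \<longleftrightarrow> (\<lambda>x. f (ray_point d x) * cis d) absolutely_integrable_on {0<..}"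

definition ray_integral :: "real \<Rightarrow> (complex \<Rightarrow> complex) \<Rightarrow> complex" where
  "ray_integral d f = integral {0<..} (\<lambda>x. f (ray_point d x) * cis d)"


section \<open>Holomorphic functions with values in a Banach space\<close>

text \<open>
  The coefficient space \<open>A(K)\<close> for compact \<open>K\<close>, with the sup norm on \<open>K\<close>; only the values on \<open>K\<close>
  matter. For \<open>K = cball 0 R\<close> it is the space of functions holomorphic on the disc and continuous on
  its closure; for \<open>K = {z}\<close> it is the space of complex numbers (evaluation at a fixed \<open>z\<close>).
\<close>

definition A_space :: "complex set \<Rightarrow> (complex \<Rightarrow> complex) set" where
  "A_space K = {g. continuous_on K g \<and> g holomorphic_on (interior K)}"

text \<open>Complex differentiability of \<open>v\<close>, as a function of its first argument with values in \<open>A(K)\<close>,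
  at every point of the open set \<open>S\<close>: the difference quotients converge in the sup norm.\<close>

definition holomorphic_A :: "complex set \<Rightarrow> (complex \<Rightarrow> complex \<Rightarrow> complex) \<Rightarrow> complex set \<Rightarrow> bool" where
  "holomorphic_A K v S \<longleftrightarrow>
     (\<forall>w\<in>S. v w \<in> A_space K \<and>
        (\<exists>v'\<in>A_space K. uniform_limit K (\<lambda>x z. (v x z - v w z) / (x - w)) v' (at w)))"

text \<open>Holomorphy of a function of two complex variables on an open set.\<close>

definition holomorphic2_on :: "(complex \<Rightarrow> complex \<Rightarrow> complex) \<Rightarrow> (complex \<times> complex) set \<Rightarrow> bool" where
  "holomorphic2_on f S \<longleftrightarrow>
     (\<forall>P\<in>S. \<exists>A B. ((\<lambda>(t, z). f t z) has_derivative (\<lambda>(h, k). A * h + B * k)) (at P))"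

text \<open>The growth condition of order \<open>\<kappa>\<close> on every proper subsector of \<open>sector d \<alpha>\<close>.\<close>

definition growth_order ::
    "real \<Rightarrow> complex set \<Rightarrow> real \<Rightarrow> real \<Rightarrow> (complex \<Rightarrow> complex \<Rightarrow> complex) \<Rightarrow> bool" where
  "growth_order \<kappa> K d \<alpha> v \<longleftrightarrow>
     (\<forall>d' \<alpha>'. d - \<alpha> / 2 < d' - \<alpha>' / 2 \<and> d' + \<alpha>' / 2 < d + \<alpha> / 2 \<longrightarrow>
        (\<exists>C1>0. \<exists>C2>0. \<forall>w\<in>sector d' \<alpha>'. \<forall>z\<in>K.
           norm (v w z) \<le> C1 * exp (C2 * exp (Re w) powr \<kappa>)))"

text \<open>
  The space of holomorphic functions of growth order \<open>\<kappa>\<close> on the disc-sector formed by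
  \<open>sector d \<epsilon>\<close> and a disc: \<open>v\<close> is the function on the sector (in the logarithmic coordinate) and
  \<open>v0\<close> the function on the disc.
\<close>

definition disc_sector_space :: "real \<Rightarrow> complex set \<Rightarrow> real \<Rightarrow> real \<Rightarrow>
    (complex \<Rightarrow> complex \<Rightarrow> complex) \<Rightarrow> (complex \<Rightarrow> complex \<Rightarrow> complex) \<Rightarrow> bool" where
  "disc_sector_space \<kappa> K d \<epsilon> v0 v \<longleftrightarrow>
     \<epsilon> > 0 \<and> holomorphic_A K v (sector d \<epsilon>) \<and> growth_order \<kappa> K d \<epsilon> v \<and>
     (\<exists>\<rho>>0. holomorphic_A K v0 (ball 0 \<rho>) \<and>
        (\<forall>w\<in>bounded_sector d \<epsilon> \<rho>. \<forall>z\<in>K. v w z = v0 (exp w) z))"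


section \<open>Analytic continuation\<close>

text \<open>
  \<open>\<phi>\<close>, given near \<open>0\<close>, continues analytically to the universal covering space of the plane
  without \<open>z0\<close>, with growth of order \<open>\<kappa>\<close> at infinity. The point \<open>w\<close> of the covering space lies
  over \<open>z0 + exp w\<close>; the base point \<open>w0\<close> lies over \<open>0\<close>.
\<close>

definition covering_growth :: "real \<Rightarrow> complex \<Rightarrow> (complex \<Rightarrow> complex) \<Rightarrow> bool" where
  "covering_growth \<kappa> z0 \<phi> \<longleftrightarrow>
     (\<exists>\<Phi> w0. \<Phi> holomorphic_on UNIV \<and> z0 + exp w0 = 0 \<and>
        (\<forall>\<^sub>F w in nhds w0. \<Phi> w = \<phi> (z0 + exp w)) \<and>
        (\<forall>A B R. R > 0 \<longrightarrow>
           (\<exists>C1>0. \<exists>C2>0. \<forall>w. A \<le> Im w \<and> Im w \<le> B \<and> exp (Re w) \<ge> R \<longrightarrow>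
              norm (\<Phi> w) \<le> C1 * exp (C2 * norm (z0 + exp w) powr \<kappa>))))"

text \<open>The value at \<open>z + h\<close> of the analytic continuation of the germ of \<open>\<phi>\<close> at \<open>z\<close> along the
  segment from \<open>z\<close> to \<open>z + h\<close> (unique, by the identity theorem, whenever it exists).\<close>

definition continued :: "(complex \<Rightarrow> complex) \<Rightarrow> complex \<Rightarrow> complex \<Rightarrow> complex" where
  "continued \<phi> z h = (THE c. \<exists>U F. open U \<and> convex U \<and> closed_segment z (z + h) \<subseteq> U \<and>
     F holomorphic_on U \<and> (\<forall>\<^sub>F x in nhds z. F x = \<phi> x) \<and> F (z + h) = c)"


section \<open>Kernel functions, moment Borel and Laplace transforms\<close>

definition is_kernel_function :: "real \<Rightarrow> (complex \<Rightarrow> complex) \<Rightarrow> (complex \<Rightarrow> complex) \<Rightarrow> bool" where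
  "is_kernel_function \<kappa> m e \<longleftrightarrow>
     e holomorphic_on sector 0 (pi / \<kappa>) \<and>
     (\<forall>x>0. e (ray_point 0 x) \<in> \<real> \<and> Re (e (ray_point 0 x)) > 0) \<and>
     (\<forall>\<theta>. \<bar>\<theta>\<bar> < pi / (2 * \<kappa>) \<longrightarrow>
        (\<lambda>x. e (ray_point \<theta> x) / of_real x) absolutely_integrable_on {0<..1}) \<and>
     (\<forall>\<epsilon>>0. \<exists>A>0. \<exists>B>0. \<forall>w\<in>sector 0 (pi / \<kappa> - \<epsilon>).
        norm (e w) \<le> A * exp (- ((exp (Re w) / B) powr \<kappa>))) \<and>
     (\<forall>u. Re u \<ge> 0 \<longrightarrow>
        ((\<lambda>x. of_real x powr (u - 1) * e (ray_point 0 x)) has_integral m u) {0<..})"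

definition formal_borel :: "(complex \<Rightarrow> complex) \<Rightarrow> complex fps \<Rightarrow> complex fps" where
  "formal_borel m F = Abs_fps (\<lambda>n. fps_nth F n / m (of_nat n))"

text \<open>\<open>\<integral> e(s/t) v(s) ds/s\<close> over the half-line in direction \<open>d\<close>, and its absolute convergence.\<close>

definition moment_laplace ::
    "(complex \<Rightarrow> complex) \<Rightarrow> real \<Rightarrow> (complex \<Rightarrow> complex) \<Rightarrow> complex \<Rightarrow> complex" where
  "moment_laplace e d v t = ray_integral d (\<lambda>s. e (s - t) * v s / exp s)"

definition moment_laplace_converges ::
    "(complex \<Rightarrow> complex) \<Rightarrow> real \<Rightarrow> (complex \<Rightarrow> complex) \<Rightarrow> complex \<Rightarrow> bool" where
  "moment_laplace_converges e d v t \<longleftrightarrow> ray_integrable d (\<lambda>s. e (s - t) * v s / exp s)"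

definition gamma_moment :: "real \<Rightarrow> complex \<Rightarrow> complex" where
  "gamma_moment \<kappa> u = Gamma (1 + u / of_real \<kappa>)"

text \<open>The kernel function \<open>\<kappa> x^\<kappa> exp (- x^\<kappa>)\<close> of \<open>gamma_moment \<kappa>\<close>; see
  \<open>is_kernel_function_gamma_kernel\<close> below.\<close>

definition gamma_kernel :: "real \<Rightarrow> complex \<Rightarrow> complex" where
  "gamma_kernel \<kappa> w = of_real \<kappa> * exp (of_real \<kappa> * w) * exp (- exp (of_real \<kappa> * w))"


section \<open>Summability\<close>

text \<open>
  A formal power series in \<open>t\<close> with coefficients in \<open>A(K)\<close> is given by \<open>f\<close>, where \<open>f z\<close> is the
  series of the values of the coefficients at \<open>z\<close>. The following says that the moment Borel
  transform of \<open>f\<close> converges near \<open>0\<close> and that its sum continues to the function \<open>v\<close> of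
  growth order \<open>\<kappa>\<close> on a disc-sector of opening \<open>\<epsilon>\<close> in direction \<open>d\<close>.
\<close>

definition borel_continuation :: "real \<Rightarrow> (complex \<Rightarrow> complex) \<Rightarrow> complex set \<Rightarrow>
    (complex \<Rightarrow> complex fps) \<Rightarrow> real \<Rightarrow> real \<Rightarrow> (complex \<Rightarrow> complex \<Rightarrow> complex) \<Rightarrow> bool" where
  "borel_continuation \<kappa> m K f d \<epsilon> v \<longleftrightarrow>
     (\<forall>n. (\<lambda>z. fps_nth (f z) n) \<in> A_space K) \<and>
     (\<exists>\<rho>>0. \<forall>t\<in>ball 0 \<rho>. uniformly_convergent_on K
        (\<lambda>N z. \<Sum>n<N. fps_nth (formal_borel m (f z)) n * t ^ n)) \<and>
     disc_sector_space \<kappa> K d \<epsilon> (\<lambda>t z. eval_fps (formal_borel m (f z)) t) v"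

definition summable_in_direction ::
    "real \<Rightarrow> complex set \<Rightarrow> (complex \<Rightarrow> complex fps) \<Rightarrow> real \<Rightarrow> bool" where
  "summable_in_direction \<kappa> K f d \<longleftrightarrow> (\<exists>\<epsilon>>0. \<exists>v. borel_continuation \<kappa> (gamma_moment \<kappa>) K f d \<epsilon> v)"

text \<open>
  \<open>u\<close> is the \<open>\<kappa>\<close>-sum of \<open>f\<close> in direction \<open>d\<close>. For each direction \<open>\<theta>\<close> in the disc-sector the
  Laplace integral converges on \<open>bounded_sector \<theta> (pi / \<kappa> - \<eta>) \<rho>\<close> for small \<open>\<rho>\<close> depending on
  \<open>\<theta>\<close> and \<open>\<eta>\<close>. So this determines \<open>u\<close> near the origin; farther away \<open>u\<close> is determined as an
  analytic continuation where it is required to be holomorphic.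
\<close>

definition is_sum_in_direction :: "real \<Rightarrow> complex set \<Rightarrow> (complex \<Rightarrow> complex fps) \<Rightarrow> real \<Rightarrow>
    (complex \<Rightarrow> complex \<Rightarrow> complex) \<Rightarrow> bool" where
  "is_sum_in_direction \<kappa> K f d u \<longleftrightarrow>
     (\<exists>\<epsilon>>0. \<exists>v. borel_continuation \<kappa> (gamma_moment \<kappa>) K f d \<epsilon> v \<and>
        (\<forall>\<theta>. d - \<epsilon> / 2 < \<theta> \<and> \<theta> < d + \<epsilon> / 2 \<longrightarrow>
           (\<forall>\<eta>>0. \<exists>\<rho>>0. \<forall>t\<in>bounded_sector \<theta> (pi / \<kappa> - \<eta>) \<rho>. \<forall>z\<in>K.
              moment_laplace_converges (gamma_kernel \<kappa>) \<theta> (\<lambda>s. v s z) t \<and>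
              u t z = moment_laplace (gamma_kernel \<kappa>) \<theta> (\<lambda>s. v s z) t)))"

definition kappa_summable :: "real \<Rightarrow> complex set \<Rightarrow> (complex \<Rightarrow> complex fps) \<Rightarrow> bool" where
  "kappa_summable \<kappa> K f \<longleftrightarrow>
     (\<exists>E. finite E \<and>
        (\<forall>d. (\<forall>d0\<in>E. \<forall>k::int. d \<noteq> d0 + 2 * pi * of_int k) \<longrightarrow> summable_in_direction \<kappa> K f d))"

definition stokes_line ::
    "real \<Rightarrow> complex set \<Rightarrow> (complex \<Rightarrow> complex fps) \<Rightarrow> complex set \<Rightarrow> bool" where
  "stokes_line \<kappa> K f L \<longleftrightarrow>
     kappa_summable \<kappa> K f \<and> (\<exists>d. L = half_line d \<and> \<not> summable_in_direction \<kappa> K f d)"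

text \<open>\<open>J\<close> is the jump across \<open>half_line d\<close> on \<open>bounded_sector d (pi / \<kappa>) \<rho>\<close>: the difference of
  the \<open>\<kappa>\<close>-sums in the directions \<open>d + \<epsilon>\<close> and \<open>d - \<epsilon>\<close>, both of which extend to that sector.\<close>

definition is_jump :: "real \<Rightarrow> complex set \<Rightarrow> (complex \<Rightarrow> complex fps) \<Rightarrow> real \<Rightarrow> real \<Rightarrow> real \<Rightarrow>
    (complex \<Rightarrow> complex \<Rightarrow> complex) \<Rightarrow> bool" where
  "is_jump \<kappa> K f d \<epsilon> \<rho> J \<longleftrightarrow>
     (\<exists>up um. is_sum_in_direction \<kappa> K f (d + \<epsilon>) up \<and> is_sum_in_direction \<kappa> K f (d - \<epsilon>) um \<and>
        holomorphic_A K up (bounded_sector d (pi / \<kappa>) \<rho>) \<and>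
        holomorphic_A K um (bounded_sector d (pi / \<kappa>) \<rho>) \<and>
        (\<forall>t\<in>bounded_sector d (pi / \<kappa>) \<rho>. \<forall>z\<in>K. J t z = up t z - um t z))"


section \<open>Laplace type hyperfunctions\<close>

definition slit_domain :: "real \<Rightarrow> real \<Rightarrow> real \<Rightarrow> complex set" where
  "slit_domain d \<alpha> \<rho> = {w \<in> sector d \<alpha>. Im w \<noteq> d \<or> exp (Re w) < \<rho>}"

text \<open>
  Defining functions on the union of a disc with the sector minus its bisecting half-line. Only the
  part of the disc inside the sector is used and boundedness replaces holomorphy at \<open>0\<close>, because
  defining functions such as \<open>\<phi> (z + c s^((q+1)/r))\<close> may be branched there. Proper subsectors
  of the slit sector lie on one side of the slit.
\<close>

definition slit_space :: "real \<Rightarrow> complex set \<Rightarrow> real \<Rightarrow> real \<Rightarrow> real \<Rightarrow>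
    (complex \<Rightarrow> complex \<Rightarrow> complex) \<Rightarrow> bool" where
  "slit_space \<kappa> K d \<alpha> \<rho> g \<longleftrightarrow>
     \<alpha> > 0 \<and> \<rho> > 0 \<and> holomorphic_A K g (slit_domain d \<alpha> \<rho>) \<and>
     (\<exists>C. \<forall>w\<in>bounded_sector d \<alpha> \<rho>. \<forall>z\<in>K. norm (g w z) \<le> C) \<and>
     growth_order \<kappa> K (d - \<alpha> / 4) (\<alpha> / 2) g \<and> growth_order \<kappa> K (d + \<alpha> / 4) (\<alpha> / 2) g"

text \<open>The hyperfunction supported by \<open>half_line d\<close> with defining function \<open>g\<close>, as the class of \<open>g\<close>
  modulo functions of growth order \<open>\<kappa>\<close> on a disc-sector.\<close>

definition laplace_hyperfunction :: "real \<Rightarrow> complex set \<Rightarrow> real \<Rightarrow>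
    (complex \<Rightarrow> complex \<Rightarrow> complex) \<Rightarrow> (complex \<Rightarrow> complex \<Rightarrow> complex) set" where
  "laplace_hyperfunction \<kappa> K d g =
     {h. \<exists>\<alpha> \<rho> F0 F. slit_space \<kappa> K d \<alpha> \<rho> g \<and> slit_space \<kappa> K d \<alpha> \<rho> h \<and>
        disc_sector_space \<kappa> K d \<alpha> F0 F \<and>
        (\<forall>w\<in>slit_domain d \<alpha> \<rho>. \<forall>z\<in>K. h w z - g w z = F w z)}"

text \<open>
  \<open>J t\<close> is the value of the hyperfunction \<open>H\<close> on the function \<open>\<psi> t\<close>: for every defining function
  \<open>h\<close> of \<open>H\<close> it is the integral of \<open>h * \<psi> t\<close> over the path from infinity to \<open>0\<close> in direction \<open>d1\<close>
  and from \<open>0\<close> to infinity in direction \<open>d2\<close>, for all \<open>d1 < d < d2\<close> close to \<open>d\<close>. The functions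
  \<open>\<psi> t\<close> decay fast enough on the path only if \<open>t\<close> is small, depending on the distance of \<open>arg t\<close>
  to the boundary of \<open>sector d (pi / \<kappa>)\<close>.
\<close>

definition hyperfunction_value :: "real \<Rightarrow> complex set \<Rightarrow> real \<Rightarrow>
    (complex \<Rightarrow> complex \<Rightarrow> complex) set \<Rightarrow> (complex \<Rightarrow> complex \<Rightarrow> complex) \<Rightarrow>
    (complex \<Rightarrow> complex \<Rightarrow> complex) \<Rightarrow> bool" where
  "hyperfunction_value \<kappa> K d H \<psi> J \<longleftrightarrow>
     H \<noteq> {} \<and>
     (\<forall>h\<in>H. \<forall>\<eta>>0. \<exists>\<rho>>0. \<forall>t\<in>bounded_sector d (pi / \<kappa> - \<eta>) \<rho>. \<exists>\<sigma>>0. \<forall>d1 d2.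
        d - \<sigma> < d1 \<and> d1 < d \<and> d < d2 \<and> d2 < d + \<sigma> \<longrightarrow>
        (\<forall>z\<in>K. ray_integrable d1 (\<lambda>s. h s z * \<psi> t s) \<and> ray_integrable d2 (\<lambda>s. h s z * \<psi> t s) \<and>
           J t z = ray_integral d2 (\<lambda>s. h s z * \<psi> t s) - ray_integral d1 (\<lambda>s. h s z * \<psi> t s)))"


section \<open>The Cauchy problem\<close>

text \<open>\<open>u z\<close> is the formal power series in \<open>t\<close> with coefficients \<open>u_n(z)\<close>; here \<open>\<partial>_z\<close> acts
  coefficientwise.\<close>

definition fps_dz :: "nat \<Rightarrow> (complex \<Rightarrow> complex fps) \<Rightarrow> complex \<Rightarrow> complex fps" where
  "fps_dz r u z = Abs_fps (\<lambda>n. (deriv ^^ r) (\<lambda>x. fps_nth (u x) n) z)"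

definition formal_solution :: "nat \<Rightarrow> nat \<Rightarrow> nat \<Rightarrow> complex \<Rightarrow> (complex \<Rightarrow> complex) \<Rightarrow> complex set \<Rightarrow>
    (complex \<Rightarrow> complex fps) \<Rightarrow> bool" where
  "formal_solution p q r a \<phi> D u \<longleftrightarrow>
     (\<forall>n. (\<lambda>z. fps_nth (u z) n) holomorphic_on D) \<and>
     (\<forall>z\<in>D. fps_deriv (u z) =
        fps_const a * ((\<lambda>F. fps_deriv (fps_X * F)) ^^ p) (fps_X ^ q * fps_dz r u z)) \<and>
     (\<forall>z\<in>D. fps_nth (u z) 0 = \<phi> z)"

definition kappa_order :: "nat \<Rightarrow> nat \<Rightarrow> nat \<Rightarrow> real" where
  "kappa_order p q r = (real q + 1) / (real p - 1 + real r)"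

definition moment_pqr :: "nat \<Rightarrow> nat \<Rightarrow> nat \<Rightarrow> complex \<Rightarrow> complex" where
  "moment_pqr p q r u =
     Gamma (1 + of_nat r * u / (of_nat q + 1)) * Gamma (1 + u / (of_nat q + 1)) powi (int p - 1)"

text \<open>\<open>e^(2 pi i j / r) a^(1/r) (q+1)^((p-1)/r) s^((q+1)/r)\<close>, with \<open>s\<close> in the logarithmic coordinate.\<close>

definition shift :: "nat \<Rightarrow> nat \<Rightarrow> nat \<Rightarrow> complex \<Rightarrow> real \<Rightarrow> nat \<Rightarrow> complex \<Rightarrow> complex" where
  "shift p q r a arga j s =
     cis (2 * pi * real j / real r) * rcis (norm a powr (1 / real r)) (arga / real r) *
     of_real ((real q + 1) powr ((real p - 1) / real r)) *
     exp (of_real ((real q + 1) / real r) * s)"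

definition singular_dir :: "nat \<Rightarrow> nat \<Rightarrow> real \<Rightarrow> real \<Rightarrow> int \<Rightarrow> real" where
  "singular_dir q r arga \<theta> l = (real r * \<theta> - 2 * pi * of_int l - arga) / (real q + 1)"


section \<open>The kernel function of the Gamma moments\<close>

lemma powr_image_Ioi: "0 < \<kappa> \<Longrightarrow> (\<lambda>x::real. x powr \<kappa>) ` {0<..} = {0<..}"
proof (intro equalityI subsetI)
  fix y :: real assume "0 < \<kappa>" "y \<in> {0<..}"
  then have "y = (y powr (1 / \<kappa>)) powr \<kappa>" "y powr (1 / \<kappa>) \<in> {0<..}"
    by (auto simp: powr_powr)
  then show "y \<in> (\<lambda>x. x powr \<kappa>) ` {0<..}" by blast
qed auto

lemma powr_image_Ioc: "0 < \<kappa> \<Longrightarrow> (\<lambda>x::real. x powr \<kappa>) ` {0<..1} = {0<..1}"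
proof (intro equalityI subsetI)
  fix y :: real assume k: "0 < \<kappa>" and y: "y \<in> {0<..1}"
  then have "y = (y powr (1 / \<kappa>)) powr \<kappa>" "y powr (1 / \<kappa>) \<in> {0<..1}"
    by (auto simp: powr_powr powr_le1)
  then show "y \<in> (\<lambda>x. x powr \<kappa>) ` {0<..1}" by blast
qed (auto simp: powr_le1)

lemma powr_substitution:
  fixes f :: "real \<Rightarrow> complex"
  assumes k: "0 < \<kappa>" and S: "S \<subseteq> {0<..}" "S \<in> sets lebesgue"
  shows "(\<lambda>x. (\<kappa> * x powr (\<kappa> - 1)) *\<^sub>R f (x powr \<kappa>)) absolutely_integrable_on S \<and>
         integral S (\<lambda>x. (\<kappa> * x powr (\<kappa> - 1)) *\<^sub>R f (x powr \<kappa>)) = b \<longleftrightarrow>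
         f absolutely_integrable_on ((\<lambda>x. x powr \<kappa>) ` S) \<and> integral ((\<lambda>x. x powr \<kappa>) ` S) f = b"
proof -
  have "inj_on (\<lambda>x. x powr \<kappa>) S"
  proof (rule inj_onI)
    fix x y assume "x \<in> S" "y \<in> S" "x powr \<kappa> = y powr \<kappa>"
    then have "(x powr \<kappa>) powr (1 / \<kappa>) = (y powr \<kappa>) powr (1 / \<kappa>)" "0 < x" "0 < y"
      using S by auto
    then show "x = y" using k by (simp add: powr_powr)
  qed
  moreover have "((\<lambda>x. x powr \<kappa>) has_field_derivative \<kappa> * x powr (\<kappa> - 1)) (at x within S)"
    if "x \<in> S" for x
    using that S(1) by (intro has_real_derivative_powr [THEN DERIV_subset]) auto
  ultimately have "(\<lambda>x. \<bar>\<kappa> * x powr (\<kappa> - 1)\<bar> *\<^sub>R f (x powr \<kappa>)) absolutely_integrable_on S \<and>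
         integral S (\<lambda>x. \<bar>\<kappa> * x powr (\<kappa> - 1)\<bar> *\<^sub>R f (x powr \<kappa>)) = b \<longleftrightarrow>
         f absolutely_integrable_on ((\<lambda>x. x powr \<kappa>) ` S) \<and> integral ((\<lambda>x. x powr \<kappa>) ` S) f = b"
    by (intro has_absolute_integral_change_of_variables_real S(2)) auto
  then show ?thesis using k by (simp add: abs_mult)
qed

lemma gamma_kernel_ray:
  assumes "x > 0"
  shows "gamma_kernel \<kappa> (ray_point \<theta> x) =
    of_real (\<kappa> * x powr \<kappa>) * cis (\<kappa> * \<theta>) * exp (- (of_real (x powr \<kappa>) * cis (\<kappa> * \<theta>)))"
proof -
  have "exp (of_real \<kappa> * ray_point \<theta> x) = of_real (x powr \<kappa>) * cis (\<kappa> * \<theta>)"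
    using assms by (simp add: ray_point_def complex_eq_iff Re_exp Im_exp powr_def)
  then show ?thesis by (simp add: gamma_kernel_def)
qed

lemma is_kernel_function_gamma_kernel:
  assumes k: "0 < \<kappa>"
  shows "is_kernel_function \<kappa> (gamma_moment \<kappa>) (gamma_kernel \<kappa>)"
  unfolding is_kernel_function_def
proof (intro conjI allI impI)
  show "gamma_kernel \<kappa> holomorphic_on sector 0 (pi / \<kappa>)"
    unfolding gamma_kernel_def by (intro holomorphic_intros)
next
  fix x :: real assume "0 < x"
  then have "gamma_kernel \<kappa> (ray_point 0 x) = of_real (\<kappa> * x powr \<kappa> * exp (- (x powr \<kappa>)))"
    by (simp add: gamma_kernel_ray exp_of_real [symmetric])
  then show "gamma_kernel \<kappa> (ray_point 0 x) \<in> \<real>" "Re (gamma_kernel \<kappa> (ray_point 0 x)) > 0"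
    using k \<open>0 < x\<close> by (simp_all only: Reals_of_real Re_complex_of_real) auto
next
  fix \<theta> :: real
  define f where "f y = cis (\<kappa> * \<theta>) * exp (- (of_real y * cis (\<kappa> * \<theta>)))" for y
  have "continuous_on {0..1} f"
    unfolding f_def by (intro continuous_intros)
  then have "f absolutely_integrable_on {0..1}"
    by (intro absolutely_integrable_continuous_real)
  then have "f absolutely_integrable_on {0<..1}"
    by (rule set_integrable_subset) auto
  then have "(\<lambda>x. (\<kappa> * x powr (\<kappa> - 1)) *\<^sub>R f (x powr \<kappa>)) absolutely_integrable_on {0<..1}"
    using powr_substitution [OF k, of "{0<..1}" f "integral {0<..1} f"] powr_image_Ioc [OF k]
    by (simp add: subset_iff)
  then show "(\<lambda>x. gamma_kernel \<kappa> (ray_point \<theta> x) / of_real x) absolutely_integrable_on {0<..1}"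
    by (rule set_integrable_cong [THEN iffD1, rotated -1])
       (auto simp: gamma_kernel_ray f_def scaleR_conv_of_real powr_diff)
next
  fix \<epsilon> :: real assume e: "0 < \<epsilon>"
  define c where "c = sin (min (\<kappa> * \<epsilon> / 2) (pi / 2))"
  have c: "0 < c" unfolding c_def using k e by (intro sin_gt_zero) (auto simp: min_less_iff_disj)
  have bound: "norm (gamma_kernel \<kappa> w) \<le> (\<kappa> * 2 / c) *
      exp (- ((exp (Re w) / (2 / c) powr (1 / \<kappa>)) powr \<kappa>))"
    if w: "w \<in> sector 0 (pi / \<kappa> - \<epsilon>)" for w
  proof -
    define X where "X = exp (\<kappa> * Re w)"
    have X: "0 < X" by (simp add: X_def)
    have "\<kappa> * \<bar>Im w\<bar> \<le> \<kappa> * ((pi / \<kappa> - \<epsilon>) / 2)"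
      using w k by (intro mult_left_mono) (auto simp: sector_def)
    also have "\<dots> = pi / 2 - \<kappa> * \<epsilon> / 2" using k by (simp add: field_simps)
    finally have 1: "\<kappa> * \<bar>Im w\<bar> \<le> pi / 2 - \<kappa> * \<epsilon> / 2" .
    have "0 \<le> \<kappa> * \<bar>Im w\<bar>" using k by simp
    with 1 have 2: "min (\<kappa> * \<epsilon> / 2) (pi / 2) = \<kappa> * \<epsilon> / 2" by linarith
    have "0 < \<kappa> * \<epsilon>" using k e by simp
    then have 3: "pi / 2 - \<kappa> * \<epsilon> / 2 \<le> pi" using pi_gt_zero by linarith
    have "c = cos (pi / 2 - \<kappa> * \<epsilon> / 2)" unfolding c_def 2 by (simp add: cos_diff)
    also have "\<dots> \<le> cos (\<kappa> * \<bar>Im w\<bar>)"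
      using 1 \<open>0 \<le> \<kappa> * \<bar>Im w\<bar>\<close> 3 by (intro cos_monotone_0_pi_le)
    also have "\<dots> = cos (\<kappa> * Im w)" by (cases "Im w \<ge> 0") auto
    finally have "c \<le> cos (\<kappa> * Im w)" .
    then have "X * c \<le> X * cos (\<kappa> * Im w)" using X by simp
    moreover have "norm (gamma_kernel \<kappa> w) = \<kappa> * X * exp (- (X * cos (\<kappa> * Im w)))"
      using k by (simp add: gamma_kernel_def norm_mult X_def Re_exp)
    ultimately have "norm (gamma_kernel \<kappa> w) \<le> \<kappa> * X * exp (- (X * c))"
      using k X by (simp add: mult_left_mono)
    also have "\<dots> = \<kappa> * (X * exp (- (X * c / 2))) * exp (- (X * c / 2))"
      by (simp add: exp_add [symmetric])
    also have "X * exp (- (X * c / 2)) \<le> 2 / c"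
    proof -
      have "X * c / 2 \<le> exp (X * c / 2)" using exp_ge_add_one_self [of "X * c / 2"] by linarith
      then show ?thesis using c by (simp add: exp_minus field_simps)
    qed
    also have "X = exp (Re w) powr \<kappa>" by (simp add: X_def powr_def)
    also have "exp (Re w) powr \<kappa> * c / 2 = (exp (Re w) / (2 / c) powr (1 / \<kappa>)) powr \<kappa>"
      using k c by (simp add: powr_divide powr_mult powr_powr)
    finally show ?thesis using k by (simp add: mult_left_mono mult_right_mono)
  qed
  show "\<exists>A>0. \<exists>B>0. \<forall>w\<in>sector 0 (pi / \<kappa> - \<epsilon>).
      norm (gamma_kernel \<kappa> w) \<le> A * exp (- ((exp (Re w) / B) powr \<kappa>))"
  proof (intro exI conjI ballI)
    show "norm (gamma_kernel \<kappa> w) \<le> (\<kappa> * 2 / c) *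
        exp (- ((exp (Re w) / (2 / c) powr (1 / \<kappa>)) powr \<kappa>))"
      if "w \<in> sector 0 (pi / \<kappa> - \<epsilon>)" for w using that by (rule bound)
  qed (use k c in auto)
next
  fix u :: complex assume u: "0 \<le> Re u"
  define z where "z = 1 + u / of_real \<kappa>"
  have z: "0 < Re z" using u k by (simp add: z_def add_pos_nonneg)
  define f :: "real \<Rightarrow> complex" where
    "f = (\<lambda>y. of_real y powr (z - 1) / of_real (exp y))"
  have "f absolutely_integrable_on {0<..}" "integral {0<..} f = Gamma z"
    using absolutely_integrable_Gamma_integral' [OF z] Gamma_integral_complex' [OF z]
    unfolding f_def by (simp_all add: integral_unique)
  then have "(\<lambda>x. (\<kappa> * x powr (\<kappa> - 1)) *\<^sub>R f (x powr \<kappa>)) absolutely_integrable_on {0<..} \<and>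
      integral {0<..} (\<lambda>x. (\<kappa> * x powr (\<kappa> - 1)) *\<^sub>R f (x powr \<kappa>)) = Gamma z"
    using powr_substitution [OF k, of "{0<..}" f "Gamma z"] powr_image_Ioi [OF k] by simp
  then have "((\<lambda>x. (\<kappa> * x powr (\<kappa> - 1)) *\<^sub>R f (x powr \<kappa>)) has_integral Gamma z) {0<..}"
    using set_lebesgue_integral_eq_integral(1) by (metis integrable_integral)
  moreover have "(\<kappa> * x powr (\<kappa> - 1)) *\<^sub>R f (x powr \<kappa>) =
      of_real x powr (u - 1) * gamma_kernel \<kappa> (ray_point 0 x)" if x: "x \<in> {0<..}" for x
  proof -
    have "of_real (x powr \<kappa>) powr (z - 1) = (of_real x powr u :: complex)"
      using x k by (simp add: z_def powr_def ln_powr Ln_of_real)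
    then show ?thesis
      using x by (simp add: f_def gamma_kernel_ray scaleR_conv_of_real powr_diff exp_minus
          exp_of_real field_simps)
  qed
  ultimately have "((\<lambda>x. of_real x powr (u - 1) * gamma_kernel \<kappa> (ray_point 0 x))
      has_integral Gamma z) {0<..}"
    by (rule has_integral_eq [rotated]) 
  then show "((\<lambda>x. of_real x powr (u - 1) * gamma_kernel \<kappa> (ray_point 0 x))
      has_integral gamma_moment \<kappa> u) {0<..}"
    by (simp add: gamma_moment_def z_def)
qed

end

theory Submission
  imports Defs "HOL-Probability.Levy" "HOL-Real_Asymp.Real_Asymp"
begin

text \<open>
  In the logarithmic coordinate the moment Laplace transform integrates a kernel against a function
  along a horizontal line. The quotient of the moments \<open>m\<close> and \<open>\<Gamma>(1 + u/\<kappa>)\<close> is, by Gauss'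
  multiplication formula, a product of constants, exponentials and Gamma quotients. Every such factor is
  realised by an operator (a translation, a first order differential operator, an average of
  translations against a beta density) which multiplies the Taylor coefficients on the Borel side by
  that factor and whose adjoint multiplies the moments of the kernel by it. So summability does not
  depend on the moment function, and since a kernel is determined by the Fourier transform of its
  restriction to a line, the \<open>\<kappa>\<close>-sum is the Laplace transform with kernel \<open>e\<close> of the Borel transform
  with respect to \<open>m\<close>.

  That Borel transform is explicit: the recurrence for the coefficients makes it the mean over the
  \<open>r\<close>-th roots of unity of \<open>\<phi> (z + c s^((q+1)/r))\<close>, which continues through the covering function
  \<open>\<Phi>\<close> of \<open>\<phi>\<close>, with the expected growth, to every sector free of singular directions.

  If it continued across a singular direction then \<open>\<Phi>\<close> would have period \<open>2 \<pi> \<i>\<close> and the singularity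
  at \<open>z0\<close> would be removable, so \<open>\<phi>\<close> would be entire. For the jump, both lateral sums are written as
  integrals over a contour that leaves the origin on one side of the singular direction, passes the
  singularity and then turns into a direction adapted to \<open>t\<close>; their difference is the hyperfunction.
\<close>

section \<open>Integrals depending on parameters\<close>

text \<open>At the origin \<open>is_kernel_function\<close> gives only integrability of e(z)/z, too
  little to move contours or to differentiate under the integral. The multipliers are therefore
  applied to the explicit kernel of the Gamma moments: the result decays quantitatively at both ends
  of every smaller strip, and uniqueness of Fourier transforms hands this decay over to
  \<open>e\<close>.

  The two lateral sums must be holomorphic on a sector of full opening pi/\<kappa> with one radius
  \<rho>. As arg t tends to an end of that sector, the directions on the opposite side of the
  singular direction in which the Laplace integral converges shrink to the singular direction
  itself, where the integrand has a singularity at a finite point. Hence the contour is cut at an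
  abscissa \<open>X\<close> behind that point. Up to \<open>X\<close> the integral converges for
  every t, however close the direction is to the singular one; behind \<open>X\<close> the direction
  may cross the singular one and keeps a fixed distance from the ends, so that the smallness of t
  demanded there is uniform.\<close>

lemma norm_deriv_le_Cauchy:
 assumes "f holomorphic_on S" "open S" "cball y r \<subseteq> S" "0 < r"
  "\<And>x. x \<in> cball y r ==> norm (f x) <= B"
 shows "norm (deriv f y) <= B / r"
proof -
 have "norm ((deriv ^^ 1) f y) <= fact 1 * B / r ^ 1"
 proof (rule Cauchy_inequality)
  show "f holomorphic_on ball y r"
   using assms(1,3) holomorphic_on_subset ball_subset_cball by (metis subset_trans)
  show "continuous_on (cball y r) f"
   using assms(1,3) holomorphic_on_imp_continuous_on holomorphic_on_subset by blast
 qed (use assms(4,5) in \<open>auto simp: dist_norm\<close>)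
 then show ?thesis by simp
qed

lemma norm_diff_le_Cauchy:
 assumes hol: "f holomorphic_on ball w r" and r: "0 < r"
  and B: "\<And>x. x \<in> ball w r ==> norm (f x) <= B"
  and x: "x \<in> ball w (r / 2)"
 shows "norm (f x - f w) <= 4 * B / r * norm (x - w)"
proof (rule field_differentiable_bound [of "ball w (r / 2)" f "deriv f"])
 have d: "cball y (r / 4) \<subseteq> ball w r" if "y \<in> ball w (r / 2)" for y
 proof
  fix z assume "z \<in> cball y (r / 4)"
  then show "z \<in> ball w r"
   using that dist_triangle [of w z y] r by (auto simp: dist_commute)
 qed
 show "(f has_field_derivative deriv f y) (at y within ball w (r / 2))" if "y \<in> ball w (r / 2)" for y
  using that r hol by (intro DERIV_subset [OF holomorphic_derivI [OF hol]]) auto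
 show "norm (deriv f y) <= 4 * B / r" if "y \<in> ball w (r / 2)" for y
 proof -
  have "norm (deriv f y) <= B / (r / 4)"
   by (rule norm_deriv_le_Cauchy [OF hol open_ball d [OF that]])
     (use r in simp, use B d [OF that] in blast)
  then show ?thesis by (simp add: mult.commute)
 qed
qed (use x r in auto)

text \<open>A local majorant g of the integrand is enough: Cauchy's estimate turns it into the
  majorant 4 g / \<delta> of the difference quotients, and dominated convergence along sequences
  differentiates under the integral.\<close>

lemma holomorphic_on_integral:
 fixes f :: "complex => 'm => complex"
 assumes S: "open S" and meas: "\<And>x. x \<in> S ==> f x \<in> borel_measurable M"
  and hol: "\<And>om. om \<in> space M ==> (%x. f x om) holomorphic_on S"
  and dom: "\<And>x. x \<in> S ==> \<exists>\<delta>>0. \<exists>g. integrable M g \<and>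
   (\<forall>y\<in>ball x \<delta> \<inter> S. \<forall>om\<in>space M. norm (f y om) <= g om)"
 shows "(%x. \<integral>om. f x om \<partial>M) holomorphic_on S"
proof (rule holomorphic_onI)
 fix x assume x: "x \<in> S"
 obtain \<delta>0 g where d0: "\<delta>0 > 0" and g: "integrable M g"
  and le0: "\<forall>y\<in>ball x \<delta>0 \<inter> S. \<forall>om\<in>space M. norm (f y om) <= g om"
  using dom [OF x] by blast
 obtain \<delta>1 where d1: "\<delta>1 > 0" "ball x \<delta>1 \<subseteq> S" using S x openE by blast
 define \<delta> where "\<delta> = min \<delta>0 \<delta>1"
 have d: "\<delta> > 0" "ball x \<delta> \<subseteq> S" using d0 d1 by (auto simp: \<delta>_def)
 have le: "norm (f y om) <= g om" if "y \<in> ball x \<delta>" "om \<in> space M" for y om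
  using le0 that d by (auto simp: \<delta>_def)
 have int: "integrable M (f y)" if "y \<in> ball x \<delta>" for y
  by (rule Bochner_Integration.integrable_bound [OF g meas])
    (use d le that in \<open>auto intro!: AE_I2 order_trans [OF _ abs_ge_self]\<close>)
 define D where "D = (%om. deriv (%x. f x om) x)"
 have quot: "((%y. (f y om - f x om) / (y - x)) \<longlongrightarrow> D om) (at x)" if "om \<in> space M" for om
  using holomorphic_derivI [OF hol [OF that] S x] by (simp add: has_field_derivative_iff D_def)
 have lip: "norm ((f y om - f x om) / (y - x)) <= 4 * g om / \<delta>"
  if "y \<in> ball x (\<delta> / 2)" "om \<in> space M" for y om
 proof (cases "y = x")
  case False
  have "norm (f y om - f x om) <= 4 * g om / \<delta> * norm (y - x)"
   by (rule norm_diff_le_Cauchy [OF _ d(1) _ that(1)])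
     (use hol that d le holomorphic_on_subset in \<open>blast+\<close>)
  then show ?thesis using False d(1) by (simp add: norm_divide pos_divide_le_eq)
 next
  case True
  then show ?thesis using order_trans [OF norm_ge_zero le [of x om]] d that by simp
 qed
 have "((%y. ((\<integral>om. f y om \<partial>M) - (\<integral>om. f x om \<partial>M)) / (y - x)) \<longlongrightarrow> (\<integral>om. D om \<partial>M)) (at x)"
  unfolding tendsto_at_iff_sequentially
 proof (intro allI impI)
  fix X :: "nat => complex" assume X: "\<forall>i. X i \<in> UNIV - {x}" "X \<longlonglongrightarrow> x"
  have "\<forall>\<^sub>F i in sequentially. X i \<in> ball x (\<delta> / 2)"
   using topological_tendstoD [OF X(2), of "ball x (\<delta>/2)"] d by auto
  then obtain N where N: "\<And>i. i \<ge> N ==> X i \<in> ball x (\<delta> / 2)"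
   by (auto simp: eventually_sequentially)
  \<comment> \<open>Dropping N terms puts the whole sequence into the half disc, so that the
    majorant of the quotients holds for every index.\<close>
  define Y where "Y i = X (i + N)" for i
  have Yb: "Y i \<in> ball x (\<delta> / 2)" "Y i \<in> ball x \<delta>" "Y i \<noteq> x" for i
   using N [of "i + N"] X d by (auto simp: Y_def)
  have Y: "filterlim Y (at x) sequentially"
   using X Yb LIMSEQ_ignore_initial_segment [OF X(2), of N]
   by (auto simp: filterlim_at Y_def [abs_def])
  have lim: "(%i. (\<integral>om. (f (Y i) om - f x om) / (Y i - x) \<partial>M)) \<longlonglongrightarrow> (\<integral>om. D om \<partial>M)"
  proof (rule integral_dominated_convergence)
   show "integrable M (%om. 4 * g om / \<delta>)" using g by simp
   show m: "(%om. (f (Y i) om - f x om) / (Y i - x)) \<in> borel_measurable M" for i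
    using meas [of "Y i"] meas [OF x] Yb(2) [of i] d by auto
   have pl: "(%i. (f (Y i) om - f x om) / (Y i - x)) \<longlonglongrightarrow> D om" if "om \<in> space M" for om
    using filterlim_compose [OF quot [OF that] Y] .
   then show "AE om in M. (%i. (f (Y i) om - f x om) / (Y i - x)) \<longlonglongrightarrow> D om" by (intro AE_I2)
   show "D \<in> borel_measurable M" using borel_measurable_LIMSEQ_metric [OF m pl] .
   show "AE om in M. norm ((f (Y i) om - f x om) / (Y i - x)) <= 4 * g om / \<delta>" for i
    using lip [OF Yb(1)] by (intro AE_I2)
  qed
  have "(\<integral>om. (f (Y i) om - f x om) / (Y i - x) \<partial>M) =
    ((\<integral>om. f (Y i) om \<partial>M) - (\<integral>om. f x om \<partial>M)) / (Y i - x)" for i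
   using int [OF Yb(2)] int [of x] d by simp
  then have "(%i. ((%y. ((\<integral>om. f y om \<partial>M) - (\<integral>om. f x om \<partial>M)) / (y - x)) \<circ> X) (i + N))
    \<longlonglongrightarrow> (\<integral>om. D om \<partial>M)"
   using lim unfolding Y_def o_def by (simp only:)
  then show "((%y. ((\<integral>om. f y om \<partial>M) - (\<integral>om. f x om \<partial>M)) / (y - x)) \<circ> X)
    \<longlonglongrightarrow> (\<integral>om. D om \<partial>M)"
   by (rule LIMSEQ_offset)
 qed
 then show "(%x. \<integral>om. f x om \<partial>M) field_differentiable at x within S"
  using field_differentiable_at_within field_differentiable_def has_field_derivative_iff by blast
qed

lemma continuous_on_integral_dominated:
 fixes f :: "'a::metric_space => 'm => complex"
 assumes meas: "\<And>x. x \<in> K ==> f x \<in> borel_measurable M"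
  and cont: "\<And>om. om \<in> space M ==> continuous_on K (%x. f x om)"
  and g: "integrable M g" and le: "\<And>x om. x \<in> K ==> om \<in> space M ==> norm (f x om) <= g om"
 shows "continuous_on K (%x. \<integral>om. f x om \<partial>M)"
 unfolding continuous_on_sequentially
proof (intro allI ballI impI, elim conjE)
 fix X a assume *: "a \<in> K" "\<forall>n. X n \<in> K" "X \<longlonglongrightarrow> a"
 have "(%i. \<integral>om. f (X i) om \<partial>M) \<longlonglongrightarrow> (\<integral>om. f a om \<partial>M)"
 proof (rule integral_dominated_convergence [OF _ _ g])
  show "AE om in M. (%i. f (X i) om) \<longlonglongrightarrow> f a om"
   using cont * by (intro AE_I2) (auto simp: continuous_on_sequentially o_def)
 qed (use * meas le in \<open>auto intro!: AE_I2\<close>)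
 then show "((%x. \<integral>om. f x om \<partial>M) \<circ> X) \<longlonglongrightarrow> (\<integral>om. f a om \<partial>M)" by (simp add: o_def)
qed

lemma integrable_exp_neg_abs:
 assumes "0 < (c::real)"
 shows "integrable lborel (%x. exp (- (c * \<bar>x\<bar>)))"
proof -
 have 1: "set_integrable lborel {0<..} (%x. exp (- (x * c)))"
  by (rule integrable_I0i_exp_mscale [OF assms])
 have 2: "integrable lborel (%x. indicator {0<..} x * exp (- (c * \<bar>x\<bar>)))"
  using 1 unfolding set_integrable_def
  by (rule Bochner_Integration.integrable_cong [THEN iffD1, rotated -1]) (auto simp: indicator_def mult.commute)
 have 3: "integrable lborel (%x. indicator {0<..} (0 + (-1) * x) * exp (- (c * \<bar>0 + (-1) * x\<bar>)))"
  by (rule lborel_integrable_real_affine [OF 2]) auto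
 have 4: "integrable lborel (%x. indicator {0<..} x * exp (- (c * \<bar>x\<bar>)) + indicator {0<..} (0 + (-1) * x) * exp (- (c * \<bar>0 + (-1) * x\<bar>)))"
  by (rule Bochner_Integration.integrable_add [OF 2 3])
 have "AE x in lborel. x \<noteq> (0::real)" by (rule AE_lborel_singleton)
 then have 5: "AE x in lborel. indicator {0<..} x * exp (- (c * \<bar>x\<bar>)) +
   indicator {0<..} (0 + (-1) * x) * exp (- (c * \<bar>0 + (-1) * x\<bar>)) = exp (- (c * \<bar>x\<bar>))"
  by eventually_elim (simp add: indicator_def)
 show ?thesis
  by (rule integrable_cong_AE_imp [OF 4 _ 5]) simp
qed

text \<open>Cauchy's estimate twice: \<open>deriv f\<close> is at most 2 B / r on the half disc, so
  \<open>norm_diff_le_Cauchy\<close> with radius r / 2 bounds the derivative of the remainder at x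
  by 4 (2 B / r) / (r / 2) |x - w|.\<close>

lemma norm_taylor2_le_Cauchy:
 assumes hol: "f holomorphic_on ball w r" and r: "0 < r"
  and B: "\<And>x. x \<in> ball w r ==> norm (f x) <= B"
  and t: "t \<in> ball w (r / 4)"
 shows "norm (f t - f w - deriv f w * (t - w)) <= 16 * B / r\<^sup>2 * norm (t - w) ^ 2"
proof -
 have B0: "0 <= B" by (rule order_trans [OF norm_ge_zero B [of w]]) (use r in simp_all)
 define g where "g x = f x - f w - deriv f w * (x - w)" for x
 have hd: "deriv f holomorphic_on ball w (r/2)"
  using holomorphic_deriv [OF hol] holomorphic_on_subset [of _ "ball w r" "ball w (r/2)"] r by (auto simp: subset_ball)
 have db: "norm (deriv f x) <= 2 * B / r" if "x \<in> ball w (r / 2)" for x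
 proof -
  have sub: "cball x (r / 2) \<subseteq> ball w r"
  proof
   fix y assume "y \<in> cball x (r / 2)"
   then show "y \<in> ball w r" using that dist_triangle [of w y x] by (auto simp: dist_commute)
  qed
  have "norm (deriv f x) <= B / (r / 2)"
   by (rule norm_deriv_le_Cauchy [OF hol open_ball sub])
     (use r in simp, use B sub in blast)
  then show ?thesis by (simp add: mult.commute)
 qed
 have dd: "norm (deriv f x - deriv f w) <= 16 * B / r\<^sup>2 * norm (x - w)" if "x \<in> ball w (r / 4)" for x
  using norm_diff_le_Cauchy [OF hd _ db, of x] that r
  by (simp add: power2_eq_square divide_simps)
 have "norm (g t - g w) <= 16 * B / r\<^sup>2 * norm (t - w) * norm (t - w)"
 proof (rule field_differentiable_bound [of "cball w (norm (t - w))" g "%x. deriv f x - deriv f w"])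
  fix x assume x: "x \<in> cball w (norm (t - w))"
  then have x': "x \<in> ball w (r / 4)" using t by (auto simp: dist_norm norm_minus_commute)
  then have "x \<in> ball w r" using r by auto
  then show "(g has_field_derivative deriv f x - deriv f w) (at x within cball w (norm (t - w)))"
  proof -
   have "(f has_field_derivative deriv f x) (at x)"
    using holomorphic_derivI [OF hol open_ball \<open>x \<in> ball w r\<close>] .
   then have "(g has_field_derivative deriv f x - 0 - deriv f w * (1 - 0)) (at x)"
    unfolding g_def by (intro DERIV_diff DERIV_const DERIV_cmult DERIV_ident)
   then show ?thesis by (simp add: has_field_derivative_at_within)
  qed
  have nx: "norm (x - w) <= norm (t - w)" using x by (simp add: dist_norm norm_minus_commute)
  have "16 * B / r\<^sup>2 * norm (x - w) <= 16 * B / r\<^sup>2 * norm (t - w)"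
   by (rule mult_left_mono [OF nx]) (use B0 in simp)
  with dd [OF x'] show "norm (deriv f x - deriv f w) <= 16 * B / r\<^sup>2 * norm (t - w)"
   by (rule order_trans)
 qed (auto simp: dist_norm norm_minus_commute)
 then show ?thesis by (simp add: g_def power2_eq_square mult.assoc)
qed

text \<open>Osgood's lemma. The remainder in t is quadratic with a constant independent of z, so the
  t-derivatives at t0 are a uniform limit of functions continuous in z. The resulting continuity of
  \<open>D\<close> at z0 is what joins the two variables.\<close>

lemma has_derivative_separately_holomorphic:
 fixes f :: "complex => complex => complex"
 assumes r: "0 < r"
  and h1: "\<And>z. z \<in> ball z0 r ==> (%t. f t z) holomorphic_on ball t0 r"
  and h2: "\<And>t. t \<in> ball t0 r ==> f t holomorphic_on ball z0 r"
  and B: "\<And>t z. t \<in> ball t0 r ==> z \<in> ball z0 r ==> norm (f t z) <= B"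
 shows "\<exists>A C. ((%(t, z). f t z) has_derivative (%(h, k). A * h + C * k)) (at (t0, z0))"
proof -
 have B0: "0 <= B" by (rule order_trans [OF norm_ge_zero B [of t0 z0]]) (use r in simp_all)
 define D where "D z = deriv (%t. f t z) t0" for z
 have second: "norm (f t z - f t0 z - D z * (t - t0)) <= 16 * B / r\<^sup>2 * norm (t - t0) ^ 2"
  if t: "t \<in> ball t0 (r / 4)" and z: "z \<in> ball z0 r" for t z
  unfolding D_def using norm_taylor2_le_Cauchy [OF h1 [OF z] r B [OF _ z] t] .
 have Dcont: "(D \<longlongrightarrow> D z0) (at z0)"
 proof -
  \<comment> \<open>The increments r / (8 (n + 1)) stay below r / 4, the range of the quadratic
    remainder estimate.\<close>
  have ub: "uniform_limit (ball z0 r) (%n z. (f (t0 + of_real (r / (8 * real (Suc n)))) z - f t0 z) / of_real (r / (8 * real (Suc n)))) D sequentially"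
  proof (rule uniform_limitI)
   fix e :: real assume e: "0 < e"
   obtain N :: nat where N: "2 * B / r / e < real N" using reals_Archimedean2 by blast
   show "\<forall>\<^sub>F n in sequentially. \<forall>z\<in>ball z0 r. dist ((f (t0 + of_real (r / (8 * real (Suc n)))) z - f t0 z) / of_real (r / (8 * real (Suc n)))) (D z) < e"
    unfolding eventually_sequentially
   proof (intro exI [of _ N] allI impI ballI)
    fix n z assume n: "N <= n" and z: "z \<in> ball z0 r"
    define h where "h = r / (8 * real (Suc n))"
    have h: "h > 0" "h < r / 4" using r by (auto simp: h_def divide_simps)
    have "norm (f (t0 + of_real h) z - f t0 z - D z * of_real h) <= 16 * B / r\<^sup>2 * h ^ 2"
     using second [of "t0 + of_real h" z] z h by (auto simp: dist_norm)
    moreover have "norm ((f (t0 + of_real h) z - f t0 z) / of_real h - D z) = norm (f (t0 + of_real h) z - f t0 z - D z * of_real h) / h"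
    proof -
     have "(f (t0 + of_real h) z - f t0 z) / of_real h - D z = (f (t0 + of_real h) z - f t0 z - D z * of_real h) / of_real h"
      using h by (simp add: divide_simps)
     then show ?thesis using h by (simp add: norm_divide)
    qed
    ultimately have "norm ((f (t0 + of_real h) z - f t0 z) / of_real h - D z) <= 16 * B / r\<^sup>2 * h ^ 2 / h"
     using h by (metis divide_right_mono less_imp_le)
    also have "\<dots> = 16 * B / r\<^sup>2 * h" using h by (simp add: power2_eq_square)
    also have "\<dots> = (2 * B / r) / real (Suc n)" using r by (simp add: h_def power2_eq_square divide_simps)
    also have "\<dots> < e"
    proof -
     have "2 * B / r / e < real (Suc n)" using N n by linarith
     then have "2 * B / r < real (Suc n) * e" using e by (simp only: pos_divide_less_eq)
     then have "2 * B / r / real (Suc n) < e" by (subst pos_divide_less_eq) (simp_all add: mult.commute del: of_nat_Suc)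
     then show ?thesis .
    qed
    finally show "dist ((f (t0 + of_real (r / (8 * real (Suc n)))) z - f t0 z) / of_real (r / (8 * real (Suc n)))) (D z) < e"
     by (simp add: dist_norm h_def)
   qed
  qed
  have "continuous_on (ball z0 r) D"
  proof (rule uniform_limit_theorem [OF _ ub])
   show "\<forall>\<^sub>F n in sequentially. continuous_on (ball z0 r) (%z. (f (t0 + of_real (r / (8 * real (Suc n)))) z - f t0 z) / of_real (r / (8 * real (Suc n))))"
   proof (intro always_eventually allI)
    fix n
    have "t0 + of_real (r / (8 * real (Suc n))) \<in> ball t0 r" "t0 \<in> ball t0 r"
    proof -
     have "r / (8 * real (Suc n)) < r" using r by (simp add: divide_less_eq)
     then show "t0 + of_real (r / (8 * real (Suc n))) \<in> ball t0 r" "t0 \<in> ball t0 r"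
      using r by (simp_all add: dist_norm del: of_real_divide of_nat_Suc)
    qed
    then show "continuous_on (ball z0 r) (%z. (f (t0 + of_real (r / (8 * real (Suc n)))) z - f t0 z) / of_real (r / (8 * real (Suc n))))"
     using h2 r by (intro continuous_intros holomorphic_on_imp_continuous_on [of "f _"]) (auto simp del: of_nat_Suc)
   qed
  qed auto
  then show ?thesis using r continuous_on_eq_continuous_at [OF open_ball, of z0 r D] isCont_def by fastforce
 qed
 have Dz: "(f t0 has_field_derivative deriv (f t0) z0) (at z0)"
  using holomorphic_derivI [OF h2, of t0 z0] r by auto
 define C where "C = deriv (f t0) z0"
 have "((%(t, z). f t z) has_derivative (%(h, k). D z0 * h + C * k)) (at (t0, z0))"
  unfolding has_derivative_within_alt
 proof (intro conjI allI impI)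
  show "bounded_linear (%(h, k). D z0 * h + C * k)"
   unfolding case_prod_beta
   by (intro bounded_linear_add bounded_linear_compose [OF bounded_linear_mult_right]
     bounded_linear_fst bounded_linear_snd)
  fix e :: real assume e: "0 < e"
  have "\<forall>\<^sub>F z in at z0. norm (D z - D z0) < e / 3"
   using tendstoD [OF Dcont, of "e / 3"] e by (simp add: dist_norm)
  then obtain d1 where d1: "d1 > 0" "\<And>z. z \<noteq> z0 ==> dist z z0 < d1 ==> norm (D z - D z0) < e / 3"
   by (auto simp: eventually_at)
  have d1': "norm (D z - D z0) <= e / 3" if "dist z z0 < d1" for z
   using d1(2) [of z] that e by (cases "z = z0") auto
  obtain d2 where d2: "d2 > 0" "\<And>z. norm (z - z0) < d2 ==> norm (f t0 z - f t0 z0 - C * (z - z0)) <= e / 3 * norm (z - z0)"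
   using Dz e unfolding has_field_derivative_def has_derivative_within_alt C_def [symmetric]
   by (metis (no_types, lifting) UNIV_I divide_pos_pos zero_less_numeral)
  define d3 where "d3 = e / 3 / (16 * B / r\<^sup>2 + 1)"
  have d3: "d3 > 0" using e B0 r by (auto simp: d3_def intro!: divide_pos_pos add_nonneg_pos)
  define d where "d = min (min d1 d2) (min d3 (r / 4))"
  have d: "d > 0" "d <= d1" "d <= d2" "d <= d3" "d <= r / 4" using d1 d2 d3 r by (auto simp: d_def)
  show "\<exists>d>0. \<forall>y\<in>UNIV. norm (y - (t0, z0)) < d -->
   norm ((case y of (t, z) => f t z) - (case (t0, z0) of (t, z) => f t z) -
    (case y - (t0, z0) of (h, k) => D z0 * h + C * k)) <= e * norm (y - (t0, z0))"
  proof (intro exI [of _ d] conjI ballI impI d(1))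
   fix y :: "complex \<times> complex" assume y: "norm (y - (t0, z0)) < d"
   obtain t z where yz: "y = (t, z)" by fastforce
   define n where "n = norm (y - (t0, z0))"
   have nt: "norm (t - t0) <= n" and nz: "norm (z - z0) <= n"
    using norm_fst_le [of "t - t0" "z - z0"] norm_snd_le [of "z - z0" "t - t0"] by (auto simp: n_def yz)
   have "norm (f t z - f t0 z - D z * (t - t0)) <= 16 * B / r\<^sup>2 * norm (t - t0) ^ 2"
    using second [of t z] nt nz y d r by (auto simp: n_def dist_norm norm_minus_commute)
   also have "\<dots> <= (16 * B / r\<^sup>2 * d3) * n"
   proof -
    have "norm (t - t0) ^ 2 <= d3 * n" unfolding power2_eq_square
     using nt y d d3 by (intro mult_mono) (auto simp: n_def)
    then show ?thesis using B0 mult_left_mono [of _ _ "16 * B / r\<^sup>2"] by (simp add: mult.assoc)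
   qed
   also have "\<dots> <= e / 3 * n"
   proof (rule mult_right_mono)
    show "16 * B / r\<^sup>2 * d3 <= e / 3"
    proof -
     have pos: "0 < 16 * B / r\<^sup>2 + 1" using B0 r by (auto intro!: add_nonneg_pos)
     have "16 * B / r\<^sup>2 * d3 <= (16 * B / r\<^sup>2 + 1) * d3" using d3 by (simp add: algebra_simps)
     also have "\<dots> = e / 3" unfolding d3_def using pos by (intro nonzero_mult_div_cancel_left [THEN trans, rotated] times_divide_eq_right [THEN trans]) auto
     finally show ?thesis .
    qed
   qed (simp add: n_def)
   finally have a: "norm (f t z - f t0 z - D z * (t - t0)) <= e / 3 * n" .
   have b: "norm ((D z - D z0) * (t - t0)) <= e / 3 * n"
    unfolding norm_mult using d1' [of z] nt nz y d e
    by (intro mult_mono) (auto simp: n_def dist_norm)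
   have c: "norm (f t0 z - f t0 z0 - C * (z - z0)) <= e / 3 * n"
   proof -
    have "norm (f t0 z - f t0 z0 - C * (z - z0)) <= e / 3 * norm (z - z0)"
     using d2(2) [of z] nz y d by (simp add: n_def)
    also have "\<dots> <= e / 3 * n" using nz e by (intro mult_left_mono) auto
    finally show ?thesis .
   qed
   \<comment> \<open>First t moves at fixed z, then the coefficient moves from \<open>D z\<close> to
     \<open>D z0\<close>, then z moves at fixed t0; each part may cost a third of e.\<close>
   have "f t z - f t0 z0 - (D z0 * (t - t0) + C * (z - z0)) =
    (f t z - f t0 z - D z * (t - t0)) + (D z - D z0) * (t - t0) + (f t0 z - f t0 z0 - C * (z - z0))"
    by (simp add: algebra_simps)
   then have "norm (f t z - f t0 z0 - (D z0 * (t - t0) + C * (z - z0))) <= e / 3 * n + e / 3 * n + e / 3 * n"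
    using a b c by (metis (no_types, lifting) add_mono norm_triangle_le)
   then show "norm ((case y of (t, z) => f t z) - (case (t0, z0) of (t, z) => f t z) -
    (case y - (t0, z0) of (h, k) => D z0 * h + C * k)) <= e * norm (y - (t0, z0))"
    by (simp add: yz n_def)
  qed
 qed
 then show ?thesis by blast
qed

text \<open>The Taylor remainder estimate has a constant independent of z, so a locally uniform
  bound upgrades pointwise differentiability to convergence in the sup norm; the derivative lies in
  \<open>A_space K\<close> as a uniform limit of difference quotients.\<close>

lemma holomorphic_A_I:
 assumes S: "open S" and A: "\<And>w. w \<in> S ==> v w \<in> A_space K"
  and hol: "\<And>z. z \<in> K ==> (%w. v w z) holomorphic_on S"
  and bd: "\<And>w. w \<in> S ==> \<exists>\<delta>>0. \<exists>B. \<forall>x\<in>ball w \<delta> \<inter> S. \<forall>z\<in>K. norm (v x z) <= B"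
 shows "holomorphic_A K v S"
 unfolding holomorphic_A_def
proof (intro ballI conjI)
 fix w assume w: "w \<in> S"
 show "v w \<in> A_space K" by (rule A [OF w])
 obtain \<delta>0 B where d0: "\<delta>0 > 0" and B0: "\<forall>x\<in>ball w \<delta>0 \<inter> S. \<forall>z\<in>K. norm (v x z) <= B"
  using bd [OF w] by blast
 obtain \<delta>1 where d1: "\<delta>1 > 0" "ball w \<delta>1 \<subseteq> S" using S w openE by blast
 define \<delta> where "\<delta> = min \<delta>0 \<delta>1"
 have d: "\<delta> > 0" "ball w \<delta> \<subseteq> S" using d0 d1 by (auto simp: \<delta>_def)
 define B1 where "B1 = max B 0"
 have B: "norm (v x z) <= B1" if "x \<in> ball w \<delta>" "z \<in> K" for x z
 proof -
  have "x \<in> ball w \<delta>0 \<inter> S" using that d(2) by (auto simp: \<delta>_def)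
  then show ?thesis using B0 that(2) by (force simp: B1_def)
 qed
 define v' where "v' z = deriv (%x. v x z) w" for z
 have tay: "norm (v x z - v w z - v' z * (x - w)) <= 16 * B1 / \<delta>\<^sup>2 * norm (x - w) ^ 2"
  if "x \<in> ball w (\<delta> / 4)" "z \<in> K" for x z
  unfolding v'_def
  by (rule norm_taylor2_le_Cauchy [OF holomorphic_on_subset [OF hol [OF that(2)] d(2)] d(1) B that(1)]) (assumption, rule that(2))
 have ul: "uniform_limit K (%x z. (v x z - v w z) / (x - w)) v' (at w)"
 proof (rule uniform_limitI)
  fix e :: real assume e: "0 < e"
  define c where "c = 16 * B1 / \<delta>\<^sup>2 + 1"
  have c: "c > 0" "16 * B1 / \<delta>\<^sup>2 <= c" by (auto simp: c_def B1_def intro!: add_nonneg_pos)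
  show "\<forall>\<^sub>F x in at w. \<forall>z\<in>K. dist ((v x z - v w z) / (x - w)) (v' z) < e"
   unfolding eventually_at
  proof (intro exI [of _ "min (\<delta> / 4) (e / c)"] conjI ballI impI)
   show "0 < min (\<delta> / 4) (e / c)" using d e c by simp
   fix x z assume x: "x \<noteq> w \<and> dist x w < min (\<delta> / 4) (e / c)" and z: "z \<in> K"
   have xb: "x \<in> ball w (\<delta> / 4)" using x by (simp add: dist_commute)
   have "norm (v x z - v w z - v' z * (x - w)) <= c * norm (x - w) ^ 2"
    using tay [OF xb z] c(2) by (meson mult_right_mono order_trans zero_le_power2)
   moreover have "(v x z - v w z) / (x - w) - v' z = (v x z - v w z - v' z * (x - w)) / (x - w)"
    using x by (simp add: divide_simps)
   ultimately have "norm ((v x z - v w z) / (x - w) - v' z) <= c * norm (x - w)"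
    using x by (simp add: norm_divide divide_le_eq power2_eq_square mult.assoc)
   also have "\<dots> < e"
   proof -
    have "norm (x - w) < e / c" using x by (simp add: dist_norm)
    then show ?thesis using c by (simp add: less_divide_eq mult.commute)
   qed
   finally show "dist ((v x z - v w z) / (x - w)) (v' z) < e" by (simp add: dist_norm)
  qed
 qed
 have hA: "\<forall>\<^sub>F x in at w. x \<in> S" using S w eventually_at_in_open' by blast
 have "continuous_on K v'"
 proof (rule uniform_limit_theorem [OF _ ul])
  show "\<forall>\<^sub>F x in at w. continuous_on K (%z. (v x z - v w z) / (x - w))"
   using hA eventually_neq_at_within [of w]
  proof eventually_elim
   case (elim x)
   then show ?case using A [OF w] A [of x] by (auto simp: A_space_def intro!: continuous_intros)
  qed
 qed simp
 moreover have "v' holomorphic_on interior K"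
 proof -
  \<comment> \<open>Weierstrass' theorem on uniform limits of holomorphic functions speaks of
    sequences, so the limit at w is taken along one.\<close>
  define X where "X n = w + of_real (\<delta> / (8 * real (Suc n)))" for n
  have X: "filterlim X (at w) sequentially"
  proof -
   have "(%n. (\<delta> / 8) / real (Suc n)) \<longlonglongrightarrow> 0" by (rule LIMSEQ_Suc [OF lim_const_over_n])
   then have "(%n. \<delta> / (8 * real (Suc n))) \<longlonglongrightarrow> 0" by simp
   then have "(%n. w + of_real (\<delta> / (8 * real (Suc n)))) \<longlonglongrightarrow> w + of_real 0"
    by (intro tendsto_intros)
   moreover have "w + of_real (\<delta> / (8 * real (Suc n))) \<noteq> w" for n
    using d by (simp del: of_nat_Suc of_real_divide)
   ultimately show ?thesis by (simp add: filterlim_at X_def [abs_def])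
  qed
  have XS: "X n \<in> S" for n
  proof -
   have "\<delta> / (8 * real (Suc n)) < \<delta>" using d by (simp add: divide_less_eq)
   then have "X n \<in> ball w \<delta>" using d(1) by (simp add: X_def dist_norm del: of_real_divide of_nat_Suc)
   then show ?thesis using d by auto
  qed
  have uls: "uniform_limit K (%n z. (v (X n) z - v w z) / (X n - w)) v' sequentially"
   using ul X by (auto simp: uniform_limit_iff intro: eventually_compose_filterlim)
  show ?thesis
  proof (rule holomorphic_uniform_sequence [OF open_interior])
   show "(%z. (v (X n) z - v w z) / (X n - w)) holomorphic_on interior K" for n
    using A [OF w] A [OF XS [of n]] d by (auto simp: A_space_def X_def intro!: holomorphic_intros)
   fix x assume "x \<in> interior K"
   then obtain e where e: "e > 0" "cball x e \<subseteq> interior K" using open_contains_cball by (metis open_interior)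
   then show "\<exists>d>0. cball x d \<subseteq> interior K \<and> uniform_limit (cball x d) (%n z. (v (X n) z - v w z) / (X n - w)) v' sequentially"
    using uniform_limit_on_subset [OF uls] interior_subset by (meson subset_trans)
  qed
 qed
 ultimately have "v' \<in> A_space K" by (simp add: A_space_def)
 then show "\<exists>v'\<in>A_space K. uniform_limit K (%x z. (v x z - v w z) / (x - w)) v' (at w)"
  using ul by blast
qed

section \<open>Half-lines as real lines (x = exp y), and uniqueness of the Fourier transform\<close>

lemma ray_of_lborel:
 fixes g :: "real => complex"
 assumes "integrable lborel g"
 shows "(%x. g (ln x) / of_real x) absolutely_integrable_on {0<..}"
  and "integral {0<..} (%x. g (ln x) / of_real x) = (\<integral>y. g y \<partial>lborel)"
proof -
 have hi: "(g has_integral (\<integral>y. g y \<partial>lborel)) UNIV" by (rule has_integral_integral_lborel [OF assms])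
 have "integrable lebesgue g" using assms by (simp add: integrable_completion borel_measurable_integrable)
 then have ai: "g absolutely_integrable_on UNIV" by (simp add: set_integrable_def)
 have eq: "\<bar>exp y\<bar> *\<^sub>R (g (ln (exp y)) / of_real (exp y)) = g y" for y
  by (simp add: scaleR_conv_of_real)
 have img: "range (exp :: real => real) = {0<..}"
  using exp_total by (auto simp: image_iff)
 have "((%y. \<bar>exp y\<bar> *\<^sub>R (g (ln (exp y)) / of_real (exp y))) absolutely_integrable_on UNIV \<and>
   integral UNIV (%y. \<bar>exp y\<bar> *\<^sub>R (g (ln (exp y)) / of_real (exp y))) = (\<integral>y. g y \<partial>lborel)) =
   ((%x. g (ln x) / of_real x) absolutely_integrable_on range exp \<and>
    integral (range exp) (%x. g (ln x) / of_real x) = (\<integral>y. g y \<partial>lborel))"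
  by (rule has_absolute_integral_change_of_variables_real)
    (auto intro!: derivative_eq_intros simp: inj_on_def)
 then have "(%x. g (ln x) / of_real x) absolutely_integrable_on {0<..} \<and>
    integral {0<..} (%x. g (ln x) / of_real x) = (\<integral>y. g y \<partial>lborel)"
  unfolding eq img using ai hi by (simp add: integral_unique)
 then show "(%x. g (ln x) / of_real x) absolutely_integrable_on {0<..}"
  "integral {0<..} (%x. g (ln x) / of_real x) = (\<integral>y. g y \<partial>lborel)" by auto
qed

lemma lborel_of_ray:
 fixes g :: "real => complex"
 assumes ai: "(%x. g (ln x) / of_real x) absolutely_integrable_on {0<..}"
  and m: "g \<in> borel_measurable borel"
 shows "integrable lborel g"
  and "(\<integral>y. g y \<partial>lborel) = integral {0<..} (%x. g (ln x) / of_real x)"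
proof -
 define b where "b = integral {0<..} (%x. g (ln x) / of_real x)"
 have eq: "\<bar>exp y\<bar> *\<^sub>R (g (ln (exp y)) / of_real (exp y)) = g y" for y
  by (simp add: scaleR_conv_of_real)
 have img: "range (exp :: real => real) = {0<..}"
  using exp_total by (auto simp: image_iff)
 have "((%y. \<bar>exp y\<bar> *\<^sub>R (g (ln (exp y)) / of_real (exp y))) absolutely_integrable_on UNIV \<and>
   integral UNIV (%y. \<bar>exp y\<bar> *\<^sub>R (g (ln (exp y)) / of_real (exp y))) = b) =
   ((%x. g (ln x) / of_real x) absolutely_integrable_on range exp \<and>
    integral (range exp) (%x. g (ln x) / of_real x) = b)"
  by (rule has_absolute_integral_change_of_variables_real)
    (auto intro!: derivative_eq_intros simp: inj_on_def)
 then have *: "g absolutely_integrable_on UNIV" "integral UNIV g = b"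
  unfolding eq img using ai by (auto simp: b_def)
 have "integrable lebesgue g" using *(1) by (simp add: set_integrable_def)
 then show il: "integrable lborel g" using m by (simp add: integrable_completion)
 show "(\<integral>y. g y \<partial>lborel) = integral {0<..} (%x. g (ln x) / of_real x)"
  using integral_unique [OF has_integral_integral_lborel [OF il]] *(2) by (simp add: b_def)
qed

text \<open>Frequency 0 shows that the positive and the negative part of g have the same mass c. If
  c > 0, both divided by c are probability densities with the same characteristic function, and
  Levy's uniqueness theorem makes them equal almost everywhere.\<close>

lemma fourier_unique_real:
 fixes g :: "real => real"
 assumes int: "integrable lborel g" and F: "\<And>\<sigma>. (\<integral>x. iexp (\<sigma> * x) * of_real (g x) \<partial>lborel) = 0"
 shows "AE x in lborel. g x = 0"
proof -
 define p where "p x = max 0 (g x)" for x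
 define n where "n x = max 0 (- g x)" for x
 have ip: "integrable lborel p" "integrable lborel n"
  using int by (auto simp: p_def [abs_def] n_def [abs_def])
 have gpn: "g x = p x - n x" for x by (simp add: p_def n_def)
 have nn: "0 <= p x" "0 <= n x" for x by (auto simp: p_def n_def)
 have ii: "complex_integrable lborel (%x. iexp (\<sigma> * x) * of_real (h x))" if "integrable lborel h" for h \<sigma>
 proof (rule Bochner_Integration.integrable_bound [OF that])
  have [measurable]: "h \<in> borel_measurable lborel" using that by (rule borel_measurable_integrable)
  show "(%x. iexp (\<sigma> * x) * complex_of_real (h x)) \<in> borel_measurable lborel" by measurable
 qed (simp add: norm_mult)
 have eq: "(\<integral>x. iexp (\<sigma> * x) * of_real (p x) \<partial>lborel) = (\<integral>x. iexp (\<sigma> * x) * of_real (n x) \<partial>lborel)" for \<sigma>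
 proof -
  have "(\<integral>x. iexp (\<sigma> * x) * of_real (p x) \<partial>lborel) - (\<integral>x. iexp (\<sigma> * x) * of_real (n x) \<partial>lborel) = (\<integral>x. iexp (\<sigma> * x) * of_real (g x) \<partial>lborel)"
   unfolding Bochner_Integration.integral_diff [OF ii [OF ip(1)] ii [OF ip(2)], symmetric]
   by (simp add: gpn right_diff_distrib)
  then show ?thesis using F by simp
 qed
 define c where "c = (\<integral>x. p x \<partial>lborel)"
 have cn: "(\<integral>x. n x \<partial>lborel) = c"
  using eq [of 0] by (simp add: c_def)
 show ?thesis
 proof (cases "c = 0")
  case True
  have "AE x in lborel. p x = 0" "AE x in lborel. n x = 0"
   using integral_nonneg_eq_0_iff_AE [OF ip(1)] integral_nonneg_eq_0_iff_AE [OF ip(2)] nn True cn c_def by auto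
  then show ?thesis by eventually_elim (simp add: gpn)
 next
  case False
  have c: "c > 0" using False nn by (simp add: c_def less_le)
  define M where "M h = density lborel (%x. ennreal (h x / c))" for h :: "real => real"
  have rd: "real_distribution (M h)" if "integrable lborel h" "\<And>x. 0 <= h x" "(\<integral>x. h x \<partial>lborel) = c" for h
  proof -
   have [measurable]: "h \<in> borel_measurable lborel" using that(1) by (rule borel_measurable_integrable)
   have "emeasure (M h) (space (M h)) = (\<integral>\<^sup>+ x. ennreal (h x / c) \<partial>lborel)"
    by (simp add: M_def emeasure_density)
   also have "\<dots> = ennreal (\<integral>x. h x / c \<partial>lborel)"
    using that c by (intro nn_integral_eq_integral) auto
   also have "\<dots> = 1" using that c by simp
   finally have "prob_space (M h)" by (rule prob_spaceI)
   then show ?thesis by (simp add: real_distribution_def real_distribution_axioms_def M_def)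
  qed
  have ch: "char (M h) \<sigma> = (\<integral>x. iexp (\<sigma> * x) * of_real (h x) \<partial>lborel) / c"
   if "integrable lborel h" "\<And>x. 0 <= h x" for h \<sigma>
  proof -
   have [measurable]: "h \<in> borel_measurable lborel" using that(1) by (rule borel_measurable_integrable)
   have "char (M h) \<sigma> = (\<integral>x. (h x / c) *\<^sub>R iexp (\<sigma> * x) \<partial>lborel)"
    unfolding char_def M_def using that c by (subst integral_density) auto
   also have "\<dots> = (\<integral>x. iexp (\<sigma> * x) * of_real (h x) / c \<partial>lborel)"
    by (simp add: scaleR_conv_of_real mult.commute)
   finally show ?thesis by simp
  qed
  have "M p = M n"
   by (rule Levy_uniqueness [OF rd rd]) (use ip nn cn eq in \<open>auto simp: c_def ch fun_eq_iff\<close>)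
  then have "AE x in lborel. ennreal (p x / c) = ennreal (n x / c)"
   unfolding M_def using ip by (intro sigma_finite_measure.density_unique [OF sigma_finite_lborel]) (auto dest: borel_measurable_integrable)
  then show ?thesis
  proof eventually_elim
   case (elim x)
   then show ?case using nn [of x] c by (simp add: gpn ennreal_inj)
  qed
 qed
qed

text \<open>Conjugating the hypothesis at -\<sigma> makes the transform of \<open>cnj g\<close>
  vanish as well, hence those of the real and imaginary parts. Almost everywhere becomes everywhere
  because the set where a continuous g is nonzero is open, and a nonempty open set is not
  negligible.\<close>

lemma fourier_unique:
 fixes g :: "real => complex"
 assumes cont: "continuous_on UNIV g" and int: "integrable lborel g"
  and F: "\<And>\<sigma>. (\<integral>x. iexp (\<sigma> * x) * g x \<partial>lborel) = 0"
 shows "g x = 0"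
proof -
 have [measurable]: "g \<in> borel_measurable borel" using int by (simp add: borel_measurable_integrable)
 have ii: "complex_integrable lborel (%x. iexp (\<sigma> * x) * g x)" for \<sigma>
  by (rule Bochner_Integration.integrable_bound [OF int]) (auto simp: norm_mult)
 have ic: "complex_integrable lborel (%x. iexp (\<sigma> * x) * cnj (g x))" for \<sigma>
  using Bochner_Integration.integrable_cnj [OF ii [of "- \<sigma>"]] by (simp add: exp_cnj)
 have Fc: "(\<integral>x. iexp (\<sigma> * x) * cnj (g x) \<partial>lborel) = 0" for \<sigma>
 proof -
  have "(\<integral>x. iexp (\<sigma> * x) * cnj (g x) \<partial>lborel) = (\<integral>x. cnj (iexp ((-\<sigma>) * x) * g x) \<partial>lborel)"
   by (intro Bochner_Integration.integral_cong) (auto simp: exp_cnj)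
  also have "\<dots> = cnj (\<integral>x. iexp ((-\<sigma>) * x) * g x \<partial>lborel)" by (rule Bochner_Integration.integral_cnj)
  finally show ?thesis using F [of "- \<sigma>"] by simp
 qed
 have re: "AE x in lborel. Re (g x) = 0"
 proof (rule fourier_unique_real)
  fix \<sigma>
  have "(\<integral>x. iexp (\<sigma> * x) * of_real (Re (g x)) \<partial>lborel) = (\<integral>x. (iexp (\<sigma> * x) * g x + iexp (\<sigma> * x) * cnj (g x)) / 2 \<partial>lborel)"
   by (intro Bochner_Integration.integral_cong) (auto simp: complex_add_cnj distrib_left [symmetric])
  also have "\<dots> = 0" using ii ic F Fc by simp
  finally show "(\<integral>x. iexp (\<sigma> * x) * of_real (Re (g x)) \<partial>lborel) = 0" .
 qed (use int in simp)
 have im: "AE x in lborel. Im (g x) = 0"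
 proof (rule fourier_unique_real)
  fix \<sigma>
  have "(\<integral>x. iexp (\<sigma> * x) * of_real (Im (g x)) \<partial>lborel) = (\<integral>x. (iexp (\<sigma> * x) * g x - iexp (\<sigma> * x) * cnj (g x)) / (2 * \<i>) \<partial>lborel)"
  proof (intro Bochner_Integration.integral_cong refl)
   fix x
   have "g x - cnj (g x) = of_real (Im (g x)) * (2 * \<i>)" by (simp add: complex_eq_iff)
   then have "iexp (\<sigma> * x) * g x - iexp (\<sigma> * x) * cnj (g x) = (iexp (\<sigma> * x) * of_real (Im (g x))) * (2 * \<i>)"
    by (simp only: right_diff_distrib [symmetric] mult.assoc)
   then show "iexp (\<sigma> * x) * of_real (Im (g x)) = (iexp (\<sigma> * x) * g x - iexp (\<sigma> * x) * cnj (g x)) / (2 * \<i>)"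
    by (subst nonzero_eq_divide_eq) simp_all
  qed
  also have "\<dots> = 0" using ii ic F Fc by simp
  finally show "(\<integral>x. iexp (\<sigma> * x) * of_real (Im (g x)) \<partial>lborel) = 0" .
 qed (use int in simp)
 have ae: "AE x in lborel. g x = 0" using re im by eventually_elim (simp add: complex_eq_iff)
 have op: "open {x. g x \<noteq> 0}" by (rule open_Collect_neq [OF cont]) (intro continuous_intros)
 then have ms: "{x. g x \<noteq> 0} \<in> sets lborel" by simp
 have "{x. g x \<noteq> 0} \<in> null_sets lborel"
  using ae ms by (subst AE_iff_null_sets) auto
 then have "negligible {x. g x \<noteq> 0}" by (simp add: negligible_iff_null_sets null_sets_completionI)
 then have "{x. g x \<noteq> 0} = {}" using op open_not_negligible by blast
 then show ?thesis by auto
qed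

text \<open>Cauchy's theorem on a half-strip, with a primitive \<open>G\<close> instead of closed
  contours: each half-line integral is the limit of increments of \<open>G\<close>, and by the decay
  of g the right ends of the two lines do not differ in the limit.\<close>

lemma strip_far:
 fixes g G :: "complex => complex"
 assumes G: "\<And>w. X <= Re w ==> c <= Im w ==> Im w <= d ==> (G has_field_derivative g w) (at w)"
  and gc: "continuous_on {w. X <= Re w \<and> c <= Im w \<and> Im w <= d} g"
  and bd: "\<And>w. X <= Re w ==> c <= Im w ==> Im w <= d ==> norm (g w) <= C * exp (- (\<eta> * \<bar>Re w\<bar>))"
  and eta: "0 < \<eta>" and x: "c <= x" "x <= d" and x': "c <= x'" "x' <= d"
 shows "set_integrable lborel {X..} (%y. g (Complex y x))"
  and "(LINT y:{X..}|lborel. g (Complex y x)) + G (Complex X x) =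
     (LINT y:{X..}|lborel. g (Complex y x')) + G (Complex X x')"
proof -
 have int: "set_integrable lborel {X..} (%y. g (Complex y x))" if x: "c <= x" "x <= d" for x
 proof (rule set_integrable_bound)
  show "set_integrable lborel {X..} (%y. C * exp (- (\<eta> * \<bar>y\<bar>)))"
   unfolding set_integrable_def
   by (rule integrable_mult_indicator) (use integrable_exp_neg_abs [OF eta] in auto)
  show "set_borel_measurable lborel {X..} (%y. g (Complex y x))"
  proof -
   have "continuous_on {X..} (%y. g (Complex y x))"
    by (rule continuous_on_compose2 [OF gc]) (use x in \<open>auto simp: Complex_eq intro!: continuous_intros\<close>)
   then show ?thesis
    unfolding set_borel_measurable_def using borel_measurable_continuous_on_indicator [of "{X..}"] by simp
  qed
  show "AE y in lborel. y \<in> {X..} --> norm (g (Complex y x)) <= norm (C * exp (- (\<eta> * \<bar>y\<bar>)))"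
   using bd [of "Complex _ x"] x by (intro AE_I2) (auto intro: order_trans [OF _ abs_ge_self])
 qed
 show "set_integrable lborel {X..} (%y. g (Complex y x))" by (rule int [OF x])
 have fin: "(LINT y:{X..Y}|lborel. g (Complex y x)) = G (Complex Y x) - G (Complex X x)"
  if x: "c <= x" "x <= d" and Y: "X <= Y" for x Y
 proof -
  have "(LINT y:{X..Y}|lborel. g (Complex y x)) = integral {X..Y} (%y. g (Complex y x))"
   by (rule set_borel_integral_eq_integral(2))
     (rule set_integrable_subset [OF int [OF x]], auto)
  also have "\<dots> = G (Complex Y x) - G (Complex X x)"
  proof (rule integral_unique, rule fundamental_theorem_of_calculus [OF Y])
   fix y assume y: "y \<in> {X..Y}"
   have "((%y. Complex y x) has_vector_derivative 1) (at y within {X..Y})"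
   proof -
    have "((%y. of_real y + \<i> * of_real x) has_vector_derivative 1 + 0) (at y within {X..Y})"
     by (intro has_vector_derivative_add has_vector_derivative_const)
       (auto intro!: derivative_eq_intros simp: has_vector_derivative_def scaleR_conv_of_real)
    then show ?thesis by (simp add: Complex_eq)
   qed
   moreover have "(G has_field_derivative g (Complex y x)) (at (Complex y x) within (%y. Complex y x) ` {X..Y})"
    by (rule has_field_derivative_at_within, rule G) (use y x in simp_all)
   ultimately have "(G \<circ> (%y. Complex y x) has_vector_derivative 1 * g (Complex y x)) (at y within {X..Y})"
    by (intro field_vector_diff_chain_within [of "%y. Complex y x" 1 y "{X..Y}" G "g (Complex y x)"])
   then show "((%y. G (Complex y x)) has_vector_derivative g (Complex y x)) (at y within {X..Y})"
    by (simp add: o_def)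
  qed
  finally show ?thesis .
 qed
 have lim: "((%Y. G (Complex Y x) - G (Complex X x)) \<longlongrightarrow> (LINT y:{X..}|lborel. g (Complex y x))) at_top"
  if x: "c <= x" "x <= d" for x
 proof -
  have "((%Y. LINT y:{X..Y}|lborel. g (Complex y x)) \<longlongrightarrow> (LINT y:{X..}|lborel. g (Complex y x))) at_top"
   by (rule tendsto_set_lebesgue_integral_at_top) (use int [OF x] in auto)
  then show ?thesis
   by (rule Lim_transform_eventually) (use fin [OF x] in \<open>auto intro!: eventually_at_top_linorderI [of X]\<close>)
 qed
 \<comment> \<open>The vertical segment at abscissa Y has length |x - x'|, and on it g is
   exponentially small in Y.\<close>
 have dz: "((%Y. G (Complex Y x) - G (Complex Y x')) \<longlongrightarrow> 0) at_top"
 proof (rule Lim_null_comparison)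
  show "\<forall>\<^sub>F Y in at_top. norm (G (Complex Y x) - G (Complex Y x')) <= C * exp (- (\<eta> * \<bar>Y\<bar>)) * \<bar>x - x'\<bar>"
  proof (rule eventually_at_top_linorderI [of X])
   fix Y assume Y: "X <= Y"
   have "norm (G (Complex Y x) - G (Complex Y x')) <= C * exp (- (\<eta> * \<bar>Y\<bar>)) * norm (Complex Y x - Complex Y x')"
   proof (rule field_differentiable_bound [of "{w. Re w = Y \<and> c <= Im w \<and> Im w <= d}" G g])
    have "{w. Re w = Y \<and> c <= Im w \<and> Im w <= d} = {w. Re w = Y} \<inter> {w. Im w \<ge> c} \<inter> {w. Im w <= d}" by auto
    then show "convex {w. Re w = Y \<and> c <= Im w \<and> Im w <= d}"
     using convex_hyperplane [of "1::complex" Y] convex_halfspace_Im_ge convex_halfspace_Im_le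
     by (auto intro!: convex_Int simp: inner_complex_def)
    fix z assume "z \<in> {w. Re w = Y \<and> c <= Im w \<and> Im w <= d}"
    then show "(G has_field_derivative g z) (at z within {w. Re w = Y \<and> c <= Im w \<and> Im w <= d})"
     "norm (g z) <= C * exp (- (\<eta> * \<bar>Y\<bar>))"
     using G bd [of z] Y by (auto intro: has_field_derivative_at_within)
   qed (use x x' in auto)
   also have "norm (Complex Y x - Complex Y x') = \<bar>x - x'\<bar>" by (simp add: cmod_def)
   finally show "norm (G (Complex Y x) - G (Complex Y x')) <= C * exp (- (\<eta> * \<bar>Y\<bar>)) * \<bar>x - x'\<bar>" .
  qed
  have "((%Y. C * exp (- (\<eta> * Y)) * \<bar>x - x'\<bar>) \<longlongrightarrow> C * 0 * \<bar>x - x'\<bar>) at_top"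
   by (intro tendsto_mult tendsto_const filterlim_compose [OF exp_at_bot])
     (use eta in \<open>auto simp: filterlim_uminus_at_bot intro!: filterlim_tendsto_pos_mult_at_top [OF tendsto_const] filterlim_ident\<close>)
  then show "((%Y. C * exp (- (\<eta> * \<bar>Y\<bar>)) * \<bar>x - x'\<bar>) \<longlongrightarrow> 0) at_top"
   by (simp, elim Lim_transform_eventually) (auto intro!: eventually_at_top_linorderI [of 0])
 qed
 have "((%Y. (G (Complex Y x) - G (Complex X x)) - (G (Complex Y x') - G (Complex X x'))) \<longlongrightarrow>
   (LINT y:{X..}|lborel. g (Complex y x)) - (LINT y:{X..}|lborel. g (Complex y x'))) at_top"
  by (intro tendsto_diff lim x x')
 moreover have "((%Y. (G (Complex Y x) - G (Complex X x)) - (G (Complex Y x') - G (Complex X x'))) \<longlongrightarrow>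
   0 - G (Complex X x) + G (Complex X x')) at_top"
 proof -
  have "((%Y. (G (Complex Y x) - G (Complex Y x')) - G (Complex X x) + G (Complex X x')) \<longlongrightarrow>
   0 - G (Complex X x) + G (Complex X x')) at_top"
   by (intro tendsto_add tendsto_diff dz tendsto_const)
  then show ?thesis by (simp add: algebra_simps)
 qed
 ultimately have "(LINT y:{X..}|lborel. g (Complex y x)) - (LINT y:{X..}|lborel. g (Complex y x')) =
   0 - G (Complex X x) + G (Complex X x')"
  using tendsto_unique trivial_limit_at_top_linorder by blast
 then show "(LINT y:{X..}|lborel. g (Complex y x)) + G (Complex X x) =
     (LINT y:{X..}|lborel. g (Complex y x')) + G (Complex X x')" by (simp add: algebra_simps)
qed

section \<open>Laplace transforms in the logarithmic coordinate\<close>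

definition laplace_log ::
  "(complex => complex) => real => (complex => complex) => complex => complex" where
 "laplace_log E \<theta> v t = (\<integral>y. E (Complex y \<theta> - t) * v (Complex y \<theta>) \<partial>lborel)"

text \<open>The first exponential is a power |s|^\<eta> near the origin, a quantitative form of
  integrability there; the second is flatness of order \<kappa>. Both survive translation,
  differentiation and averaging on every smaller strip.\<close>

definition kernel_decay :: "real => (complex => complex) => bool" where
 "kernel_decay \<kappa> E \<longleftrightarrow> E holomorphic_on sector 0 (pi / \<kappa>) \<and>
   (\<forall>\<delta>>0. \<exists>A>0. \<exists>B>0. \<exists>\<eta>>0. \<forall>w. \<bar>Im w\<bar> <= pi / \<kappa> / 2 - \<delta> -->
    norm (E w) <= A * exp (- (\<eta> * \<bar>Re w\<bar>)) * exp (- (B * exp (\<kappa> * Re w))))"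

text \<open>Moments are recorded only on the imaginary axis. There they are the Fourier transform of
  the kernel on the real line, which already determines the kernel.\<close>

definition kernel_class :: "real => (complex => complex) => (real => complex) => bool" where
 "kernel_class \<kappa> E m \<longleftrightarrow> kernel_decay \<kappa> E \<and>
   (\<forall>\<sigma>. (\<integral>y. iexp (\<sigma> * y) * E (of_real y) \<partial>lborel) = m \<sigma>)"

definition borel_growth :: "real => complex set => real => real =>
  (complex => complex => complex) => bool" where
 "borel_growth \<kappa> K d \<epsilon> v \<longleftrightarrow>
   (\<forall>w\<in>sector d \<epsilon>. v w \<in> A_space K) \<and> (\<forall>z\<in>K. (%w. v w z) holomorphic_on sector d \<epsilon>) \<and>
   (\<forall>\<delta>>0. \<exists>C1>0. \<exists>C2>0. \<forall>w. \<bar>Im w - d\<bar> <= \<epsilon> / 2 - \<delta> -->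
    (\<forall>z\<in>K. norm (v w z) <= C1 * exp (C2 * exp (\<kappa> * Re w))))"

text \<open>The part of a disc-sector inside the disc is encoded by Taylor coefficients with a
  uniform geometric bound, because multipliers act on coefficients.\<close>

definition borel_class :: "real => complex set => real => real =>
  (complex => complex => complex) => (nat => complex => complex) => bool" where
 "borel_class \<kappa> K d \<epsilon> v c \<longleftrightarrow> borel_growth \<kappa> K d \<epsilon> v \<and> (\<forall>n. c n \<in> A_space K) \<and>
   (\<exists>\<rho>>0. \<exists>B>0. (\<forall>n. \<forall>z\<in>K. norm (c n z) * \<rho> ^ n <= B) \<and>
    (\<forall>w\<in>sector d \<epsilon>. exp (Re w) < \<rho> -->
      (\<forall>z\<in>K. (%n. c n z * exp (of_nat n * w)) sums v w z)))"

text \<open>\<open>P\<close> acts on the Borel side and \<open>Q\<close> on kernels; the last clause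
  says that they are adjoint under the Laplace pairing. The integrals converge only for small t, so
  the identity comes with a threshold \<open>T\<close> for log |t|; it may depend on the margin
  \<delta>, but not on the direction, t or z.\<close>

definition multiplier_pair :: "real => (complex => complex) =>
  ((complex => complex => complex) => complex => complex => complex) =>
  ((complex => complex) => complex => complex) => bool" where
 "multiplier_pair \<kappa> f P Q \<longleftrightarrow>
   (\<forall>K d \<epsilon> v c. borel_class \<kappa> K d \<epsilon> v c --> borel_class \<kappa> K d \<epsilon> (P v) (%n z. f (of_nat n) * c n z)) \<and>
   (\<forall>E m. kernel_class \<kappa> E m --> kernel_class \<kappa> (Q E) (%\<sigma>. f (\<i> * of_real \<sigma>) * m \<sigma>)) \<and>
   (\<forall>K d \<epsilon> v c E m \<delta>. borel_class \<kappa> K d \<epsilon> v c --> kernel_class \<kappa> E m --> \<delta> > 0 -->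
    (\<exists>T. \<forall>\<theta> t z. \<bar>\<theta> - d\<bar> <= \<epsilon> / 2 - \<delta> --> \<bar>\<theta> - Im t\<bar> <= pi / \<kappa> / 2 - \<delta> --> Re t < T -->
      z \<in> K --> laplace_log E \<theta> (%w. P v w z) t = laplace_log (Q E) \<theta> (%w. v w z) t))"

definition multiplier :: "real => (complex => complex) => bool" where
 "multiplier \<kappa> f \<longleftrightarrow> (\<exists>P Q. multiplier_pair \<kappa> f P Q)"

lemma multiplier_pairD:
 assumes "multiplier_pair \<kappa> f P Q"
 shows "borel_class \<kappa> K d \<epsilon> v c ==> borel_class \<kappa> K d \<epsilon> (P v) (%n z. f (of_nat n) * c n z)"
  and "kernel_class \<kappa> E m ==> kernel_class \<kappa> (Q E) (%\<sigma>. f (\<i> * of_real \<sigma>) * m \<sigma>)"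
  and "borel_class \<kappa> K d \<epsilon> v c ==> kernel_class \<kappa> E m ==> \<delta> > 0 ==>
    (\<exists>T. \<forall>\<theta> t z. \<bar>\<theta> - d\<bar> <= \<epsilon> / 2 - \<delta> --> \<bar>\<theta> - Im t\<bar> <= pi / \<kappa> / 2 - \<delta> --> Re t < T -->
      z \<in> K --> laplace_log E \<theta> (%w. P v w z) t = laplace_log (Q E) \<theta> (%w. v w z) t)"
proof -
 note * = assms [unfolded multiplier_pair_def]
 show "borel_class \<kappa> K d \<epsilon> v c ==> borel_class \<kappa> K d \<epsilon> (P v) (%n z. f (of_nat n) * c n z)"
  by (rule *[THEN conjunct1, rule_format])
 show "kernel_class \<kappa> E m ==> kernel_class \<kappa> (Q E) (%\<sigma>. f (\<i> * of_real \<sigma>) * m \<sigma>)"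
  by (rule *[THEN conjunct2, THEN conjunct1, rule_format])
 show "borel_class \<kappa> K d \<epsilon> v c ==> kernel_class \<kappa> E m ==> \<delta> > 0 ==>
    (\<exists>T. \<forall>\<theta> t z. \<bar>\<theta> - d\<bar> <= \<epsilon> / 2 - \<delta> --> \<bar>\<theta> - Im t\<bar> <= pi / \<kappa> / 2 - \<delta> --> Re t < T -->
      z \<in> K --> laplace_log E \<theta> (%w. P v w z) t = laplace_log (Q E) \<theta> (%w. v w z) t)"
  using *[THEN conjunct2, THEN conjunct2] by blast
qed

lemma kernel_decayE:
 assumes "kernel_decay \<kappa> E" "\<delta> > 0"
 obtains A B \<eta> where "A > 0" "B > 0" "\<eta> > 0"
  "\<And>w. \<bar>Im w\<bar> <= pi / \<kappa> / 2 - \<delta> ==>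
    norm (E w) <= A * exp (- (\<eta> * \<bar>Re w\<bar>)) * exp (- (B * exp (\<kappa> * Re w)))"
 using assms(1) [unfolded kernel_decay_def, THEN conjunct2, rule_format, OF assms(2)] that by blast

lemma borel_growthE:
 assumes "borel_growth \<kappa> K d \<epsilon> v" "\<delta> > 0"
 obtains C1 C2 where "C1 > 0" "C2 > 0"
  "\<And>w z. \<bar>Im w - d\<bar> <= \<epsilon> / 2 - \<delta> ==> z \<in> K ==> norm (v w z) <= C1 * exp (C2 * exp (\<kappa> * Re w))"
 using assms(1) [unfolded borel_growth_def, THEN conjunct2, THEN conjunct2, rule_format, OF assms(2)] that by blast

section \<open>Convergence of the Laplace integral for small t\<close>

lemma open_sector [simp]: "open (sector d \<alpha>)"
proof -
 have "sector d \<alpha> = {w. Im w < d + \<alpha> / 2} \<inter> {w. Im w > d - \<alpha> / 2}"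
  by (auto simp: sector_def abs_if)
 then show ?thesis by (auto intro: open_halfspace_Im_lt open_halfspace_Im_gt)
qed

lemma convex_sector [simp]: "convex (sector d \<alpha>)"
proof -
 have "sector d \<alpha> = {w. Im w < d + \<alpha> / 2} \<inter> {w. Im w > d - \<alpha> / 2}"
  by (auto simp: sector_def abs_if)
 then show ?thesis by (auto intro: convex_Int convex_halfspace_Im_lt convex_halfspace_Im_gt)
qed

lemma continuous_on_line [continuous_intros]:
 "continuous_on S (%y. Complex (f y) \<theta>)" if "continuous_on S f"
 using that by (auto simp: Complex_eq intro!: continuous_intros)

text \<open>The source of the thresholds \<open>T\<close>: the kernel decays like exp (- B
  |s/t|^\<kappa>), which beats a growth exp (C |s|^\<kappa>) as soon as B |t|^(-\<kappa>) reaches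
  C.\<close>

lemma exp_threshold:
 fixes \<kappa> B C :: real
 assumes "\<kappa> > 0" "B > 0" "C > 0"
 shows "\<exists>T. \<forall>x<T. C <= B * exp (- (\<kappa> * x))"
proof (intro exI allI impI)
 fix x assume "x < - (ln (C / B) / \<kappa>)"
 then have "ln (C / B) < - (\<kappa> * x)" using assms by (simp add: field_simps)
 then have "C / B < exp (- (\<kappa> * x))" using assms by (metis divide_pos_pos exp_less_mono exp_ln)
 then show "C <= B * exp (- (\<kappa> * x))" using assms by (simp add: divide_less_eq mult.commute)
qed

text \<open>Here x = log |s| and a = log |t|. Under \<open>T\<close> the two double exponentials
  combine to a factor at most 1; the remaining decay in |x - a| becomes decay in |x| at the price
  exp (\<eta> |a|).\<close>

lemma kernel_growth_bound:
 fixes e v :: complex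
 assumes E: "norm e <= A * exp (- (\<eta> * \<bar>x - a\<bar>)) * exp (- (B * exp (\<kappa> * (x - a))))"
  and v: "norm v <= C1 * exp (C2 * exp (\<kappa> * x))"
  and T: "C2 <= B * exp (- (\<kappa> * a))" and pos: "0 <= \<eta>" "0 <= A" "0 <= C1"
 shows "norm (e * v) <= A * C1 * exp (\<eta> * \<bar>a\<bar>) * exp (- (\<eta> * \<bar>x\<bar>))"
proof -
 have "norm (e * v) <= (A * exp (- (\<eta> * \<bar>x - a\<bar>)) * exp (- (B * exp (\<kappa> * (x - a))))) * (C1 * exp (C2 * exp (\<kappa> * x)))"
  unfolding norm_mult using E v pos by (intro mult_mono) auto
 also have "\<dots> = A * C1 * exp (- (\<eta> * \<bar>x - a\<bar>) + (C2 - B * exp (- (\<kappa> * a))) * exp (\<kappa> * x))"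
 proof -
  have 1: "exp (\<kappa> * (x - a)) = exp (- (\<kappa> * a)) * exp (\<kappa> * x)"
   by (simp add: exp_add [symmetric] right_diff_distrib)
  have 2: "A * exp p * exp q * (C1 * exp r) = A * C1 * exp (p + q + r)" for p q r :: real
   by (simp add: exp_add)
  show ?thesis unfolding 2 1 by (simp add: algebra_simps)
 qed
 also have "\<dots> <= A * C1 * exp (\<eta> * \<bar>a\<bar> - \<eta> * \<bar>x\<bar>)"
 proof (intro mult_left_mono)
  have "(C2 - B * exp (- (\<kappa> * a))) * exp (\<kappa> * x) <= 0" using T by (intro mult_nonpos_nonneg) auto
  moreover have "\<eta> * \<bar>x\<bar> <= \<eta> * (\<bar>x - a\<bar> + \<bar>a\<bar>)" using pos by (intro mult_left_mono) auto
  ultimately show "exp (- (\<eta> * \<bar>x - a\<bar>) + (C2 - B * exp (- (\<kappa> * a))) * exp (\<kappa> * x)) <= exp (\<eta> * \<bar>a\<bar> - \<eta> * \<bar>x\<bar>)"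
   unfolding exp_le_cancel_iff distrib_left by linarith
 qed (use pos in auto)
 finally show ?thesis by (simp add: exp_diff exp_minus divide_simps)
qed

text \<open>The order of quantifiers matters: \<open>T\<close> and \<eta> depend on the growth type
  \<open>C2\<close>, but not on the factor \<open>C1\<close>, which may vary afterwards.\<close>

lemma kernel_product_bound:
 assumes k: "\<kappa> > 0" and E: "kernel_decay \<kappa> E" and d: "\<delta> > 0" and C2: "C2 > 0"
 shows "\<exists>T. \<exists>\<eta>>0. \<exists>A>0. \<forall>w t x C1. \<bar>Im w - Im t\<bar> <= pi / \<kappa> / 2 - \<delta> --> Re t < T -->
   norm x <= C1 * exp (C2 * exp (\<kappa> * Re w)) -->
   norm (E (w - t) * x) <= A * C1 * exp (\<eta> * \<bar>Re t\<bar>) * exp (- (\<eta> * \<bar>Re w\<bar>))"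
proof -
 obtain A B \<eta> where AB: "A > 0" "B > 0" "\<eta> > 0"
  and bd: "\<And>w. \<bar>Im w\<bar> <= pi / \<kappa> / 2 - \<delta> ==>
    norm (E w) <= A * exp (- (\<eta> * \<bar>Re w\<bar>)) * exp (- (B * exp (\<kappa> * Re w)))"
  by (rule kernel_decayE [OF E d], rule that)
 obtain T where T: "\<forall>x<T. C2 <= B * exp (- (\<kappa> * x))" using exp_threshold [OF k AB(2) C2] by blast
 show ?thesis
 proof (rule exI [of _ T], rule exI [of _ \<eta>], rule conjI, rule AB(3), rule exI [of _ A], intro conjI allI impI)
  fix w t x :: complex and C1 :: real
  assume *: "\<bar>Im w - Im t\<bar> <= pi / \<kappa> / 2 - \<delta>" "Re t < T" "norm x <= C1 * exp (C2 * exp (\<kappa> * Re w))"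
  have "0 <= C1 * exp (C2 * exp (\<kappa> * Re w))" using *(3) norm_ge_zero order_trans by blast
  then have "0 <= C1" by (simp add: zero_le_mult_iff)
  then show "norm (E (w - t) * x) <= A * C1 * exp (\<eta> * \<bar>Re t\<bar>) * exp (- (\<eta> * \<bar>Re w\<bar>))"
   using kernel_growth_bound [of "E (w - t)" A \<eta> "Re w" "Re t" B \<kappa> x C1 C2] bd [of "w - t"] * AB T by simp
 qed (use AB in auto)
qed

lemma continuous_line_product:
 assumes E: "kernel_decay \<kappa> E" and v: "borel_growth \<kappa> K d \<epsilon> v" and d: "\<delta> > 0"
  and *: "\<bar>\<theta> - d\<bar> <= \<epsilon> / 2 - \<delta>" "\<bar>\<theta> - Im t\<bar> <= pi / \<kappa> / 2 - \<delta>" "z \<in> K"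
 shows "continuous_on UNIV (%y. E (Complex y \<theta> - t) * v (Complex y \<theta>) z)"
proof (intro continuous_on_mult)
 have "continuous_on (sector 0 (pi / \<kappa>)) E" using E by (auto simp: kernel_decay_def intro: holomorphic_on_imp_continuous_on)
 then show "continuous_on UNIV (%y. E (Complex y \<theta> - t))"
  by (rule continuous_on_compose2) (use * d in \<open>auto intro!: continuous_intros simp: sector_def\<close>)
 have "continuous_on (sector d \<epsilon>) (%w. v w z)"
  using v *(3) by (auto simp: borel_growth_def intro: holomorphic_on_imp_continuous_on)
 then show "continuous_on UNIV (%y. v (Complex y \<theta>) z)"
  by (rule continuous_on_compose2) (use * d in \<open>auto intro!: continuous_intros simp: sector_def\<close>)
qed

lemma laplace_line_bound:
 assumes k: "\<kappa> > 0" and E: "kernel_decay \<kappa> E" and v: "borel_growth \<kappa> K d \<epsilon> v" and d: "\<delta> > 0"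
 shows "\<exists>T. \<exists>\<eta>>0. \<exists>C>0. \<forall>w t z. \<bar>Im w - d\<bar> <= \<epsilon> / 2 - \<delta> --> \<bar>Im w - Im t\<bar> <= pi / \<kappa> / 2 - \<delta> -->
   Re t < T --> z \<in> K -->
   norm (E (w - t) * v w z) <= C * exp (\<eta> * \<bar>Re t\<bar>) * exp (- (\<eta> * \<bar>Re w\<bar>))"
proof -
 obtain C1 C2 where C: "C1 > 0" "C2 > 0"
  and vb: "\<And>w z. \<bar>Im w - d\<bar> <= \<epsilon> / 2 - \<delta> ==> z \<in> K ==> norm (v w z) <= C1 * exp (C2 * exp (\<kappa> * Re w))"
  by (rule borel_growthE [OF v d], rule that)
 obtain T \<eta> A where T: "\<eta> > 0" "A > 0" and b: "\<And>w t x C1. \<bar>Im w - Im t\<bar> <= pi / \<kappa> / 2 - \<delta> ==> Re t < T ==>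
   norm x <= C1 * exp (C2 * exp (\<kappa> * Re w)) ==>
   norm (E (w - t) * x) <= A * C1 * exp (\<eta> * \<bar>Re t\<bar>) * exp (- (\<eta> * \<bar>Re w\<bar>))"
  using kernel_product_bound [OF k E d C(2)] by blast
 show ?thesis
 proof (rule exI [of _ T], rule exI [of _ \<eta>], rule conjI, rule T(1), rule exI [of _ "A * C1"], intro conjI allI impI)
  fix w t z
  assume *: "\<bar>Im w - d\<bar> <= \<epsilon> / 2 - \<delta>" "\<bar>Im w - Im t\<bar> <= pi / \<kappa> / 2 - \<delta>" "Re t < T" "z \<in> K"
  show "norm (E (w - t) * v w z) <= A * C1 * exp (\<eta> * \<bar>Re t\<bar>) * exp (- (\<eta> * \<bar>Re w\<bar>))"
   by (rule b [OF *(2,3) vb [OF *(1,4)]])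
 qed (use T C in auto)
qed

lemma integrable_exp_bound:
 fixes f :: "real => complex"
 assumes "continuous_on UNIV f" "\<And>y. norm (f y) <= C * exp (- (\<eta> * \<bar>y\<bar>))" "\<eta> > 0"
 shows "integrable lborel f"
proof (rule Bochner_Integration.integrable_bound)
 show "integrable lborel (%y. C * exp (- (\<eta> * \<bar>y\<bar>)))" using integrable_exp_neg_abs [OF assms(3)] by simp
 show "f \<in> borel_measurable lborel" using borel_measurable_continuous_onI [OF assms(1)] by simp
qed (use assms(2) in \<open>auto intro: order_trans [OF _ abs_ge_self]\<close>)

lemma laplace_integrable:
 assumes k: "\<kappa> > 0" and E: "kernel_decay \<kappa> E" and v: "borel_growth \<kappa> K d \<epsilon> v" and d: "\<delta> > 0"
 shows "\<exists>T. \<forall>\<theta> t z. \<bar>\<theta> - d\<bar> <= \<epsilon> / 2 - \<delta> --> \<bar>\<theta> - Im t\<bar> <= pi / \<kappa> / 2 - \<delta> --> Re t < T --> z \<in> K -->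
   integrable lborel (%y. E (Complex y \<theta> - t) * v (Complex y \<theta>) z)"
proof -
 obtain T \<eta> C where T: "\<eta> > 0" "C > 0" and b: "\<And>w t z. \<bar>Im w - d\<bar> <= \<epsilon> / 2 - \<delta> ==> \<bar>Im w - Im t\<bar> <= pi / \<kappa> / 2 - \<delta> ==>
   Re t < T ==> z \<in> K ==> norm (E (w - t) * v w z) <= C * exp (\<eta> * \<bar>Re t\<bar>) * exp (- (\<eta> * \<bar>Re w\<bar>))"
  using laplace_line_bound [OF k E v d] by blast
 show ?thesis
 proof (intro exI [of _ T] allI impI)
  fix \<theta> t z assume *: "\<bar>\<theta> - d\<bar> <= \<epsilon> / 2 - \<delta>" "\<bar>\<theta> - Im t\<bar> <= pi / \<kappa> / 2 - \<delta>" "Re t < T" "z \<in> K"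
  show "integrable lborel (%y. E (Complex y \<theta> - t) * v (Complex y \<theta>) z)"
   by (rule integrable_exp_bound [OF continuous_line_product [OF E v d *(1,2,4)] _ T(1), of "C * exp (\<eta> * \<bar>Re t\<bar>)"])
     (use b [of "Complex _ \<theta>" t z] * in simp)
 qed
qed

lemma multiplier_mult:
 assumes "multiplier \<kappa> f" "multiplier \<kappa> g"
 shows "multiplier \<kappa> (%x. g x * f x)"
proof -
 obtain P1 Q1 where 1: "multiplier_pair \<kappa> f P1 Q1" using assms(1) by (auto simp: multiplier_def)
 obtain P2 Q2 where 2: "multiplier_pair \<kappa> g P2 Q2" using assms(2) by (auto simp: multiplier_def)
 note 1 = multiplier_pairD [OF 1] and 2 = multiplier_pairD [OF 2]
 show ?thesis
  unfolding multiplier_def multiplier_pair_def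
 \<comment> \<open>Adjoints compose in the opposite order.\<close>
 proof (rule exI [of _ "%v. P2 (P1 v)"], rule exI [of _ "%E. Q1 (Q2 E)"], intro conjI allI impI)
  fix K d \<epsilon> v c assume v: "borel_class \<kappa> K d \<epsilon> v c"
  then show "borel_class \<kappa> K d \<epsilon> (P2 (P1 v)) (%n z. g (of_nat n) * f (of_nat n) * c n z)"
   using 2(1) [OF 1(1) [OF v]] by (simp add: mult.assoc)
 next
  fix E m assume E: "kernel_class \<kappa> E m"
  then show "kernel_class \<kappa> (Q1 (Q2 E)) (%\<sigma>. g (\<i> * of_real \<sigma>) * f (\<i> * of_real \<sigma>) * m \<sigma>)"
   using 1(2) [OF 2(2) [OF E]] by (simp add: mult_ac)
 next
  fix K d \<epsilon> v c E m and \<delta> :: real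
  assume v: "borel_class \<kappa> K d \<epsilon> v c" and E: "kernel_class \<kappa> E m" and d: "\<delta> > 0"
  obtain T1 where T1: "\<And>\<theta> t z. \<bar>\<theta> - d\<bar> <= \<epsilon> / 2 - \<delta> ==> \<bar>\<theta> - Im t\<bar> <= pi / \<kappa> / 2 - \<delta> ==> Re t < T1 ==>
      z \<in> K ==> laplace_log E \<theta> (%w. P2 (P1 v) w z) t = laplace_log (Q2 E) \<theta> (%w. P1 v w z) t"
   using 2(3) [OF 1(1) [OF v] E d] by blast
  obtain T2 where T2: "\<And>\<theta> t z. \<bar>\<theta> - d\<bar> <= \<epsilon> / 2 - \<delta> ==> \<bar>\<theta> - Im t\<bar> <= pi / \<kappa> / 2 - \<delta> ==> Re t < T2 ==>
      z \<in> K ==> laplace_log (Q2 E) \<theta> (%w. P1 v w z) t = laplace_log (Q1 (Q2 E)) \<theta> (%w. v w z) t"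
   using 1(3) [OF v 2(2) [OF E] d] by blast
  show "\<exists>T. \<forall>\<theta> t z. \<bar>\<theta> - d\<bar> <= \<epsilon> / 2 - \<delta> --> \<bar>\<theta> - Im t\<bar> <= pi / \<kappa> / 2 - \<delta> --> Re t < T -->
      z \<in> K --> laplace_log E \<theta> (%w. P2 (P1 v) w z) t = laplace_log (Q1 (Q2 E)) \<theta> (%w. v w z) t"
   by (intro exI [of _ "min T1 T2"]) (use T1 T2 in auto)
 qed
qed

lemma fubini_dominated:
 fixes f :: "real => 'n => complex"
 assumes N: "finite_measure N" and m: "(%(y, om). f y om) \<in> borel_measurable (lborel \<Otimes>\<^sub>M N)"
  and g: "integrable lborel g" and h: "integrable N h"
  and le: "\<And>y om. om \<in> space N ==> norm (f y om) <= g y * h om"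
 shows "(\<integral>om. (\<integral>y. f y om \<partial>lborel) \<partial>N) = (\<integral>y. (\<integral>om. f y om \<partial>N) \<partial>lborel)"
proof -
 interpret N: finite_measure N by (rule N)
 interpret pair_sigma_finite lborel N ..
 have [measurable]: "g \<in> borel_measurable borel" "h \<in> borel_measurable N" using g h by auto
 have "integrable (lborel \<Otimes>\<^sub>M N) (%(y, om). g y * h om)"
 proof (rule Fubini_integrable)
  have "(\<integral>om. norm (case (y, om) of (y, om) => g y * h om) \<partial>N) = \<bar>g y\<bar> * (\<integral>om. \<bar>h om\<bar> \<partial>N)" for y
   by (simp add: abs_mult)
  then show "integrable lborel (%y. \<integral>om. norm (case (y, om) of (y, om) => g y * h om) \<partial>N)"
   using g by simp
 qed (use h in auto)
 then have "integrable (lborel \<Otimes>\<^sub>M N) (%(y, om). f y om)"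
  by (rule Bochner_Integration.integrable_bound [OF _ m])
    (auto intro!: AE_I2 order_trans [OF le abs_ge_self] simp: space_pair_measure)
 then show ?thesis by (rule Fubini_integral)
qed

section \<open>Multipliers given by averages\<close>

lemma borel_classI:
 assumes "borel_growth \<kappa> K d \<epsilon> v" "\<And>n. c n \<in> A_space K" "\<rho> > 0" "B > 0"
  "\<And>n z. z \<in> K ==> norm (c n z) * \<rho> ^ n <= B"
  "\<And>w z. w \<in> sector d \<epsilon> ==> exp (Re w) < \<rho> ==> z \<in> K ==> (%n. c n z * exp (of_nat n * w)) sums v w z"
 shows "borel_class \<kappa> K d \<epsilon> v c"
 unfolding borel_class_def
proof (rule conjI, rule assms(1), rule conjI, intro allI, rule assms(2), rule exI [of _ \<rho>],
  rule conjI, rule assms(3), rule exI [of _ B], rule conjI, rule assms(4), intro conjI allI ballI impI)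
qed (use assms(5,6) in auto)

lemma borel_classE:
 assumes "borel_class \<kappa> K d \<epsilon> v c"
 obtains \<rho> B where "\<rho> > 0" "B > 0"
  "\<And>n z. z \<in> K ==> norm (c n z) * \<rho> ^ n <= B"
  "\<And>w z. w \<in> sector d \<epsilon> ==> exp (Re w) < \<rho> ==> z \<in> K ==> (%n. c n z * exp (of_nat n * w)) sums v w z"
 using assms unfolding borel_class_def by blast

lemma sector_ball:
 assumes "w \<in> sector d \<epsilon>"
 obtains \<delta> where "\<delta> > 0" "\<delta> < 1" "\<And>x. x \<in> cball w \<delta> ==> \<bar>Im x - d\<bar> <= \<epsilon> / 2 - \<delta>"
proof
 define \<delta> where "\<delta> = min ((\<epsilon> / 2 - \<bar>Im w - d\<bar>) / 2) (1 / 2)"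
 show "\<delta> > 0" "\<delta> < 1" using assms by (auto simp: \<delta>_def sector_def)
 fix x assume "x \<in> cball w \<delta>"
 then have "\<bar>Im (w - x)\<bar> <= \<delta>" using abs_Im_le_cmod order_trans by (fastforce simp: dist_norm)
 moreover have "\<delta> <= (\<epsilon> / 2 - \<bar>Im w - d\<bar>) / 2" unfolding \<delta>_def by (rule min.cobounded1)
 ultimately show "\<bar>Im x - d\<bar> <= \<epsilon> / 2 - \<delta>" by (simp add: abs_if split: if_splits)
qed

lemma Re_le_in_cball: "x \<in> cball w \<delta> ==> Re x <= Re w + \<delta>"
 using abs_Re_le_cmod [of "w - x"] by (simp add: dist_norm)

text \<open>One constant serves all translations by \<xi> \<le> b, however far to the left: the
  growth bound increases with Re w, so only the upper end of the translations enters. This is the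
  local majorant for averages.\<close>

lemma borel_growth_local_bound:
 assumes "borel_growth \<kappa> K d \<epsilon> v" "\<kappa> > 0" "w \<in> sector d \<epsilon>"
 shows "\<exists>\<delta>>0. \<exists>B>0. \<forall>b. \<forall>x\<in>ball w \<delta>. \<forall>z\<in>K. \<forall>\<xi>\<le>b. norm (v (x + of_real \<xi>) z) <= B * exp (B * exp (\<kappa> * b))"
proof -
 obtain \<delta> where d: "\<delta> > 0" "\<delta> < 1" "\<And>x. x \<in> cball w \<delta> ==> \<bar>Im x - d\<bar> <= \<epsilon> / 2 - \<delta>"
  using sector_ball [OF assms(3)] by blast
 obtain C1 C2 where C: "C1 > 0" "C2 > 0"
  "\<And>w z. \<bar>Im w - d\<bar> <= \<epsilon> / 2 - \<delta> ==> z \<in> K ==> norm (v w z) <= C1 * exp (C2 * exp (\<kappa> * Re w))"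
  by (rule borel_growthE [OF assms(1) d(1)], rule that)
 define B where "B = max C1 (C2 * exp (\<kappa> * (Re w + \<delta>)))"
 have B: "B > 0" "C1 <= B" "C2 * exp (\<kappa> * (Re w + \<delta>)) <= B" using C by (auto simp: B_def)
 show ?thesis
 proof (rule exI [of _ \<delta>], rule conjI, rule d(1), rule exI [of _ B], rule conjI, rule B(1), intro allI ballI impI)
  fix b x z and \<tau> :: real assume x: "x \<in> ball w \<delta>" and z: "z \<in> K" and t: "\<tau> <= b"
  have xc: "x \<in> cball w \<delta>" using x by simp
  have "norm (v (x + of_real \<tau>) z) <= C1 * exp (C2 * exp (\<kappa> * Re (x + of_real \<tau>)))"
   using d(3) [OF xc] z by (intro C(3)) auto
  also have "\<dots> <= B * exp (B * exp (\<kappa> * b))"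
  proof (intro mult_mono)
   have "C2 * exp (\<kappa> * Re (x + of_real \<tau>)) <= C2 * exp (\<kappa> * ((Re w + \<delta>) + b))"
    using Re_le_in_cball [OF xc] t assms(2) C by (intro mult_left_mono) auto
   also have "\<dots> = (C2 * exp (\<kappa> * (Re w + \<delta>))) * exp (\<kappa> * b)" by (simp add: distrib_left exp_add)
   also have "\<dots> <= B * exp (\<kappa> * b)" using B by (intro mult_right_mono) auto
   finally show "exp (C2 * exp (\<kappa> * Re (x + of_real \<tau>))) <= exp (B * exp (\<kappa> * b))" by simp
  qed (use B in auto)
  finally show "norm (v (x + of_real \<tau>) z) <= B * exp (B * exp (\<kappa> * b))" .
 qed
qed

lemma exp_pos_neg_bound:
 fixes \<tau> :: real assumes "\<tau> <= b" "0 <= \<eta>" "\<eta> <= \<eta>0"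
 shows "exp (\<eta> * \<bar>\<tau>\<bar>) <= exp (\<eta> * \<bar>b\<bar>) + exp (- (\<eta>0 * \<tau>))"
proof (cases "0 <= \<tau>")
 case True
 then have "exp (\<eta> * \<bar>\<tau>\<bar>) <= exp (\<eta> * \<bar>b\<bar>)" using assms by (auto intro!: mult_left_mono)
 then show ?thesis by (simp add: add_increasing2)
next
 case False
 then have "\<eta> * \<bar>\<tau>\<bar> <= - (\<eta>0 * \<tau>)" using assms mult_right_mono [of \<eta> \<eta>0 "- \<tau>"] by simp
 then have "exp (\<eta> * \<bar>\<tau>\<bar>) <= exp (- (\<eta>0 * \<tau>))" by simp
 then show ?thesis by (simp add: add_increasing)
qed

text \<open>A translation by \<tau> in w multiplies s by exp \<tau>. The bound \<tau> \<le> b means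
  that the growth type is only rescaled. Below, \<tau> may be unbounded (a logarithm of a beta
  variable is), and the exponential moment of order \<eta>0 controls this.\<close>

locale averaging = finite_measure N for N :: "real measure" +
 fixes \<tau> :: "real => real" and b \<eta>0 \<kappa> :: real
 assumes tau [measurable]: "\<tau> \<in> borel_measurable N" and tau_le: "\<And>om. om \<in> space N ==> \<tau> om <= b"
  and eta0: "\<eta>0 > 0" and exp_int: "integrable N (%om. exp (- (\<eta>0 * \<tau> om)))" and kappa: "\<kappa> > 0"
begin

definition avg_v :: "(complex => complex => complex) => complex => complex => complex" where
 "avg_v v w z = (\<integral>om. v (w + of_real (\<tau> om)) z \<partial>N)"

text \<open>The sign is opposite to that in \<open>avg_v\<close>: translating the line of
  integration moves the shift from the function to the kernel.\<close>

definition avg_k :: "(complex => complex) => complex => complex" where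
 "avg_k E w = (\<integral>om. E (w - of_real (\<tau> om)) \<partial>N)"

text \<open>The eigenvalue of the averaging on exp (x w): at x = n it multiplies the n-th Taylor
  coefficient, at x = \<i> \<sigma> the Fourier transform of the kernel.\<close>

definition avg_f :: "complex => complex" where
 "avg_f x = (\<integral>om. exp (x * of_real (\<tau> om)) \<partial>N)"

lemma shift_measurable:
 assumes "f holomorphic_on sector d \<epsilon>" "w \<in> sector d \<epsilon>"
 shows "(%om. f (w + of_real (s * \<tau> om))) \<in> borel_measurable N"
proof -
 have "continuous_on UNIV (%x::real. f (w + of_real x))"
  by (rule continuous_on_compose2 [OF holomorphic_on_imp_continuous_on [OF assms(1)]])
    (use assms(2) in \<open>auto simp: sector_def intro!: continuous_intros\<close>)
 then have [measurable]: "(%x::real. f (w + of_real x)) \<in> borel_measurable borel"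
  by (rule borel_measurable_continuous_onI)
 show ?thesis by measurable
qed

lemma integrable_const_bound':
 fixes f :: "real => complex"
 assumes "f \<in> borel_measurable N" "\<And>om. om \<in> space N ==> norm (f om) <= C"
 shows "integrable N f" and "norm (\<integral>om. f om \<partial>N) <= measure N (space N) * C"
proof -
 show i: "integrable N f" by (rule integrable_const_bound [of _ C]) (use assms in auto)
 have "norm (\<integral>om. f om \<partial>N) <= (\<integral>om. C \<partial>N)"
  by (rule Bochner_Integration.integral_norm_bound_integral [OF i]) (use assms in auto)
 then show "norm (\<integral>om. f om \<partial>N) <= measure N (space N) * C" by simp
qed

lemma avg_v_growth:
 assumes v: "borel_growth \<kappa> K d \<epsilon> v"
 shows "borel_growth \<kappa> K d \<epsilon> (avg_v v)"
 unfolding borel_growth_def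
proof (intro conjI ballI allI impI)
 have hol: "(%w. v w z) holomorphic_on sector d \<epsilon>" if "z \<in> K" for z
  using v that by (auto simp: borel_growth_def)
 have meas: "(%om. v (w + of_real (\<tau> om)) z) \<in> borel_measurable N" if "z \<in> K" "w \<in> sector d \<epsilon>" for z w
  using shift_measurable [OF hol [OF that(1)] that(2), of 1] by simp
 have inS: "w + of_real x \<in> sector d \<epsilon>" if "w \<in> sector d \<epsilon>" for w and x :: real
  using that by (simp add: sector_def)
 show "avg_v v w \<in> A_space K" if w: "w \<in> sector d \<epsilon>" for w
 proof -
  obtain \<delta> B where B: "\<delta> > 0" "B > 0" "\<forall>b. \<forall>x\<in>ball w \<delta>. \<forall>z\<in>K. \<forall>\<xi>\<le>b. norm (v (x + of_real \<xi>) z) <= B * exp (B * exp (\<kappa> * b))"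
   using borel_growth_local_bound [OF v kappa w] by blast
  have le: "norm (v (w + of_real (\<tau> om)) z) <= B * exp (B * exp (\<kappa> * b))" if "om \<in> space N" "z \<in> K" for om z
   using B that tau_le by simp
  have A: "v (w + of_real (\<tau> om)) \<in> A_space K" for om using v inS [OF w] by (auto simp: borel_growth_def)
  have "continuous_on K (avg_v v w)"
   unfolding avg_v_def
   by (rule continuous_on_integral_dominated [where g = "%_. B * exp (B * exp (\<kappa> * b))"])
     (use meas w le A in \<open>auto simp: A_space_def\<close>)
  moreover have "avg_v v w holomorphic_on interior K"
   unfolding avg_v_def
  proof (rule holomorphic_on_integral)
   fix x assume x: "x \<in> interior K"
   show "(%om. v (w + of_real (\<tau> om)) x) \<in> borel_measurable N" using meas w x interior_subset by blast
   show "\<exists>\<delta>>0. \<exists>g. integrable N g \<and> (\<forall>y\<in>ball x \<delta> \<inter> interior K. \<forall>om\<in>space N. norm (v (w + of_real (\<tau> om)) y) <= g om)"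
    by (rule exI [of _ 1], simp, rule exI [of _ "%_. B * exp (B * exp (\<kappa> * b))"])
      (use le interior_subset in auto)
  qed (use A in \<open>auto simp: A_space_def\<close>)
  ultimately show ?thesis by (simp add: A_space_def)
 qed
 show "(%w. avg_v v w z) holomorphic_on sector d \<epsilon>" if z: "z \<in> K" for z
  unfolding avg_v_def
 proof (rule holomorphic_on_integral)
  show "(%x. v (x + of_real (\<tau> om)) z) holomorphic_on sector d \<epsilon>" for om
  proof -
   have 1: "(%x. x + complex_of_real (\<tau> om)) holomorphic_on sector d \<epsilon>" by (intro holomorphic_intros)
   have 2: "(%x. x + complex_of_real (\<tau> om)) ` sector d \<epsilon> \<subseteq> sector d \<epsilon>" using inS by auto
   show ?thesis using holomorphic_on_compose_gen [OF 1 hol [OF z] 2] by (simp add: o_def)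
  qed
  fix x assume x: "x \<in> sector d \<epsilon>"
  obtain \<delta> B where B: "\<delta> > 0" "B > 0" "\<forall>b. \<forall>x\<in>ball x \<delta>. \<forall>z\<in>K. \<forall>\<xi>\<le>b. norm (v (x + of_real \<xi>) z) <= B * exp (B * exp (\<kappa> * b))"
   using borel_growth_local_bound [OF v kappa x] by blast
  show "\<exists>\<delta>>0. \<exists>g. integrable N g \<and> (\<forall>y\<in>ball x \<delta> \<inter> sector d \<epsilon>. \<forall>om\<in>space N. norm (v (y + of_real (\<tau> om)) z) <= g om)"
   by (rule exI [of _ \<delta>], rule conjI, rule B(1), rule exI [of _ "%_. B * exp (B * exp (\<kappa> * b))"])
     (use B tau_le z in auto)
 qed (use meas z in auto)
 fix \<delta> :: real assume d: "\<delta> > 0"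
 obtain C1 C2 where C: "C1 > 0" "C2 > 0"
  "\<And>w z. \<bar>Im w - d\<bar> <= \<epsilon> / 2 - \<delta> ==> z \<in> K ==> norm (v w z) <= C1 * exp (C2 * exp (\<kappa> * Re w))"
  by (rule borel_growthE [OF v d], rule that)
 define M where "M = measure N (space N) + 1"
 have M: "M > 0" by (simp add: M_def add_nonneg_pos)
 show "\<exists>C1>0. \<exists>C2>0. \<forall>w. \<bar>Im w - d\<bar> <= \<epsilon> / 2 - \<delta> --> (\<forall>z\<in>K. norm (avg_v v w z) <= C1 * exp (C2 * exp (\<kappa> * Re w)))"
 proof (rule exI [of _ "C1 * M"], rule conjI, simp add: C M, rule exI [of _ "C2 * exp (\<kappa> * b)"], rule conjI, simp add: C, intro allI impI ballI)
  fix w z assume w: "\<bar>Im w - d\<bar> <= \<epsilon> / 2 - \<delta>" and z: "z \<in> K"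
  have "w \<in> sector d \<epsilon>" using w d by (simp add: sector_def)
  have le: "norm (v (w + of_real (\<tau> om)) z) <= C1 * exp (C2 * exp (\<kappa> * b) * exp (\<kappa> * Re w))" if "om \<in> space N" for om
  proof -
   have "norm (v (w + of_real (\<tau> om)) z) <= C1 * exp (C2 * exp (\<kappa> * Re (w + of_real (\<tau> om))))"
    using w z by (intro C(3)) auto
   also have "\<dots> <= C1 * exp (C2 * exp (\<kappa> * (b + Re w)))"
    using C kappa tau_le [OF that] by auto
   finally show ?thesis by (simp add: distrib_left exp_add mult.assoc)
  qed
  have "norm (avg_v v w z) <= measure N (space N) * (C1 * exp (C2 * exp (\<kappa> * b) * exp (\<kappa> * Re w)))"
   unfolding avg_v_def by (rule integrable_const_bound' [OF meas [OF z \<open>w \<in> sector d \<epsilon>\<close>] le])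
  also have "\<dots> <= C1 * M * exp (C2 * exp (\<kappa> * b) * exp (\<kappa> * Re w))"
   using C by (simp add: M_def algebra_simps)
  finally show "norm (avg_v v w z) <= C1 * M * exp (C2 * exp (\<kappa> * b) * exp (\<kappa> * Re w))" .
 qed
qed

lemma avg_f_bound: "norm (avg_f (of_nat n)) <= measure N (space N) * exp (real n * b)"
proof -
 have le: "norm (exp (of_nat n * of_real (\<tau> om) :: complex)) <= exp (real n * b)" if "om \<in> space N" for om
  using tau_le [OF that] by (auto intro!: mult_left_mono)
 show ?thesis unfolding avg_f_def by (rule integrable_const_bound' [OF _ le]) auto
qed

lemma avg_v_class:
 assumes v: "borel_class \<kappa> K d \<epsilon> v c"
 shows "borel_class \<kappa> K d \<epsilon> (avg_v v) (%n z. avg_f (of_nat n) * c n z)"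
proof -
 obtain \<rho> B where r: "\<rho> > 0" "B > 0" and cb: "\<And>n z. z \<in> K ==> norm (c n z) * \<rho> ^ n <= B"
  and sm: "\<And>w z. w \<in> sector d \<epsilon> ==> exp (Re w) < \<rho> ==> z \<in> K ==> (%n. c n z * exp (of_nat n * w)) sums v w z"
  by (rule borel_classE [OF v], rule that)
 \<comment> \<open>The radius shrinks by exp (- b), so that w + \<tau> is still inside the old disc
   for every \<tau> \<le> b.\<close>
 define \<rho>' where "\<rho>' = \<rho> * exp (- b)"
 define B' where "B' = measure N (space N) * B + 1"
 have r': "\<rho>' > 0" "B' > 0" using r by (auto simp: \<rho>'_def B'_def intro!: add_nonneg_pos)
 have 1: "norm (avg_f (of_nat n) * c n z) * \<rho>' ^ n <= B'" if z: "z \<in> K" for n z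
 proof -
  have "norm (avg_f (of_nat n) * c n z) * \<rho>' ^ n <= (measure N (space N) * exp (real n * b) * norm (c n z)) * \<rho>' ^ n"
   using r' avg_f_bound by (intro mult_right_mono) (auto simp: norm_mult intro!: mult_right_mono)
  also have "\<dots> = measure N (space N) * (norm (c n z) * \<rho> ^ n)"
   by (simp add: \<rho>'_def power_mult_distrib exp_of_nat_mult exp_minus power_inverse)
  also have "\<dots> <= measure N (space N) * B" using cb [OF z] by (intro mult_left_mono) auto
  finally show ?thesis by (simp add: B'_def)
 qed
 have 2: "(%n. avg_f (of_nat n) * c n z * exp (of_nat n * w)) sums avg_v v w z"
  if w: "w \<in> sector d \<epsilon>" "exp (Re w) < \<rho>'" and z: "z \<in> K" for w z
 proof -
  define q where "q = exp (Re w + b) / \<rho>"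
  have q: "0 <= q" "q < 1" using w(2) r by (auto simp: q_def \<rho>'_def exp_add exp_minus divide_simps)
  have le: "norm (c n z * exp (of_nat n * (w + of_real (\<tau> om)))) <= B * q ^ n" if "om \<in> space N" for n om
  proof -
   have "norm (c n z * exp (of_nat n * (w + of_real (\<tau> om)))) = norm (c n z) * exp (real n * (Re w + \<tau> om))"
    by (simp add: norm_mult)
   also have "\<dots> <= norm (c n z) * exp (real n * (Re w + b))"
    using tau_le [OF that] by (intro mult_left_mono) (auto intro!: mult_left_mono)
   also have "\<dots> = (norm (c n z) * \<rho> ^ n) * q ^ n"
    using r by (simp add: q_def power_divide exp_of_nat_mult)
   also have "\<dots> <= B * q ^ n" using cb [OF z] q by (intro mult_right_mono) auto
   finally show ?thesis .
  qed
  have eqv: "v (w + of_real (\<tau> om)) z = (\<Sum>n. c n z * exp (of_nat n * (w + of_real (\<tau> om))))" if "om \<in> space N" for om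
  proof (rule sums_unique [OF sm])
   show "w + of_real (\<tau> om) \<in> sector d \<epsilon>" using w(1) by (simp add: sector_def)
   have "exp (Re (w + of_real (\<tau> om))) <= exp (Re w) * exp b" using tau_le [OF that] by (simp add: exp_add)
   also have "\<dots> < \<rho>" using w(2) by (simp add: \<rho>'_def exp_minus divide_simps)
   finally show "exp (Re (w + of_real (\<tau> om))) < \<rho>" .
  qed (rule z)
  have sq: "summable (%n. B * q ^ n)" using q by (intro summable_mult summable_geometric) auto
  have ig: "integrable N (%om. c n z * exp (of_nat n * (w + of_real (\<tau> om))))" for n
   by (rule integrable_const_bound' [OF _ le]) auto
  \<comment> \<open>Termwise integration; the geometric majorant B q^n is uniform over the sample
    space.\<close>
  have "(%n. \<integral>om. c n z * exp (of_nat n * (w + of_real (\<tau> om))) \<partial>N) sums (\<integral>om. (\<Sum>n. c n z * exp (of_nat n * (w + of_real (\<tau> om)))) \<partial>N)"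
  proof (rule sums_integral [OF ig])
   show "AE om in N. summable (%n. norm (c n z * exp (of_nat n * (w + of_real (\<tau> om)))))"
    by (intro AE_I2 summable_comparison_test' [OF sq, of 0]) (use le in auto)
   show "summable (%n. \<integral>om. norm (c n z * exp (of_nat n * (w + of_real (\<tau> om)))) \<partial>N)"
   proof (rule summable_comparison_test' [of "%n. measure N (space N) * (B * q ^ n)" 0])
    show "summable (%n. measure N (space N) * (B * q ^ n))" by (intro summable_mult sq)
    fix n
    have "(\<integral>om. norm (c n z * exp (of_nat n * (w + of_real (\<tau> om)))) \<partial>N) <= (\<integral>om. B * q ^ n \<partial>N)"
     by (rule integral_mono) (use ig le in auto)
    then show "norm (\<integral>om. norm (c n z * exp (of_nat n * (w + of_real (\<tau> om)))) \<partial>N) <= measure N (space N) * (B * q ^ n)"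
     by simp
   qed
  qed
  moreover have "(\<integral>om. (\<Sum>n. c n z * exp (of_nat n * (w + of_real (\<tau> om)))) \<partial>N) = avg_v v w z"
   unfolding avg_v_def by (intro Bochner_Integration.integral_cong) (use eqv in auto)
  moreover have "(\<integral>om. c n z * exp (of_nat n * (w + of_real (\<tau> om))) \<partial>N) = avg_f (of_nat n) * c n z * exp (of_nat n * w)" for n
  proof -
   have "c n z * exp (of_nat n * (w + of_real (\<tau> om))) = (c n z * exp (of_nat n * w)) * exp (of_nat n * of_real (\<tau> om))" for om
    by (simp add: distrib_left exp_add)
   then show ?thesis
    unfolding avg_f_def by (simp only: integral_mult_right_zero mult_ac)
  qed
  ultimately show ?thesis by (simp only:)
 qed
 have 3: "(%z. avg_f (of_nat n) * c n z) \<in> A_space K" for n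
  using v by (auto simp: borel_class_def A_space_def intro!: continuous_intros holomorphic_intros)
 have "borel_growth \<kappa> K d \<epsilon> (avg_v v)" using avg_v_growth v by (simp add: borel_class_def)
 then show ?thesis by (rule borel_classI [OF _ 3 r' 1 2])
qed

end

section \<open>The adjoint average on kernels\<close>

context averaging
begin

text \<open>An integrable majorant of exp (\<eta> |\<tau>|) for \<eta> \<le> \<eta>0: the first term
  serves \<tau> \<ge> 0, the second \<tau> < 0.\<close>

definition avg_h :: "real => real => real" where
 "avg_h \<eta> om = exp (\<eta> * \<bar>b\<bar>) + exp (- (\<eta>0 * \<tau> om))"

lemma integrable_avg_h: "integrable N (avg_h \<eta>)"
 unfolding avg_h_def [abs_def] using exp_int by simp

text \<open>Since \<tau> \<le> b, the flatness constant loses only the factor exp (- \<kappa> b).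
  The decay in |Re w| must be weakened to a rate \<eta>' that the exponential moment of \<tau> can
  pay for, hence the weight \<open>avg_h\<close>.\<close>

lemma shifted_decay:
 assumes E: "norm (E (w - of_real (\<tau> om))) <= A * exp (- (\<eta> * \<bar>Re w - \<tau> om\<bar>)) * exp (- (B * exp (\<kappa> * (Re w - \<tau> om))))"
  and w: "om \<in> space N" and pos: "0 <= A" "0 <= B" "0 <= \<eta>'" "\<eta>' <= \<eta>" "\<eta>' <= \<eta>0"
 shows "norm (E (w - of_real (\<tau> om))) <=
  A * avg_h \<eta>' om * exp (- (\<eta>' * \<bar>Re w\<bar>)) * exp (- (B * exp (- (\<kappa> * b)) * exp (\<kappa> * Re w)))"
proof -
 have 1: "exp (- (B * exp (\<kappa> * (Re w - \<tau> om)))) <= exp (- (B * exp (- (\<kappa> * b)) * exp (\<kappa> * Re w)))"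
 proof -
  have "\<kappa> * (Re w - b) <= \<kappa> * (Re w - \<tau> om)"
   using tau_le [OF w] kappa by (intro mult_left_mono) auto
  then have "exp (\<kappa> * (Re w - b)) <= exp (\<kappa> * (Re w - \<tau> om))" by simp
  moreover have "exp (\<kappa> * (Re w - b)) = exp (- (\<kappa> * b)) * exp (\<kappa> * Re w)"
   by (simp add: exp_add [symmetric] right_diff_distrib)
  ultimately show ?thesis using pos mult_left_mono [of _ _ B] by (simp add: mult.assoc)
 qed
 have 2: "exp (- (\<eta> * \<bar>Re w - \<tau> om\<bar>)) <= avg_h \<eta>' om * exp (- (\<eta>' * \<bar>Re w\<bar>))"
 proof -
  have "\<eta>' * \<bar>Re w\<bar> <= \<eta>' * (\<bar>Re w - \<tau> om\<bar> + \<bar>\<tau> om\<bar>)" using pos by (intro mult_left_mono) auto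
  moreover have "\<eta>' * \<bar>Re w - \<tau> om\<bar> <= \<eta> * \<bar>Re w - \<tau> om\<bar>" using pos by (intro mult_right_mono) auto
  ultimately have "- (\<eta> * \<bar>Re w - \<tau> om\<bar>) <= \<eta>' * \<bar>\<tau> om\<bar> + - (\<eta>' * \<bar>Re w\<bar>)"
   unfolding distrib_left by linarith
  then have "exp (- (\<eta> * \<bar>Re w - \<tau> om\<bar>)) <= exp (\<eta>' * \<bar>\<tau> om\<bar>) * exp (- (\<eta>' * \<bar>Re w\<bar>))"
   by (subst exp_add [symmetric]) simp
  also have "\<dots> <= avg_h \<eta>' om * exp (- (\<eta>' * \<bar>Re w\<bar>))"
   unfolding avg_h_def using exp_pos_neg_bound [OF tau_le [OF w] pos(3,5)] by (intro mult_right_mono) auto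
  finally show ?thesis .
 qed
 have "norm (E (w - of_real (\<tau> om))) <= A * (avg_h \<eta>' om * exp (- (\<eta>' * \<bar>Re w\<bar>))) * exp (- (B * exp (- (\<kappa> * b)) * exp (\<kappa> * Re w)))"
  by (rule order_trans [OF E], intro mult_mono mult_left_mono 1 2) (use pos in \<open>auto simp: avg_h_def\<close>)
 then show ?thesis by (simp only: mult.assoc)
qed

lemma avg_k_measurable:
 assumes "kernel_decay \<kappa> E" "w \<in> sector 0 (pi / \<kappa>)"
 shows "(%om. E (w - of_real (\<tau> om))) \<in> borel_measurable N"
proof -
 have "E holomorphic_on sector 0 (pi / \<kappa>)" using assms by (simp add: kernel_decay_def)
 from shift_measurable [OF this assms(2), of "-1"] show ?thesis by simp
qed

lemma avg_k_decay:
 assumes E: "kernel_decay \<kappa> E"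
 shows "kernel_decay \<kappa> (avg_k E)"
 unfolding kernel_decay_def
proof (intro conjI allI impI)
 have hol: "E holomorphic_on sector 0 (pi / \<kappa>)" using E by (simp add: kernel_decay_def)
 show "avg_k E holomorphic_on sector 0 (pi / \<kappa>)"
  unfolding avg_k_def
 proof (rule holomorphic_on_integral)
  show "(%x. E (x - of_real (\<tau> om))) holomorphic_on sector 0 (pi / \<kappa>)" for om
  proof -
   have 1: "(%x. x - complex_of_real (\<tau> om)) holomorphic_on sector 0 (pi / \<kappa>)" by (intro holomorphic_intros)
   have 2: "(%x. x - complex_of_real (\<tau> om)) ` sector 0 (pi / \<kappa>) \<subseteq> sector 0 (pi / \<kappa>)" by (auto simp: sector_def)
   show ?thesis using holomorphic_on_compose_gen [OF 1 hol 2] by (simp add: o_def)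
  qed
  fix x assume x: "x \<in> sector 0 (pi / \<kappa>)"
  show "(%om. E (x - of_real (\<tau> om))) \<in> borel_measurable N" by (rule avg_k_measurable [OF E x])
  obtain \<delta> where d: "\<delta> > 0" "\<And>y. y \<in> cball x \<delta> ==> \<bar>Im y - 0\<bar> <= pi / \<kappa> / 2 - \<delta>"
   using sector_ball [OF x] by metis
  obtain A B \<eta> where AB: "A > 0" "B > 0" "\<eta> > 0"
   "\<And>w. \<bar>Im w\<bar> <= pi / \<kappa> / 2 - \<delta> ==> norm (E w) <= A * exp (- (\<eta> * \<bar>Re w\<bar>)) * exp (- (B * exp (\<kappa> * Re w)))"
   by (rule kernel_decayE [OF E d(1)], rule that)
  have le: "norm (E (y - of_real (\<tau> om))) <= A" if "y \<in> ball x \<delta>" for y om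
  proof -
   have "\<bar>Im (y - of_real (\<tau> om))\<bar> <= pi / \<kappa> / 2 - \<delta>" using d(2) [of y] that by simp
   from AB(4) [OF this] have "norm (E (y - of_real (\<tau> om))) <= A * exp (- (\<eta> * \<bar>Re (y - of_real (\<tau> om))\<bar>)) * exp (- (B * exp (\<kappa> * Re (y - of_real (\<tau> om)))))" .
   also have "\<dots> <= A * 1 * 1" using AB by (intro mult_mono) auto
   finally show ?thesis by simp
  qed
  show "\<exists>\<delta>>0. \<exists>g. integrable N g \<and> (\<forall>y\<in>ball x \<delta> \<inter> sector 0 (pi / \<kappa>). \<forall>om\<in>space N. norm (E (y - of_real (\<tau> om))) <= g om)"
   by (rule exI [of _ \<delta>], rule conjI, rule d(1), rule exI [of _ "%_. A"]) (use le in auto)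
 qed auto
 fix \<delta> :: real assume d: "\<delta> > 0"
 obtain A B \<eta> where AB: "A > 0" "B > 0" "\<eta> > 0"
  "\<And>w. \<bar>Im w\<bar> <= pi / \<kappa> / 2 - \<delta> ==> norm (E w) <= A * exp (- (\<eta> * \<bar>Re w\<bar>)) * exp (- (B * exp (\<kappa> * Re w)))"
  by (rule kernel_decayE [OF E d(1)], rule that)
 define \<eta>' where "\<eta>' = min \<eta> \<eta>0"
 have e': "\<eta>' > 0" "\<eta>' <= \<eta>" "\<eta>' <= \<eta>0" using AB eta0 by (auto simp: \<eta>'_def)
 define M where "M = (\<integral>om. avg_h \<eta>' om \<partial>N)"
 have M: "M \<ge> 0" unfolding M_def by (rule Bochner_Integration.integral_nonneg) (simp add: avg_h_def)
 have AM: "A * (M + 1) > 0" using AB M by simp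
 show "\<exists>A>0. \<exists>B>0. \<exists>\<eta>>0. \<forall>w. \<bar>Im w\<bar> <= pi / \<kappa> / 2 - \<delta> -->
    norm (avg_k E w) <= A * exp (- (\<eta> * \<bar>Re w\<bar>)) * exp (- (B * exp (\<kappa> * Re w)))"
 proof (rule exI [of _ "A * (M + 1)"], rule conjI, rule AM, rule exI [of _ "B * exp (- (\<kappa> * b))"], rule conjI, simp add: AB,
   rule exI [of _ \<eta>'], rule conjI, rule e'(1), intro allI impI)
  fix w assume w: "\<bar>Im w\<bar> <= pi / \<kappa> / 2 - \<delta>"
  define R where "R = exp (- (\<eta>' * \<bar>Re w\<bar>)) * exp (- (B * exp (- (\<kappa> * b)) * exp (\<kappa> * Re w)))"
  have le: "norm (E (w - of_real (\<tau> om))) <= (A * R) * avg_h \<eta>' om" if "om \<in> space N" for om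
   using shifted_decay [OF _ that, of E w A \<eta> B \<eta>'] AB(4) [of "w - of_real (\<tau> om)"] AB(1-3) e' w
   by (simp add: R_def mult_ac)
  have ih: "integrable N (%om. (A * R) * avg_h \<eta>' om)" using integrable_avg_h by simp
  have ws: "w \<in> sector 0 (pi / \<kappa>)" using w d by (simp add: sector_def)
  have ie: "integrable N (%om. E (w - of_real (\<tau> om)))"
   by (rule Bochner_Integration.integrable_bound [OF ih avg_k_measurable [OF E ws]])
     (use le in \<open>auto intro!: AE_I2 order_trans [OF le abs_ge_self]\<close>)
  have "norm (avg_k E w) <= (\<integral>om. (A * R) * avg_h \<eta>' om \<partial>N)"
   unfolding avg_k_def by (rule Bochner_Integration.integral_norm_bound_integral [OF ie ih le])
  also have "\<dots> = A * M * R" by (simp add: M_def)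
  also have "\<dots> <= A * (M + 1) * R" using AB by (intro mult_right_mono) (auto simp: R_def)
  finally show "norm (avg_k E w) <= A * (M + 1) * exp (- (\<eta>' * \<bar>Re w\<bar>)) * exp (- (B * exp (- (\<kappa> * b)) * exp (\<kappa> * Re w)))"
   by (simp add: R_def mult.assoc)
 qed
qed

lemma lborel_translate: "(\<integral>y. f (y + c) \<partial>lborel) = (\<integral>y. f y \<partial>lborel)" for f :: "real => complex" and c :: real
 using lborel_integral_real_affine [of 1 f c] by (simp add: add.commute)

lemma line_measurable:
 assumes "f holomorphic_on sector d \<epsilon>" "\<bar>\<theta> - d\<bar> < \<epsilon> / 2"
 shows "(%y. f (Complex y \<theta>)) \<in> borel_measurable borel"
proof (rule borel_measurable_continuous_onI)
 show "continuous_on UNIV (%y. f (Complex y \<theta>))"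
  by (rule continuous_on_compose2 [OF holomorphic_on_imp_continuous_on [OF assms(1)]])
    (use assms(2) in \<open>auto simp: sector_def intro!: continuous_intros\<close>)
qed

text \<open>Fubini, and the fact that translating a function on the line by \<tau> multiplies its
  Fourier transform by exp (\<i> \<sigma> \<tau>).\<close>

lemma avg_k_class:
 assumes E: "kernel_class \<kappa> E m"
 shows "kernel_class \<kappa> (avg_k E) (%\<sigma>. avg_f (\<i> * of_real \<sigma>) * m \<sigma>)"
 unfolding kernel_class_def
proof (intro conjI allI)
 have Ed: "kernel_decay \<kappa> E" and Em: "\<And>\<sigma>. (\<integral>y. iexp (\<sigma> * y) * E (of_real y) \<partial>lborel) = m \<sigma>"
  using E by (auto simp: kernel_class_def)
 show "kernel_decay \<kappa> (avg_k E)" by (rule avg_k_decay [OF Ed])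
 fix \<sigma> :: real
 have hol: "E holomorphic_on sector 0 (pi / \<kappa>)" using Ed by (simp add: kernel_decay_def)
 \<comment> \<open>With this margin the closed substrip degenerates to the real axis, where the
   moments live.\<close>
 define \<delta> where "\<delta> = pi / \<kappa> / 2"
 have d: "\<delta> > 0" using kappa by (simp add: \<delta>_def)
 obtain A B \<eta> where AB: "A > 0" "B > 0" "\<eta> > 0"
  "\<And>w. \<bar>Im w\<bar> <= pi / \<kappa> / 2 - \<delta> ==> norm (E w) <= A * exp (- (\<eta> * \<bar>Re w\<bar>)) * exp (- (B * exp (\<kappa> * Re w)))"
  by (rule kernel_decayE [OF Ed d(1)], rule that)
 define \<eta>' where "\<eta>' = min \<eta> \<eta>0"
 have e': "\<eta>' > 0" "\<eta>' <= \<eta>" "\<eta>' <= \<eta>0" using AB eta0 by (auto simp: \<eta>'_def)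
 define f where "f y om = iexp (\<sigma> * y) * E (of_real y - of_real (\<tau> om))" for y om
 have Em2 [measurable]: "(%y::real. E (of_real y)) \<in> borel_measurable borel"
  using line_measurable [OF hol, of 0] kappa by (simp add: Complex_eq)
 have le: "norm (f y om) <= (A * exp (- (\<eta>' * \<bar>y\<bar>))) * avg_h \<eta>' om" if "om \<in> space N" for y om
 proof -
  have "norm (f y om) = norm (E (of_real y - of_real (\<tau> om)))" by (simp add: f_def norm_mult)
  also have "\<dots> <= A * avg_h \<eta>' om * exp (- (\<eta>' * \<bar>Re (of_real y)\<bar>)) * exp (- (B * exp (- (\<kappa> * b)) * exp (\<kappa> * Re (of_real y))))"
   using AB(4) [of "of_real y - of_real (\<tau> om)"] AB(1-3) e' by (intro shifted_decay [OF _ that]) (auto simp: \<delta>_def)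
  also have "\<dots> <= A * avg_h \<eta>' om * exp (- (\<eta>' * \<bar>Re (of_real y)\<bar>)) * 1"
   using AB(1,2) by (intro mult_left_mono) (auto simp: avg_h_def)
  finally show ?thesis by (simp add: mult_ac)
 qed
 have "(\<integral>om. (\<integral>y. f y om \<partial>lborel) \<partial>N) = (\<integral>y. (\<integral>om. f y om \<partial>N) \<partial>lborel)"
 proof (rule fubini_dominated [OF finite_measure_axioms _ _ integrable_avg_h le])
  have "(%(y, om). (%y::real. E (of_real y)) (y - \<tau> om)) \<in> borel_measurable (lborel \<Otimes>\<^sub>M N)"
   by measurable
  then have [measurable]: "(%(y, om). E (of_real y - of_real (\<tau> om))) \<in> borel_measurable (lborel \<Otimes>\<^sub>M N)" by simp
  show "(%(y, om). f y om) \<in> borel_measurable (lborel \<Otimes>\<^sub>M N)"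
   unfolding f_def by measurable
  show "integrable lborel (%y. A * exp (- (\<eta>' * \<bar>y\<bar>)))" using integrable_exp_neg_abs [OF e'(1)] by simp
 qed
 moreover have "(\<integral>y. f y om \<partial>lborel) = exp (\<i> * of_real \<sigma> * of_real (\<tau> om)) * m \<sigma>" for om
 proof -
  have "(\<integral>y. f y om \<partial>lborel) = (\<integral>y. f (y + \<tau> om) om \<partial>lborel)" by (rule lborel_translate [symmetric])
  also have "\<dots> = (\<integral>y. exp (\<i> * of_real \<sigma> * of_real (\<tau> om)) * (iexp (\<sigma> * y) * E (of_real y)) \<partial>lborel)"
   by (intro Bochner_Integration.integral_cong) (auto simp: f_def exp_add [symmetric] algebra_simps)
  also have "\<dots> = exp (\<i> * of_real \<sigma> * of_real (\<tau> om)) * m \<sigma>" using Em [of \<sigma>] by simp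
  finally show ?thesis .
 qed
 ultimately show "(\<integral>y. iexp (\<sigma> * y) * avg_k E (of_real y) \<partial>lborel) = avg_f (\<i> * of_real \<sigma>) * m \<sigma>"
  unfolding avg_f_def avg_k_def by (simp add: f_def)
qed

text \<open>Fubini, translation of the line by \<tau>, Fubini back. The two exchanges need different
  majorants: before the translation the shift sits in v and raises its growth type, afterwards it
  sits in the kernel and weakens its decay.\<close>

lemma avg_laplace:
 assumes v: "borel_growth \<kappa> K d \<epsilon> v" and E: "kernel_decay \<kappa> E" and dl: "\<delta> > 0"
 shows "\<exists>T. \<forall>\<theta> t z. \<bar>\<theta> - d\<bar> <= \<epsilon> / 2 - \<delta> --> \<bar>\<theta> - Im t\<bar> <= pi / \<kappa> / 2 - \<delta> --> Re t < T -->
      z \<in> K --> laplace_log E \<theta> (%w. avg_v v w z) t = laplace_log (avg_k E) \<theta> (%w. v w z) t"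
proof -
 obtain A B \<eta> where AB: "A > 0" "B > 0" "\<eta> > 0"
  "\<And>w. \<bar>Im w\<bar> <= pi / \<kappa> / 2 - \<delta> ==> norm (E w) <= A * exp (- (\<eta> * \<bar>Re w\<bar>)) * exp (- (B * exp (\<kappa> * Re w)))"
  by (rule kernel_decayE [OF E dl], rule that)
 obtain C1 C2 where C: "C1 > 0" "C2 > 0"
  "\<And>w z. \<bar>Im w - d\<bar> <= \<epsilon> / 2 - \<delta> ==> z \<in> K ==> norm (v w z) <= C1 * exp (C2 * exp (\<kappa> * Re w))"
  by (rule borel_growthE [OF v dl], rule that)
 \<comment> \<open>Shifting v by at most b multiplies its type by exp (\<kappa> b); shifting the
   kernel costs the factor exp (- \<kappa> b). \<open>T1\<close> and \<open>T2\<close> below are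
   these two forms of one threshold.\<close>
 have "C2 * exp (\<kappa> * b) > 0" using C by simp
 then obtain T where T: "\<forall>x<T. C2 * exp (\<kappa> * b) <= B * exp (- (\<kappa> * x))" using exp_threshold [OF kappa AB(2)] by blast
 define \<eta>' where "\<eta>' = min \<eta> \<eta>0"
 have e': "\<eta>' > 0" "\<eta>' <= \<eta>" "\<eta>' <= \<eta>0" using AB eta0 by (auto simp: \<eta>'_def)
 have Ehol: "E holomorphic_on sector 0 (pi / \<kappa>)" using E by (simp add: kernel_decay_def)
 show ?thesis
 proof (intro exI [of _ T] allI impI)
  fix \<theta> t z assume *: "\<bar>\<theta> - d\<bar> <= \<epsilon> / 2 - \<delta>" "\<bar>\<theta> - Im t\<bar> <= pi / \<kappa> / 2 - \<delta>" "Re t < T" "z \<in> K"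
  have vhol: "(%w. v w z) holomorphic_on sector d \<epsilon>" using v *(4) by (simp add: borel_growth_def)
  have vm [measurable]: "(%y. v (Complex y \<theta>) z) \<in> borel_measurable borel"
   using line_measurable [OF vhol, of \<theta>] * dl by simp
  have Em [measurable]: "(%y. E (Complex y \<theta> - t)) \<in> borel_measurable borel"
  proof (rule borel_measurable_continuous_onI)
   show "continuous_on UNIV (%y. E (Complex y \<theta> - t))"
    by (rule continuous_on_compose2 [OF holomorphic_on_imp_continuous_on [OF Ehol]])
      (use * dl in \<open>auto simp: sector_def intro!: continuous_intros\<close>)
  qed
  have cx: "Complex y \<theta> + of_real s = Complex (y + s) \<theta>" "Complex y \<theta> - t - of_real s = Complex (y - s) \<theta> - t" for y s
   by (auto simp: complex_eq_iff)
  have T1: "C2 * exp (\<kappa> * b) <= B * exp (- (\<kappa> * Re t))" using T *(3) by blast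
  have T2: "C2 <= B * exp (- (\<kappa> * b)) * exp (- (\<kappa> * Re t))"
  proof -
   have "C2 = C2 * exp (\<kappa> * b) * exp (- (\<kappa> * b))" by (simp add: exp_minus)
   also have "\<dots> <= B * exp (- (\<kappa> * Re t)) * exp (- (\<kappa> * b))" using T1 by (intro mult_right_mono) auto
   finally show ?thesis by (simp add: mult_ac)
  qed
  define f1 where "f1 y om = E (Complex y \<theta> - t) * v (Complex (y + \<tau> om) \<theta>) z" for y om
  define f2 where "f2 y om = E (Complex (y - \<tau> om) \<theta> - t) * v (Complex y \<theta>) z" for y om
  have m1: "(%(y, om). f1 y om) \<in> borel_measurable (lborel \<Otimes>\<^sub>M N)"
  proof -
   have "(%(y, om). E (Complex y \<theta> - t) * (%y. v (Complex y \<theta>) z) (y + \<tau> om)) \<in> borel_measurable (lborel \<Otimes>\<^sub>M N)"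
    by measurable
   then show ?thesis by (simp add: f1_def)
  qed
  have m2: "(%(y, om). f2 y om) \<in> borel_measurable (lborel \<Otimes>\<^sub>M N)"
  proof -
   have "(%(y, om). (%y. E (Complex y \<theta> - t)) (y - \<tau> om) * v (Complex y \<theta>) z) \<in> borel_measurable (lborel \<Otimes>\<^sub>M N)"
    by measurable
   then show ?thesis by (simp add: f2_def)
  qed
  have le1: "norm (f1 y om) <= (A * C1 * exp (\<eta> * \<bar>Re t\<bar>) * exp (- (\<eta> * \<bar>y\<bar>))) * (%_. 1) om" if "om \<in> space N" for y om
  proof -
   have "norm (v (Complex (y + \<tau> om) \<theta>) z) <= C1 * exp (C2 * exp (\<kappa> * (y + \<tau> om)))"
    using C(3) [of "Complex (y + \<tau> om) \<theta>" z] * by simp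
   also have "\<dots> <= C1 * exp (C2 * exp (\<kappa> * (b + y)))"
    using C kappa tau_le [OF that] by auto
   finally have vb: "norm (v (Complex (y + \<tau> om) \<theta>) z) <= C1 * exp (C2 * exp (\<kappa> * b) * exp (\<kappa> * y))"
    by (simp add: distrib_left exp_add mult.assoc)
   have Eb: "norm (E (Complex y \<theta> - t)) <= A * exp (- (\<eta> * \<bar>y - Re t\<bar>)) * exp (- (B * exp (\<kappa> * (y - Re t))))"
    using AB(4) [of "Complex y \<theta> - t"] * by simp
   have "norm (f1 y om) <= A * C1 * exp (\<eta> * \<bar>Re t\<bar>) * exp (- (\<eta> * \<bar>y\<bar>))"
    unfolding f1_def by (rule kernel_growth_bound [OF Eb vb T1]) (use AB C in auto)
   then show ?thesis by simp
  qed
  have le2: "norm (f2 y om) <= (A * C1 * exp (\<eta>' * \<bar>Re t\<bar>) * exp (- (\<eta>' * \<bar>y\<bar>))) * avg_h \<eta>' om" if "om \<in> space N" for y om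
  proof -
   have "norm (v (Complex y \<theta>) z) <= C1 * exp (C2 * exp (\<kappa> * y))"
    using C(3) [of "Complex y \<theta>" z] * by simp
   moreover have "norm (E ((Complex y \<theta> - t) - of_real (\<tau> om))) <= A * avg_h \<eta>' om * exp (- (\<eta>' * \<bar>Re (Complex y \<theta> - t)\<bar>)) *
     exp (- (B * exp (- (\<kappa> * b)) * exp (\<kappa> * Re (Complex y \<theta> - t))))"
    using AB(4) [of "(Complex y \<theta> - t) - of_real (\<tau> om)"] AB(1-3) e' * by (intro shifted_decay [OF _ that, of E _ A \<eta>]) auto
   moreover have "0 <= A * avg_h \<eta>' om" using AB by (simp add: avg_h_def)
   ultimately have "norm (f2 y om) <= (A * avg_h \<eta>' om) * C1 * exp (\<eta>' * \<bar>Re t\<bar>) * exp (- (\<eta>' * \<bar>y\<bar>))"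
    unfolding f2_def cx using T2 e' C(1) by (intro kernel_growth_bound [of _ _ _ y "Re t" "B * exp (- (\<kappa> * b))" \<kappa> _ _ C2]) auto
   then show ?thesis by (simp only: mult_ac)
  qed
  have "laplace_log E \<theta> (%w. avg_v v w z) t = (\<integral>y. (\<integral>om. f1 y om \<partial>N) \<partial>lborel)"
   by (simp add: laplace_log_def avg_v_def f1_def cx)
  also have "\<dots> = (\<integral>om. (\<integral>y. f1 y om \<partial>lborel) \<partial>N)"
   by (rule fubini_dominated [OF finite_measure_axioms m1 _ _ le1, symmetric])
     (use integrable_exp_neg_abs [OF AB(3)] in auto)
  also have "\<dots> = (\<integral>om. (\<integral>y. f2 y om \<partial>lborel) \<partial>N)"
  proof (rule Bochner_Integration.integral_cong [OF refl])
   fix om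
   show "(\<integral>y. f1 y om \<partial>lborel) = (\<integral>y. f2 y om \<partial>lborel)"
    using lborel_translate [of "%y. f2 y om" "\<tau> om"] by (simp add: f1_def f2_def)
  qed
  also have "\<dots> = (\<integral>y. (\<integral>om. f2 y om \<partial>N) \<partial>lborel)"
   by (rule fubini_dominated [OF finite_measure_axioms m2 _ integrable_avg_h le2])
     (use integrable_exp_neg_abs [OF e'(1)] in auto)
  also have "\<dots> = laplace_log (avg_k E) \<theta> (%w. v w z) t"
   by (simp add: laplace_log_def avg_k_def f2_def cx)
  finally show "laplace_log E \<theta> (%w. avg_v v w z) t = laplace_log (avg_k E) \<theta> (%w. v w z) t" .
 qed
qed

lemma multiplier_avg: "multiplier \<kappa> avg_f"
 unfolding multiplier_def multiplier_pair_def
proof (rule exI [of _ avg_v], rule exI [of _ avg_k], intro conjI allI impI)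
 fix K d \<epsilon> v c assume "borel_class \<kappa> K d \<epsilon> v c"
 then show "borel_class \<kappa> K d \<epsilon> (avg_v v) (%n z. avg_f (of_nat n) * c n z)" by (rule avg_v_class)
next
 fix E m assume "kernel_class \<kappa> E m"
 then show "kernel_class \<kappa> (avg_k E) (%\<sigma>. avg_f (\<i> * of_real \<sigma>) * m \<sigma>)" by (rule avg_k_class)
next
 fix K d \<epsilon> v c E m and \<delta> :: real
 assume "borel_class \<kappa> K d \<epsilon> v c" "kernel_class \<kappa> E m" "\<delta> > 0"
 then show "\<exists>T. \<forall>\<theta> t z. \<bar>\<theta> - d\<bar> <= \<epsilon> / 2 - \<delta> --> \<bar>\<theta> - Im t\<bar> <= pi / \<kappa> / 2 - \<delta> --> Re t < T -->
      z \<in> K --> laplace_log E \<theta> (%w. avg_v v w z) t = laplace_log (avg_k E) \<theta> (%w. v w z) t"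
  by (intro avg_laplace) (auto simp: borel_class_def kernel_class_def)
qed

end

section \<open>Integration by parts, and stability of the classes under derivatives and linear
  combinations\<close>

lemma integral_vector_derivative_zero:
 fixes F F' :: "real => complex"
 assumes D: "\<And>y. (F has_vector_derivative F' y) (at y)" and int: "integrable lborel F'"
  and le: "\<And>y. norm (F y) <= C * exp (- (\<eta> * \<bar>y\<bar>))" and eta: "\<eta> > 0"
 shows "(\<integral>y. F' y \<partial>lborel) = 0"
proof -
 have fin: "(\<integral>y. indicator {- real n..real n} y *\<^sub>R F' y \<partial>lborel) = F (real n) - F (- real n)" for n
 proof -
  have si: "set_integrable lborel {- real n..real n} F'"
   unfolding set_integrable_def by (rule integrable_mult_indicator [OF _ int]) auto
  have "(\<integral>y. indicator {- real n..real n} y *\<^sub>R F' y \<partial>lborel) = integral {- real n..real n} F'"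
   using set_borel_integral_eq_integral(2) [OF si] by (simp add: set_lebesgue_integral_def)
  also have "\<dots> = F (real n) - F (- real n)"
   by (rule integral_unique, rule fundamental_theorem_of_calculus)
     (use D in \<open>auto intro: has_vector_derivative_at_within\<close>)
  finally show ?thesis .
 qed
 have m [measurable]: "F' \<in> borel_measurable borel" using int by auto
 have "(%n. \<integral>y. indicator {- real n..real n} y *\<^sub>R F' y \<partial>lborel) \<longlonglongrightarrow> (\<integral>y. F' y \<partial>lborel)"
 proof (rule integral_dominated_convergence)
  show "integrable lborel (%y. norm (F' y))" using int by simp
  show "AE y in lborel. (%n. indicator {- real n..real n} y *\<^sub>R F' y) \<longlonglongrightarrow> F' y"
  proof (rule AE_I2, rule tendsto_eventually)
   fix y :: real
   obtain N :: nat where "\<bar>y\<bar> <= real N" using real_arch_simple by blast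
   then show "\<forall>\<^sub>F n in sequentially. indicator {- real n..real n} y *\<^sub>R F' y = F' y"
    by (intro eventually_sequentiallyI [of N]) (auto simp: indicator_def)
  qed
 qed (auto simp: indicator_def)
 moreover have "(%n. F (real n) - F (- real n)) \<longlonglongrightarrow> 0"
 proof (rule Lim_null_comparison)
  show "\<forall>\<^sub>F n in sequentially. norm (F (real n) - F (- real n)) <= C * exp (- (\<eta> * real n)) + C * exp (- (\<eta> * real n))"
  proof (intro always_eventually allI)
   fix n
   have "norm (F (real n) - F (- real n)) <= norm (F (real n)) + norm (F (- real n))" by (rule norm_triangle_ineq4)
   then show "norm (F (real n) - F (- real n)) <= C * exp (- (\<eta> * real n)) + C * exp (- (\<eta> * real n))"
    using le [of "real n"] le [of "- real n"] by simp
  qed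
  have "((%Y. C * exp (- (\<eta> * Y))) \<longlongrightarrow> C * 0) at_top"
   by (intro tendsto_mult tendsto_const filterlim_compose [OF exp_at_bot])
     (use eta in \<open>auto simp: filterlim_uminus_at_bot intro!: filterlim_tendsto_pos_mult_at_top [OF tendsto_const] filterlim_ident\<close>)
  then have "(%n. C * exp (- (\<eta> * real n))) \<longlonglongrightarrow> 0"
   using filterlim_compose filterlim_real_sequentially by fastforce
  from tendsto_add [OF this this] show "(%n. C * exp (- (\<eta> * real n)) + C * exp (- (\<eta> * real n))) \<longlonglongrightarrow> 0" by simp
 qed
 ultimately show ?thesis using fin LIMSEQ_unique by auto
qed

lemma borel_growthI:
 assumes "\<And>w. w \<in> sector d \<epsilon> ==> v w \<in> A_space K" "\<And>z. z \<in> K ==> (%w. v w z) holomorphic_on sector d \<epsilon>"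
  "\<And>\<delta>. \<delta> > 0 ==> \<exists>C1>0. \<exists>C2>0. \<forall>w. \<bar>Im w - d\<bar> <= \<epsilon> / 2 - \<delta> -->
    (\<forall>z\<in>K. norm (v w z) <= C1 * exp (C2 * exp (\<kappa> * Re w)))"
 shows "borel_growth \<kappa> K d \<epsilon> v"
 unfolding borel_growth_def by (intro conjI ballI allI impI assms)

lemma borel_growth_holomorphic_A:
 assumes "borel_growth \<kappa> K d \<epsilon> v" "\<kappa> > 0"
 shows "holomorphic_A K v (sector d \<epsilon>)"
proof (rule holomorphic_A_I)
 fix w assume w: "w \<in> sector d \<epsilon>"
 show "v w \<in> A_space K" using assms w by (simp add: borel_growth_def)
 obtain \<delta> B where B: "\<delta> > 0" "\<forall>b. \<forall>x\<in>ball w \<delta>. \<forall>z\<in>K. \<forall>\<tau>\<le>b. norm (v (x + of_real \<tau>) z) <= B * exp (B * exp (\<kappa> * b))"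
  using borel_growth_local_bound [OF assms w] by blast
 have "norm (v x z) <= B * exp (B * exp (\<kappa> * 0))" if "x \<in> ball w \<delta>" "z \<in> K" for x z
  using B(2) [THEN spec, THEN bspec, OF that(1), THEN bspec, OF that(2), THEN spec, of 0 0] by simp
 then show "\<exists>\<delta>>0. \<exists>B. \<forall>x\<in>ball w \<delta> \<inter> sector d \<epsilon>. \<forall>z\<in>K. norm (v x z) <= B" using B(1) by blast
qed (use assms in \<open>auto simp: borel_growth_def\<close>)

lemma holomorphic_A_deriv:
 assumes "holomorphic_A K v S" "w \<in> S"
 shows "(%z. deriv (%x. v x z) w) \<in> A_space K"
  and "z \<in> K ==> (%x. v x z) field_differentiable at w"
proof -
 obtain v' where v': "v' \<in> A_space K" "uniform_limit K (%x z. (v x z - v w z) / (x - w)) v' (at w)"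
  using assms unfolding holomorphic_A_def by blast
 have D: "((%x. v x z) has_field_derivative v' z) (at w)" if "z \<in> K" for z
  using tendsto_uniform_limitI [OF v'(2) that] by (simp add: has_field_derivative_iff)
 have eq: "deriv (%x. v x z) w = v' z" if "z \<in> K" for z using DERIV_imp_deriv [OF D [OF that]] .
 have "continuous_on K (%z. deriv (%x. v x z) w)"
 proof -
  have "continuous_on K (%z. deriv (%x. v x z) w) = continuous_on K v'"
   by (rule continuous_on_cong [OF refl]) (rule eq)
  then show ?thesis using v'(1) by (simp add: A_space_def)
 qed
 moreover have "(%z. deriv (%x. v x z) w) holomorphic_on interior K"
  using v'(1) holomorphic_cong [OF refl, of "interior K" "%z. deriv (%x. v x z) w" v'] eq interior_subset
  by (auto simp: A_space_def)
 ultimately show "(%z. deriv (%x. v x z) w) \<in> A_space K" by (simp add: A_space_def)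
 show "(%x. v x z) field_differentiable at w" if "z \<in> K"
  using D [OF that] field_differentiable_def by blast
qed

lemma borel_growth_deriv:
 assumes v: "borel_growth \<kappa> K d \<epsilon> v" and k: "\<kappa> > 0"
 shows "borel_growth \<kappa> K d \<epsilon> (%w z. deriv (%x. v x z) w)"
proof (rule borel_growthI)
 show "(%z. deriv (%x. v x z) w) \<in> A_space K" if "w \<in> sector d \<epsilon>" for w
  by (rule holomorphic_A_deriv [OF borel_growth_holomorphic_A [OF v k] that])
 have hol: "(%w. v w z) holomorphic_on sector d \<epsilon>" if "z \<in> K" for z
  using v that by (auto simp: borel_growth_def)
 then show "deriv (%x. v x z) holomorphic_on sector d \<epsilon>" if "z \<in> K" for z
  using that by (intro holomorphic_deriv) auto
 fix \<delta> :: real assume d: "\<delta> > 0"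
 \<comment> \<open>Radius for Cauchy's estimate: \<delta> / 2 keeps the disc in the wider strip, and
   1 changes exp (\<kappa> Re w) by at most the factor exp \<kappa>.\<close>
 define r where "r = min (\<delta> / 2) 1"
 have r: "r > 0" "r <= \<delta> / 2" "r <= 1" using d by (auto simp: r_def)
 have d2: "\<delta> / 2 > 0" using d by simp
 obtain C1 C2 where C: "C1 > 0" "C2 > 0"
  "\<And>w z. \<bar>Im w - d\<bar> <= \<epsilon> / 2 - \<delta> / 2 ==> z \<in> K ==> norm (v w z) <= C1 * exp (C2 * exp (\<kappa> * Re w))"
  by (rule borel_growthE [OF v d2], rule that)
 show "\<exists>C1>0. \<exists>C2>0. \<forall>w. \<bar>Im w - d\<bar> <= \<epsilon> / 2 - \<delta> -->
    (\<forall>z\<in>K. norm (deriv (%x. v x z) w) <= C1 * exp (C2 * exp (\<kappa> * Re w)))"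
 proof (rule exI [of _ "C1 / r"], rule conjI, simp add: C r, rule exI [of _ "C2 * exp \<kappa>"], rule conjI, simp add: C, intro allI impI ballI)
  fix w z assume w: "\<bar>Im w - d\<bar> <= \<epsilon> / 2 - \<delta>" and z: "z \<in> K"
  have im: "\<bar>Im x - d\<bar> <= \<epsilon> / 2 - \<delta> / 2" if "x \<in> cball w r" for x
  proof -
   have "\<bar>Im (w - x)\<bar> <= r" using that abs_Im_le_cmod [of "w - x"] by (simp add: dist_norm)
   then show ?thesis using w r by (simp add: abs_if split: if_splits)
  qed
  have "norm (deriv (%x. v x z) w) <= (C1 * exp (C2 * exp \<kappa> * exp (\<kappa> * Re w))) / r"
  proof (rule norm_deriv_le_Cauchy [OF hol [OF z] open_sector _ r(1)])
   show "cball w r \<subseteq> sector d \<epsilon>"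
   proof
    fix x assume "x \<in> cball w r"
    from im [OF this] show "x \<in> sector d \<epsilon>" using d2 by (simp add: sector_def)
   qed
   fix x assume x: "x \<in> cball w r"
   have "norm (v x z) <= C1 * exp (C2 * exp (\<kappa> * Re x))" by (rule C(3) [OF im [OF x] z])
   also have "\<dots> <= C1 * exp (C2 * exp (\<kappa> * (Re w + 1)))"
    using C k Re_le_in_cball [OF x] r by auto
   finally show "norm (v x z) <= C1 * exp (C2 * exp \<kappa> * exp (\<kappa> * Re w))"
    by (simp add: distrib_left exp_add mult_ac)
  qed
  then show "norm (deriv (%x. v x z) w) <= C1 / r * exp (C2 * exp \<kappa> * exp (\<kappa> * Re w))" by simp
 qed
qed

lemma borel_growth_lin:
 assumes v: "borel_growth \<kappa> K d \<epsilon> v" and u: "borel_growth \<kappa> K d \<epsilon> u"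
 shows "borel_growth \<kappa> K d \<epsilon> (%w z. a * v w z + b * u w z)"
proof (rule borel_growthI)
 show "(%z. a * v w z + b * u w z) \<in> A_space K" if "w \<in> sector d \<epsilon>" for w
  using u v that by (auto simp: borel_growth_def A_space_def intro!: continuous_intros holomorphic_intros)
 show "(%w. a * v w z + b * u w z) holomorphic_on sector d \<epsilon>" if "z \<in> K" for z
  using u v that by (auto simp: borel_growth_def intro!: holomorphic_intros)
 fix \<delta> :: real assume d: "\<delta> > 0"
 obtain C1 C2 where C: "C1 > 0" "C2 > 0"
  "\<And>w z. \<bar>Im w - d\<bar> <= \<epsilon> / 2 - \<delta> ==> z \<in> K ==> norm (v w z) <= C1 * exp (C2 * exp (\<kappa> * Re w))"
  by (rule borel_growthE [OF v d], rule that)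
 obtain B1 B2 where B: "B1 > 0" "B2 > 0"
  "\<And>w z. \<bar>Im w - d\<bar> <= \<epsilon> / 2 - \<delta> ==> z \<in> K ==> norm (u w z) <= B1 * exp (B2 * exp (\<kappa> * Re w))"
  by (rule borel_growthE [OF u d], rule that)
 have pos: "0 < norm a * C1 + norm b * B1 + 1" using B C by (intro add_nonneg_pos) auto
 have pos2: "0 < max C2 B2" using B C by simp
 show "\<exists>C1>0. \<exists>C2>0. \<forall>w. \<bar>Im w - d\<bar> <= \<epsilon> / 2 - \<delta> -->
    (\<forall>z\<in>K. norm (a * v w z + b * u w z) <= C1 * exp (C2 * exp (\<kappa> * Re w)))"
 proof (rule exI, rule conjI, rule pos, rule exI, rule conjI, rule pos2, intro allI impI ballI)
  fix w z assume w: "\<bar>Im w - d\<bar> <= \<epsilon> / 2 - \<delta>" and z: "z \<in> K"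
  define e where "e = exp (max C2 B2 * exp (\<kappa> * Re w))"
  have e: "exp (C2 * exp (\<kappa> * Re w)) <= e" "exp (B2 * exp (\<kappa> * Re w)) <= e" "e > 0"
   by (auto simp: e_def intro!: mult_right_mono)
  have "norm (v w z) <= C1 * e" using C(3) [OF w z] mult_left_mono [OF e(1)] C(1) by (meson less_imp_le order_trans)
  moreover have "norm (u w z) <= B1 * e" using B(3) [OF w z] mult_left_mono [OF e(2)] B(1) by (meson less_imp_le order_trans)
  ultimately have "norm (a * v w z) + norm (b * u w z) <= norm a * (C1 * e) + norm b * (B1 * e)"
   unfolding norm_mult by (intro add_mono mult_left_mono) auto
  then have "norm (a * v w z + b * u w z) <= (norm a * C1 + norm b * B1) * e"
   using norm_triangle_le by (simp add: algebra_simps)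
  also have "\<dots> <= (norm a * C1 + norm b * B1 + 1) * e" using e by (intro mult_right_mono) auto
  finally show "norm (a * v w z + b * u w z) <= (norm a * C1 + norm b * B1 + 1) * exp (max C2 B2 * exp (\<kappa> * Re w))"
   by (simp add: e_def)
 qed
qed

lemma kernel_decayI:
 assumes "E holomorphic_on sector 0 (pi / \<kappa>)"
  "\<And>\<delta>. \<delta> > 0 ==> \<exists>A>0. \<exists>B>0. \<exists>\<eta>>0. \<forall>w. \<bar>Im w\<bar> <= pi / \<kappa> / 2 - \<delta> -->
    norm (E w) <= A * exp (- (\<eta> * \<bar>Re w\<bar>)) * exp (- (B * exp (\<kappa> * Re w)))"
 shows "kernel_decay \<kappa> E"
 unfolding kernel_decay_def by (intro conjI allI impI assms)

lemma kernel_decay_lin: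
 assumes v: "kernel_decay \<kappa> v" and u: "kernel_decay \<kappa> u"
 shows "kernel_decay \<kappa> (%w. a * v w + b * u w)"
proof (rule kernel_decayI)
 show "(%w. a * v w + b * u w) holomorphic_on sector 0 (pi / \<kappa>)"
  using u v by (auto simp: kernel_decay_def intro!: holomorphic_intros)
 fix \<delta> :: real assume d: "\<delta> > 0"
 obtain A B \<eta> where A: "A > 0" "B > 0" "\<eta> > 0"
  "\<And>w. \<bar>Im w\<bar> <= pi / \<kappa> / 2 - \<delta> ==> norm (v w) <= A * exp (- (\<eta> * \<bar>Re w\<bar>)) * exp (- (B * exp (\<kappa> * Re w)))"
  by (rule kernel_decayE [OF v d], rule that)
 obtain A' B' \<eta>' where A': "A' > 0" "B' > 0" "\<eta>' > 0"
  "\<And>w. \<bar>Im w\<bar> <= pi / \<kappa> / 2 - \<delta> ==> norm (u w) <= A' * exp (- (\<eta>' * \<bar>Re w\<bar>)) * exp (- (B' * exp (\<kappa> * Re w)))"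
  by (rule kernel_decayE [OF u d], rule that)
 have pos: "0 < norm a * A + norm b * A' + 1" using A A' by (intro add_nonneg_pos) auto
 have pos2: "0 < min B B'" "0 < min \<eta> \<eta>'" using A A' by auto
 show "\<exists>A>0. \<exists>B>0. \<exists>\<eta>>0. \<forall>w. \<bar>Im w\<bar> <= pi / \<kappa> / 2 - \<delta> -->
    norm (a * v w + b * u w) <= A * exp (- (\<eta> * \<bar>Re w\<bar>)) * exp (- (B * exp (\<kappa> * Re w)))"
 proof (rule exI, rule conjI, rule pos, rule exI, rule conjI, rule pos2(1), rule exI, rule conjI, rule pos2(2), intro allI impI)
  fix w assume w: "\<bar>Im w\<bar> <= pi / \<kappa> / 2 - \<delta>"
  define e where "e = exp (- (min \<eta> \<eta>' * \<bar>Re w\<bar>)) * exp (- (min B B' * exp (\<kappa> * Re w)))"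
  have e: "exp (- (\<eta> * \<bar>Re w\<bar>)) * exp (- (B * exp (\<kappa> * Re w))) <= e"
   "exp (- (\<eta>' * \<bar>Re w\<bar>)) * exp (- (B' * exp (\<kappa> * Re w))) <= e" "e > 0"
   unfolding e_def by (auto intro!: mult_mono mult_right_mono)
  have "norm (v w) <= A * e"
   by (rule order_trans [OF A(4) [OF w]], unfold mult.assoc, rule mult_left_mono [OF e(1)]) (use A in simp)
  moreover have "norm (u w) <= A' * e"
   by (rule order_trans [OF A'(4) [OF w]], unfold mult.assoc, rule mult_left_mono [OF e(2)]) (use A' in simp)
  ultimately have "norm (a * v w) + norm (b * u w) <= norm a * (A * e) + norm b * (A' * e)"
   unfolding norm_mult by (intro add_mono mult_left_mono) auto
  then have "norm (a * v w + b * u w) <= (norm a * A + norm b * A') * e"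
   using norm_triangle_le by (simp add: algebra_simps)
  also have "\<dots> <= (norm a * A + norm b * A' + 1) * e" using e by (intro mult_right_mono) auto
  finally show "norm (a * v w + b * u w) <= (norm a * A + norm b * A' + 1) * exp (- (min \<eta> \<eta>' * \<bar>Re w\<bar>)) * exp (- (min B B' * exp (\<kappa> * Re w)))"
   by (simp add: e_def mult.assoc)
 qed
qed

lemma kernel_decay_deriv:
 assumes E: "kernel_decay \<kappa> E" and k: "\<kappa> > 0"
 shows "kernel_decay \<kappa> (deriv E)"
proof (rule kernel_decayI)
 have hol: "E holomorphic_on sector 0 (pi / \<kappa>)" using E by (simp add: kernel_decay_def)
 then show "deriv E holomorphic_on sector 0 (pi / \<kappa>)" by (rule holomorphic_deriv) simp
 fix \<delta> :: real assume d: "\<delta> > 0"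
 define r where "r = min (\<delta> / 2) 1"
 have r: "r > 0" "r <= \<delta> / 2" "r <= 1" using d by (auto simp: r_def)
 have d2: "\<delta> / 2 > 0" using d by simp
 obtain A B \<eta> where A: "A > 0" "B > 0" "\<eta> > 0"
  "\<And>w. \<bar>Im w\<bar> <= pi / \<kappa> / 2 - \<delta> / 2 ==> norm (E w) <= A * exp (- (\<eta> * \<bar>Re w\<bar>)) * exp (- (B * exp (\<kappa> * Re w)))"
  by (rule kernel_decayE [OF E d2], rule that)
 have pos: "0 < A * exp \<eta> / r" "0 < B * exp (- \<kappa>)" using A r by auto
 show "\<exists>A>0. \<exists>B>0. \<exists>\<eta>>0. \<forall>w. \<bar>Im w\<bar> <= pi / \<kappa> / 2 - \<delta> -->
    norm (deriv E w) <= A * exp (- (\<eta> * \<bar>Re w\<bar>)) * exp (- (B * exp (\<kappa> * Re w)))"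
 proof (rule exI, rule conjI, rule pos(1), rule exI, rule conjI, rule pos(2), rule exI, rule conjI, rule A(3), intro allI impI)
  fix w assume w: "\<bar>Im w\<bar> <= pi / \<kappa> / 2 - \<delta>"
  have im: "\<bar>Im x\<bar> <= pi / \<kappa> / 2 - \<delta> / 2" if "x \<in> cball w r" for x
  proof -
   have "\<bar>Im (w - x)\<bar> <= r" using that abs_Im_le_cmod [of "w - x"] by (simp add: dist_norm)
   then show ?thesis using w r by (simp add: abs_if split: if_splits)
  qed
  have re: "\<bar>Re x - Re w\<bar> <= 1" if "x \<in> cball w r" for x
  proof -
   have "\<bar>Re (w - x)\<bar> <= r" using that abs_Re_le_cmod [of "w - x"] by (simp add: dist_norm)
   then show ?thesis using r by simp
  qed
  have "norm (deriv E w) <= (A * (exp \<eta> * exp (- (\<eta> * \<bar>Re w\<bar>))) * exp (- (B * exp (- \<kappa>) * exp (\<kappa> * Re w)))) / r"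
  proof (rule norm_deriv_le_Cauchy [OF hol open_sector _ r(1)])
   show "cball w r \<subseteq> sector 0 (pi / \<kappa>)"
   proof
    fix x assume "x \<in> cball w r"
    from im [OF this] show "x \<in> sector 0 (pi / \<kappa>)" using d2 by (simp add: sector_def)
   qed
   fix x assume x: "x \<in> cball w r"
   have 1: "exp (- (\<eta> * \<bar>Re x\<bar>)) <= exp \<eta> * exp (- (\<eta> * \<bar>Re w\<bar>))"
   proof -
    have "\<eta> * \<bar>Re w\<bar> <= \<eta> * (\<bar>Re x\<bar> + 1)" using re [OF x] A by (intro mult_left_mono) auto
    then show ?thesis by (simp add: exp_add [symmetric] distrib_left)
   qed
   have 2: "exp (- (B * exp (\<kappa> * Re x))) <= exp (- (B * exp (- \<kappa>) * exp (\<kappa> * Re w)))"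
   proof -
    have "\<kappa> * (Re w - 1) <= \<kappa> * Re x" using re [OF x] k by (intro mult_left_mono) auto
    then have "exp (\<kappa> * (Re w - 1)) <= exp (\<kappa> * Re x)" by simp
    then have "B * exp (\<kappa> * (Re w - 1)) <= B * exp (\<kappa> * Re x)" using A by simp
    moreover have "exp (\<kappa> * (Re w - 1)) = exp (- \<kappa>) * exp (\<kappa> * Re w)"
     by (simp add: exp_add [symmetric] right_diff_distrib)
    ultimately show ?thesis by (simp add: mult.assoc)
   qed
   have "norm (E x) <= A * exp (- (\<eta> * \<bar>Re x\<bar>)) * exp (- (B * exp (\<kappa> * Re x)))" by (rule A(4) [OF im [OF x]])
   also have "\<dots> <= A * (exp \<eta> * exp (- (\<eta> * \<bar>Re w\<bar>))) * exp (- (B * exp (- \<kappa>) * exp (\<kappa> * Re w)))"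
    by (intro mult_mono mult_left_mono 1 2) (use A in auto)
   finally show "norm (E x) <= A * (exp \<eta> * exp (- (\<eta> * \<bar>Re w\<bar>))) * exp (- (B * exp (- \<kappa>) * exp (\<kappa> * Re w)))" .
  qed
  then show "norm (deriv E w) <= A * exp \<eta> / r * exp (- (\<eta> * \<bar>Re w\<bar>)) * exp (- (B * exp (- \<kappa>) * exp (\<kappa> * Re w)))" by (simp add: mult.assoc)
 qed
qed

section \<open>Multipliers of degree one\<close>

lemma kernel_line:
 assumes E: "kernel_decay \<kappa> E" and k: "\<kappa> > 0"
 shows "\<exists>A>0. \<exists>\<eta>>0. \<forall>y. norm (E (of_real y)) <= A * exp (- (\<eta> * \<bar>y\<bar>))"
  and "continuous_on UNIV (%y::real. E (of_real y))"
  and "complex_integrable lborel (%y. iexp (\<sigma> * y) * E (of_real y))"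
proof -
 have d: "pi / \<kappa> / 2 > 0" using k by simp
 obtain A B \<eta> where A: "A > 0" "B > 0" "\<eta> > 0"
  "\<And>w. \<bar>Im w\<bar> <= pi / \<kappa> / 2 - pi / \<kappa> / 2 ==> norm (E w) <= A * exp (- (\<eta> * \<bar>Re w\<bar>)) * exp (- (B * exp (\<kappa> * Re w)))"
  by (rule kernel_decayE [OF E d], rule that)
 have le: "norm (E (of_real y)) <= A * exp (- (\<eta> * \<bar>y\<bar>))" for y
 proof -
  have "norm (E (of_real y)) <= A * exp (- (\<eta> * \<bar>y\<bar>)) * exp (- (B * exp (\<kappa> * y)))" using A(4) [of "of_real y"] by simp
  also have "\<dots> <= A * exp (- (\<eta> * \<bar>y\<bar>)) * 1" using A by (intro mult_left_mono) auto
  finally show ?thesis by simp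
 qed
 then show "\<exists>A>0. \<exists>\<eta>>0. \<forall>y. norm (E (of_real y)) <= A * exp (- (\<eta> * \<bar>y\<bar>))" using A by blast
 have hol: "E holomorphic_on sector 0 (pi / \<kappa>)" using E by (simp add: kernel_decay_def)
 show c: "continuous_on UNIV (%y::real. E (of_real y))"
  by (rule continuous_on_compose2 [OF holomorphic_on_imp_continuous_on [OF hol]])
    (use d in \<open>auto simp: sector_def intro!: continuous_intros\<close>)
 show "complex_integrable lborel (%y. iexp (\<sigma> * y) * E (of_real y))"
  by (rule integrable_exp_bound [OF _ _ A(3), of _ A]) (use c le in \<open>auto intro!: continuous_intros simp: norm_mult\<close>)
qed

lemma of_real_vector_derivative: "((%y. of_real y + c) has_vector_derivative (1::complex)) (at y)"
proof -
 have "((%y. of_real y + c) has_vector_derivative 1 + (0::complex)) (at y)"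
  by (intro has_vector_derivative_add has_vector_derivative_const)
    (auto intro!: derivative_eq_intros simp: has_vector_derivative_def scaleR_conv_of_real)
 then show ?thesis by simp
qed

lemma line_vector_derivative:
 fixes f :: "complex => complex"
 assumes "(f has_field_derivative f') (at (of_real y + c))"
 shows "((%y. f (of_real y + c)) has_vector_derivative f') (at y)"
 using field_vector_diff_chain_at [OF of_real_vector_derivative assms] by (simp add: o_def)

text \<open>Integration by parts: the Fourier transform of E' is - \<i> \<sigma> times that of E.
  This explains the minus sign in front of s.\<close>

lemma kernel_class_linear:
 assumes E: "kernel_class \<kappa> E m" and k: "\<kappa> > 0"
 shows "kernel_class \<kappa> (%w. (- s) * deriv E w + \<beta> * E w) (%\<sigma>. (s * (\<i> * of_real \<sigma>) + \<beta>) * m \<sigma>)"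
 unfolding kernel_class_def
proof (intro conjI allI)
 have Ed: "kernel_decay \<kappa> E" and Em: "\<And>\<sigma>. (\<integral>y. iexp (\<sigma> * y) * E (of_real y) \<partial>lborel) = m \<sigma>"
  using E by (auto simp: kernel_class_def)
 have Dd: "kernel_decay \<kappa> (deriv E)" by (rule kernel_decay_deriv [OF Ed k])
 show "kernel_decay \<kappa> (%w. (- s) * deriv E w + \<beta> * E w)" by (rule kernel_decay_lin [OF Dd Ed])
 fix \<sigma> :: real
 have hol: "E holomorphic_on sector 0 (pi / \<kappa>)" using Ed by (simp add: kernel_decay_def)
 note iE = kernel_line(3) [OF Ed k, of \<sigma>] and iD = kernel_line(3) [OF Dd k, of \<sigma>]
 obtain A \<eta> where A: "A > 0" "\<eta> > 0" "\<And>y. norm (E (of_real y)) <= A * exp (- (\<eta> * \<bar>y\<bar>))"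
  using kernel_line(1) [OF Ed k] by blast
 have iF: "complex_integrable lborel (%y. \<i> * of_real \<sigma> * (iexp (\<sigma> * y) * E (of_real y)) + iexp (\<sigma> * y) * deriv E (of_real y))"
  using iE iD by simp
 have "(\<integral>y. \<i> * of_real \<sigma> * (iexp (\<sigma> * y) * E (of_real y)) + iexp (\<sigma> * y) * deriv E (of_real y) \<partial>lborel) = 0"
 proof (rule integral_vector_derivative_zero [OF _ iF _ A(2)])
  fix y
  have ys: "of_real y \<in> sector 0 (pi / \<kappa>)" using k by (simp add: sector_def)
  have "((%w. exp (\<i> * of_real \<sigma> * w) * E w) has_field_derivative
    \<i> * of_real \<sigma> * (exp (\<i> * of_real \<sigma> * of_real y) * E (of_real y)) + exp (\<i> * of_real \<sigma> * of_real y) * deriv E (of_real y)) (at (of_real y + 0))"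
   using holomorphic_derivI [OF hol open_sector ys]
   by (auto intro!: derivative_eq_intros simp: algebra_simps)
  from line_vector_derivative [OF this]
  show "((%y. iexp (\<sigma> * y) * E (of_real y)) has_vector_derivative
    \<i> * of_real \<sigma> * (iexp (\<sigma> * y) * E (of_real y)) + iexp (\<sigma> * y) * deriv E (of_real y)) (at y)"
   by (simp add: mult.assoc)
  show "norm (iexp (\<sigma> * y) * E (of_real y)) <= A * exp (- (\<eta> * \<bar>y\<bar>))" using A(3) by (simp add: norm_mult)
 qed
 then have D: "(\<integral>y. iexp (\<sigma> * y) * deriv E (of_real y) \<partial>lborel) = - (\<i> * of_real \<sigma> * m \<sigma>)"
  using iE iD Em [of \<sigma>] by (simp add: add_eq_0_iff)
 have "(\<integral>y. iexp (\<sigma> * y) * (- s * deriv E (of_real y) + \<beta> * E (of_real y)) \<partial>lborel) =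
  (\<integral>y. (- s) * (iexp (\<sigma> * y) * deriv E (of_real y)) + \<beta> * (iexp (\<sigma> * y) * E (of_real y)) \<partial>lborel)"
  by (intro Bochner_Integration.integral_cong) (auto simp: algebra_simps)
 also have "\<dots> = (- s) * (\<integral>y. iexp (\<sigma> * y) * deriv E (of_real y) \<partial>lborel) + \<beta> * (\<integral>y. iexp (\<sigma> * y) * E (of_real y) \<partial>lborel)"
  using iE iD by (subst Bochner_Integration.integral_add) auto
 also have "\<dots> = (s * (\<i> * of_real \<sigma>) + \<beta>) * m \<sigma>" unfolding D Em by (simp add: algebra_simps)
 finally show "(\<integral>y. iexp (\<sigma> * y) * (- s * deriv E (of_real y) + \<beta> * E (of_real y)) \<partial>lborel) = (s * (\<i> * of_real \<sigma>) + \<beta>) * m \<sigma>" .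
qed

text \<open>The derivative in the logarithmic coordinate is the Euler operator t d/dt, which
  multiplies the n-th coefficient by n.\<close>

lemma borel_class_linear:
 assumes v: "borel_class \<kappa> K d \<epsilon> v c" and k: "\<kappa> > 0"
 shows "borel_class \<kappa> K d \<epsilon> (%w z. s * deriv (%x. v x z) w + \<beta> * v w z) (%n z. (s * of_nat n + \<beta>) * c n z)"
proof -
 obtain \<rho> B where r: "\<rho> > 0" "B > 0" and cb: "\<And>n z. z \<in> K ==> norm (c n z) * \<rho> ^ n <= B"
  and sm: "\<And>w z. w \<in> sector d \<epsilon> ==> exp (Re w) < \<rho> ==> z \<in> K ==> (%n. c n z * exp (of_nat n * w)) sums v w z"
  by (rule borel_classE [OF v], rule that)
 have vg: "borel_growth \<kappa> K d \<epsilon> v" and cA: "\<And>n. c n \<in> A_space K" using v by (auto simp: borel_class_def)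
 have g: "borel_growth \<kappa> K d \<epsilon> (%w z. s * deriv (%x. v x z) w + \<beta> * v w z)"
  by (rule borel_growth_lin [OF borel_growth_deriv [OF vg k] vg])
 have summ: "summable (%n. c n z * x ^ n)" if z: "z \<in> K" and x: "norm x < \<rho>" for x z
 proof (rule summable_comparison_test')
  show "summable (%n. B * (norm x / \<rho>) ^ n)" using x r by (intro summable_mult summable_geometric) auto
  fix n :: nat
  have "norm (c n z * x ^ n) = (norm (c n z) * \<rho> ^ n) * (norm x / \<rho>) ^ n"
   using r by (simp add: norm_mult norm_power power_divide)
  also have "\<dots> <= B * (norm x / \<rho>) ^ n" using cb [OF z] r by (intro mult_right_mono) auto
  finally show "norm (c n z * x ^ n) <= B * (norm x / \<rho>) ^ n" .
 qed
 show ?thesis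
 proof (rule borel_classI [OF g])
  show "(%z. (s * of_nat n + \<beta>) * c n z) \<in> A_space K" for n
   using cA [of n] by (auto simp: A_space_def intro!: continuous_intros holomorphic_intros)
  \<comment> \<open>Halving the radius pays for the factor n, since n \<le> 2^n.\<close>
  show "\<rho> / 2 > 0" using r by simp
  show "(norm s + norm \<beta>) * B + 1 > 0" using r by (intro add_nonneg_pos) auto
  show "norm ((s * of_nat n + \<beta>) * c n z) * (\<rho> / 2) ^ n <= (norm s + norm \<beta>) * B + 1" if z: "z \<in> K" for n z
  proof -
   have n2: "real n <= 2 ^ n" by (simp add: less_imp_le of_nat_less_two_power)
   have "norm (s * of_nat n + \<beta>) <= norm s * real n + norm \<beta>"
    by (rule order_trans [OF norm_triangle_ineq]) (simp add: norm_mult)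
   also have "\<dots> <= norm s * 2 ^ n + norm \<beta> * 2 ^ n"
    using n2 by (intro add_mono mult_left_mono) (auto simp: mult_le_cancel_left1)
   finally have 1: "norm (s * of_nat n + \<beta>) <= (norm s + norm \<beta>) * 2 ^ n" by (simp add: distrib_right)
   have "norm ((s * of_nat n + \<beta>) * c n z) * (\<rho> / 2) ^ n = norm (s * of_nat n + \<beta>) * (norm (c n z) * \<rho> ^ n) / 2 ^ n"
    by (simp add: norm_mult power_divide)
   also have "\<dots> <= ((norm s + norm \<beta>) * 2 ^ n) * B / 2 ^ n"
    using 1 cb [OF z] r by (intro divide_right_mono mult_mono) auto
   finally show ?thesis by simp
  qed
  fix w z assume w: "w \<in> sector d \<epsilon>" "exp (Re w) < \<rho> / 2" and z: "z \<in> K"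
  have w2: "exp (Re w) < \<rho>" using w r by simp
  \<comment> \<open>Termwise differentiation is done for the power series in exp w and brought back
    by the chain rule.\<close>
  define F where "F x = (\<Sum>n. c n z * x ^ n)" for x
  define D where "D = (\<Sum>n. diffs (%n. c n z) n * exp w ^ n)"
  have "DERIV F (exp w) :> D"
   unfolding F_def D_def
  proof (rule termdiffs_strong)
   show "summable (%n. c n z * complex_of_real (\<rho> / 2) ^ n)" by (rule summ [OF z]) (use r in simp)
   show "norm (exp w) < norm (complex_of_real (\<rho> / 2))" using w r by simp
  qed
  then have "((%x. F (exp x)) has_field_derivative D * exp w) (at w)"
   by (rule DERIV_chain2) (rule DERIV_exp)
  moreover have "open (sector d \<epsilon> \<inter> {x. Re x < ln \<rho>})" by (intro open_Int open_sector open_halfspace_Re_lt)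
  moreover have "w \<in> sector d \<epsilon> \<inter> {x. Re x < ln \<rho>}" using w w2 r by (simp, metis exp_less_cancel_iff exp_ln)
  moreover have "F (exp x) = v x z" if "x \<in> sector d \<epsilon> \<inter> {x. Re x < ln \<rho>}" for x
  proof -
   have "exp (Re x) < \<rho>" using that r by (metis IntD2 exp_less_cancel_iff exp_ln mem_Collect_eq)
   from sums_unique [OF sm [OF _ this z]] that show ?thesis by (simp add: F_def exp_of_nat_mult)
  qed
  ultimately have "((%x. v x z) has_field_derivative D * exp w) (at w)"
   by (rule has_field_derivative_transform_within_open)
  then have dv: "deriv (%x. v x z) w = D * exp w" by (rule DERIV_imp_deriv)
  have "summable (%n. diffs (%n. c n z) n * exp w ^ n)"
   by (rule termdiff_converges [of _ \<rho>]) (use summ [OF z] w2 in auto)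
  from diffs_equiv [OF this] have "(%n. of_nat n * c n z * exp w ^ (n - Suc 0)) sums D" by (simp add: D_def)
  from sums_mult2 [OF this, of "exp w"] have "(%n. of_nat n * c n z * exp w ^ (n - Suc 0) * exp w) sums (D * exp w)" .
  moreover have "of_nat n * c n z * exp w ^ (n - Suc 0) * exp w = of_nat n * c n z * exp (of_nat n * w)" for n
  proof (cases n)
   case (Suc k)
   then have "exp (of_nat n * w) = exp w ^ k * exp w" by (simp add: exp_of_nat_mult del: of_nat_Suc)
   then show ?thesis using Suc by simp
  qed simp
  ultimately have "(%n. of_nat n * c n z * exp (of_nat n * w)) sums deriv (%x. v x z) w" by (simp add: dv)
  from sums_add [OF sums_mult [OF this, of s] sums_mult [OF sm [OF w(1) w2 z], of \<beta>]]
  show "(%n. (s * of_nat n + \<beta>) * c n z * exp (of_nat n * w)) sums (s * deriv (%x. v x z) w + \<beta> * v w z)"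
   by (simp add: algebra_simps)
 qed
qed

text \<open>The derivative of E (w - t) v(w) has integral zero along the line, so the derivative
  passes from v to E with a minus sign.\<close>

lemma linear_laplace:
 assumes v: "borel_growth \<kappa> K d \<epsilon> v" and E: "kernel_decay \<kappa> E" and k: "\<kappa> > 0" and dl: "\<delta> > 0"
 shows "\<exists>T. \<forall>\<theta> t z. \<bar>\<theta> - d\<bar> <= \<epsilon> / 2 - \<delta> --> \<bar>\<theta> - Im t\<bar> <= pi / \<kappa> / 2 - \<delta> --> Re t < T -->
   z \<in> K --> laplace_log E \<theta> (%w. s * deriv (%x. v x z) w + \<beta> * v w z) t =
    laplace_log (%w. (- s) * deriv E w + \<beta> * E w) \<theta> (%w. v w z) t"
proof -
 have v': "borel_growth \<kappa> K d \<epsilon> (%w z. deriv (%x. v x z) w)" by (rule borel_growth_deriv [OF v k])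
 have E': "kernel_decay \<kappa> (deriv E)" by (rule kernel_decay_deriv [OF E k])
 obtain T1 where T1: "\<And>\<theta> t z. \<bar>\<theta> - d\<bar> <= \<epsilon> / 2 - \<delta> ==> \<bar>\<theta> - Im t\<bar> <= pi / \<kappa> / 2 - \<delta> ==> Re t < T1 ==> z \<in> K ==>
   integrable lborel (%y. E (Complex y \<theta> - t) * deriv (%x. v x z) (Complex y \<theta>))"
  using laplace_integrable [OF k E v' dl] by blast
 obtain T2 where T2: "\<And>\<theta> t z. \<bar>\<theta> - d\<bar> <= \<epsilon> / 2 - \<delta> ==> \<bar>\<theta> - Im t\<bar> <= pi / \<kappa> / 2 - \<delta> ==> Re t < T2 ==> z \<in> K ==>
   integrable lborel (%y. deriv E (Complex y \<theta> - t) * v (Complex y \<theta>) z)"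
  using laplace_integrable [OF k E' v dl] by blast
 obtain T3 where T3: "\<And>\<theta> t z. \<bar>\<theta> - d\<bar> <= \<epsilon> / 2 - \<delta> ==> \<bar>\<theta> - Im t\<bar> <= pi / \<kappa> / 2 - \<delta> ==> Re t < T3 ==> z \<in> K ==>
   integrable lborel (%y. E (Complex y \<theta> - t) * v (Complex y \<theta>) z)"
  using laplace_integrable [OF k E v dl] by blast
 obtain T4 \<eta> C where T4: "\<eta> > 0" "C > 0" "\<And>w t z. \<bar>Im w - d\<bar> <= \<epsilon> / 2 - \<delta> ==> \<bar>Im w - Im t\<bar> <= pi / \<kappa> / 2 - \<delta> ==>
   Re t < T4 ==> z \<in> K ==> norm (E (w - t) * v w z) <= C * exp (\<eta> * \<bar>Re t\<bar>) * exp (- (\<eta> * \<bar>Re w\<bar>))"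
  using laplace_line_bound [OF k E v dl] by blast
 have Eh: "E holomorphic_on sector 0 (pi / \<kappa>)" using E by (simp add: kernel_decay_def)
 show ?thesis
 proof (intro exI [of _ "min (min T1 T2) (min T3 T4)"] allI impI)
  fix \<theta> t z assume *: "\<bar>\<theta> - d\<bar> <= \<epsilon> / 2 - \<delta>" "\<bar>\<theta> - Im t\<bar> <= pi / \<kappa> / 2 - \<delta>" "Re t < min (min T1 T2) (min T3 T4)" "z \<in> K"
  have vh: "(%w. v w z) holomorphic_on sector d \<epsilon>" using v *(4) by (simp add: borel_growth_def)
  have i1: "integrable lborel (%y. E (Complex y \<theta> - t) * deriv (%x. v x z) (Complex y \<theta>))" by (rule T1) (use * in auto)
  have i2: "integrable lborel (%y. deriv E (Complex y \<theta> - t) * v (Complex y \<theta>) z)" by (rule T2) (use * in auto)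
  have i3: "integrable lborel (%y. E (Complex y \<theta> - t) * v (Complex y \<theta>) z)" by (rule T3) (use * in auto)
  have cx: "Complex y \<theta> = of_real y + Complex 0 \<theta>" for y by (simp add: complex_eq_iff)
  have "(\<integral>y. deriv E (Complex y \<theta> - t) * v (Complex y \<theta>) z + E (Complex y \<theta> - t) * deriv (%x. v x z) (Complex y \<theta>) \<partial>lborel) = 0"
  proof (rule integral_vector_derivative_zero [OF _ _ _ T4(1)])
   fix y
   have ys: "Complex y \<theta> - t \<in> sector 0 (pi / \<kappa>)" "Complex y \<theta> \<in> sector d \<epsilon>" using * dl by (auto simp: sector_def)
   have e1: "(E has_field_derivative deriv E (Complex y \<theta> - t)) (at (Complex y \<theta> - t))"
    by (rule holomorphic_derivI [OF Eh open_sector ys(1)])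
   have e2: "((%w. E (w - t)) has_field_derivative deriv E (Complex y \<theta> - t) * (1 - 0)) (at (Complex y \<theta>))"
    by (rule DERIV_chain2 [of E _ "%w. w - t"]) (rule e1, intro DERIV_diff DERIV_ident DERIV_const)
   have e3: "((%w. v w z) has_field_derivative deriv (%x. v x z) (Complex y \<theta>)) (at (Complex y \<theta>))"
    by (rule holomorphic_derivI [OF vh open_sector ys(2)])
   from DERIV_mult [OF e2 e3]
   have "((%w. E (w - t) * v w z) has_field_derivative
     deriv E (Complex y \<theta> - t) * v (Complex y \<theta>) z + E (Complex y \<theta> - t) * deriv (%x. v x z) (Complex y \<theta>)) (at (Complex y \<theta>))"
    by (simp add: mult.commute add.commute)
   then have "((%w. E (w - t) * v w z) has_field_derivative
     deriv E (Complex y \<theta> - t) * v (Complex y \<theta>) z + E (Complex y \<theta> - t) * deriv (%x. v x z) (Complex y \<theta>)) (at (of_real y + Complex 0 \<theta>))"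
    by (simp only: cx [symmetric])
   from line_vector_derivative [OF this]
   show "((%y. E (Complex y \<theta> - t) * v (Complex y \<theta>) z) has_vector_derivative
    deriv E (Complex y \<theta> - t) * v (Complex y \<theta>) z + E (Complex y \<theta> - t) * deriv (%x. v x z) (Complex y \<theta>)) (at y)"
    by (simp only: cx [symmetric])
   show "norm (E (Complex y \<theta> - t) * v (Complex y \<theta>) z) <= C * exp (\<eta> * \<bar>Re t\<bar>) * exp (- (\<eta> * \<bar>y\<bar>))"
    using T4(3) [of "Complex y \<theta>" t z] * by simp
  qed (use i1 i2 in simp)
  then have Z: "(\<integral>y. deriv E (Complex y \<theta> - t) * v (Complex y \<theta>) z \<partial>lborel) + (\<integral>y. E (Complex y \<theta> - t) * deriv (%x. v x z) (Complex y \<theta>) \<partial>lborel) = 0"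
   using i1 i2 by simp
  have "laplace_log E \<theta> (%w. s * deriv (%x. v x z) w + \<beta> * v w z) t =
   (\<integral>y. s * (E (Complex y \<theta> - t) * deriv (%x. v x z) (Complex y \<theta>)) + \<beta> * (E (Complex y \<theta> - t) * v (Complex y \<theta>) z) \<partial>lborel)"
   unfolding laplace_log_def by (intro Bochner_Integration.integral_cong) (auto simp: algebra_simps)
  also have "\<dots> = s * (\<integral>y. E (Complex y \<theta> - t) * deriv (%x. v x z) (Complex y \<theta>) \<partial>lborel) + \<beta> * (\<integral>y. E (Complex y \<theta> - t) * v (Complex y \<theta>) z \<partial>lborel)"
   using i1 i3 by (subst Bochner_Integration.integral_add) auto
  also have "\<dots> = (- s) * (\<integral>y. deriv E (Complex y \<theta> - t) * v (Complex y \<theta>) z \<partial>lborel) + \<beta> * (\<integral>y. E (Complex y \<theta> - t) * v (Complex y \<theta>) z \<partial>lborel)"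
   using Z by (simp add: add_eq_0_iff)
  also have "\<dots> = (\<integral>y. (- s) * (deriv E (Complex y \<theta> - t) * v (Complex y \<theta>) z) + \<beta> * (E (Complex y \<theta> - t) * v (Complex y \<theta>) z) \<partial>lborel)"
   using i2 i3 by (subst Bochner_Integration.integral_add) auto
  also have "\<dots> = laplace_log (%w. (- s) * deriv E w + \<beta> * E w) \<theta> (%w. v w z) t"
   unfolding laplace_log_def by (intro Bochner_Integration.integral_cong) (auto simp: algebra_simps)
  finally show "laplace_log E \<theta> (%w. s * deriv (%x. v x z) w + \<beta> * v w z) t =
    laplace_log (%w. (- s) * deriv E w + \<beta> * E w) \<theta> (%w. v w z) t" .
 qed
qed

lemma multiplier_linear:
 assumes k: "\<kappa> > 0"
 shows "multiplier \<kappa> (%x. s * x + \<beta>)"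
 unfolding multiplier_def multiplier_pair_def
proof (rule exI [of _ "%v w z. s * deriv (%x. v x z) w + \<beta> * v w z"],
  rule exI [of _ "%E w. (- s) * deriv E w + \<beta> * E w"], intro conjI allI impI)
 fix K d \<epsilon> v c assume "borel_class \<kappa> K d \<epsilon> v c"
 then show "borel_class \<kappa> K d \<epsilon> (%w z. s * deriv (%x. v x z) w + \<beta> * v w z) (%n z. (s * of_nat n + \<beta>) * c n z)"
  by (rule borel_class_linear [OF _ k])
next
 fix E m assume "kernel_class \<kappa> E m"
 then show "kernel_class \<kappa> (%w. (- s) * deriv E w + \<beta> * E w) (%\<sigma>. (s * (\<i> * of_real \<sigma>) + \<beta>) * m \<sigma>)"
  by (rule kernel_class_linear [OF _ k])
next
 fix K d \<epsilon> v c E m and \<delta> :: real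
 assume "borel_class \<kappa> K d \<epsilon> v c" "kernel_class \<kappa> E m" "\<delta> > 0"
 then show "\<exists>T. \<forall>\<theta> t z. \<bar>\<theta> - d\<bar> <= \<epsilon> / 2 - \<delta> --> \<bar>\<theta> - Im t\<bar> <= pi / \<kappa> / 2 - \<delta> --> Re t < T -->
   z \<in> K --> laplace_log E \<theta> (%w. s * deriv (%x. v x z) w + \<beta> * v w z) t =
    laplace_log (%w. (- s) * deriv E w + \<beta> * E w) \<theta> (%w. v w z) t"
  by (intro linear_laplace k) (auto simp: borel_class_def kernel_class_def)
qed

section \<open>Quotients of Gamma moments\<close>

text \<open>A multiplier is seen only at natural numbers and on the imaginary axis. Both lie in the
  closed right half-plane, where the Gamma functions in question have no poles.\<close>

lemma multiplier_cong:
 assumes f: "multiplier \<kappa> f" and eq: "\<And>x. 0 <= Re x ==> f x = g x"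
 shows "multiplier \<kappa> g"
proof -
 have "f (of_nat n) = g (of_nat n)" "f (\<i> * of_real \<sigma>) = g (\<i> * of_real \<sigma>)" for n \<sigma>
  by (rule eq, simp)+
 then show ?thesis using f unfolding multiplier_def multiplier_pair_def by simp
qed

lemma multiplier_const: "\<kappa> > 0 ==> multiplier \<kappa> (%_. c)"
 using multiplier_linear [of \<kappa> 0 c] by simp

text \<open>The average over a point mass: translation by the constant c.\<close>

lemma multiplier_exp:
 assumes "\<kappa> > 0" shows "multiplier \<kappa> (%x. exp (x * of_real c))"
proof -
 interpret P: prob_space "return borel (0::real)" by (rule prob_space_return) simp
 interpret averaging "return borel (0::real)" "%_. c" c 1 \<kappa>
 proof (intro averaging.intro averaging_axioms.intro P.finite_measure_axioms)
  show "integrable (return borel (0::real)) (%om. exp (- (1 * c)))" by (rule P.integrable_const)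
 qed (use assms in simp_all)
 have "avg_f x = exp (x * of_real c)" for x
  unfolding avg_f_def using P.prob_space by simp
 from multiplier_cong [OF multiplier_avg this] show ?thesis .
qed

lemma multiplier_prod:
 assumes "finite I" "\<And>i. i \<in> I ==> multiplier \<kappa> (f i)" "\<kappa> > 0"
 shows "multiplier \<kappa> (%x. \<Prod>i\<in>I. f i x)"
 using assms(1,2)
proof (induction rule: finite_induct)
 case empty
 then show ?case using multiplier_const [OF assms(3), of 1] by simp
next
 case (insert i I)
 then have "multiplier \<kappa> (%x. f i x * (\<Prod>i\<in>I. f i x))" by (intro multiplier_mult) auto
 then show ?case using insert by simp
qed

text \<open>Allows \<open>avg_f\<close> to be computed on the real axis and continued; the
  half-plane reaches left of 0 by the order \<eta>0 of the exponential moment.\<close>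

lemma (in averaging) avg_f_holomorphic: "avg_f holomorphic_on {x. Re x > - \<eta>0}"
 unfolding avg_f_def
proof (rule holomorphic_on_integral)
 show "open {x. Re x > - \<eta>0}" by (rule open_halfspace_Re_gt)
 fix x assume x: "x \<in> {x. Re x > - \<eta>0}"
 define M where "M = \<bar>Re x\<bar> + 1"
 show "\<exists>\<delta>>0. \<exists>g. integrable N g \<and> (\<forall>y\<in>ball x \<delta> \<inter> {x. Re x > - \<eta>0}. \<forall>om\<in>space N. norm (exp (y * of_real (\<tau> om))) <= g om)"
 proof (rule exI [of _ 1], rule conjI, simp, rule exI [of _ "%om. exp (M * \<bar>b\<bar>) + exp (- (\<eta>0 * \<tau> om))"], intro conjI ballI)
  show "integrable N (%om. exp (M * \<bar>b\<bar>) + exp (- (\<eta>0 * \<tau> om)))" using exp_int by simp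
  fix y om assume y: "y \<in> ball x 1 \<inter> {x. Re x > - \<eta>0}" and w: "om \<in> space N"
  have "norm (x - y) < 1" using y by (simp add: dist_norm)
  then have "\<bar>Re x - Re y\<bar> < 1" using abs_Re_le_cmod [of "x - y"] by simp
  then have ry: "Re y <= M" unfolding M_def by linarith
  have M0: "0 <= M" by (simp add: M_def)
  have "norm (exp (y * of_real (\<tau> om))) = exp (Re y * \<tau> om)" by simp
  also have "\<dots> <= exp (M * \<bar>b\<bar>) + exp (- (\<eta>0 * \<tau> om))"
  proof (cases "0 <= \<tau> om")
   case True
   have "Re y * \<tau> om <= M * \<tau> om" using ry True by (intro mult_right_mono)
   also have "\<dots> <= M * \<bar>b\<bar>" using tau_le [OF w] M0 by (intro mult_left_mono) auto
   finally have "exp (Re y * \<tau> om) <= exp (M * \<bar>b\<bar>)" by simp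
   then show ?thesis using exp_gt_zero [of "- (\<eta>0 * \<tau> om)"] by linarith
  next
   case False
   have "Re y * \<tau> om <= (- \<eta>0) * \<tau> om" using y False by (intro mult_right_mono_neg) auto
   then have "exp (Re y * \<tau> om) <= exp (- (\<eta>0 * \<tau> om))" by simp
   then show ?thesis using exp_gt_zero [of "M * \<bar>b\<bar>"] by linarith
  qed
  finally show "norm (exp (y * of_real (\<tau> om))) <= exp (M * \<bar>b\<bar>) + exp (- (\<eta>0 * \<tau> om))" .
 qed
qed (auto intro!: holomorphic_intros)

lemma not_nonpos_Ints_Re: "0 < Re z ==> z \<notin> \<int>\<^sub>\<le>\<^sub>0"
 by (auto elim!: nonpos_Ints_cases)

lemma lborel_integral_Beta:
 fixes a b :: real
 assumes "a > 0" "b > 0"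
 shows "integrable lborel (%y. indicator {0<..<1} y * (y powr (a - 1) * (1 - y) powr (b - 1)))"
  and "(\<integral>y. indicator {0<..<1} y * (y powr (a - 1) * (1 - y) powr (b - 1)) \<partial>lborel) = Beta a b"
proof -
 have 1: "set_integrable lborel {0..1} (%y. y powr (a - 1) * (1 - y) powr (b - 1))"
  by (rule integrable_Beta [OF assms])
 have 2: "set_integrable lborel {0<..<1} (%y. y powr (a - 1) * (1 - y) powr (b - 1))"
  by (rule set_integrable_subset [OF 1]) auto
 then show "integrable lborel (%y. indicator {0<..<1} y * (y powr (a - 1) * (1 - y) powr (b - 1)))"
  by (simp add: set_integrable_def)
 have "(LINT y:{0<..<1}|lborel. y powr (a - 1) * (1 - y) powr (b - 1)) = integral {0<..<1} (%y. y powr (a - 1) * (1 - y) powr (b - 1))"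
  by (rule set_borel_integral_eq_integral(2) [OF 2])
 also have "\<dots> = integral {0..1} (%y. y powr (a - 1) * (1 - y) powr (b - 1))"
  by (rule integral_subset_negligible) (auto intro!: negligible_subset [of "{0,1}"])
 also have "\<dots> = Beta a b" by (rule integral_unique [OF has_integral_Beta_real [OF assms]])
 finally show "(\<integral>y. indicator {0<..<1} y * (y powr (a - 1) * (1 - y) powr (b - 1)) \<partial>lborel) = Beta a b"
  by (simp add: set_lebesgue_integral_def)
qed

text \<open>Euler's beta integral. Averaging with \<tau> = s ln y against y^(\<alpha>-1)
  (1-y)^(\<gamma>-1) on (0,1), \<gamma> = \<beta> - \<alpha>, gives Beta (\<alpha> + s x) \<gamma>,
  which is the wanted quotient times Gamma \<gamma>. The identity holds for real x and extends by
  analytic continuation.\<close>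

lemma multiplier_Gamma_ratio_less:
 fixes s \<alpha> \<beta> \<kappa> :: real
 assumes k: "\<kappa> > 0" and s: "s > 0" and ab: "0 < \<alpha>" "\<alpha> < \<beta>"
 shows "multiplier \<kappa> (%x. Gamma (of_real \<alpha> + of_real s * x) / Gamma (of_real \<beta> + of_real s * x))"
proof -
 define \<gamma> where "\<gamma> = \<beta> - \<alpha>"
 have g: "\<gamma> > 0" using ab by (simp add: \<gamma>_def)
 define D where "D y = indicator {0<..<1} y * (y powr (\<alpha> - 1) * (1 - y) powr (\<gamma> - 1))" for y :: real
 have Dm [measurable]: "D \<in> borel_measurable borel" unfolding D_def [abs_def] by measurable
 have D0: "0 <= D y" for y by (simp add: D_def)
 have Di: "integrable lborel D" using lborel_integral_Beta(1) [OF ab(1) g] by (simp add: D_def [abs_def])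
 define N where "N = density lborel (%y. ennreal (D y))"
 \<comment> \<open>Outside (0,1), where the density vanishes, the value 0 keeps \<tau> \<le> 0 true
   on the whole sample space.\<close>
 define \<tau> where "\<tau> y = (if 0 < y \<and> y < 1 then s * ln y else 0)" for y :: real
 \<comment> \<open>Then \<alpha> - \<eta>0 s = \<alpha> / 2 > 0, so the exponential moment is itself
   a convergent beta integral.\<close>
 define \<eta>0 where "\<eta>0 = \<alpha> / (2 * s)"
 have tm [measurable]: "\<tau> \<in> borel_measurable borel" unfolding \<tau>_def [abs_def] by measurable
 have De: "D y * exp (c * \<tau> y) = indicator {0<..<1} y * (y powr (\<alpha> + c * s - 1) * (1 - y) powr (\<gamma> - 1))" for y c
  by (auto simp: D_def \<tau>_def indicator_def powr_def exp_add [symmetric] algebra_simps)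
 have "emeasure N (space N) = (\<integral>\<^sup>+ y. ennreal (D y) \<partial>lborel)"
  by (simp add: N_def emeasure_density)
 also have "\<dots> = ennreal (\<integral>y. D y \<partial>lborel)" using Di D0 by (intro nn_integral_eq_integral) auto
 finally have fm: "finite_measure N" by (intro finite_measureI) simp
 interpret averaging N \<tau> 0 \<eta>0 \<kappa>
 proof (intro averaging.intro averaging_axioms.intro fm)
  show "\<tau> \<in> borel_measurable N" by (simp add: N_def)
  show "\<tau> y <= 0" for y using s by (auto simp: \<tau>_def mult_le_0_iff)
  show "\<eta>0 > 0" using ab s by (simp add: \<eta>0_def)
  show "integrable N (%y. exp (- (\<eta>0 * \<tau> y)))"
  proof -
   have "\<alpha> + (- \<eta>0) * s > 0" using ab s by (simp add: \<eta>0_def)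
   from lborel_integral_Beta(1) [OF this g] have "integrable lborel (%y. D y * exp ((- \<eta>0) * \<tau> y))" by (simp only: De)
   then show ?thesis unfolding N_def using D0 by (subst integrable_density) (auto simp del: mult_minus_left)
  qed
  show "0 < \<kappa>" by (rule k)
 qed
 define F where "F x = Gamma (of_real \<alpha> + of_real s * x) * of_real (Gamma \<gamma>) / Gamma (of_real \<beta> + of_real s * x)" for x :: complex
 have eta_pos: "- \<eta>0 < 0" using eta0 by simp
 have rex: "0 < \<alpha> + s * Re x" if "Re x > - \<eta>0" for x
 proof -
  have "s * (- \<eta>0) < s * Re x" using that s by (intro mult_strict_left_mono)
  moreover have "s * \<eta>0 = \<alpha> / 2" using s by (simp add: \<eta>0_def)
  ultimately show ?thesis using ab by simp
 qed
 have Fh: "F holomorphic_on {x. Re x > - \<eta>0}"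
 proof -
  have "of_real \<alpha> + of_real s * x \<notin> \<int>\<^sub>\<le>\<^sub>0" "of_real \<beta> + of_real s * x \<notin> \<int>\<^sub>\<le>\<^sub>0" if "Re x > - \<eta>0" for x :: complex
   by (rule not_nonpos_Ints_Re, use rex [OF that] ab in simp)+
  then show ?thesis unfolding F_def by (intro holomorphic_intros) (auto simp: Gamma_eq_zero_iff)
 qed
 have real_eq: "avg_f (of_real c) = F (of_real c)" if c: "c > - \<eta>0" for c :: real
 proof -
  have ac: "0 < \<alpha> + c * s" using rex [of "of_real c"] c by (simp add: mult.commute)
  have "avg_f (of_real c) = (\<integral>y. of_real (exp (c * \<tau> y)) \<partial>N)"
   unfolding avg_f_def by (intro Bochner_Integration.integral_cong) (auto simp: exp_of_real [symmetric])
  also have "\<dots> = of_real (\<integral>y. exp (c * \<tau> y) \<partial>N)" by (rule integral_complex_of_real)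
  also have "(\<integral>y. exp (c * \<tau> y) \<partial>N) = (\<integral>y. D y * exp (c * \<tau> y) \<partial>lborel)"
   unfolding N_def using D0 by (subst integral_density) auto
  also have "\<dots> = Beta (\<alpha> + c * s) \<gamma>"
   unfolding De by (rule lborel_integral_Beta(2) [OF ac g])
  also have "of_real (Beta (\<alpha> + c * s) \<gamma>) = F (of_real c)"
  proof -
   have e: "of_real \<alpha> + of_real s * of_real c = complex_of_real (\<alpha> + c * s)"
    "of_real \<beta> + of_real s * of_real c = complex_of_real (\<alpha> + c * s + \<gamma>)"
    by (simp_all add: \<gamma>_def mult.commute)
   show ?thesis unfolding F_def Beta_def e Gamma_complex_of_real by simp
  qed
  finally show ?thesis .
 qed
 have eq: "avg_f x = F x" if x: "Re x > - \<eta>0" for x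
 proof -
  have "avg_f x - F x = 0"
  proof (rule analytic_continuation [of "%x. avg_f x - F x" "{x. Re x > - \<eta>0}" "of_real ` {0..1}" 0])
   show "(%x. avg_f x - F x) holomorphic_on {x. Re x > - \<eta>0}"
    by (intro holomorphic_intros avg_f_holomorphic Fh)
   show "open {x. Re x > - \<eta>0}" by (rule open_halfspace_Re_gt)
   show "connected {x. Re x > - \<eta>0}" by (intro convex_connected convex_halfspace_Re_gt)
   show "0 \<in> {x. Re x > - \<eta>0}" using eta_pos by simp
   show "complex_of_real ` {0..1} \<subseteq> {x. Re x > - \<eta>0}" using eta_pos by auto
   show "0 islimpt complex_of_real ` {0..1}"
    unfolding islimpt_approachable
   proof (intro allI impI)
    fix e :: real assume "0 < e"
    then show "\<exists>x'\<in>complex_of_real ` {0..1}. x' \<noteq> 0 \<and> dist x' 0 < e"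
     by (intro bexI [of _ "of_real (min (e / 2) 1)"]) (auto simp: min_def)
   qed
   show "avg_f z - F z = 0" if "z \<in> complex_of_real ` {0..1}" for z
    using that real_eq eta_pos by auto
  qed (use x in simp)
  then show ?thesis by simp
 qed
 have G: "Gamma \<gamma> \<noteq> 0" using Gamma_real_pos [OF g] by simp
 have "multiplier \<kappa> F" by (rule multiplier_cong [OF multiplier_avg eq]) (use eta_pos in simp)
 then have "multiplier \<kappa> (%x. of_real (1 / Gamma \<gamma>) * F x)"
  by (rule multiplier_mult [OF _ multiplier_const [OF k]])
 then show ?thesis using G by (simp add: F_def [abs_def])
qed

text \<open>For \<alpha> \<ge> \<beta> the beta density is not integrable. The denominator is raised
  to \<beta> + 1, and the functional equation of Gamma restores it through the degree one multiplier
  s x + \<beta>.\<close>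

lemma multiplier_Gamma_ratio:
 fixes s \<alpha> \<beta> \<kappa> :: real
 assumes k: "\<kappa> > 0" and s: "s > 0" and ab: "0 < \<alpha>" "\<alpha> < \<beta> + 1" "0 < \<beta>"
 shows "multiplier \<kappa> (%x. Gamma (of_real \<alpha> + of_real s * x) / Gamma (of_real \<beta> + of_real s * x))"
proof -
 have "multiplier \<kappa> (%x. (of_real s * x + of_real \<beta>) * (Gamma (of_real \<alpha> + of_real s * x) / Gamma (of_real (\<beta> + 1) + of_real s * x)))"
  by (rule multiplier_mult [OF multiplier_Gamma_ratio_less [OF k s ab(1,2)] multiplier_linear [OF k]])
 then show ?thesis
 proof (rule multiplier_cong)
  fix x :: complex assume x: "0 <= Re x"
  have "0 < Re (of_real \<beta> + of_real s * x)" using x s ab by (auto intro!: add_pos_nonneg)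
  then have n: "of_real \<beta> + of_real s * x \<notin> \<int>\<^sub>\<le>\<^sub>0" "of_real \<beta> + of_real s * x \<noteq> 0"
   by (rule not_nonpos_Ints_Re, metis less_irrefl zero_complex.sel(1))
  have "Gamma (of_real (\<beta> + 1) + of_real s * x) = (of_real \<beta> + of_real s * x) * Gamma (of_real \<beta> + of_real s * x)"
   using Gamma_plus1 [OF n(1)] by (simp add: add_ac)
  then show "(of_real s * x + of_real \<beta>) * (Gamma (of_real \<alpha> + of_real s * x) / Gamma (of_real (\<beta> + 1) + of_real s * x)) =
   Gamma (of_real \<alpha> + of_real s * x) / Gamma (of_real \<beta> + of_real s * x)"
   using n(2) by (simp add: add.commute)
 qed
qed

section \<open>Gauss' multiplication formula, from Gamma (z + n + 1) ~ n! n^z\<close>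

lemma Gamma_shift_LIMSEQ:
 fixes z :: complex assumes "z \<notin> \<int>\<^sub>\<le>\<^sub>0"
 shows "(%n. Gamma (z + of_nat (Suc n)) / (fact n * exp (z * of_real (ln (of_nat n))))) \<longlonglongrightarrow> 1"
proof -
 have G: "Gamma z \<noteq> 0" using assms by (simp add: Gamma_eq_zero_iff)
 have "(%n. rGamma_series z n * Gamma z) \<longlonglongrightarrow> rGamma z * Gamma z" by (intro tendsto_intros)
 moreover have "rGamma z * Gamma z = 1" using G by (simp add: rGamma_inverse_Gamma)
 moreover have "rGamma_series z n * Gamma z = Gamma (z + of_nat (Suc n)) / (fact n * exp (z * of_real (ln (of_nat n))))" for n
  using G pochhammer_Gamma [OF assms, of "Suc n"] by (simp add: rGamma_series_def del: of_nat_Suc)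
 ultimately show ?thesis by simp
qed

text \<open>The quotient of the two sides of Gauss' formula has period 1: a unit step multiplies
  Gamma (1 + N z) by the product of the N z + i, which is N^N times the product of the z + i/N
  gained by the other factors.\<close>

lemma prod_Gamma_shift:
 fixes z :: complex and N :: nat
 assumes N: "N > 0" and z: "0 <= Re z"
 shows "Gamma (1 + of_nat N * (z + 1)) * exp (- (of_nat N * (z + 1) * of_real (ln (real N)))) / (\<Prod>i=1..N. Gamma (z + 1 + of_nat i / of_nat N)) =
  Gamma (1 + of_nat N * z) * exp (- (of_nat N * z * of_real (ln (real N)))) / (\<Prod>i=1..N. Gamma (z + of_nat i / of_nat N))"
proof -
 have NZ: "complex_of_nat N \<noteq> 0" using N by simp
 have n1: "1 + of_nat N * z \<notin> \<int>\<^sub>\<le>\<^sub>0" by (rule not_nonpos_Ints_Re) (use z in \<open>auto intro!: add_pos_nonneg\<close>)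
 have zi: "0 < Re (z + of_nat i / of_nat N)" if "i \<in> {1..N}" for i
  using that z N by (auto intro!: add_nonneg_pos)
 have zi0: "z + of_nat i / of_nat N \<noteq> 0" if "i \<in> {1..N}" for i
  using zi [OF that] by (metis less_irrefl zero_complex.sel(1))
 have A: "Gamma (1 + of_nat N * (z + 1)) = (\<Prod>i=1..N. of_nat N * z + of_nat i) * Gamma (1 + of_nat N * z)"
 proof -
  have "Gamma (1 + of_nat N * z + of_nat N) = pochhammer (1 + of_nat N * z) N * Gamma (1 + of_nat N * z)"
   using pochhammer_Gamma [OF n1, of N] n1 by (simp add: Gamma_eq_zero_iff)
  also have "pochhammer (1 + of_nat N * z) N = (\<Prod>i=1..N. of_nat N * z + of_nat i)"
   unfolding pochhammer_prod by (rule prod.reindex_bij_witness [of _ "%i. i - 1" Suc]) auto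
  finally show ?thesis by (simp add: algebra_simps)
 qed
 have B: "(\<Prod>i=1..N. of_nat N * z + of_nat i) = of_nat N ^ N * (\<Prod>i=1..N. z + of_nat i / of_nat N)"
 proof -
  have "(\<Prod>i=1..N. of_nat N * z + of_nat i) = (\<Prod>i=1..N. of_nat N * (z + of_nat i / of_nat N))"
   using NZ by (intro prod.cong) (auto simp: distrib_left)
  then show ?thesis by (simp add: prod.distrib)
 qed
 have C: "(\<Prod>i=1..N. Gamma (z + 1 + of_nat i / of_nat N)) = (\<Prod>i=1..N. z + of_nat i / of_nat N) * (\<Prod>i=1..N. Gamma (z + of_nat i / of_nat N))"
  unfolding prod.distrib [symmetric]
 proof (rule prod.cong [OF refl])
  fix i assume "i \<in> {1..N}"
  from Gamma_plus1 [OF not_nonpos_Ints_Re [OF zi [OF this]]]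
  show "Gamma (z + 1 + of_nat i / of_nat N) = (z + of_nat i / of_nat N) * Gamma (z + of_nat i / of_nat N)"
   by (simp add: add_ac)
 qed
 have D: "exp (- (of_nat N * (z + 1) * of_real (ln (real N)))) = exp (- (of_nat N * z * of_real (ln (real N)))) / of_nat N ^ N"
 proof -
  have "exp (of_nat N * complex_of_real (ln (real N))) = of_nat N ^ N"
   using N by (simp add: exp_of_nat_mult exp_of_real)
  moreover have "- (of_nat N * (z + 1) * of_real (ln (real N))) = - (of_nat N * z * of_real (ln (real N))) - of_nat N * complex_of_real (ln (real N))"
   by (simp add: algebra_simps)
  ultimately show ?thesis by (simp add: exp_diff)
 qed
 have P: "(\<Prod>i=1..N. z + of_nat i / of_nat N) \<noteq> 0" using zi0 by simp
 show ?thesis unfolding A B C D using P NZ by (simp add: field_simps)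
qed

text \<open>By periodicity h z / h 0 = h (z + n) / h n for all n, and the asymptotics of Gamma makes
  the right side tend to 1. So h is constant; \<open>C\<close> is its value at 0.\<close>

lemma Gauss_multiplication:
 assumes N: "N > 0"
 shows "\<exists>C. C \<noteq> 0 \<and> (\<forall>z. 0 <= Re z --> Gamma (1 + of_nat N * z) =
  C * exp (of_nat N * z * of_real (ln (real N))) * (\<Prod>i=1..N. Gamma (z + of_nat i / of_nat N)))"
proof -
 define h where "h z = Gamma (1 + of_nat N * z) * exp (- (of_nat N * z * of_real (ln (real N)))) /
  (\<Prod>i=1..N. Gamma (z + of_nat i / of_nat N))" for z :: complex
 have Gz: "(\<Prod>i=1..N. Gamma (z + of_nat i / of_nat N)) \<noteq> 0" if "0 <= Re z" for z :: complex
 proof -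
  have "z + of_nat i / of_nat N \<notin> \<int>\<^sub>\<le>\<^sub>0" if "i \<in> {1..N}" for i
   by (rule not_nonpos_Ints_Re) (use that \<open>0 <= Re z\<close> N in \<open>auto intro!: add_nonneg_pos\<close>)
  then show ?thesis unfolding prod_zero_iff [OF finite_atLeastAtMost] Gamma_eq_zero_iff by blast
 qed
 have hn: "h (z + of_nat k) = h z" if z: "0 <= Re z" for z k
 proof (induction k)
  case (Suc k)
  have "h (z + of_nat k + 1) = h (z + of_nat k)"
   unfolding h_def by (rule prod_Gamma_shift [OF N]) (use z in simp)
  then show ?case using Suc by (simp add: add_ac)
 qed simp
 define b where "b y k = Gamma (y + of_nat (Suc k)) / (fact k * exp (y * of_real (ln (of_nat k))))" for y :: complex and k
 have bl: "b y \<longlonglongrightarrow> 1" if "y \<notin> \<int>\<^sub>\<le>\<^sub>0" for y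
  unfolding b_def using Gamma_shift_LIMSEQ [OF that] by simp
 have bG: "Gamma (y + of_nat (Suc k)) = b y k * (fact k * exp (y * of_real (ln (of_nat k))))" for y k
  by (simp add: b_def)
 have h0: "h 0 \<noteq> 0" using Gz [of 0] by (simp add: h_def)
 have main: "h z = h 0" if z: "0 <= Re z" for z
 \<comment> \<open>At z = 0 the point N z is a pole of Gamma, where
   \<open>Gamma_shift_LIMSEQ\<close> does not apply; there the claim is trivial.\<close>
 proof (cases "z = 0")
  case False
  \<comment> \<open>The quotient h (z + n + 1) / h (n + 1) with every Gamma replaced by its
    normalised form \<open>b\<close>, which tends to 1. The index N (n + 1) comes from Gamma (1 + N
    (z + n + 1)).\<close>
  define g where "g n = b (of_nat N * z) (N * Suc n) * (\<Prod>i=1..N. b (of_nat i / of_nat N) n / b (z + of_nat i / of_nat N) n) *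
    exp (of_nat N * z * of_real (ln (real (Suc n)) - ln (real n)))" for n
  have Nz: "of_nat N * z \<notin> \<int>\<^sub>\<le>\<^sub>0"
  proof
   assume "of_nat N * z \<in> \<int>\<^sub>\<le>\<^sub>0"
   then obtain k where k: "of_nat N * z = - of_nat k" by (auto elim: nonpos_Ints_cases')
   from arg_cong [OF this, of Re] have "real N * Re z = - real k" by simp
   moreover have "0 <= real N * Re z" using z by simp
   ultimately have "k = 0" by simp
   then show False using k False N by simp
  qed
  have zi: "y + of_nat i / of_nat N \<notin> \<int>\<^sub>\<le>\<^sub>0" if "i \<in> {1..N}" "0 <= Re y" for i and y :: complex
   by (rule not_nonpos_Ints_Re) (use that z N in \<open>auto intro!: add_nonneg_pos\<close>)
  have zi: "z + of_nat i / of_nat N \<notin> \<int>\<^sub>\<le>\<^sub>0" "of_nat i / of_nat N \<notin> (\<int>\<^sub>\<le>\<^sub>0 :: complex set)" if "i \<in> {1..N}" for i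
   using zi [OF that z] zi [OF that, of 0] by simp_all
  have "g \<longlonglongrightarrow> 1 * (\<Prod>i=1..N. 1 / 1) * exp (of_nat N * z * of_real 0)"
   unfolding g_def
  proof (intro tendsto_mult tendsto_prod tendsto_divide bl zi tendsto_exp tendsto_of_real tendsto_const)
   have "filterlim (%n. N * Suc n) sequentially sequentially"
    by (rule filterlim_subseq) (use N in \<open>auto simp: strict_mono_Suc_iff\<close>)
   from filterlim_compose [OF bl [OF Nz] this] show "(%n. b (of_nat N * z) (N * Suc n)) \<longlonglongrightarrow> 1" .
   show "(%n. ln (real (Suc n)) - ln (real n)) \<longlonglongrightarrow> 0" by real_asymp
  qed auto
  then have gl: "g \<longlonglongrightarrow> 1" by simp
  have "g n = h z / h 0" if n: "n \<ge> 1" for n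
  proof -
   define M where "M = N * Suc n"
   have M0: "M > 0" using N by (simp add: M_def)
   have hz: "h z = h (z + of_nat (Suc n))" by (rule hn [OF z, symmetric])
   have ho: "h 0 = h (of_nat (Suc n))" using hn [of 0 "Suc n"] by simp
   have G1: "Gamma (1 + of_nat N * (z + of_nat (Suc n))) = b (of_nat N * z) M * (fact M * exp (of_nat N * z * of_real (ln (real M))))"
   proof -
    have "1 + of_nat N * (z + of_nat (Suc n)) = of_nat N * z + of_nat (Suc M)" by (simp add: M_def algebra_simps)
    then show ?thesis by (simp only: bG)
   qed
   have G2: "Gamma (1 + of_nat N * (of_nat (Suc n))) = (fact M :: complex)"
   proof -
    have "of_nat N * of_nat (Suc n) = (of_nat M :: complex)" by (simp only: M_def of_nat_mult)
    then show ?thesis by (simp only: Gamma_fact)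
   qed
   have G3: "(\<Prod>i=1..N. Gamma (z + of_nat (Suc n) + of_nat i / of_nat N)) =
     (\<Prod>i=1..N. b (z + of_nat i / of_nat N) n) * (\<Prod>i=1..N. fact n * exp (of_nat i / of_nat N * of_real (ln (real n)))) * exp (z * of_real (ln (real n))) ^ N"
   proof -
    have "Gamma (z + of_nat (Suc n) + of_nat i / of_nat N) = b (z + of_nat i / of_nat N) n * (fact n * exp (of_nat i / of_nat N * of_real (ln (real n)))) * exp (z * of_real (ln (real n)))" for i
    proof -
     have "z + of_nat (Suc n) + of_nat i / of_nat N = (z + of_nat i / of_nat N) + of_nat (Suc n)" by (simp only: add_ac)
     then have "Gamma (z + of_nat (Suc n) + of_nat i / of_nat N) = b (z + of_nat i / of_nat N) n * (fact n * exp ((z + of_nat i / of_nat N) * of_real (ln (real n))))"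
      by (simp only: bG)
     moreover have "exp ((z + of_nat i / of_nat N) * of_real (ln (real n))) = exp (z * of_real (ln (real n))) * exp (of_nat i / of_nat N * of_real (ln (real n)))"
      by (simp only: distrib_right exp_add)
     ultimately show ?thesis by (simp only: mult_ac)
    qed
    then show ?thesis by (simp add: prod.distrib)
   qed
   have G4: "(\<Prod>i=1..N. Gamma (of_nat (Suc n) + of_nat i / of_nat N)) =
     (\<Prod>i=1..N. b (of_nat i / of_nat N) n) * (\<Prod>i=1..N. fact n * exp (of_nat i / of_nat N * of_real (ln (real n))))"
   proof -
    have "Gamma (of_nat (Suc n) + of_nat i / of_nat N) = b (of_nat i / of_nat N) n * (fact n * exp (of_nat i / of_nat N * complex_of_real (ln (real n))))" for i
    proof -
     have "of_nat (Suc n) + of_nat i / of_nat N = of_nat i / of_nat N + (of_nat (Suc n) :: complex)" by (rule add.commute)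
     then show ?thesis by (simp only: bG)
    qed
    then show ?thesis by (simp add: prod.distrib)
   qed
   have P4: "(\<Prod>i=1..N. Gamma (of_nat (Suc n) + of_nat i / of_nat N)) \<noteq> (0::complex)" using Gz [of "of_nat (Suc n)"] by simp
   have P3: "(\<Prod>i=1..N. Gamma (z + of_nat (Suc n) + of_nat i / of_nat N)) \<noteq> (0::complex)" using Gz [of "z + of_nat (Suc n)"] z by simp
   define B3 where "B3 = (\<Prod>i=1..N. b (z + of_nat i / of_nat N) n)"
   define B4 where "B4 = (\<Prod>i=1..N. b (of_nat i / of_nat N) n)"
   define Q where "Q = (\<Prod>i=1..N. fact n * exp (of_nat i / of_nat N * complex_of_real (ln (real n))))"
   have nz: "B3 \<noteq> 0" "B4 \<noteq> 0" "Q \<noteq> 0" using P3 P4 unfolding G3 G4 B3_def B4_def Q_def by auto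
   \<comment> \<open>With ln M = ln N + ln (n + 1) the z-dependent powers of N cancel; against the
     powers of n from the N Gamma factors only ln (n + 1) - ln n remains.\<close>
   have E: "exp (of_nat N * z * complex_of_real (ln (real M))) * exp (- (of_nat N * (z + of_nat (Suc n)) * of_real (ln (real N)))) =
    exp (- (of_nat N * of_nat (Suc n) * of_real (ln (real N)))) * exp (z * of_real (ln (real n))) ^ N * exp (of_nat N * z * of_real (ln (real (Suc n)) - ln (real n)))"
   proof -
    have "ln (real M) = ln (real N) + ln (real (Suc n))"
     unfolding M_def of_nat_mult by (rule ln_mult_pos) (use N in auto)
    then show ?thesis
     by (simp add: exp_of_nat_mult [symmetric] exp_add [symmetric] algebra_simps del: of_nat_Suc)
   qed
   have hz2: "h z = b (of_nat N * z) M * fact M * (exp (- (of_nat N * of_nat (Suc n) * of_real (ln (real N)))) * exp (z * of_real (ln (real n))) ^ N * exp (of_nat N * z * of_real (ln (real (Suc n)) - ln (real n)))) /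
     (B3 * Q * exp (z * of_real (ln (real n))) ^ N)"
    unfolding hz unfolding h_def G1 G3 B3_def [symmetric] Q_def [symmetric] E [symmetric] by (simp only: mult_ac)
   have ho2: "h 0 = fact M * exp (- (of_nat N * of_nat (Suc n) * of_real (ln (real N)))) / (B4 * Q)"
    unfolding ho unfolding h_def G2 G4 B4_def [symmetric] Q_def [symmetric] by simp
   have "g n = b (of_nat N * z) M * (B4 / B3) * exp (of_nat N * z * of_real (ln (real (Suc n)) - ln (real n)))"
    unfolding g_def M_def [symmetric] B3_def B4_def by (simp add: prod_dividef)
   then show ?thesis unfolding hz2 ho2 using nz by (simp del: of_nat_Suc)
  qed
  then have "(%n. h z / h 0) \<longlonglongrightarrow> 1"
   by (intro Lim_transform_eventually [OF gl]) (auto intro!: eventually_sequentiallyI [of 1])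
  then have "h z / h 0 = 1" using LIMSEQ_unique tendsto_const by blast
  then show ?thesis using h0 by simp
 qed simp
 show ?thesis
 proof (intro exI [of _ "h 0"] conjI allI impI h0)
  fix z :: complex assume z: "0 <= Re z"
  have "h 0 * exp (of_nat N * z * of_real (ln (real N))) * (\<Prod>i=1..N. Gamma (z + of_nat i / of_nat N)) =
   h z * exp (of_nat N * z * of_real (ln (real N))) * (\<Prod>i=1..N. Gamma (z + of_nat i / of_nat N))" using main [OF z] by simp
  also have "\<dots> = Gamma (1 + of_nat N * z)" using Gz [OF z] by (simp add: h_def exp_minus)
  finally show "Gamma (1 + of_nat N * z) = h 0 * exp (of_nat N * z * of_real (ln (real N))) * (\<Prod>i=1..N. Gamma (z + of_nat i / of_nat N))" ..
 qed
qed

text \<open>Gauss' formula divided by Gamma (1 + s x)^N splits into a constant, an exponential and N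
  quotients with parameters i/N and 1. These differ by less than 1, so both orders of the parameters
  are admissible.\<close>

lemma multiplier_Gamma_multiple:
 assumes k: "\<kappa> > 0" and s: "s > 0" and N: "N > 0"
 shows "multiplier \<kappa> (%x. Gamma (1 + of_nat N * (of_real s * x)) / Gamma (1 + of_real s * x) ^ N)"
  and "multiplier \<kappa> (%x. Gamma (1 + of_real s * x) ^ N / Gamma (1 + of_nat N * (of_real s * x)))"
proof -
 obtain C where C: "C \<noteq> 0" and G: "\<And>z. 0 <= Re z ==> Gamma (1 + of_nat N * z) =
  C * exp (of_nat N * z * of_real (ln (real N))) * (\<Prod>i=1..N. Gamma (z + of_nat i / of_nat N))"
  using Gauss_multiplication [OF N] by blast
 define c where "c = real N * s * ln (real N)"
 have cx: "of_nat N * (of_real s * x) * of_real (ln (real N)) = x * complex_of_real c" for x by (simp add: c_def)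
 have iN: "0 < real i / real N" "real i / real N < 1 + 1" "1 < real i / real N + 1" if "i \<in> {1..N}" for i
 proof -
  show 1: "0 < real i / real N" using that N by simp
  have "real i / real N <= 1" using that by (simp add: divide_le_eq)
  then show "real i / real N < 1 + 1" "1 < real i / real N + 1" using 1 by linarith+
 qed
 have pr: "(\<Prod>i=1..N. f i) / y ^ N = (\<Prod>i=1..N. f i / y)" "y ^ N / (\<Prod>i=1..N. f i) = (\<Prod>i=1..N. y / f i)" for f :: "nat => complex" and y
  by (simp_all add: prod_dividef)
 have "multiplier \<kappa> (%x. C * (exp (x * of_real c) * (\<Prod>i=1..N. Gamma (of_real (real i / real N) + of_real s * x) / Gamma (of_real 1 + of_real s * x))))"
  by (intro multiplier_mult multiplier_const multiplier_exp multiplier_prod multiplier_Gamma_ratio k s finite_atLeastAtMost iN zero_less_one)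
 then show "multiplier \<kappa> (%x. Gamma (1 + of_nat N * (of_real s * x)) / Gamma (1 + of_real s * x) ^ N)"
 proof (rule multiplier_cong)
  fix x :: complex assume "0 <= Re x"
  then have "0 <= Re (of_real s * x)" using s by simp
  from G [OF this] show "C * (exp (x * of_real c) * (\<Prod>i=1..N. Gamma (of_real (real i / real N) + of_real s * x) / Gamma (of_real 1 + of_real s * x))) =
   Gamma (1 + of_nat N * (of_real s * x)) / Gamma (1 + of_real s * x) ^ N"
   unfolding cx pr(1) [symmetric] by (simp add: add.commute mult.assoc)
 qed
 have "multiplier \<kappa> (%x. (1 / C) * (exp (x * of_real (- c)) * (\<Prod>i=1..N. Gamma (of_real 1 + of_real s * x) / Gamma (of_real (real i / real N) + of_real s * x))))"
  by (intro multiplier_mult multiplier_const multiplier_exp multiplier_prod multiplier_Gamma_ratio k s finite_atLeastAtMost iN zero_less_one)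
 then show "multiplier \<kappa> (%x. Gamma (1 + of_real s * x) ^ N / Gamma (1 + of_nat N * (of_real s * x)))"
 proof (rule multiplier_cong)
  fix x :: complex assume "0 <= Re x"
  then have "0 <= Re (of_real s * x)" using s by simp
  from G [OF this] show "(1 / C) * (exp (x * of_real (- c)) * (\<Prod>i=1..N. Gamma (of_real 1 + of_real s * x) / Gamma (of_real (real i / real N) + of_real s * x))) =
   Gamma (1 + of_real s * x) ^ N / Gamma (1 + of_nat N * (of_real s * x))"
   unfolding cx pr(2) [symmetric] by (simp add: add.commute exp_minus divide_inverse mult_ac)
 qed
qed

section \<open>The quotient of the two moment functions\<close>

lemma kappa_order_pos: "r > 1 ==> kappa_order p q r > 0"
proof -
 assume "r > 1"
 then have "0 < real p - 1 + real r" by linarith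
 then show ?thesis by (simp add: kappa_order_def divide_pos_pos)
qed

text \<open>With s = 1/(q+1) one has 1/\<kappa> = (p + r - 1) s, so both moments are made of Gamma
  at integer multiples of s x, the form that Gauss' formula treats.\<close>

lemma moments_as_multiples:
 fixes p q r :: nat
 assumes r: "r > 1"
 defines "s \<equiv> 1 / (real q + 1)"
 shows "gamma_moment (kappa_order p q r) x = Gamma (1 + of_nat (p + r - 1) * (of_real s * x))"
  and "0 <= Re x ==> moment_pqr p q r x = Gamma (1 + of_nat r * (of_real s * x)) * Gamma (1 + of_real s * x) powi (int p - 1)"
  and "0 <= Re x ==> Gamma (1 + of_real s * x) \<noteq> 0"
  and "0 <= Re x ==> Gamma (1 + of_nat n * (of_real s * x)) \<noteq> 0"
proof -
 have q: "of_real (1 / (real q + 1)) = (1 / (of_nat q + 1) :: complex)" by simp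
 have N: "of_nat (p + r - 1) = (of_nat p - 1 + of_nat r :: complex)" using r by (simp add: of_nat_diff)
 show "gamma_moment (kappa_order p q r) x = Gamma (1 + of_nat (p + r - 1) * (of_real s * x))"
 proof -
  have "x / of_real (kappa_order p q r) = of_nat (p + r - 1) * (of_real s * x)"
   unfolding kappa_order_def s_def N by simp
  then show ?thesis by (simp only: gamma_moment_def)
 qed
 show "0 <= Re x ==> moment_pqr p q r x = Gamma (1 + of_nat r * (of_real s * x)) * Gamma (1 + of_real s * x) powi (int p - 1)"
  unfolding moment_pqr_def s_def q times_divide_eq_left times_divide_eq_right mult_1_left by (rule refl)
 have "0 < Re (1 + of_nat n * (of_real s * x))" if "0 <= Re x" for n
  using that by (auto simp: s_def intro!: add_pos_nonneg)
 then show 4: "0 <= Re x ==> Gamma (1 + of_nat n * (of_real s * x)) \<noteq> 0" for n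
  using not_nonpos_Ints_Re by (auto simp: Gamma_eq_zero_iff)
 from 4 [of 1] show "0 <= Re x ==> Gamma (1 + of_real s * x) \<noteq> 0" by simp
qed

lemma moments_nonzero:
 assumes "r > 1" "0 <= Re x"
 shows "gamma_moment (kappa_order p q r) x \<noteq> 0" "moment_pqr p q r x \<noteq> 0"
 using moments_as_multiples(4) [OF assms(1) assms(2), where q = q] moments_as_multiples(3) [OF assms, where q = q]
 by (simp_all add: moments_as_multiples(1) [OF assms(1)] moments_as_multiples(2) [OF assms] power_int_not_zero)

text \<open>Up to multiples covered by Gauss' formula both moments are the same power Gamma (1 + s
  x)^N, N = p + r - 1. Inserting this power splits the quotient into two known multipliers, in
  either direction.\<close>

lemma multiplier_moment_ratio:
 fixes p q r :: nat
 assumes r: "r > 1"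
 defines "\<kappa> \<equiv> kappa_order p q r"
 shows "multiplier \<kappa> (%x. moment_pqr p q r x / gamma_moment \<kappa> x)"
  and "multiplier \<kappa> (%x. gamma_moment \<kappa> x / moment_pqr p q r x)"
proof -
 define s where "s = 1 / (real q + 1)"
 define N where "N = p + r - 1"
 have pos: "\<kappa> > 0" "s > 0" "N > 0" "r > 0" using r kappa_order_pos [OF r] by (auto simp: \<kappa>_def s_def N_def)
 note M = moments_as_multiples(1,2) [OF r, where p = p and q = q, folded s_def]
  moments_as_multiples(3) [OF r, where q = q, folded s_def]
 \<comment> \<open>For p = 0 the second exponent is -1, hence the integer power; the total is the
   natural number N in every case.\<close>
 have pw: "y ^ r * y powi (int p - 1) = y ^ N" if "y \<noteq> 0" for y :: complex
 proof -
  have "y ^ r * y powi (int p - 1) = y powi (int r + (int p - 1))"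
   using that by (simp add: power_int_add)
  also have "int r + (int p - 1) = int N" using r by (simp add: N_def)
  finally show ?thesis by simp
 qed
 have "multiplier \<kappa> (%x. (Gamma (1 + of_nat r * (of_real s * x)) / Gamma (1 + of_real s * x) ^ r) *
  (Gamma (1 + of_real s * x) ^ N / Gamma (1 + of_nat N * (of_real s * x))))"
  by (intro multiplier_mult multiplier_Gamma_multiple pos)
 then show "multiplier \<kappa> (%x. moment_pqr p q r x / gamma_moment \<kappa> x)"
 proof (rule multiplier_cong)
  fix x :: complex assume x: "0 <= Re x"
  show "(Gamma (1 + of_nat r * (of_real s * x)) / Gamma (1 + of_real s * x) ^ r) *
   (Gamma (1 + of_real s * x) ^ N / Gamma (1 + of_nat N * (of_real s * x))) = moment_pqr p q r x / gamma_moment \<kappa> x"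
   unfolding \<kappa>_def M(1) M(2) [OF x] N_def [symmetric] pw [OF M(3) [OF x], symmetric]
   using M(3) [OF x] by simp
 qed
 have "multiplier \<kappa> (%x. (Gamma (1 + of_nat N * (of_real s * x)) / Gamma (1 + of_real s * x) ^ N) *
  (Gamma (1 + of_real s * x) ^ r / Gamma (1 + of_nat r * (of_real s * x))))"
  by (intro multiplier_mult multiplier_Gamma_multiple pos)
 then show "multiplier \<kappa> (%x. gamma_moment \<kappa> x / moment_pqr p q r x)"
 proof (rule multiplier_cong)
  fix x :: complex assume x: "0 <= Re x"
  show "(Gamma (1 + of_nat N * (of_real s * x)) / Gamma (1 + of_real s * x) ^ N) *
   (Gamma (1 + of_real s * x) ^ r / Gamma (1 + of_nat r * (of_real s * x))) = gamma_moment \<kappa> x / moment_pqr p q r x"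
   unfolding \<kappa>_def M(1) M(2) [OF x] N_def [symmetric] pw [OF M(3) [OF x], symmetric]
   using M(3) [OF x] by simp
 qed
qed

section \<open>Uniqueness and decay of the kernel function\<close>

lemma kernel_function_fourier:
 assumes e: "is_kernel_function \<kappa> m e" and k: "\<kappa> > 0"
 shows "continuous_on UNIV (%y::real. e (of_real y))"
  and "integrable lborel (%y. iexp (\<sigma> * y) * e (of_real y))"
  and "(\<integral>y. iexp (\<sigma> * y) * e (of_real y) \<partial>lborel) = m (\<i> * of_real \<sigma>)"
proof -
 have hol: "e holomorphic_on sector 0 (pi / \<kappa>)" and pos: "\<And>x. x > 0 ==> e (ray_point 0 x) \<in> \<real> \<and> Re (e (ray_point 0 x)) > 0"
  and hi: "\<And>u. Re u \<ge> 0 ==> ((%x. of_real x powr (u - 1) * e (ray_point 0 x)) has_integral m u) {0<..}"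
  using e unfolding is_kernel_function_def by auto
 show c: "continuous_on UNIV (%y::real. e (of_real y))"
  by (rule continuous_on_compose2 [OF holomorphic_on_imp_continuous_on [OF hol]])
    (use k in \<open>auto simp: sector_def intro!: continuous_intros\<close>)
 have rp: "ray_point 0 x = of_real (ln x)" for x by (simp add: ray_point_def complex_eq_iff)
 have pw: "of_real x powr (u - 1) = exp (u * of_real (ln x)) / of_real x" if "x > 0" for x :: real and u :: complex
  using that by (simp add: powr_def Ln_of_real left_diff_distrib exp_diff exp_of_real)
 define g where "g \<sigma> y = iexp (\<sigma> * y) * e (of_real y)" for \<sigma> y :: real
 have gm: "g \<sigma> \<in> borel_measurable borel" for \<sigma>
  unfolding g_def [abs_def] by (intro borel_measurable_continuous_onI continuous_intros c)
 have hg: "((%x. g \<sigma> (ln x) / of_real x) has_integral m (\<i> * of_real \<sigma>)) {0<..}" for \<sigma>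
  by (rule has_integral_eq [OF _ hi [of "\<i> * of_real \<sigma>"]]) (simp_all add: g_def rp pw mult.assoc)
 \<comment> \<open>The moments are gauge integrals and need not converge absolutely a priori.
   Positivity of the kernel on the half-line makes the integrand for \<sigma> = 0 equal to the
   modulus of all the others, and it is integrable.\<close>
 have ai: "(%x. g \<sigma> (ln x) / of_real x) absolutely_integrable_on {0<..}" for \<sigma>
 proof (rule absolutely_integrable_integrable_bound)
  show "(%x. g \<sigma> (ln x) / of_real x) integrable_on {0<..}" using hg by blast
  have "(%x. g 0 (ln x) / of_real x) integrable_on {0<..}" using hg by blast
  from integrable_linear [OF this bounded_linear_Re] show "(%x. Re (g 0 (ln x) / of_real x)) integrable_on {0<..}"
   by (simp add: o_def)
  fix x :: real assume x: "x \<in> {0<..}"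
  have "e (of_real (ln x)) \<in> \<real>" "Re (e (of_real (ln x))) > 0" using pos [of x] x by (auto simp: rp)
  then have "norm (e (of_real (ln x))) = Re (e (of_real (ln x)))" by (simp add: cmod_eq_Re complex_is_Real_iff)
  then show "norm (g \<sigma> (ln x) / of_real x) <= Re (g 0 (ln x) / of_real x)"
   using x by (simp add: g_def norm_mult norm_divide Re_divide_of_real)
 qed
 show "integrable lborel (%y. iexp (\<sigma> * y) * e (of_real y))"
  using lborel_of_ray(1) [OF ai gm, of \<sigma>] unfolding g_def .
 show "(\<integral>y. iexp (\<sigma> * y) * e (of_real y) \<partial>lborel) = m (\<i> * of_real \<sigma>)"
  using lborel_of_ray(2) [OF ai gm, of \<sigma>] integral_unique [OF hg [of \<sigma>]] unfolding g_def by simp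
qed

text \<open>Equal Fourier transforms give equality on the real line, and the identity theorem
  extends it to the strip. In this way a kernel function inherits from E the decay at the
  origin.\<close>

lemma kernel_class_unique:
 assumes e: "is_kernel_function \<kappa> m e" and E: "kernel_class \<kappa> E (%\<sigma>. m (\<i> * of_real \<sigma>))" and k: "\<kappa> > 0"
 shows "w \<in> sector 0 (pi / \<kappa>) ==> e w = E w" and "kernel_class \<kappa> e (%\<sigma>. m (\<i> * of_real \<sigma>))"
proof -
 have Ed: "kernel_decay \<kappa> E" and Em: "\<And>\<sigma>. (\<integral>y. iexp (\<sigma> * y) * E (of_real y) \<partial>lborel) = m (\<i> * of_real \<sigma>)"
  using E by (auto simp: kernel_class_def)
 have eh: "e holomorphic_on sector 0 (pi / \<kappa>)" using e by (simp add: is_kernel_function_def)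
 have Eh: "E holomorphic_on sector 0 (pi / \<kappa>)" using Ed by (simp add: kernel_decay_def)
 note ie = kernel_function_fourier [OF e k] and iE = kernel_line(2,3) [OF Ed k]
 have re: "e (of_real x) - E (of_real x) = 0" for x :: real
 proof (rule fourier_unique [of "%x. e (of_real x) - E (of_real x)"])
  show "continuous_on UNIV (%x::real. e (of_real x) - E (of_real x))" by (intro continuous_intros ie(1) iE(1))
  show "integrable lborel (%x. e (of_real x) - E (of_real x))" using ie(2) [of 0] iE(2) [of 0] by simp
  show "(\<integral>x. iexp (\<sigma> * x) * (e (of_real x) - E (of_real x)) \<partial>lborel) = 0" for \<sigma>
  proof -
   have "(\<integral>x. iexp (\<sigma> * x) * (e (of_real x) - E (of_real x)) \<partial>lborel) = (\<integral>x. iexp (\<sigma> * x) * e (of_real x) - iexp (\<sigma> * x) * E (of_real x) \<partial>lborel)"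
    by (simp add: right_diff_distrib)
   also have "\<dots> = 0" using Bochner_Integration.integral_diff [OF ie(2) iE(2), of \<sigma>] ie(3) [of \<sigma>] Em [of \<sigma>] by simp
   finally show ?thesis .
  qed
 qed
 have eq: "e w = E w" if w: "w \<in> sector 0 (pi / \<kappa>)" for w
 proof -
  have z: "0 \<in> sector 0 (pi / \<kappa>)" using k by (simp add: sector_def)
  have "e w - E w = 0"
  proof (rule analytic_continuation [of "%w. e w - E w" "sector 0 (pi / \<kappa>)" "range complex_of_real" 0])
   show "connected (sector 0 (pi / \<kappa>))" by (rule convex_connected) simp
   show "range complex_of_real \<subseteq> sector 0 (pi / \<kappa>)" using k by (auto simp: sector_def)
   show "0 islimpt range complex_of_real"
    unfolding islimpt_approachable
   proof (intro allI impI)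
    fix e :: real assume "0 < e"
    then show "\<exists>x'\<in>range complex_of_real. x' \<noteq> 0 \<and> dist x' 0 < e"
     by (intro bexI [OF _ rangeI [of _ "e / 2"]]) auto
   qed
  qed (use z w re in \<open>auto intro!: holomorphic_intros eh Eh\<close>)
  then show ?thesis by simp
 qed
 then show "w \<in> sector 0 (pi / \<kappa>) ==> e w = E w" .
 have "kernel_decay \<kappa> e"
 proof (rule kernel_decayI [OF eh])
  fix \<delta> :: real assume d: "\<delta> > 0"
  obtain A B \<eta> where A: "A > 0" "B > 0" "\<eta> > 0"
   "\<And>w. \<bar>Im w\<bar> <= pi / \<kappa> / 2 - \<delta> ==> norm (E w) <= A * exp (- (\<eta> * \<bar>Re w\<bar>)) * exp (- (B * exp (\<kappa> * Re w)))"
   by (rule kernel_decayE [OF Ed d], rule that)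
  have "norm (e w) <= A * exp (- (\<eta> * \<bar>Re w\<bar>)) * exp (- (B * exp (\<kappa> * Re w)))" if "\<bar>Im w\<bar> <= pi / \<kappa> / 2 - \<delta>" for w
  proof -
   have "w \<in> sector 0 (pi / \<kappa>)" using that d by (simp add: sector_def)
   then show ?thesis using A(4) [OF that] eq by simp
  qed
  then show "\<exists>A>0. \<exists>B>0. \<exists>\<eta>>0. \<forall>w. \<bar>Im w\<bar> <= pi / \<kappa> / 2 - \<delta> -->
   norm (e w) <= A * exp (- (\<eta> * \<bar>Re w\<bar>)) * exp (- (B * exp (\<kappa> * Re w)))" using A(1-3) by blast
 qed
 then show "kernel_class \<kappa> e (%\<sigma>. m (\<i> * of_real \<sigma>))" using ie(3) by (simp add: kernel_class_def)
qed

text \<open>The starting point for all other kernels. With X = exp (\<kappa> Re w) the modulus is at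
  most \<kappa> X exp (- c X); the factor X gives the decay on the left, and half of the exponent is
  spent on the decay on the right.\<close>

lemma kernel_class_gamma_kernel:
 assumes k: "\<kappa> > 0"
 shows "kernel_class \<kappa> (gamma_kernel \<kappa>) (%\<sigma>. gamma_moment \<kappa> (\<i> * of_real \<sigma>))"
proof -
 have dec: "kernel_decay \<kappa> (gamma_kernel \<kappa>)"
 proof (rule kernel_decayI)
  show "gamma_kernel \<kappa> holomorphic_on sector 0 (pi / \<kappa>)"
   unfolding gamma_kernel_def by (intro holomorphic_intros)
  fix \<delta> :: real assume d: "\<delta> > 0"
  define c where "c = sin (min (\<kappa> * \<delta>) (pi / 2))"
  have c: "0 < c" unfolding c_def using k d by (intro sin_gt_zero) (auto simp: min_less_iff_disj)
  \<comment> \<open>X exp (- c X / 2) is at most X for X \<le> 1 and, by the quadratic term of exp,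
    at most (8 / c^2) / X for X \<ge> 1; both are below (8 / c^2 + 1) exp (- \<kappa> |Re
    w|).\<close>
  define A where "A = \<kappa> * (8 / c\<^sup>2 + 1)"
  have A: "A > 0" using k c by (auto simp: A_def intro!: mult_pos_pos add_pos_pos)
  have c2: "c / 2 > 0" using c by simp
  show "\<exists>A>0. \<exists>B>0. \<exists>\<eta>>0. \<forall>w. \<bar>Im w\<bar> <= pi / \<kappa> / 2 - \<delta> -->
   norm (gamma_kernel \<kappa> w) <= A * exp (- (\<eta> * \<bar>Re w\<bar>)) * exp (- (B * exp (\<kappa> * Re w)))"
  proof (rule exI, rule conjI, rule A, rule exI, rule conjI, rule c2, rule exI, rule conjI, rule k, intro allI impI)
   fix w assume w: "\<bar>Im w\<bar> <= pi / \<kappa> / 2 - \<delta>"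
   define X where "X = exp (\<kappa> * Re w)"
   have X: "0 < X" by (simp add: X_def)
   have "\<kappa> * \<bar>Im w\<bar> <= \<kappa> * (pi / \<kappa> / 2 - \<delta>)" using w k by (intro mult_left_mono) auto
   also have "\<dots> = pi / 2 - \<kappa> * \<delta>" using k by (simp add: field_simps)
   finally have 1: "\<kappa> * \<bar>Im w\<bar> <= pi / 2 - \<kappa> * \<delta>" .
   have 0: "0 <= \<kappa> * \<bar>Im w\<bar>" using k by simp
   with 1 have 2: "min (\<kappa> * \<delta>) (pi / 2) = \<kappa> * \<delta>" by linarith
   have "0 < \<kappa> * \<delta>" using k d by simp
   then have 3: "pi / 2 - \<kappa> * \<delta> <= pi" using pi_gt_zero by linarith
   have "c = cos (pi / 2 - \<kappa> * \<delta>)" unfolding c_def 2 by (simp add: cos_diff)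
   also have "\<dots> <= cos (\<kappa> * \<bar>Im w\<bar>)" using 1 0 3 by (intro cos_monotone_0_pi_le)
   also have "\<dots> = cos (\<kappa> * Im w)" by (cases "Im w \<ge> 0") auto
   finally have cc: "X * c <= X * cos (\<kappa> * Im w)" using X by simp
   have "norm (gamma_kernel \<kappa> w) = \<kappa> * X * exp (- (X * cos (\<kappa> * Im w)))"
    using k by (simp add: gamma_kernel_def norm_mult X_def Re_exp)
   also have "\<dots> <= \<kappa> * X * exp (- (X * c))" using k X cc by (simp add: mult_left_mono)
   also have "\<dots> = \<kappa> * (X * exp (- (c / 2 * X))) * exp (- (c / 2 * X))"
    by (simp add: exp_add [symmetric] mult.commute)
   also have "\<dots> <= \<kappa> * ((8 / c\<^sup>2 + 1) * exp (- (\<kappa> * \<bar>Re w\<bar>))) * exp (- (c / 2 * X))"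
   proof (intro mult_right_mono mult_left_mono)
    show "X * exp (- (c / 2 * X)) <= (8 / c\<^sup>2 + 1) * exp (- (\<kappa> * \<bar>Re w\<bar>))"
    proof (cases "Re w <= 0")
     case True
     then have "exp (- (\<kappa> * \<bar>Re w\<bar>)) = X" by (simp add: X_def)
     moreover have "X * exp (- (c / 2 * X)) <= X * 1" using X c by (intro mult_left_mono) auto
     moreover have "X * 1 <= X * (8 / c\<^sup>2 + 1)" using X c by (intro mult_left_mono) auto
     ultimately show ?thesis by (simp add: mult.commute)
    next
     case False
     then have e: "exp (- (\<kappa> * \<bar>Re w\<bar>)) = 1 / X" by (simp add: X_def exp_minus divide_inverse)
     have "(c / 2 * X)\<^sup>2 / 2 <= exp (c / 2 * X)"
     proof -
      have "1 + c / 2 * X + (c / 2 * X)\<^sup>2 / 2 <= exp (c / 2 * X)"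
       using exp_lower_Taylor_quadratic [of "c / 2 * X"] X c by simp
      moreover have "0 <= c / 2 * X" using X c by simp
      ultimately show ?thesis by linarith
     qed
     then have "X\<^sup>2 <= 8 / c\<^sup>2 * exp (c / 2 * X)" using c by (simp add: field_simps power2_eq_square)
     then have "X\<^sup>2 * exp (- (c / 2 * X)) <= 8 / c\<^sup>2 * exp (c / 2 * X) * exp (- (c / 2 * X))" by (intro mult_right_mono) auto
     also have "\<dots> = 8 / c\<^sup>2" by (simp add: exp_minus)
     also have "\<dots> <= 8 / c\<^sup>2 + 1" by simp
     finally have "X * (X * exp (- (c / 2 * X))) <= 8 / c\<^sup>2 + 1" by (simp add: power2_eq_square mult.assoc)
     then show ?thesis unfolding e using X by (simp add: le_divide_eq mult.commute)
    qed
   qed (use k in auto)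
   finally show "norm (gamma_kernel \<kappa> w) <= A * exp (- (\<kappa> * \<bar>Re w\<bar>)) * exp (- (c / 2 * exp (\<kappa> * Re w)))"
    by (simp add: A_def X_def mult.assoc)
  qed
 qed
 then show ?thesis
  using kernel_function_fourier(3) [OF is_kernel_function_gamma_kernel [OF k] k] by (simp add: kernel_class_def)
qed

section \<open>Borel continuation\<close>

lemma exp_powr: "exp (x::real) powr k = exp (k * x)"
 by (simp add: powr_def)

lemma growth_order_borel_growth:
 assumes "borel_growth \<kappa> K d \<epsilon> v"
 shows "growth_order \<kappa> K d \<epsilon> v"
 unfolding growth_order_def
proof (intro allI impI, elim conjE)
 fix d' \<alpha>' assume *: "d - \<epsilon> / 2 < d' - \<alpha>' / 2" "d' + \<alpha>' / 2 < d + \<epsilon> / 2"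
 define \<delta> where "\<delta> = min ((d' - \<alpha>' / 2) - (d - \<epsilon> / 2)) ((d + \<epsilon> / 2) - (d' + \<alpha>' / 2))"
 have dl: "\<delta> > 0" using * by (simp add: \<delta>_def)
 obtain C1 C2 where C: "C1 > 0" "C2 > 0"
  "\<And>w z. \<bar>Im w - d\<bar> <= \<epsilon> / 2 - \<delta> ==> z \<in> K ==> norm (v w z) <= C1 * exp (C2 * exp (\<kappa> * Re w))"
  by (rule borel_growthE [OF assms dl], rule that)
 have "norm (v w z) <= C1 * exp (C2 * exp (Re w) powr \<kappa>)" if "w \<in> sector d' \<alpha>'" "z \<in> K" for w z
 proof -
  have "\<delta> <= (d' - \<alpha>' / 2) - (d - \<epsilon> / 2)" "\<delta> <= (d + \<epsilon> / 2) - (d' + \<alpha>' / 2)" by (auto simp: \<delta>_def)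
  then have "\<bar>Im w - d\<bar> <= \<epsilon> / 2 - \<delta>" using that(1) by (simp add: sector_def abs_if split: if_splits)
  from C(3) [OF this that(2)] show ?thesis by (simp add: exp_powr)
 qed
 then show "\<exists>C1>0. \<exists>C2>0. \<forall>w\<in>sector d' \<alpha>'. \<forall>z\<in>K. norm (v w z) <= C1 * exp (C2 * exp (Re w) powr \<kappa>)"
  using C(1,2) by blast
qed

lemma borel_growth_growth_order:
 assumes "\<And>w. w \<in> sector d \<epsilon> ==> v w \<in> A_space K" "\<And>z. z \<in> K ==> (%w. v w z) holomorphic_on sector d \<epsilon>"
  and g: "growth_order \<kappa> K d \<epsilon> v"
 shows "borel_growth \<kappa> K d \<epsilon> v"
proof (rule borel_growthI)
 fix \<delta> :: real assume d: "\<delta> > 0"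
 have "d - \<epsilon> / 2 < d - (\<epsilon> - \<delta>) / 2 \<and> d + (\<epsilon> - \<delta>) / 2 < d + \<epsilon> / 2" using d by simp
 then obtain C1 C2 where C: "C1 > 0" "C2 > 0" "\<forall>w\<in>sector d (\<epsilon> - \<delta>). \<forall>z\<in>K. norm (v w z) <= C1 * exp (C2 * exp (Re w) powr \<kappa>)"
  using g unfolding growth_order_def by blast
 have "\<forall>w. \<bar>Im w - d\<bar> <= \<epsilon> / 2 - \<delta> --> (\<forall>z\<in>K. norm (v w z) <= C1 * exp (C2 * exp (\<kappa> * Re w)))"
 proof (intro allI impI ballI)
  fix w z assume w: "\<bar>Im w - d\<bar> <= \<epsilon> / 2 - \<delta>" and z: "z \<in> K"
  have "w \<in> sector d (\<epsilon> - \<delta>)" using w d by (simp add: sector_def)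
  then show "norm (v w z) <= C1 * exp (C2 * exp (\<kappa> * Re w))" using C(3) z by (simp add: exp_powr)
 qed
 then show "\<exists>C1>0. \<exists>C2>0. \<forall>w. \<bar>Im w - d\<bar> <= \<epsilon> / 2 - \<delta> --> (\<forall>z\<in>K. norm (v w z) <= C1 * exp (C2 * exp (\<kappa> * Re w)))"
  using C(1,2) by blast
qed (use assms in auto)

lemma borel_continuation_of_class:
 assumes v: "borel_class \<kappa> K d \<epsilon> v (%n z. fps_nth (f z) n / m (of_nat n))"
  and f: "\<And>n. (%z. fps_nth (f z) n) \<in> A_space K" and k: "\<kappa> > 0" and e: "\<epsilon> > 0"
 shows "borel_continuation \<kappa> m K f d \<epsilon> v"
proof -
 define c where "c n z = fps_nth (f z) n / m (of_nat n)" for n z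
 have vc: "borel_class \<kappa> K d \<epsilon> v c" using v by (simp add: c_def [abs_def])
 obtain \<rho> B where r: "\<rho> > 0" "B > 0" and cb: "\<And>n z. z \<in> K ==> norm (c n z) * \<rho> ^ n <= B"
  and sm: "\<And>w z. w \<in> sector d \<epsilon> ==> exp (Re w) < \<rho> ==> z \<in> K ==> (%n. c n z * exp (of_nat n * w)) sums v w z"
  by (rule borel_classE [OF vc], rule that)
 have vg: "borel_growth \<kappa> K d \<epsilon> v" and cA: "\<And>n. c n \<in> A_space K" using vc unfolding borel_class_def by auto
 have cf: "fps_nth (formal_borel m (f z)) n = c n z" for n z by (simp add: formal_borel_def c_def)
 \<comment> \<open>Half the radius turns the coefficient bound into a geometric majorant, uniform in
   z and t.\<close>
 have le: "norm (c n z * t ^ n) <= B * (1 / 2) ^ n" if z: "z \<in> K" and t: "norm t < \<rho> / 2" for n z t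
 proof -
  have "norm t ^ n <= (\<rho> / 2) ^ n" using t by (intro power_mono) auto
  then have "norm (c n z * t ^ n) <= norm (c n z) * (\<rho> / 2) ^ n"
   by (simp add: norm_mult norm_power mult_left_mono)
  also have "\<dots> = (norm (c n z) * \<rho> ^ n) * (1 / 2) ^ n" by (simp add: power_divide)
  also have "\<dots> <= B * (1 / 2) ^ n" using cb [OF z] by (intro mult_right_mono) auto
  finally show ?thesis .
 qed
 have sg: "summable (%n. B * (1 / 2) ^ n)" by (intro summable_mult summable_geometric) auto
 have ul: "uniform_limit K (%N z. \<Sum>n<N. c n z * t ^ n) (%z. \<Sum>n. c n z * t ^ n) sequentially" if t: "norm t < \<rho> / 2" for t
  by (rule Weierstrass_m_test [OF le [OF _ t] sg])
 define v0 where "v0 t z = (\<Sum>n. c n z * t ^ n)" for t z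
 have smb: "summable (%n. c n z * t ^ n)" if "z \<in> K" "norm t < \<rho> / 2" for z t
  by (rule summable_comparison_test' [OF sg]) (rule le [OF that])
 have hA: "holomorphic_A K v0 (ball 0 (\<rho> / 2))"
 proof (rule holomorphic_A_I)
  fix t :: complex assume t: "t \<in> ball 0 (\<rho> / 2)"
  then have t': "norm t < \<rho> / 2" by simp
  have co: "continuous_on K (%z. \<Sum>n<N. c n z * t ^ n)" "(%z. \<Sum>n<N. c n z * t ^ n) holomorphic_on interior K" for N
   using cA by (auto simp: A_space_def intro!: continuous_intros holomorphic_intros)
  have "continuous_on K (v0 t)" unfolding v0_def [abs_def]
   by (rule uniform_limit_theorem [OF _ ul [OF t']]) (use co in auto)
  moreover have "v0 t holomorphic_on interior K" unfolding v0_def [abs_def]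
  proof (rule holomorphic_uniform_sequence [OF open_interior co(2)])
   fix x assume "x \<in> interior K"
   then obtain e where e: "e > 0" "cball x e \<subseteq> interior K" using open_contains_cball by (metis open_interior)
   then show "\<exists>d>0. cball x d \<subseteq> interior K \<and> uniform_limit (cball x d) (%N z. \<Sum>n<N. c n z * t ^ n) (%z. \<Sum>n. c n z * t ^ n) sequentially"
    using uniform_limit_on_subset [OF ul [OF t']] interior_subset by (meson subset_trans)
  qed
  ultimately show "v0 t \<in> A_space K" by (simp add: A_space_def)
  show "\<exists>\<delta>>0. \<exists>B. \<forall>x\<in>ball t \<delta> \<inter> ball 0 (\<rho> / 2). \<forall>z\<in>K. norm (v0 x z) <= B"
  proof (rule exI [of _ 1], rule conjI, simp, rule exI [of _ "\<Sum>n. B * (1 / 2) ^ n"], intro ballI)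
   fix x z assume "x \<in> ball t 1 \<inter> ball 0 (\<rho> / 2)" "z \<in> K"
   then show "norm (v0 x z) <= (\<Sum>n. B * (1 / 2) ^ n)"
    unfolding v0_def by (intro norm_suminf_le [OF le sg]) auto
  qed
 next
  fix z assume z: "z \<in> K"
  show "(%t. v0 t z) holomorphic_on ball 0 (\<rho> / 2)"
  proof (rule holomorphic_onI)
   fix x :: complex assume x: "x \<in> ball 0 (\<rho> / 2)"
   have "((%t. v0 t z) has_field_derivative (\<Sum>n. diffs (%n. c n z) n * x ^ n)) (at x)"
    unfolding v0_def by (rule termdiffs_strong' [of "\<rho> / 2"]) (use x smb [OF z] in auto)
   then show "(%t. v0 t z) field_differentiable at x within ball 0 (\<rho> / 2)"
    using field_differentiable_at_within field_differentiable_def by blast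
  qed
 qed simp
 have ev: "eval_fps (formal_borel m (f z)) t = v0 t z" for z t by (simp add: eval_fps_def v0_def cf)
 have eqv: "v w z = v0 (exp w) z" if "w \<in> bounded_sector d \<epsilon> (\<rho> / 2)" "z \<in> K" for w z
 proof -
  have "(%n. c n z * exp (of_nat n * w)) sums v w z"
   using that r by (intro sm) (auto simp: bounded_sector_def)
  then show ?thesis by (simp add: v0_def exp_of_nat_mult sums_iff)
 qed
 have uc: "uniformly_convergent_on K (%N z. \<Sum>n<N. fps_nth (formal_borel m (f z)) n * t ^ n)" if "t \<in> ball 0 (\<rho> / 2)" for t
  using ul [of t] that unfolding cf by (auto simp: uniformly_convergent_on_def)
 have r2: "\<rho> / 2 > 0" using r by simp
 have "\<exists>\<rho>>0. holomorphic_A K v0 (ball 0 \<rho>) \<and> (\<forall>w\<in>bounded_sector d \<epsilon> \<rho>. \<forall>z\<in>K. v w z = v0 (exp w) z)"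
  using hA eqv r2 by blast
 then have 1: "disc_sector_space \<kappa> K d \<epsilon> v0 v"
  unfolding disc_sector_space_def
  using e borel_growth_holomorphic_A [OF vg k] growth_order_borel_growth [OF vg] by (intro conjI)
 have 2: "\<exists>\<rho>>0. \<forall>t\<in>ball 0 \<rho>. uniformly_convergent_on K (%N z. \<Sum>n<N. fps_nth (formal_borel m (f z)) n * t ^ n)"
  using uc r2 by blast
 have 3: "(%t z. eval_fps (formal_borel m (f z)) t) = v0" by (intro ext) (rule ev)
 show ?thesis
  unfolding borel_continuation_def 3 using f 1 2 by blast
qed

lemma borel_growth_of_disc_sector:
 assumes "disc_sector_space \<kappa> K d \<epsilon> v0 v"
 shows "borel_growth \<kappa> K d \<epsilon> v"
proof (rule borel_growth_growth_order)
 have h: "holomorphic_A K v (sector d \<epsilon>)" using assms by (simp add: disc_sector_space_def)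
 show "v w \<in> A_space K" if "w \<in> sector d \<epsilon>" for w using h that by (auto simp: holomorphic_A_def)
 show "(%w. v w z) holomorphic_on sector d \<epsilon>" if "z \<in> K" for z
  using holomorphic_A_deriv(2) [OF h _ that] field_differentiable_at_within by (auto simp: holomorphic_on_def)
 show "growth_order \<kappa> K d \<epsilon> v" using assms by (simp add: disc_sector_space_def)
qed

text \<open>The converse of \<open>borel_continuation_of_class\<close> at a single z, where the
  bound on the coefficients follows from convergence at one positive radius. It makes an assumed
  summability accessible to the inverse multiplier.\<close>

lemma class_of_borel_continuation:
 assumes b: "borel_continuation \<kappa> m {z} f d \<epsilon> v"
 shows "borel_class \<kappa> {z} d \<epsilon> v (%n z. fps_nth (f z) n / m (of_nat n))"
proof -
 define c where "c n z = fps_nth (f z) n / m (of_nat n)" for n z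
 have cf: "fps_nth (formal_borel m (f z)) n = c n z" for n z by (simp add: formal_borel_def c_def)
 have d: "disc_sector_space \<kappa> {z} d \<epsilon> (%t z. eval_fps (formal_borel m (f z)) t) v"
  using b by (simp add: borel_continuation_def)
 obtain \<rho>1 where r1: "\<rho>1 > 0" and uc: "\<forall>t\<in>ball 0 \<rho>1. uniformly_convergent_on {z} (%N z. \<Sum>n<N. fps_nth (formal_borel m (f z)) n * t ^ n)"
  using b unfolding borel_continuation_def by blast
 obtain \<rho>2 where r2: "\<rho>2 > 0" and eq: "\<forall>w\<in>bounded_sector d \<epsilon> \<rho>2. \<forall>z\<in>{z}. v w z = eval_fps (formal_borel m (f z)) (exp w)"
  using d unfolding disc_sector_space_def by blast
 have sm: "summable (%n. c n z * t ^ n)" if "norm t < \<rho>1" for t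
 proof -
  have "uniformly_convergent_on {z} (%N z. \<Sum>n<N. c n z * t ^ n)" using uc that by (simp add: cf)
  then obtain l where "uniform_limit {z} (%N z. \<Sum>n<N. c n z * t ^ n) l sequentially"
   unfolding uniformly_convergent_on_def by blast
  from tendsto_uniform_limitI [OF this, of z] show ?thesis by (auto simp: summable_def sums_def)
 qed
 define \<rho> where "\<rho> = min (\<rho>1 / 2) \<rho>2"
 have r: "\<rho> > 0" "\<rho> < \<rho>1" "\<rho> <= \<rho>2" using r1 r2 by (auto simp: \<rho>_def)
 have "summable (%n. c n z * of_real \<rho> ^ n)" by (rule sm) (use r in simp)
 then have "convergent (%n. c n z * of_real \<rho> ^ n)" using summable_LIMSEQ_zero convergentI by blast
 then have "Bseq (%n. c n z * of_real \<rho> ^ n)" by (rule convergent_imp_Bseq)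
 then obtain B where B: "B > 0" "\<And>n. norm (c n z * of_real \<rho> ^ n) <= B" by (rule BseqE) blast
 have "borel_class \<kappa> {z} d \<epsilon> v c"
 proof (rule borel_classI [OF borel_growth_of_disc_sector [OF d] _ r(1) B(1)])
  show "c n \<in> A_space {z}" for n by (simp add: A_space_def holomorphic_on_def)
  show "norm (c n y) * \<rho> ^ n <= B" if "y \<in> {z}" for n y
   using B(2) [of n] that r by (simp add: norm_mult norm_power)
  fix w y assume w: "w \<in> sector d \<epsilon>" "exp (Re w) < \<rho>" and y: "y \<in> {z}"
  have "v w z = eval_fps (formal_borel m (f z)) (exp w)" using eq w r by (auto simp: bounded_sector_def)
  moreover have "summable (%n. c n z * exp w ^ n)" by (rule sm) (use w r in simp)
  ultimately show "(%n. c n y * exp (of_nat n * w)) sums v w y"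
   using y by (simp add: eval_fps_def cf exp_of_nat_mult summable_sums)
 qed
 then show ?thesis by (simp add: c_def [abs_def])
qed

section \<open>Distance from the slit in the exponential coordinate\<close>

lemma cos_le_of_dist:
 assumes "\<And>k::int. \<delta> <= \<bar>y - 2 * pi * of_int k\<bar>" "0 <= \<delta>" "\<delta> <= pi"
 shows "cos y <= cos \<delta>"
proof -
 define k where "k = round (y / (2 * pi))"
 define y' where "y' = y - 2 * pi * of_int k"
 have "\<bar>of_int k - y / (2 * pi)\<bar> <= 1 / 2" unfolding k_def by (rule of_int_round_abs_le)
 then have "2 * pi * \<bar>of_int k - y / (2 * pi)\<bar> <= 2 * pi * (1 / 2)" by (intro mult_left_mono) auto
 moreover have "2 * pi * \<bar>of_int k - y / (2 * pi)\<bar> = \<bar>y'\<bar>"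
 proof -
  have "y' = 2 * pi * (y / (2 * pi) - of_int k)" by (simp add: y'_def right_diff_distrib)
  then show ?thesis by (simp add: abs_mult abs_minus_commute)
 qed
 ultimately have "\<bar>y'\<bar> <= pi" by simp
 moreover have "\<delta> <= \<bar>y'\<bar>" using assms(1) by (simp add: y'_def)
 ultimately have "cos \<bar>y'\<bar> <= cos \<delta>" using assms(2) by (intro cos_monotone_0_pi_le) auto
 moreover have "cos y = cos y'"
 proof -
  have "y = y' + 2 * pi * of_int k" by (simp add: y'_def)
  then show ?thesis by (metis cos_add cos_int_2pin sin_int_2pin mult.right_neutral mult_zero_right diff_zero)
 qed
 ultimately show ?thesis by simp
qed

text \<open>If Im \<zeta> stays \<delta> away from the multiples of 2 pi, exp \<zeta> avoids the
  cone of half-angle \<delta> about the positive axis, and sin \<delta> is the distance of 1 from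
  the line in direction \<delta>. In formulas: a square is completed in x = |exp \<zeta>|.\<close>

lemma norm_one_minus_exp_ge:
 assumes "\<And>k::int. \<delta> <= \<bar>Im \<zeta> - 2 * pi * of_int k\<bar>" "0 <= \<delta>" "\<delta> <= pi"
 shows "norm (1 - exp \<zeta>) \<ge> sin \<delta>"
proof -
 define x where "x = exp (Re \<zeta>)"
 have "(sin \<delta>)\<^sup>2 <= (norm (1 - exp \<zeta>))\<^sup>2"
 proof -
  have "(norm (1 - exp \<zeta>))\<^sup>2 = (1 - x * cos (Im \<zeta>))\<^sup>2 + (x * sin (Im \<zeta>))\<^sup>2"
   by (simp add: cmod_power2 Re_exp Im_exp x_def)
  also have "\<dots> = 1 - 2 * x * cos (Im \<zeta>) + x\<^sup>2 * ((sin (Im \<zeta>))\<^sup>2 + (cos (Im \<zeta>))\<^sup>2)" by algebra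
  also have "\<dots> = 1 - 2 * x * cos (Im \<zeta>) + x\<^sup>2" by (simp only: sin_cos_squared_add mult_1_right)
  also have "\<dots> \<ge> 1 - 2 * x * cos \<delta> + x\<^sup>2"
   using cos_le_of_dist [OF assms] by (simp add: x_def)
  also have "1 - 2 * x * cos \<delta> + x\<^sup>2 = (x - cos \<delta>)\<^sup>2 + (sin \<delta>)\<^sup>2"
   using sin_cos_squared_add [of \<delta>] by (simp add: power2_eq_square algebra_simps)
  finally show ?thesis by (smt (verit) zero_le_power2)
 qed
 then show ?thesis by (rule power2_le_imp_le) simp
qed

lemma one_minus_exp_notin_nonpos_Reals:
 assumes "\<And>k::int. Im \<zeta> \<noteq> 2 * pi * of_int k"
 shows "1 - exp \<zeta> \<notin> \<real>\<^sub>\<le>\<^sub>0"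
proof
 assume *: "1 - exp \<zeta> \<in> \<real>\<^sub>\<le>\<^sub>0"
 then have s: "sin (Im \<zeta>) = 0" and c: "1 <= exp (Re \<zeta>) * cos (Im \<zeta>)" by (auto simp: complex_nonpos_Reals_iff Re_exp Im_exp)
 then have "cos (Im \<zeta>) > 0" by (metis exp_gt_zero less_le_trans zero_less_mult_pos zero_less_one)
 moreover have "(cos (Im \<zeta>))\<^sup>2 = 1" using s sin_cos_squared_add [of "Im \<zeta>"] by simp
 ultimately have "cos (Im \<zeta>) = 1" by (simp add: power2_eq_1_iff)
 then obtain k :: int where "Im \<zeta> = of_int k * 2 * pi" using cos_one_2pi_int by auto
 then show False using assms [of k] by simp
qed

section \<open>The Borel transform of the formal solution\<close>

locale continuation =
 fixes p q r :: nat and a z0 :: complex and arga R0 :: real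
  and \<phi> :: "complex => complex" and u :: "complex => complex fps" and e :: "complex => complex"
  and \<Phi> :: "complex => complex" and w0 :: complex
 assumes r: "r > 1" and a0: "a \<noteq> 0" and arga: "a = rcis (norm a) arga" and z00: "z0 \<noteq> 0"
  and R0: "R0 > 0" and phi_hol: "\<phi> holomorphic_on ball 0 R0"
  and sol: "formal_solution p q r a \<phi> (ball 0 R0) u"
  and ker: "is_kernel_function (kappa_order p q r) (moment_pqr p q r) e"
  and Phi_hol: "\<Phi> holomorphic_on UNIV" and w0: "z0 + exp w0 = 0"
  and germ: "\<forall>\<^sub>F w in nhds w0. \<Phi> w = \<phi> (z0 + exp w)"
  and growth: "\<And>A B R. R > 0 ==> \<exists>C1>0. \<exists>C2>0. \<forall>w. A <= Im w \<and> Im w <= B \<and> exp (Re w) \<ge> R -->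
       norm (\<Phi> w) <= C1 * exp (C2 * norm (z0 + exp w) powr (real r / (real p - 1 + real r)))"
begin

definition "\<kappa> = kappa_order p q r"
definition "b = (real q + 1) / real r"
definition "c0 = norm a powr (1 / real r) * (real q + 1) powr ((real p - 1) / real r)"
text \<open>The point of the covering space over z + h reached from \<open>w0\<close> along the
  segment from 0 to z and then from z to z + h. Each principal logarithm lifts one segment; the cut
  of the second is the ray of points z + h hidden behind z0 as seen from z.\<close>

definition "Lam z h = w0 + Ln (1 - z / z0) + Ln (1 - h / (z0 - z))"
definition "Psi z h = \<Phi> (Lam z h)"
definition "r1 = min R0 (norm z0)"
definition "sd \<theta> l = singular_dir q r arga \<theta> l"
definition "sh j w = shift p q r a arga j w"
definition "V w z = (1 / of_nat r) * (\<Sum>j<r. Psi z (sh j w))"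

lemma pos: "\<kappa> > 0" "b > 0" "c0 > 0" "r1 > 0" "real r > 0" "r1 <= R0" "r1 <= norm z0"
 using r a0 R0 z00 kappa_order_pos [OF r] by (auto simp: \<kappa>_def b_def c0_def r1_def)

text \<open>Growth of order r/(p-1+r) in h, with |h| proportional to |s|^b, is growth of order
  \<kappa> in s.\<close>

lemma b_kappa: "b * (real r / (real p - 1 + real r)) = \<kappa>"
 using r by (simp add: b_def \<kappa>_def kappa_order_def)

lemma near_ne:
 assumes "norm z < norm z0" shows "z0 - z \<noteq> 0" "1 - z / z0 \<noteq> 0" "1 - z / z0 \<notin> \<real>\<^sub>\<le>\<^sub>0" "0 < Re (1 - z / z0)"
proof -
 have "norm (z / z0) < 1" using assms z00 by (simp add: norm_divide)
 then show 1: "0 < Re (1 - z / z0)" using complex_Re_le_cmod [of "z / z0"] by simp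
 then show "1 - z / z0 \<notin> \<real>\<^sub>\<le>\<^sub>0" "1 - z / z0 \<noteq> 0" by (auto simp: complex_nonpos_Reals_iff)
 show "z0 - z \<noteq> 0" using assms by auto
qed

lemma exp_Lam:
 assumes "norm z < norm z0" "1 - h / (z0 - z) \<noteq> 0"
 shows "z0 + exp (Lam z h) = z + h"
proof -
 have "exp w0 = - z0" using w0 by (simp add: add_eq_0_iff)
 then have "exp (Lam z h) = - z0 * (1 - z / z0) * (1 - h / (z0 - z))"
  using near_ne [OF assms(1)] assms(2) by (simp add: Lam_def exp_add)
 also have "- z0 * (1 - z / z0) = - (z0 - z)" using z00 by (simp add: field_simps)
 also have "- (z0 - z) * (1 - h / (z0 - z)) = z + h - z0" using near_ne(1) [OF assms(1)] by (simp add: field_simps)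
 finally show ?thesis by simp
qed

lemma Phi_compose_hol: "f holomorphic_on S ==> (%x. \<Phi> (f x)) holomorphic_on S"
 using holomorphic_on_compose_gen [of f S \<Phi> UNIV] Phi_hol by (simp add: o_def)

lemma Psi_hol_h:
 assumes "norm z < norm z0"
 shows "Psi z holomorphic_on {h. 1 - h / (z0 - z) \<notin> \<real>\<^sub>\<le>\<^sub>0}"
proof -
 have "(%h. \<Phi> (w0 + Ln (1 - z / z0) + Ln (1 - h / (z0 - z)))) holomorphic_on {h. 1 - h / (z0 - z) \<notin> \<real>\<^sub>\<le>\<^sub>0}"
  by (intro Phi_compose_hol holomorphic_intros) (use near_ne [OF assms] in auto)
 then show ?thesis by (simp add: Psi_def [abs_def] Lam_def)
qed

lemma Psi_hol_z:
 shows "(%z. Psi z h) holomorphic_on {z. norm z < norm z0 \<and> 1 - h / (z0 - z) \<notin> \<real>\<^sub>\<le>\<^sub>0}"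
proof -
 have "(%z. \<Phi> (w0 + Ln (1 - z / z0) + Ln (1 - h / (z0 - z)))) holomorphic_on {z. norm z < norm z0 \<and> 1 - h / (z0 - z) \<notin> \<real>\<^sub>\<le>\<^sub>0}"
  by (intro Phi_compose_hol holomorphic_intros) (use near_ne z00 in auto)
 then show ?thesis by (simp add: Psi_def [abs_def] Lam_def)
qed

lemma F0_eq:
 assumes "norm x < r1"
 shows "\<Phi> (w0 + Ln (1 - x / z0)) = \<phi> x"
proof -
 define F where "F x = \<Phi> (w0 + Ln (1 - x / z0))" for x
 have sub: "norm x < norm z0" "norm x < R0" if "norm x < r1" for x :: complex using that pos by auto
 have Fh: "F holomorphic_on ball 0 r1"
  unfolding F_def by (intro Phi_compose_hol holomorphic_intros) (use near_ne sub z00 in auto)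
 have ph: "\<phi> holomorphic_on ball 0 r1" by (rule holomorphic_on_subset [OF phi_hol]) (use pos in auto)
 have tends: "((%x. w0 + Ln (1 - x / z0)) \<longlongrightarrow> w0) (nhds 0)"
 proof -
  have "isCont (%x. w0 + Ln (1 - x / z0)) 0" by (intro continuous_intros) (use z00 in auto)
  then show ?thesis
   using tendsto_at_iff_tendsto_nhds [of "%x. w0 + Ln (1 - x / z0)" 0] by (simp add: isCont_def)
 qed
 have "\<forall>\<^sub>F x in nhds 0. \<Phi> (w0 + Ln (1 - x / z0)) = \<phi> (z0 + exp (w0 + Ln (1 - x / z0)))"
  by (rule eventually_compose_filterlim [OF germ tends])
 moreover have "\<forall>\<^sub>F x in nhds 0. x \<in> ball 0 r1" using pos by (intro eventually_nhds_in_open) auto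
 ultimately have "\<forall>\<^sub>F x in nhds 0. F x = \<phi> x"
 proof eventually_elim
  case (elim x)
  have "z0 + exp (w0 + Ln (1 - x / z0)) = x"
   using exp_Lam [of x 0] elim(2) sub(1) [of x] by (simp add: Lam_def)
  then show ?case using elim(1) by (simp add: F_def)
 qed
 then obtain S where S: "open S" "0 \<in> S" "\<And>x. x \<in> S ==> F x = \<phi> x" unfolding eventually_nhds by blast
 have "F x = \<phi> x"
 proof (rule analytic_continuation_open [of "S \<inter> ball 0 r1" "ball 0 r1" F \<phi> x])
  show "S \<inter> ball 0 r1 \<noteq> {}" using S pos by auto
 qed (use S assms Fh ph in auto)
 then show ?thesis by (simp add: F_def)
qed

text \<open>Both logarithms in \<open>Lam\<close> have arguments in the right half-plane, so they
  add up to one principal logarithm of 1 - (z + h)/z0, where \<Phi> is \<phi>.\<close>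

lemma Psi_near:
 assumes z: "norm z < norm z0" and h: "norm h < norm (z0 - z)" and zh: "norm (z + h) < r1"
 shows "Psi z h = \<phi> (z + h)"
proof -
 have n: "norm (h / (z0 - z)) < 1" using h near_ne(1) [OF z] by (simp add: norm_divide)
 then have re: "0 < Re (1 - h / (z0 - z))" using complex_Re_le_cmod [of "h / (z0 - z)"] by simp
 have nz: "1 - h / (z0 - z) \<noteq> 0" using n by auto
 have "Ln (1 - z / z0) + Ln (1 - h / (z0 - z)) = Ln ((1 - z / z0) * (1 - h / (z0 - z)))"
 proof (rule Ln_times_simple [symmetric])
  have "\<bar>Im (Ln (1 - h / (z0 - z)))\<bar> < pi / 2" using Re_Ln_pos_lt [of "1 - h / (z0 - z)"] re nz by simp
  moreover have "\<bar>Im (Ln (1 - z / z0))\<bar> < pi / 2" using Re_Ln_pos_lt [of "1 - z / z0"] near_ne [OF z] by simp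
  ultimately show "- pi < Im (Ln (1 - z / z0)) + Im (Ln (1 - h / (z0 - z)))" "Im (Ln (1 - z / z0)) + Im (Ln (1 - h / (z0 - z))) <= pi" by linarith+
 qed (use near_ne [OF z] nz in auto)
 also have "(1 - z / z0) * (1 - h / (z0 - z)) = 1 - (z + h) / z0"
  using near_ne(1) [OF z] z00 by (simp add: divide_simps)
 finally show ?thesis using F0_eq [OF zh] by (simp add: Psi_def Lam_def add.assoc)
qed

lemma Phi_growth:
 assumes mu: "\<mu> > 0"
 shows "\<exists>C1>0. \<exists>C2>0. \<forall>w z h. A <= Im w --> Im w <= B --> \<mu> <= exp (Re w) --> z0 + exp w = z + h --> norm z <= norm z0 -->
  norm (\<Phi> w) <= C1 * exp (C2 * norm h powr (real r / (real p - 1 + real r)))"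
proof -
 define k where "k = real r / (real p - 1 + real r)"
 have k: "k > 0" using r by (simp add: k_def divide_pos_pos)
 from growth [OF mu, of A B, folded k_def]
 obtain C1 C2 where C: "C1 > 0" "C2 > 0" and bd: "\<And>w. A <= Im w ==> Im w <= B ==>
   \<mu> <= exp (Re w) ==> norm (\<Phi> w) <= C1 * exp (C2 * norm (z0 + exp w) powr k)" by blast
 define D where "D = C2 * 2 powr k"
 have D: "D > 0" using C by (simp add: D_def)
 define E where "E = C1 * exp (D * norm z0 powr k)"
 have E: "E > 0" using C by (simp add: E_def)
 have "norm (\<Phi> w) <= E * exp (D * norm h powr k)"
  if *: "A <= Im w" "Im w <= B" "\<mu> <= exp (Re w)" "z0 + exp w = z + h" "norm z <= norm z0" for w z h
 proof -
  have "norm (\<Phi> w) <= C1 * exp (C2 * norm (z + h) powr k)" using bd [OF *(1-3)] *(4) by simp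
  also have "norm (z + h) powr k <= 2 powr k * (norm z0 powr k + norm h powr k)"
  proof -
   have "norm (z + h) <= norm z0 + norm h" using norm_triangle_ineq [of z h] *(5) by simp
   also have "\<dots> <= 2 * max (norm z0) (norm h)" by simp
   finally have "norm (z + h) powr k <= (2 * max (norm z0) (norm h)) powr k" using k by (intro powr_mono2) auto
   also have "\<dots> = 2 powr k * max (norm z0) (norm h) powr k" by (simp add: powr_mult max_def)
   also have "\<dots> <= 2 powr k * (norm z0 powr k + norm h powr k)" by (intro mult_left_mono) (auto simp: max_def)
   finally show ?thesis .
  qed
  then have "C1 * exp (C2 * norm (z + h) powr k) <= C1 * exp (C2 * (2 powr k * (norm z0 powr k + norm h powr k)))"
   using C by simp
  also have "\<dots> = E * exp (D * norm h powr k)" by (simp add: E_def D_def distrib_left exp_add mult_ac)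
  finally show ?thesis .
 qed
 then show ?thesis unfolding k_def [symmetric] using D E by blast
qed

text \<open>The principal logarithms confine Im (Lam z h) to an interval of length 4 pi, and \<mu>
  keeps z + h away from z0 by at least \<mu> |z0| / 2: the two restrictions under which the growth
  of \<Phi> is assumed.\<close>

lemma Psi_growth:
 assumes mu: "\<mu> > 0"
 shows "\<exists>C1>0. \<exists>C2>0. \<forall>z h. norm z <= norm z0 / 2 --> \<mu> <= norm (1 - h / (z0 - z)) -->
  norm (Psi z h) <= C1 * exp (C2 * norm h powr (real r / (real p - 1 + real r)))"
proof -
 have "\<mu> * (norm z0 / 2) > 0" using mu z00 by simp
 from Phi_growth [OF this, of "Im w0 - 2 * pi" "Im w0 + 2 * pi"] obtain C1 C2 where C: "C1 > 0" "C2 > 0"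
  and bd: "\<forall>w z h. Im w0 - 2 * pi <= Im w --> Im w <= Im w0 + 2 * pi --> \<mu> * (norm z0 / 2) <= exp (Re w) -->
   z0 + exp w = z + h --> norm z <= norm z0 --> norm (\<Phi> w) <= C1 * exp (C2 * norm h powr (real r / (real p - 1 + real r)))"
  by (elim exE conjE) (rule that)
 have "norm (Psi z h) <= C1 * exp (C2 * norm h powr (real r / (real p - 1 + real r)))"
  if z: "norm z <= norm z0 / 2" and h: "\<mu> <= norm (1 - h / (z0 - z))" for z h
 proof -
  have z': "norm z < norm z0" using z z00 by (metis half_gt_zero_iff field_sum_of_halves less_add_same_cancel1 order_le_less_trans zero_less_norm_iff)
  have nz: "1 - h / (z0 - z) \<noteq> 0" using h mu by auto
  have eL: "exp (Lam z h) = z + h - z0" using exp_Lam [OF z' nz] by (simp add: algebra_simps)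
  have "\<bar>Im (Ln (1 - z / z0))\<bar> <= pi" "\<bar>Im (Ln (1 - h / (z0 - z)))\<bar> <= pi"
   using mpi_less_Im_Ln [of "1 - z / z0"] Im_Ln_le_pi [of "1 - z / z0"] mpi_less_Im_Ln [of "1 - h / (z0 - z)"] Im_Ln_le_pi [of "1 - h / (z0 - z)"]
    near_ne(2) [OF z'] nz by (auto simp: abs_le_iff)
  then have im: "Im w0 - 2 * pi <= Im (Lam z h)" "Im (Lam z h) <= Im w0 + 2 * pi" by (auto simp: Lam_def)
  have "norm z0 / 2 <= norm (z0 - z)" using norm_triangle_ineq2 [of z0 z] z by simp
  then have "\<mu> * (norm z0 / 2) <= norm (1 - h / (z0 - z)) * norm (z0 - z)" using h mu by (intro mult_mono) auto
  also have "\<dots> = norm ((1 - h / (z0 - z)) * (z0 - z))" by (rule norm_mult [symmetric])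
  also have "(1 - h / (z0 - z)) * (z0 - z) = - (z + h - z0)" using near_ne(1) [OF z'] by (simp add: field_simps)
  also have "norm (- (z + h - z0)) = exp (Re (Lam z h))" by (simp only: norm_minus_cancel eL [symmetric] norm_exp_eq_Re)
  finally have R: "\<mu> * (norm z0 / 2) <= exp (Re (Lam z h))" .
  show ?thesis using bd [rule_format, OF im R exp_Lam [OF z' nz]] z' by (simp add: Psi_def)
 qed
 then show ?thesis using C by blast
qed

lemma sh_norm: "norm (sh j w) = c0 * exp (b * Re w)"
 using a0 by (simp add: sh_def shift_def norm_mult c0_def b_def)

lemma sh_0: "sh j w = cis (2 * pi * real j / real r) * sh 0 w"
 by (simp add: sh_def shift_def mult.assoc)

lemma sh_hol [holomorphic_intros]: "sh j holomorphic_on S"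
 unfolding sh_def [abs_def] shift_def by (intro holomorphic_intros)

text \<open>In the exponent on the right the singularity h = z0 - z is where exp equals 1, and the
  direction \<open>sd \<theta> j\<close> is where the imaginary part vanishes.\<close>

lemma sh_quotient:
 assumes th: "z0 - z = rcis (norm (z0 - z)) \<theta>" and z: "z0 - z \<noteq> 0"
 shows "sh j w / (z0 - z) = exp (of_real b * (w - \<i> * of_real (sd \<theta> (int j))) + of_real (ln (c0 / norm (z0 - z))))"
proof -
 define n where "n = norm (z0 - z)"
 have n: "n > 0" using z by (simp add: n_def)
 have bs: "b * sd \<theta> (int j) = \<theta> - (2 * pi * real j / real r + arga / real r)"
 proof -
  have "(Q / R) * (X / Q) = X / R" if "Q \<noteq> 0" for Q R X :: real using that by simp
  moreover have "real q + 1 \<noteq> 0" by simp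
  ultimately have "b * sd \<theta> (int j) = (real r * \<theta> - 2 * pi * real j - arga) / real r"
   unfolding b_def sd_def singular_dir_def by simp
  then show ?thesis using pos(5) by (simp add: diff_divide_distrib)
 qed
 have "of_real b * (w - \<i> * of_real (sd \<theta> (int j))) + of_real (ln (c0 / n)) =
   of_real b * w + \<i> * of_real (2 * pi * real j / real r) + \<i> * of_real (arga / real r) - \<i> * of_real \<theta> + of_real (ln (c0 / n))"
 proof -
  have "of_real b * (\<i> * of_real (sd \<theta> (int j))) = \<i> * of_real (b * sd \<theta> (int j))" by simp
  then show ?thesis unfolding right_diff_distrib bs by (simp add: algebra_simps)
 qed
 then have "exp (of_real b * (w - \<i> * of_real (sd \<theta> (int j))) + of_real (ln (c0 / n))) =
   exp (of_real b * w) * cis (2 * pi * real j / real r) * cis (arga / real r) / cis \<theta> * of_real (c0 / n)"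
 proof -
  have "exp (of_real (ln (c0 / n))) = (of_real (c0 / n) :: complex)" using n pos(3) by (simp add: exp_of_real)
  then show ?thesis unfolding \<open>of_real b * (w - \<i> * of_real (sd \<theta> (int j))) + of_real (ln (c0 / n)) = _\<close>
   by (simp add: exp_add exp_diff cis_conv_exp)
 qed
 also have "\<dots> = sh j w / (of_real n * cis \<theta>)"
  by (simp add: sh_def shift_def c0_def rcis_def b_def mult_ac)
 also have "of_real n * cis \<theta> = z0 - z" using th by (simp add: rcis_def n_def)
 finally show ?thesis by (simp add: n_def)
qed

text \<open>A branch of arg (z0 - z) that is continuous in z near 0 and starts at
  \<open>Arg z0\<close>; continuity is what makes the gap to the singular directions uniform in
  z.\<close>

definition "theta z = Arg z0 + Im (Ln (1 - z / z0))"

lemma theta_rcis: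
 assumes "norm z < norm z0" shows "z0 - z = rcis (norm (z0 - z)) (theta z)"
proof -
 have "z0 - z = z0 * (1 - z / z0)" using z00 by (simp add: field_simps)
 also have "\<dots> = rcis (norm z0) (Arg z0) * rcis (norm (1 - z / z0)) (Arg (1 - z / z0))" by (simp add: rcis_cmod_Arg)
 also have "\<dots> = rcis (norm (z0 * (1 - z / z0))) (theta z)"
  using near_ne(2) [OF assms] by (simp add: rcis_mult norm_mult theta_def Arg_eq_Im_Ln)
 also have "z0 * (1 - z / z0) = z0 - z" using z00 by (simp add: field_simps)
 finally show ?thesis .
qed

text \<open>The root of unity with index j depends on j modulo r only; this is the corresponding
  periodicity of its singular directions.\<close>

lemma sd_shift: "sd \<theta> (l - int r * k) = sd \<theta> l + 2 * pi * of_int k / b"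
proof -
 have "real r * \<theta> - 2 * pi * of_int (l - int r * k) - arga = (real r * \<theta> - 2 * pi * of_int l - arga) + 2 * pi * of_int k * real r"
  by (simp add: algebra_simps)
 then have "sd \<theta> (l - int r * k) = sd \<theta> l + 2 * pi * of_int k * real r / (real q + 1)"
  by (simp only: sd_def singular_dir_def add_divide_distrib)
 then show ?thesis by (simp add: b_def)
qed

end

section \<open>The formal solution and its Borel transform in closed form\<close>

lemma fps_nth_euler_power:
 "fps_nth (((%F. fps_deriv (fps_X * F)) ^^ p) F) n = of_nat (n + 1) ^ p * fps_nth F n" for F :: "complex fps"
proof -
 have 1: "fps_nth (fps_deriv (fps_X * H)) n = of_nat (n + 1) * fps_nth H n" for H :: "complex fps"
  unfolding fps_deriv_nth fps_X_mult_nth by simp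
 show ?thesis by (induction p) (simp_all only: funpow.simps o_apply id_apply 1 power_Suc power_0 mult.assoc mult_1_left)
qed

lemma sum_cis_powers:
 assumes r: "r > 0"
 shows "(\<Sum>j<r. cis (2 * pi * real j / real r) ^ k) = (if r dvd k then of_nat r else 0)"
proof -
 define x where "x = cis (2 * pi * real k / real r)"
 have xe: "x = exp (2 * of_real pi * \<i> * of_nat k / of_nat r)" by (simp add: x_def cis_conv_exp mult_ac)
 have x1: "x = 1 \<longleftrightarrow> r dvd k" unfolding xe by (rule complex_root_unity_eq_1) (use r in simp)
 have "cis (2 * pi * real j / real r) ^ k = x ^ j" for j
  by (simp add: x_def Complex.DeMoivre mult_ac)
 then have s: "(\<Sum>j<r. cis (2 * pi * real j / real r) ^ k) = (\<Sum>j<r. x ^ j)" by simp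
 show ?thesis
 proof (cases "r dvd k")
  case True
  then show ?thesis unfolding s using x1 by simp
 next
  case False
  have "x ^ r = cis (2 * pi * real k)" using r by (simp add: x_def Complex.DeMoivre)
  also have "\<dots> = 1" by (simp add: cis_multiple_2pi)
  finally show ?thesis unfolding s using x1 False by (simp add: geometric_sum)
 qed
qed

context continuation
begin

lemma recurrence:
 assumes z: "z \<in> ball 0 R0"
 shows "fps_nth (u z) 0 = \<phi> z"
  and "of_nat (Suc n) * fps_nth (u z) (Suc n) =
   a * (of_nat (Suc n) ^ p * (if n < q then 0 else (deriv ^^ r) (%x. fps_nth (u x) (n - q)) z))"
proof -
 have eq: "fps_deriv (u z) = fps_const a * ((%F. fps_deriv (fps_X * F)) ^^ p) (fps_X ^ q * fps_dz r u z)"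
  and "fps_nth (u z) 0 = \<phi> z" using sol z unfolding formal_solution_def by blast+
 then show "fps_nth (u z) 0 = \<phi> z" by simp
 from arg_cong [OF eq, of "%F. fps_nth F n"]
 show "of_nat (Suc n) * fps_nth (u z) (Suc n) =
   a * (of_nat (Suc n) ^ p * (if n < q then 0 else (deriv ^^ r) (%x. fps_nth (u x) (n - q)) z))"
  unfolding fps_deriv_nth fps_mult_left_const_nth fps_nth_euler_power fps_X_power_mult_nth fps_dz_def fps_nth_Abs_fps
  by (simp only: Suc_eq_plus1)
qed

text \<open>The solution of the recursion \<open>G_Suc\<close>: the j-th step, at degree (q+1) j,
  contributes a, the factor ((q+1) j)^p of the Euler operator and the division by (q+1) j from
  integrating in t.\<close>

definition "G m = a ^ m * (of_nat ((q + 1) ^ m * fact m)) powi (int p - 1)"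

lemma G_Suc: "G (Suc m) = a * (of_nat ((q + 1) * Suc m)) ^ p / of_nat ((q + 1) * Suc m) * G m"
proof -
 define x where "x = complex_of_nat ((q + 1) * Suc m)"
 have x: "x \<noteq> 0" unfolding x_def of_nat_eq_0_iff by simp
 have "complex_of_nat ((q + 1) ^ Suc m * fact (Suc m)) = x * of_nat ((q + 1) ^ m * fact m)"
  by (simp add: x_def algebra_simps)
 then have "G (Suc m) = a * x powi (int p - 1) * G m"
  unfolding G_def by (simp only: power_int_mult_distrib power_Suc mult_ac)
 also have "x powi (int p - 1) = x ^ p / x" using x by (simp add: power_int_diff)
 finally show ?thesis by (simp add: x_def)
qed

text \<open>The recurrence leads from degree n' to n' + q + 1 and applies r derivatives in z;
  started at degree 0, it reaches only multiples of q + 1.\<close>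

lemma solution_coeff:
 "z \<in> ball 0 R0 ==> fps_nth (u z) n = (if (q + 1) dvd n then G (n div (q + 1)) * (deriv ^^ (r * (n div (q + 1)))) \<phi> z else 0)"
proof (induction n arbitrary: z rule: less_induct)
 case (less n)
 show ?case
 proof (cases n)
  case 0
  then show ?thesis using recurrence(1) [OF less.prems] by (simp add: G_def)
 next
  case (Suc k)
  have nz: "complex_of_nat (Suc k) \<noteq> 0" unfolding of_nat_eq_0_iff by simp
  show ?thesis
  proof (cases "k < q")
   case True
   then have "\<not> (q + 1) dvd Suc k" by (auto dest: dvd_imp_le)
   moreover have "fps_nth (u z) (Suc k) = 0" using recurrence(2) [OF less.prems, of k] True nz by simp
   ultimately show ?thesis using Suc by simp
  next
   case False
   define n' where "n' = k - q"
   have n': "n' < n" "Suc k = n' + (q + 1)" using False Suc by (auto simp: n'_def)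
   have ev: "\<forall>\<^sub>F x in nhds z. x \<in> ball 0 R0" using less.prems by (intro eventually_nhds_in_open) auto
   have rec: "fps_nth (u z) (Suc k) = a * of_nat (Suc k) ^ p / of_nat (Suc k) * (deriv ^^ r) (%x. fps_nth (u x) n') z"
   proof -
    have "of_nat (Suc k) * fps_nth (u z) (Suc k) = a * of_nat (Suc k) ^ p * (deriv ^^ r) (%x. fps_nth (u x) n') z"
     using recurrence(2) [OF less.prems, of k] False by (simp add: n'_def mult.assoc)
    then show ?thesis using nz by (simp add: field_simps del: of_nat_Suc)
   qed
   show ?thesis
   proof (cases "(q + 1) dvd n'")
    case True
    then obtain m where m: "n' = (q + 1) * m" by (auto elim: dvdE)
    have Sk: "Suc k = (q + 1) * Suc m" using n' m by simp
    have "(deriv ^^ r) (%x. fps_nth (u x) n') z = (deriv ^^ r) (%x. G m * (deriv ^^ (r * m)) \<phi> x) z"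
    proof (rule higher_deriv_cong_ev [OF _ refl])
     show "\<forall>\<^sub>F x in nhds z. fps_nth (u x) n' = G m * (deriv ^^ (r * m)) \<phi> x"
      using ev
     proof eventually_elim
      case (elim x)
      have "n' div (q + 1) = m" unfolding m by (rule nonzero_mult_div_cancel_left) simp
      then show ?case using less.IH [OF n'(1) elim] True by simp
     qed
    qed
    also have "\<dots> = G m * (deriv ^^ r) ((deriv ^^ (r * m)) \<phi>) z"
     by (rule higher_deriv_cmult [where A = "ball 0 R0"]) (use less.prems phi_hol in \<open>auto intro!: holomorphic_higher_deriv\<close>)
    also have "(deriv ^^ r) ((deriv ^^ (r * m)) \<phi>) = (deriv ^^ (r * Suc m)) \<phi>" by (simp add: funpow_add)
    finally have "fps_nth (u z) (Suc k) = a * of_nat (Suc k) ^ p / of_nat (Suc k) * (G m * (deriv ^^ (r * Suc m)) \<phi> z)"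
     unfolding rec by simp
    also have "\<dots> = G (Suc m) * (deriv ^^ (r * Suc m)) \<phi> z" unfolding G_Suc Sk by (simp only: mult.assoc)
    moreover have "(q + 1) dvd n" "n div (q + 1) = Suc m" unfolding Suc Sk by (simp_all only: dvd_triv_left nonzero_mult_div_cancel_left)
    ultimately show ?thesis unfolding Suc by simp
   next
    case False
    have "(deriv ^^ r) (%x. fps_nth (u x) n') z = (deriv ^^ r) (%x. 0) z"
    proof (rule higher_deriv_cong_ev [OF _ refl])
     show "\<forall>\<^sub>F x in nhds z. fps_nth (u x) n' = 0"
      using ev
     proof eventually_elim
      case (elim x)
      then show ?case using less.IH [OF n'(1) elim] False by simp
     qed
    qed
    also have "\<dots> = 0" using r by (simp add: higher_deriv_const)
    finally have "fps_nth (u z) (Suc k) = 0" unfolding rec by simp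
    moreover have "\<not> (q + 1) dvd n"
    proof -
     have "n = n' + (q + 1)" using n' Suc by simp
     then show ?thesis using False dvd_add_left_iff [of "q + 1" "q + 1" n'] by simp
    qed
    ultimately show ?thesis unfolding Suc by simp
   qed
  qed
 qed
qed

text \<open>Powers with exponent r m remove all fractional exponents, so no branch of a^(1/r) or
  s^((q+1)/r) is left.\<close>

lemma sh_power: "sh 0 w ^ (r * m) = a ^ m * (of_nat ((q + 1) ^ m)) powi (int p - 1) * exp (of_nat ((q + 1) * m) * w)"
proof -
 have q: "real q + 1 > 0" by simp
 have "(rcis (norm a powr (1 / real r)) (arga / real r)) ^ r = rcis (norm a) arga"
 proof -
  have "(norm a powr (1 / real r)) ^ r = norm a" using a0 r by (simp add: powr_power)
  then show ?thesis using r by (simp add: DeMoivre2)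
 qed
 then have 1: "(rcis (norm a powr (1 / real r)) (arga / real r)) ^ r = a" using arga by simp
 have 2: "complex_of_real ((real q + 1) powr ((real p - 1) / real r)) ^ r = of_nat (q + 1) powi (int p - 1)"
 proof -
  have "((real q + 1) powr ((real p - 1) / real r)) ^ r = (real q + 1) powr (real p - 1)"
   using r q by (simp add: powr_power)
  also have "(real q + 1) powr (real p - 1) = (real q + 1) powi (int p - 1)"
   using powr_real_of_int' [of "real q + 1" "int p - 1"] q by simp
  finally have "((real q + 1) powr ((real p - 1) / real r)) ^ r = (real q + 1) powi (int p - 1)" .
  from arg_cong [OF this, of complex_of_real] show ?thesis by (simp add: add.commute)
 qed
 have 3: "exp (of_real ((real q + 1) / real r) * w) ^ r = exp (of_nat (q + 1) * w)"
 proof -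
  have "of_nat r * (complex_of_real ((real q + 1) / real r) * w) = of_nat (q + 1) * w" using r by (simp add: field_simps)
  then show ?thesis by (simp add: exp_of_nat_mult [symmetric])
 qed
 have "sh 0 w ^ r = a * of_nat (q + 1) powi (int p - 1) * exp (of_nat (q + 1) * w)"
  unfolding sh_def shift_def power_mult_distrib 1 2 3 by simp
 then have "sh 0 w ^ (r * m) = a ^ m * (of_nat (q + 1) powi (int p - 1)) ^ m * exp (of_nat (q + 1) * w) ^ m"
  by (simp only: power_mult power_mult_distrib)
 also have "(of_nat (q + 1) powi (int p - 1)) ^ m = (of_nat ((q + 1) ^ m) :: complex) powi (int p - 1)"
  by (simp only: of_nat_power power_int_power power_int_power' mult.commute)
 also have "exp (of_nat (q + 1) * w) ^ m = exp (of_nat ((q + 1) * m) * w)"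
  by (simp only: exp_of_nat_mult power_mult)
 finally show ?thesis .
qed

definition "c n z = fps_nth (u z) n / moment_pqr p q r (of_nat n)"

text \<open>At these degrees the Gamma factors are factorials. Dividing by the moment cancels
  (m!)^(p-1) in \<open>G\<close> and supplies the (r m)! of the Taylor coefficient of
  \<phi>.\<close>

lemma moment_at: "moment_pqr p q r (of_nat ((q + 1) * m)) = fact (r * m) * (of_nat (fact m)) powi (int p - 1)"
proof -
 have q: "complex_of_nat q + 1 \<noteq> 0" by (metis of_nat_Suc of_nat_eq_0_iff Suc_eq_plus1 nat.distinct(1) of_nat_1 of_nat_add)
 have 1: "of_nat r * of_nat ((q + 1) * m) / (of_nat q + 1) = (of_nat (r * m) :: complex)" using q by (simp add: field_simps)
 have 2: "of_nat ((q + 1) * m) / (of_nat q + 1) = (of_nat m :: complex)" using q by (simp add: field_simps)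
 show ?thesis unfolding moment_pqr_def 1 2 Gamma_fact by simp
qed

lemma c_eq:
 assumes "z \<in> ball 0 R0"
 shows "c ((q + 1) * m) z * exp (of_nat ((q + 1) * m) * w) = (deriv ^^ (r * m)) \<phi> z / fact (r * m) * sh 0 w ^ (r * m)"
  and "\<not> (q + 1) dvd n ==> c n z = 0"
proof -
 have nz: "(of_nat (fact m)) powi (int p - 1) \<noteq> (0 :: complex)" by (simp add: power_int_not_zero)
 have "fps_nth (u z) ((q + 1) * m) = G m * (deriv ^^ (r * m)) \<phi> z"
  unfolding solution_coeff [OF assms] by (simp only: dvd_triv_left nonzero_mult_div_cancel_left if_True)
 then have "c ((q + 1) * m) z = a ^ m * (of_nat ((q + 1) ^ m)) powi (int p - 1) * ((deriv ^^ (r * m)) \<phi> z / fact (r * m))"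
  unfolding c_def moment_at G_def of_nat_mult [of _ "fact m"] power_int_mult_distrib using nz by simp
 then show "c ((q + 1) * m) z * exp (of_nat ((q + 1) * m) * w) = (deriv ^^ (r * m)) \<phi> z / fact (r * m) * sh 0 w ^ (r * m)"
  unfolding sh_power by (simp only: mult_ac)
 show "\<not> (q + 1) dvd n ==> c n z = 0" unfolding c_def solution_coeff [OF assms] by simp
qed

text \<open>The mean over the r-th roots of unity keeps exactly the terms of degree r m in the
  Taylor series of \<phi> at z. The bounds r1/4 for z and for the shift keep z + h where \<phi> is
  given and \<open>Psi_near\<close> applies.\<close>

lemma V_series:
 assumes z: "norm z <= r1 / 4" and w: "c0 * exp (b * Re w) < r1 / 4"
 shows "(%n. c n z * exp (of_nat n * w)) sums V w z"
proof -
 have p1: "r1 > 0" "r1 <= R0" "r1 <= norm z0" using pos by auto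
 have zR: "z \<in> ball 0 R0" using z p1 by simp
 have zn: "norm z < norm z0" using z p1 by simp
 have shn: "norm (sh j w) < r1 / 4" for j using w by (simp add: sh_norm)
 have hol: "\<phi> holomorphic_on ball z (r1 / 2)"
 proof (rule holomorphic_on_subset [OF phi_hol])
  show "ball z (r1 / 2) \<subseteq> ball 0 R0"
  proof
   fix x assume "x \<in> ball z (r1 / 2)"
   then show "x \<in> ball 0 R0" using z p1 norm_triangle_sub [of x z] by (simp add: dist_norm norm_minus_commute)
  qed
 qed
 define g where "g k = (deriv ^^ k) \<phi> z / fact k" for k
 have ser: "(%k. g k * sh j w ^ k) sums Psi z (sh j w)" for j
 proof -
  have "z + sh j w \<in> ball z (r1 / 2)" using shn [of j] p1 by (simp add: dist_norm)
  from holomorphic_power_series [OF hol this] have "(%k. g k * sh j w ^ k) sums \<phi> (z + sh j w)" by (simp add: g_def)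
  moreover have "Psi z (sh j w) = \<phi> (z + sh j w)"
  proof (rule Psi_near [OF zn])
   have "norm z0 - norm z <= norm (z0 - z)" by (rule norm_triangle_ineq2)
   then show "norm (sh j w) < norm (z0 - z)" using shn [of j] z p1 by simp
   show "norm (z + sh j w) < r1" using norm_triangle_ineq [of z "sh j w"] shn [of j] z p1 by simp
  qed
  ultimately show ?thesis by simp
 qed
 have "(%k. (1 / of_nat r) * (\<Sum>j<r. g k * sh j w ^ k)) sums V w z"
  unfolding V_def by (intro sums_mult sums_sum ser)
 moreover have "(1 / of_nat r) * (\<Sum>j<r. g k * sh j w ^ k) = (if r dvd k then g k * sh 0 w ^ k else 0)" for k
 proof -
  have "(\<Sum>j<r. g k * sh j w ^ k) = g k * sh 0 w ^ k * (\<Sum>j<r. cis (2 * pi * real j / real r) ^ k)"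
   by (subst sh_0) (simp add: power_mult_distrib sum_distrib_left mult_ac)
  also have "(\<Sum>j<r. cis (2 * pi * real j / real r) ^ k) = (if r dvd k then of_nat r else 0)"
   by (rule sum_cis_powers) (use r in simp)
  finally show ?thesis using r by simp
 qed
 ultimately have s: "(%k. if r dvd k then g k * sh 0 w ^ k else 0) sums V w z" by simp
 \<comment> \<open>Two sparse series: one lives on multiples of r, the other on multiples of q + 1.
   Both are compressed to the common index m.\<close>
 have "(%m. (%k. if r dvd k then g k * sh 0 w ^ k else 0) (r * m)) sums V w z"
  by (subst sums_mono_reindex) (use r s in \<open>auto simp: strict_mono_def elim!: dvdE\<close>)
 then have "(%m. (%n. c n z * exp (of_nat n * w)) ((q + 1) * m)) sums V w z"
  unfolding c_eq(1) [OF zR] by (simp add: g_def)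
 moreover have "(%m. (%n. c n z * exp (of_nat n * w)) ((q + 1) * m)) sums V w z \<longleftrightarrow> (%n. c n z * exp (of_nat n * w)) sums V w z"
 proof (rule sums_mono_reindex)
  show "strict_mono (%m. (q + 1) * m)" by (rule strict_monoI) (simp only: nat_mult_less_cancel1 add_gr_0 zero_less_one simp_thms)
  fix n assume "n \<notin> range (%m. (q + 1) * m)"
  then have "\<not> (q + 1) dvd n" by (auto elim!: dvdE)
  then show "c n z * exp (of_nat n * w) = 0" using c_eq(2) [OF zR] by simp
 qed
 ultimately show ?thesis by blast
qed

end

section \<open>Contours\<close>

lemma moment_laplace_eq:
 assumes "integrable lborel (%y. E (Complex y \<theta> - t) * v (Complex y \<theta>))"
 shows "moment_laplace_converges E \<theta> v t" and "moment_laplace E \<theta> v t = laplace_log E \<theta> v t"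
proof -
 define g where "g y = E (Complex y \<theta> - t) * v (Complex y \<theta>)" for y
 have i: "integrable lborel g" using assms by (simp add: g_def [abs_def])
 have eq: "E (ray_point \<theta> x - t) * v (ray_point \<theta> x) / exp (ray_point \<theta> x) * cis \<theta> = g (ln x) / of_real x" if "x \<in> {0<..}" for x
 proof -
  have "exp (ray_point \<theta> x) = of_real x * cis \<theta>" using that by (simp add: ray_point_def complex_eq_iff Re_exp Im_exp)
  then show ?thesis using that by (simp add: g_def ray_point_def)
 qed
 have c: "(%x. E (ray_point \<theta> x - t) * v (ray_point \<theta> x) / exp (ray_point \<theta> x) * cis \<theta>) absolutely_integrable_on {0<..} \<longleftrightarrow>
   (%x. g (ln x) / of_real x) absolutely_integrable_on {0<..}"
  by (rule set_integrable_cong) (use eq in auto)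
 then show "moment_laplace_converges E \<theta> v t"
  unfolding moment_laplace_converges_def ray_integrable_def using ray_of_lborel(1) [OF i] by simp
 have "integral {0<..} (%x. E (ray_point \<theta> x - t) * v (ray_point \<theta> x) / exp (ray_point \<theta> x) * cis \<theta>) = integral {0<..} (%x. g (ln x) / of_real x)"
  by (rule Henstock_Kurzweil_Integration.integral_cong) (rule eq)
 then show "moment_laplace E \<theta> v t = laplace_log E \<theta> v t"
  unfolding moment_laplace_def ray_integral_def laplace_log_def using ray_of_lborel(2) [OF i] by (simp add: g_def)
qed

text \<open>The reflection w \<mapsto> -w reduces this end to \<open>strip_far\<close>; the sign of
  the primitive changes with the orientation.\<close>

lemma strip_near:
 fixes g G :: "complex => complex"
 assumes G: "\<And>w. Re w <= X ==> c <= Im w ==> Im w <= d ==> (G has_field_derivative g w) (at w)"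
  and gc: "continuous_on {w. Re w <= X \<and> c <= Im w \<and> Im w <= d} g"
  and bd: "\<And>w. Re w <= X ==> c <= Im w ==> Im w <= d ==> norm (g w) <= C * exp (- (\<eta> * \<bar>Re w\<bar>))"
  and eta: "0 < \<eta>" and x: "c <= x" "x <= d" and x': "c <= x'" "x' <= d"
 shows "set_integrable lborel {..X} (%y. g (Complex y x))"
  and "(LINT y:{..X}|lborel. g (Complex y x)) - G (Complex X x) =
     (LINT y:{..X}|lborel. g (Complex y x')) - G (Complex X x')"
proof -
 define h where "h w = g (- w)" for w
 define H where "H w = - G (- w)" for w
 have cm: "- Complex y s = Complex (- y) (- s)" for y s by (simp add: complex_eq_iff)
 have D: "(H has_field_derivative h w) (at w)" if "- X <= Re w" "- d <= Im w" "Im w <= - c" for w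
 proof -
  have "(G has_field_derivative g (- w)) (at (- w))" by (rule G) (use that in auto)
  then have "((%w. G (- w)) has_field_derivative g (- w) * (- 1)) (at w)"
   by (rule DERIV_chain2) (auto intro!: derivative_eq_intros)
  from DERIV_minus [OF this] show ?thesis unfolding H_def h_def by simp
 qed
 have hc: "continuous_on {w. - X <= Re w \<and> - d <= Im w \<and> Im w <= - c} h"
  unfolding h_def by (rule continuous_on_compose2 [OF gc]) (auto intro!: continuous_intros)
 have hb: "norm (h w) <= C * exp (- (\<eta> * \<bar>Re w\<bar>))" if "- X <= Re w" "- d <= Im w" "Im w <= - c" for w
  using bd [of "- w"] that by (simp add: h_def)
 have ind: "indicator {- X..} y = indicator {..X} (- y)" for y :: real by (simp add: indicator_def)
 have si: "set_integrable lborel {- X..} (%y. h (Complex y (- s))) \<longleftrightarrow> set_integrable lborel {..X} (%y. g (Complex y s))" for s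
  using lborel_integrable_real_affine_iff [of "-1" "%y. indicator {..X} y *\<^sub>R g (Complex y s)" 0]
  by (simp add: set_integrable_def h_def cm ind)
 have li: "(LINT y:{- X..}|lborel. h (Complex y (- s))) = (LINT y:{..X}|lborel. g (Complex y s))" for s
  using lborel_integral_real_affine [of "-1" "%y. indicator {..X} y *\<^sub>R g (Complex y s)" 0]
  by (simp add: set_lebesgue_integral_def h_def cm ind)
 have mx: "- d <= - x" "- x <= - c" "- d <= - x'" "- x' <= - c" using x x' by auto
 show "set_integrable lborel {..X} (%y. g (Complex y x))"
  using strip_far(1) [OF D hc hb eta mx] unfolding si .
 from strip_far(2) [OF D hc hb eta mx]
 show "(LINT y:{..X}|lborel. g (Complex y x)) - G (Complex X x) =
     (LINT y:{..X}|lborel. g (Complex y x')) - G (Complex X x')"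
  unfolding li by (simp add: H_def cm)
qed

lemma split_line_integral:
 fixes f :: "real => complex"
 assumes "set_integrable lborel {..X} f" "set_integrable lborel {X..} f"
 shows "integrable lborel f" and "(\<integral>y. f y \<partial>lborel) = (LINT y:{..X}|lborel. f y) + (LINT y:{X..}|lborel. f y)"
proof -
 have "AE y in lborel. y \<noteq> X" by (rule AE_lborel_singleton)
 then have ae: "AE y in lborel. indicator {..X} y *\<^sub>R f y + indicator {X..} y *\<^sub>R f y = f y"
  by eventually_elim (auto simp: indicator_def)
 have s: "integrable lborel (%y. indicator {..X} y *\<^sub>R f y + indicator {X..} y *\<^sub>R f y)"
  using assms unfolding set_integrable_def by (rule Bochner_Integration.integrable_add)
 have fm: "f \<in> borel_measurable lborel"
 proof -
  have "(%y. indicator {..X} y *\<^sub>R f y + indicator {X<..} y *\<^sub>R f y) \<in> borel_measurable lborel"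
  proof (rule borel_measurable_add)
   show "(%y. indicator {..X} y *\<^sub>R f y) \<in> borel_measurable lborel" using assms(1) unfolding set_integrable_def by (rule borel_measurable_integrable)
   have "set_integrable lborel {X<..} f" by (rule set_integrable_subset [OF assms(2)]) auto
   then show "(%y. indicator {X<..} y *\<^sub>R f y) \<in> borel_measurable lborel" unfolding set_integrable_def by (rule borel_measurable_integrable)
  qed
  moreover have "indicator {..X} y *\<^sub>R f y + indicator {X<..} y *\<^sub>R f y = f y" for y by (simp add: indicator_def)
  ultimately show ?thesis by simp
 qed
 show "integrable lborel f" by (rule integrable_cong_AE_imp [OF s fm ae])
 have "(\<integral>y. f y \<partial>lborel) = (\<integral>y. indicator {..X} y *\<^sub>R f y + indicator {X..} y *\<^sub>R f y \<partial>lborel)"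
  by (rule integral_cong_AE) (use fm s ae in \<open>auto elim: AE_mp\<close>)
 also have "\<dots> = (LINT y:{..X}|lborel. f y) + (LINT y:{X..}|lborel. f y)"
  using assms unfolding set_integrable_def set_lebesgue_integral_def by (rule Bochner_Integration.integral_add)
 finally show "(\<integral>y. f y \<partial>lborel) = (LINT y:{..X}|lborel. f y) + (LINT y:{X..}|lborel. f y)" .
qed

text \<open>Parametrised over [0,1], so the orientation is right for \<theta>2 < \<theta>1 as
  well.\<close>

definition vertical_int :: "(complex => complex) => real => real => real => complex" where
 "vertical_int g X \<theta>1 \<theta>2 = (LINT x:{0..1}|lborel. \<i> * of_real (\<theta>2 - \<theta>1) * g (Complex X (\<theta>1 + x * (\<theta>2 - \<theta>1))))"

definition path_int :: "(complex => complex) => real => real => real => complex" where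
 "path_int g X \<theta>1 \<theta>2 = (LINT y:{..X}|lborel. g (Complex y \<theta>1)) + vertical_int g X \<theta>1 \<theta>2 + (LINT y:{X..}|lborel. g (Complex y \<theta>2))"

lemma vertical_int_primitive:
 assumes G: "\<And>s. min \<theta>1 \<theta>2 <= s ==> s <= max \<theta>1 \<theta>2 ==> (G has_field_derivative g (Complex X s)) (at (Complex X s))"
  and gc: "continuous_on {w. Re w = X \<and> min \<theta>1 \<theta>2 <= Im w \<and> Im w <= max \<theta>1 \<theta>2} g"
 shows "vertical_int g X \<theta>1 \<theta>2 = G (Complex X \<theta>2) - G (Complex X \<theta>1)"
proof -
 have rng: "min \<theta>1 \<theta>2 <= \<theta>1 + x * (\<theta>2 - \<theta>1)" "\<theta>1 + x * (\<theta>2 - \<theta>1) <= max \<theta>1 \<theta>2" if "x \<in> {0..1}" for x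
 proof -
  have "\<theta>1 + x * (\<theta>2 - \<theta>1) = (1 - x) * \<theta>1 + x * \<theta>2" by (simp add: algebra_simps)
  moreover have "(1 - x) * min \<theta>1 \<theta>2 + x * min \<theta>1 \<theta>2 <= (1 - x) * \<theta>1 + x * \<theta>2" using that by (intro add_mono mult_left_mono) auto
  moreover have "(1 - x) * \<theta>1 + x * \<theta>2 <= (1 - x) * max \<theta>1 \<theta>2 + x * max \<theta>1 \<theta>2" using that by (intro add_mono mult_left_mono) auto
  ultimately show "min \<theta>1 \<theta>2 <= \<theta>1 + x * (\<theta>2 - \<theta>1)" "\<theta>1 + x * (\<theta>2 - \<theta>1) <= max \<theta>1 \<theta>2" by (simp_all add: algebra_simps)
 qed
 have cont: "continuous_on {0..1} (%x. \<i> * of_real (\<theta>2 - \<theta>1) * g (Complex X (\<theta>1 + x * (\<theta>2 - \<theta>1))))"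
  by (intro continuous_intros continuous_on_compose2 [OF gc]) (use rng in \<open>auto simp: Complex_eq intro!: continuous_intros\<close>)
 have "vertical_int g X \<theta>1 \<theta>2 = integral {0..1} (%x. \<i> * of_real (\<theta>2 - \<theta>1) * g (Complex X (\<theta>1 + x * (\<theta>2 - \<theta>1))))"
  unfolding vertical_int_def
  by (rule set_borel_integral_eq_integral(2)) (rule borel_integrable_atLeastAtMost', rule cont)
 also have "\<dots> = G (Complex X (\<theta>1 + 1 * (\<theta>2 - \<theta>1))) - G (Complex X (\<theta>1 + 0 * (\<theta>2 - \<theta>1)))"
 proof (rule integral_unique, rule fundamental_theorem_of_calculus)
  fix x :: real assume x: "x \<in> {0..1}"
  have 1: "((%x. Complex X (\<theta>1 + x * (\<theta>2 - \<theta>1))) has_vector_derivative \<i> * of_real (\<theta>2 - \<theta>1)) (at x within {0..1})"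
   unfolding Complex_eq by (auto intro!: derivative_eq_intros simp: has_vector_derivative_def scaleR_conv_of_real algebra_simps)
  have 2: "(G has_field_derivative g (Complex X (\<theta>1 + x * (\<theta>2 - \<theta>1)))) (at (Complex X (\<theta>1 + x * (\<theta>2 - \<theta>1))) within (%x. Complex X (\<theta>1 + x * (\<theta>2 - \<theta>1))) ` {0..1})"
   by (rule has_field_derivative_at_within, rule G) (use rng [OF x] in auto)
  from field_vector_diff_chain_within [OF 1 2]
  show "((%x. G (Complex X (\<theta>1 + x * (\<theta>2 - \<theta>1)))) has_vector_derivative \<i> * of_real (\<theta>2 - \<theta>1) * g (Complex X (\<theta>1 + x * (\<theta>2 - \<theta>1)))) (at x within {0..1})"
   by (simp add: o_def)
 qed simp
 finally show ?thesis by simp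
qed

text \<open>The contour comes in along direction \<open>\<theta>1\<close> up to abscissa \<open>X\<close> and goes out along direction
 \<open>\<theta>2\<close>; it may be moved inside the two convex pieces of the domain of holomorphy.\<close>

lemma path_int_independent:
 fixes g :: "complex => complex"
 assumes g: "g holomorphic_on {w. a1 < Im w \<and> Im w < b1} \<union> {w. X0 < Re w \<and> a2 < Im w \<and> Im w < b2}"
  and I: "a2 <= a1" "b1 <= b2" "X0 < X"
  and th1: "a1 < \<theta>1" "\<theta>1 < b1" "a1 < \<theta>1'" "\<theta>1' < b1"
  and th2: "a2 < \<theta>2" "\<theta>2 < b2" "a2 < \<theta>2'" "\<theta>2' < b2"
  and near: "\<And>w. Re w <= X ==> min \<theta>1 \<theta>1' <= Im w ==> Im w <= max \<theta>1 \<theta>1' ==> norm (g w) <= C * exp (- (\<eta> * \<bar>Re w\<bar>))"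
  and far: "\<And>w. X <= Re w ==> min \<theta>2 \<theta>2' <= Im w ==> Im w <= max \<theta>2 \<theta>2' ==> norm (g w) <= C' * exp (- (\<eta>' * \<bar>Re w\<bar>))"
  and eta: "0 < \<eta>" "0 < \<eta>'"
 shows "path_int g X \<theta>1 \<theta>2 = path_int g X \<theta>1' \<theta>2'"
  and "set_integrable lborel {..X} (%y. g (Complex y \<theta>1))" and "set_integrable lborel {X..} (%y. g (Complex y \<theta>2))"
proof -
 define A where "A = {w. a1 < Im w \<and> Im w < b1}"
 define B where "B = {w. X0 < Re w \<and> a2 < Im w \<and> Im w < b2}"
 have Ai: "A = {w. Im w > a1} \<inter> {w. Im w < b1}" and Bi: "B = {w. Re w > X0} \<inter> ({w. Im w > a2} \<inter> {w. Im w < b2})"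
  by (auto simp: A_def B_def)
 have A: "open A" "convex A" unfolding Ai by (intro open_Int open_halfspace_Im_lt open_halfspace_Im_gt convex_Int convex_halfspace_Im_lt convex_halfspace_Im_gt)+
 have B: "open B" "convex B" unfolding Bi
  by (intro open_Int open_halfspace_Im_lt open_halfspace_Im_gt open_halfspace_Re_gt convex_Int convex_halfspace_Im_lt convex_halfspace_Im_gt convex_halfspace_Re_gt)+
 have gA: "g holomorphic_on A" and gB: "g holomorphic_on B"
  using g unfolding A_def B_def by (auto elim: holomorphic_on_subset)
 obtain GA where GA0: "\<And>x. x \<in> A ==> (GA has_field_derivative g x) (at x within A)"
  using holomorphic_convex_primitive' [OF A(2,1) gA] by blast
 obtain GB where GB0: "\<And>x. x \<in> B ==> (GB has_field_derivative g x) (at x within B)"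
  using holomorphic_convex_primitive' [OF B(2,1) gB] by blast
 have GA: "(GA has_field_derivative g x) (at x)" if "x \<in> A" for x using GA0 [OF that] at_within_open [OF that A(1)] by simp
 have GB: "(GB has_field_derivative g x) (at x)" if "x \<in> B" for x using GB0 [OF that] at_within_open [OF that B(1)] by simp
 have inA: "w \<in> A" if "min \<theta>1 \<theta>1' <= Im w" "Im w <= max \<theta>1 \<theta>1'" for w using that th1 by (auto simp: A_def)
 have inB: "w \<in> B" if "X <= Re w" "min s s' <= Im w" "Im w <= max s s'" "a2 < s" "s < b2" "a2 < s'" "s' < b2" for w s s'
  using that I by (auto simp: B_def)
 have cA: "continuous_on A g" and cB: "continuous_on B g" using gA gB holomorphic_on_imp_continuous_on by auto
 have N: "set_integrable lborel {..X} (%y. g (Complex y \<theta>1))" "(LINT y:{..X}|lborel. g (Complex y \<theta>1)) - GA (Complex X \<theta>1) =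
     (LINT y:{..X}|lborel. g (Complex y \<theta>1')) - GA (Complex X \<theta>1')"
  by (rule strip_near [where c = "min \<theta>1 \<theta>1'" and d = "max \<theta>1 \<theta>1'" and G = GA and \<eta> = \<eta> and C = C],
    use GA inA near eta in \<open>auto intro!: continuous_on_subset [OF cA]\<close>)+
 have inB2: "w \<in> B" if "X <= Re w" "min \<theta>2 \<theta>2' <= Im w" "Im w <= max \<theta>2 \<theta>2'" for w
  by (rule inB [OF that th2])
 have F: "set_integrable lborel {X..} (%y. g (Complex y \<theta>2))" "(LINT y:{X..}|lborel. g (Complex y \<theta>2)) + GB (Complex X \<theta>2) =
     (LINT y:{X..}|lborel. g (Complex y \<theta>2')) + GB (Complex X \<theta>2')"
  by (rule strip_far [where c = "min \<theta>2 \<theta>2'" and d = "max \<theta>2 \<theta>2'" and G = GB and \<eta> = \<eta>' and C = C'],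
    use GB inB2 far eta in \<open>auto intro!: continuous_on_subset [OF cB]\<close>)+
 show "set_integrable lborel {..X} (%y. g (Complex y \<theta>1))" by (rule N(1))
 show "set_integrable lborel {X..} (%y. g (Complex y \<theta>2))" by (rule F(1))
 have V: "vertical_int g X s s' = GB (Complex X s') - GB (Complex X s)" if "a2 < s" "s < b2" "a2 < s'" "s' < b2" for s s'
 proof (rule vertical_int_primitive)
  have B': "w \<in> B" if "Re w = X" "min s s' <= Im w" "Im w <= max s s'" for w
   by (rule inB [OF _ that(2,3) \<open>a2 < s\<close> \<open>s < b2\<close> \<open>a2 < s'\<close> \<open>s' < b2\<close>]) (use that in simp)
  show "(GB has_field_derivative g (Complex X x)) (at (Complex X x))" if "min s s' <= x" "x <= max s s'" for x
   by (rule GB, rule B') (use that in auto)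
  show "continuous_on {w. Re w = X \<and> min s s' <= Im w \<and> Im w <= max s s'} g"
   by (rule continuous_on_subset [OF cB]) (use B' in auto)
 qed
 \<comment> \<open>The domain need not be convex, but each piece is and has a primitive; on their
   convex intersection, which contains both turning points at \<open>X\<close>, the two primitives
   differ by a constant.\<close>
 have "\<exists>k. \<forall>x\<in>A \<inter> B. GA x - GB x = k"
 proof (rule has_field_derivative_zero_constant)
  show "convex (A \<inter> B)" by (intro convex_Int A B)
  show "((%x. GA x - GB x) has_field_derivative 0) (at x within A \<inter> B)" if "x \<in> A \<inter> B" for x
  proof -
   have "(GA has_field_derivative g x) (at x)" "(GB has_field_derivative g x) (at x)" using that GA GB by auto
   from DERIV_diff [OF this] show ?thesis by (simp add: has_field_derivative_at_within)
  qed
 qed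
 moreover have "Complex X \<theta>1 \<in> A \<inter> B" "Complex X \<theta>1' \<in> A \<inter> B" using th1 I by (auto simp: A_def B_def)
 ultimately have k: "GA (Complex X \<theta>1) - GB (Complex X \<theta>1) = GA (Complex X \<theta>1') - GB (Complex X \<theta>1')" by metis
 have t1: "a2 < \<theta>1" "\<theta>1 < b2" "a2 < \<theta>1'" "\<theta>1' < b2" using th1 I by auto
 have "path_int g X \<theta>1 \<theta>2 = ((LINT y:{..X}|lborel. g (Complex y \<theta>1)) - GA (Complex X \<theta>1)) + (GA (Complex X \<theta>1) - GB (Complex X \<theta>1)) + ((LINT y:{X..}|lborel. g (Complex y \<theta>2)) + GB (Complex X \<theta>2))"
  unfolding path_int_def V [OF t1(1,2) th2(1,2)] by simp
 also have "\<dots> = ((LINT y:{..X}|lborel. g (Complex y \<theta>1')) - GA (Complex X \<theta>1')) + (GA (Complex X \<theta>1') - GB (Complex X \<theta>1')) + ((LINT y:{X..}|lborel. g (Complex y \<theta>2')) + GB (Complex X \<theta>2'))"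
  unfolding N(2) F(2) k by (rule refl)
 also have "\<dots> = path_int g X \<theta>1' \<theta>2'"
  unfolding path_int_def V [OF t1(3,4) th2(3,4)] by simp
 finally show "path_int g X \<theta>1 \<theta>2 = path_int g X \<theta>1' \<theta>2'" .
qed

lemma path_int_straight:
 assumes "set_integrable lborel {..X} (%y. g (Complex y \<theta>))" "set_integrable lborel {X..} (%y. g (Complex y \<theta>))"
 shows "path_int g X \<theta> \<theta> = (\<integral>y. g (Complex y \<theta>) \<partial>lborel)"
 using split_line_integral(2) [OF assms] by (simp add: path_int_def vertical_int_def)

section \<open>Change of the moment function\<close>

context continuation
begin

text \<open>One multiplier pair proves all the claims: \<open>Q\<close> of the Gamma kernel has the
  moments of \<open>e\<close> and so equals it, \<open>P V\<close> has the coefficients of the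
  Gamma-Borel transform of u, and adjointness identifies the two Laplace integrals.\<close>

lemma kernel: "kernel_class \<kappa> e (%\<sigma>. moment_pqr p q r (\<i> * of_real \<sigma>))" "kernel_decay \<kappa> e"
 and sum_exists: "\<And>K d \<epsilon>. borel_class \<kappa> K d \<epsilon> V c ==> K \<subseteq> ball 0 R0 ==> \<epsilon> > 0 ==>
  \<exists>v. borel_continuation \<kappa> (gamma_moment \<kappa>) K u d \<epsilon> v \<and> (\<forall>\<delta>>0. \<exists>T. \<forall>\<theta> t z. \<bar>\<theta> - d\<bar> <= \<epsilon> / 2 - \<delta> --> \<bar>\<theta> - Im t\<bar> <= pi / \<kappa> / 2 - \<delta> --> Re t < T -->
      z \<in> K --> moment_laplace_converges (gamma_kernel \<kappa>) \<theta> (%s. v s z) t \<and>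
       moment_laplace (gamma_kernel \<kappa>) \<theta> (%s. v s z) t = laplace_log e \<theta> (%s. V s z) t)"
proof -
 obtain P Q where PQ: "multiplier_pair \<kappa> (%x. moment_pqr p q r x / gamma_moment \<kappa> x) P Q"
  using multiplier_moment_ratio(1) [OF r, of p q] unfolding multiplier_def \<kappa>_def by blast
 define E where "E = Q (gamma_kernel \<kappa>)"
 have gk: "kernel_class \<kappa> (gamma_kernel \<kappa>) (%\<sigma>. gamma_moment \<kappa> (\<i> * of_real \<sigma>))" by (rule kernel_class_gamma_kernel [OF pos(1)])
 have gn: "gamma_moment \<kappa> x \<noteq> 0" if "0 <= Re x" for x using moments_nonzero(1) [OF r that, of p q] by (simp add: \<kappa>_def)
 have mn: "moment_pqr p q r x \<noteq> 0" if "0 <= Re x" for x by (rule moments_nonzero(2) [OF r that])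
 have Ek: "kernel_class \<kappa> E (%\<sigma>. moment_pqr p q r (\<i> * of_real \<sigma>))"
  using multiplier_pairD(2) [OF PQ gk] gn by (simp add: E_def)
 have ek: "is_kernel_function \<kappa> (moment_pqr p q r) e" using ker by (simp add: \<kappa>_def)
 show k: "kernel_class \<kappa> e (%\<sigma>. moment_pqr p q r (\<i> * of_real \<sigma>))" by (rule kernel_class_unique(2) [OF ek Ek pos(1)])
 then show "kernel_decay \<kappa> e" by (simp add: kernel_class_def)
 fix K d \<epsilon> assume v: "borel_class \<kappa> K d \<epsilon> V c" and K: "K \<subseteq> ball 0 R0" and ep: "\<epsilon> > 0"
 have "borel_class \<kappa> K d \<epsilon> (P V) (%n z. moment_pqr p q r (of_nat n) / gamma_moment \<kappa> (of_nat n) * c n z)"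
  by (rule multiplier_pairD(1) [OF PQ v])
 moreover have "moment_pqr p q r (of_nat n) / gamma_moment \<kappa> (of_nat n) * c n z = fps_nth (u z) n / gamma_moment \<kappa> (of_nat n)" for n z
  using mn [of "of_nat n"] by (simp add: c_def)
 ultimately have PV: "borel_class \<kappa> K d \<epsilon> (P V) (%n z. fps_nth (u z) n / gamma_moment \<kappa> (of_nat n))" by (simp only:)
 have uA: "(%z. fps_nth (u z) n) \<in> A_space K" for n
 proof -
  have "(%z. fps_nth (u z) n) holomorphic_on ball 0 R0" using sol by (simp add: formal_solution_def)
  then show ?thesis using K interior_subset unfolding A_space_def
   by (auto intro: holomorphic_on_imp_continuous_on holomorphic_on_subset)
 qed
 show "\<exists>v. borel_continuation \<kappa> (gamma_moment \<kappa>) K u d \<epsilon> v \<and> (\<forall>\<delta>>0. \<exists>T. \<forall>\<theta> t z. \<bar>\<theta> - d\<bar> <= \<epsilon> / 2 - \<delta> --> \<bar>\<theta> - Im t\<bar> <= pi / \<kappa> / 2 - \<delta> --> Re t < T -->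
      z \<in> K --> moment_laplace_converges (gamma_kernel \<kappa>) \<theta> (%s. v s z) t \<and>
       moment_laplace (gamma_kernel \<kappa>) \<theta> (%s. v s z) t = laplace_log e \<theta> (%s. V s z) t)"
 proof (rule exI [of _ "P V"], intro conjI allI impI)
  show "borel_continuation \<kappa> (gamma_moment \<kappa>) K u d \<epsilon> (P V)" by (rule borel_continuation_of_class [OF PV uA pos(1) ep])
  fix \<delta> :: real assume dl: "\<delta> > 0"
  obtain T1 where T1: "\<And>\<theta> t z. \<bar>\<theta> - d\<bar> <= \<epsilon> / 2 - \<delta> ==> \<bar>\<theta> - Im t\<bar> <= pi / \<kappa> / 2 - \<delta> ==> Re t < T1 ==>
      z \<in> K ==> laplace_log (gamma_kernel \<kappa>) \<theta> (%w. P V w z) t = laplace_log E \<theta> (%w. V w z) t"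
   using multiplier_pairD(3) [OF PQ v gk dl] unfolding E_def by blast
  have gd: "kernel_decay \<kappa> (gamma_kernel \<kappa>)" using gk by (simp add: kernel_class_def)
  have PVg: "borel_growth \<kappa> K d \<epsilon> (P V)" using PV by (simp add: borel_class_def)
  obtain T2 where T2: "\<And>\<theta> t z. \<bar>\<theta> - d\<bar> <= \<epsilon> / 2 - \<delta> ==> \<bar>\<theta> - Im t\<bar> <= pi / \<kappa> / 2 - \<delta> ==> Re t < T2 ==>
      z \<in> K ==> integrable lborel (%y. gamma_kernel \<kappa> (Complex y \<theta> - t) * P V (Complex y \<theta>) z)"
   using laplace_integrable [OF pos(1) gd PVg dl] by blast
  have "moment_laplace_converges (gamma_kernel \<kappa>) \<theta> (%s. P V s z) t \<and>
       moment_laplace (gamma_kernel \<kappa>) \<theta> (%s. P V s z) t = laplace_log e \<theta> (%s. V s z) t"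
   if *: "\<bar>\<theta> - d\<bar> <= \<epsilon> / 2 - \<delta>" "\<bar>\<theta> - Im t\<bar> <= pi / \<kappa> / 2 - \<delta>" "Re t < min T1 T2" "z \<in> K" for \<theta> t z
  proof -
   have i: "integrable lborel (%y. gamma_kernel \<kappa> (Complex y \<theta> - t) * P V (Complex y \<theta>) z)" by (rule T2) (use * in auto)
   have "laplace_log E \<theta> (%w. V w z) t = laplace_log e \<theta> (%w. V w z) t"
    unfolding laplace_log_def
   proof (rule Bochner_Integration.integral_cong [OF refl])
    fix y
    have "Complex y \<theta> - t \<in> sector 0 (pi / \<kappa>)" using * dl by (simp add: sector_def)
    then show "E (Complex y \<theta> - t) * V (Complex y \<theta>) z = e (Complex y \<theta> - t) * V (Complex y \<theta>) z"
     using kernel_class_unique(1) [OF ek Ek pos(1)] by simp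
   qed
   moreover have "laplace_log (gamma_kernel \<kappa>) \<theta> (%w. P V w z) t = laplace_log E \<theta> (%w. V w z) t" by (rule T1) (use * in auto)
   ultimately show ?thesis using moment_laplace_eq [OF i] by simp
  qed
  then show "\<exists>T. \<forall>\<theta> t z. \<bar>\<theta> - d\<bar> <= \<epsilon> / 2 - \<delta> --> \<bar>\<theta> - Im t\<bar> <= pi / \<kappa> / 2 - \<delta> --> Re t < T -->
      z \<in> K --> moment_laplace_converges (gamma_kernel \<kappa>) \<theta> (%s. P V s z) t \<and>
       moment_laplace (gamma_kernel \<kappa>) \<theta> (%s. P V s z) t = laplace_log e \<theta> (%s. V s z) t" by blast
 qed
qed

lemma is_sum_I:
 assumes v: "borel_class \<kappa> K d \<epsilon> V c" and K: "K \<subseteq> ball 0 R0" and ep: "\<epsilon> > 0"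
  and U: "\<And>\<delta>. \<delta> > 0 ==> \<exists>T. \<forall>\<theta> t z. \<bar>\<theta> - d\<bar> <= \<epsilon> / 2 - \<delta> --> \<bar>\<theta> - Im t\<bar> <= pi / \<kappa> / 2 - \<delta> --> Re t < T -->
      z \<in> K --> U t z = laplace_log e \<theta> (%s. V s z) t"
 shows "is_sum_in_direction \<kappa> K u d U"
proof -
 obtain v where v1: "borel_continuation \<kappa> (gamma_moment \<kappa>) K u d \<epsilon> v"
  and v2: "\<And>\<delta>. \<delta> > 0 ==> \<exists>T. \<forall>\<theta> t z. \<bar>\<theta> - d\<bar> <= \<epsilon> / 2 - \<delta> --> \<bar>\<theta> - Im t\<bar> <= pi / \<kappa> / 2 - \<delta> --> Re t < T -->
      z \<in> K --> moment_laplace_converges (gamma_kernel \<kappa>) \<theta> (%s. v s z) t \<and>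
       moment_laplace (gamma_kernel \<kappa>) \<theta> (%s. v s z) t = laplace_log e \<theta> (%s. V s z) t"
  using sum_exists [OF v K ep] by blast
 have "\<exists>\<rho>>0. \<forall>t\<in>bounded_sector \<theta> (pi / \<kappa> - \<eta>) \<rho>. \<forall>z\<in>K.
       moment_laplace_converges (gamma_kernel \<kappa>) \<theta> (%s. v s z) t \<and>
       U t z = moment_laplace (gamma_kernel \<kappa>) \<theta> (%s. v s z) t"
  if th: "d - \<epsilon> / 2 < \<theta>" "\<theta> < d + \<epsilon> / 2" and eta: "\<eta> > 0" for \<theta> \<eta>
 proof -
  define \<delta> where "\<delta> = min (\<epsilon> / 2 - \<bar>\<theta> - d\<bar>) (\<eta> / 2)"
  have "\<bar>\<theta> - d\<bar> < \<epsilon> / 2" using th by linarith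
  then have "\<delta> > 0" unfolding \<delta>_def min_less_iff_conj using eta by linarith
  moreover have "\<delta> <= \<epsilon> / 2 - \<bar>\<theta> - d\<bar>" unfolding \<delta>_def by (rule min.cobounded1)
  moreover have "\<delta> <= \<eta> / 2" unfolding \<delta>_def by (rule min.cobounded2)
  ultimately have dl: "\<delta> > 0" "\<delta> <= \<epsilon> / 2 - \<bar>\<theta> - d\<bar>" "\<delta> <= \<eta> / 2" .
  obtain T1 where T1: "\<forall>\<theta> t z. \<bar>\<theta> - d\<bar> <= \<epsilon> / 2 - \<delta> --> \<bar>\<theta> - Im t\<bar> <= pi / \<kappa> / 2 - \<delta> --> Re t < T1 -->
      z \<in> K --> U t z = laplace_log e \<theta> (%s. V s z) t" using U [OF dl(1)] by blast
  obtain T2 where T2: "\<forall>\<theta> t z. \<bar>\<theta> - d\<bar> <= \<epsilon> / 2 - \<delta> --> \<bar>\<theta> - Im t\<bar> <= pi / \<kappa> / 2 - \<delta> --> Re t < T2 -->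
      z \<in> K --> moment_laplace_converges (gamma_kernel \<kappa>) \<theta> (%s. v s z) t \<and>
       moment_laplace (gamma_kernel \<kappa>) \<theta> (%s. v s z) t = laplace_log e \<theta> (%s. V s z) t" using v2 [OF dl(1)] by blast
  show ?thesis
  proof (intro exI [of _ "exp (min T1 T2)"] conjI ballI)
   fix t z assume t: "t \<in> bounded_sector \<theta> (pi / \<kappa> - \<eta>) (exp (min T1 T2))" and z: "z \<in> K"
   have "\<bar>\<theta> - d\<bar> <= \<epsilon> / 2 - \<delta>" using dl by simp
   moreover have "\<bar>\<theta> - Im t\<bar> <= pi / \<kappa> / 2 - \<delta>"
   proof -
    have "\<bar>\<theta> - Im t\<bar> < (pi / \<kappa> - \<eta>) / 2" using t by (simp add: bounded_sector_def sector_def abs_minus_commute)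
    then show ?thesis using dl(3) unfolding diff_divide_distrib by linarith
   qed
   moreover have "Re t < T1" "Re t < T2" using t by (auto simp: bounded_sector_def)
   ultimately show "moment_laplace_converges (gamma_kernel \<kappa>) \<theta> (%s. v s z) t"
    "U t z = moment_laplace (gamma_kernel \<kappa>) \<theta> (%s. v s z) t" using T1 T2 z by simp_all
  qed simp
 qed
 then show ?thesis unfolding is_sum_in_direction_def using ep v1 by blast
qed

end

lemma borel_growth_sum:
 assumes "finite J" "\<And>j. j \<in> J ==> borel_growth \<kappa> K d \<epsilon> (f j)" "borel_growth \<kappa> K d \<epsilon> f0"
 shows "borel_growth \<kappa> K d \<epsilon> (%w z. x * (\<Sum>j\<in>J. f j w z))"
proof -
 have "borel_growth \<kappa> K d \<epsilon> (%w z. \<Sum>j\<in>J. f j w z)" using assms(1,2)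
 proof (induction J)
  case empty
  \<comment> \<open>The empty sum is written as 0 f0 + 0 f0, which is why one function of the class
    is assumed.\<close>
  show ?case using borel_growth_lin [OF assms(3) assms(3), of 0 0] by simp
 next
  case (insert j J)
  have "borel_growth \<kappa> K d \<epsilon> (%w z. 1 * f j w z + 1 * (\<Sum>j\<in>J. f j w z))"
   by (rule borel_growth_lin) (use insert in auto)
  then show ?case using insert by simp
 qed
 from borel_growth_lin [OF this this, of x 0] show ?thesis by simp
qed

context continuation
begin

text \<open>A gap \<delta> in direction is a gap b \<delta> in the imaginary part of the exponent of
  \<open>sh_quotient\<close>; index j - r k belongs to its value 2 pi k. The cap pi/2 keeps the
  angle in the range of \<open>norm_one_minus_exp_ge\<close>.\<close>

lemma slit_value:
 assumes z: "norm z < norm z0" and th: "z0 - z = rcis (norm (z0 - z)) \<theta>"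
  and gap: "\<And>k. \<delta> <= \<bar>Im w - sd \<theta> (int j - int r * k)\<bar>" and d: "0 < \<delta>"
 shows "1 - sh j w / (z0 - z) \<notin> \<real>\<^sub>\<le>\<^sub>0" and "sin (min (b * \<delta>) (pi / 2)) <= norm (1 - sh j w / (z0 - z))"
proof -
 define \<zeta> where "\<zeta> = of_real b * (w - \<i> * of_real (sd \<theta> (int j))) + of_real (ln (c0 / norm (z0 - z)))"
 have q: "sh j w / (z0 - z) = exp \<zeta>" unfolding \<zeta>_def by (rule sh_quotient [OF th near_ne(1) [OF z]])
 have im: "Im \<zeta> = b * (Im w - sd \<theta> (int j))" by (simp add: \<zeta>_def)
 have *: "b * \<delta> <= \<bar>Im \<zeta> - 2 * pi * of_int k\<bar>" for k :: int
 proof -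
  have "Im \<zeta> - 2 * pi * of_int k = b * (Im w - sd \<theta> (int j - int r * k))"
   unfolding im sd_shift using pos(2) by (simp add: algebra_simps)
  then show ?thesis using gap [of k] pos(2) by (simp add: abs_mult)
 qed
 have bd: "0 < b * \<delta>" using pos(2) d by simp
 have "Im \<zeta> \<noteq> 2 * pi * of_int k" for k :: int using * [of k] bd by auto
 then show "1 - sh j w / (z0 - z) \<notin> \<real>\<^sub>\<le>\<^sub>0" unfolding q by (rule one_minus_exp_notin_nonpos_Reals)
 show "sin (min (b * \<delta>) (pi / 2)) <= norm (1 - sh j w / (z0 - z))" unfolding q
 proof (rule norm_one_minus_exp_ge)
  show "min (b * \<delta>) (pi / 2) <= \<bar>Im \<zeta> - 2 * pi * of_int k\<bar>" for k :: int
   by (rule order_trans [OF min.cobounded1 *])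
  show "0 <= min (b * \<delta>) (pi / 2)" using bd by simp
  show "min (b * \<delta>) (pi / 2) <= pi" by (rule order_trans [OF min.cobounded2]) simp
 qed
qed

lemma norm_sh_powr: "norm (sh j w) powr (real r / (real p - 1 + real r)) = c0 powr (real r / (real p - 1 + real r)) * exp (\<kappa> * Re w)"
proof -
 define k where "k = real r / (real p - 1 + real r)"
 have "k * (b * Re w) = \<kappa> * Re w" using b_kappa unfolding k_def by (metis mult.assoc mult.commute)
 moreover have "(c0 * exp (b * Re w)) powr k = c0 powr k * exp (b * Re w) powr k"
  by (rule powr_mult)
 ultimately show ?thesis unfolding sh_norm k_def [symmetric] exp_powr by simp
qed

lemma Psi_sh_growth:
 assumes K: "\<And>z. z \<in> K ==> norm z <= r1 / 4"
  and th: "\<And>z. z \<in> K ==> z0 - z = rcis (norm (z0 - z)) (\<theta> z)"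
  and gap: "\<And>z k. z \<in> K ==> \<epsilon> / 2 <= \<bar>sd (\<theta> z) (int j - int r * k) - d\<bar>"
 shows "borel_growth \<kappa> K d \<epsilon> (%w z. Psi z (sh j w))"
proof (rule borel_growthI)
 have zn: "norm z < norm z0" "norm z <= norm z0 / 2" if "z \<in> K" for z using K [OF that] pos by linarith+
 have g: "\<delta> <= \<bar>Im w - sd (\<theta> z) (int j - int r * k)\<bar>" if "\<bar>Im w - d\<bar> <= \<epsilon> / 2 - \<delta>" "z \<in> K" for w z k \<delta>
  using gap [OF that(2), of k] that(1) by linarith
 have ns: "1 - sh j w / (z0 - z) \<notin> \<real>\<^sub>\<le>\<^sub>0" if "w \<in> sector d \<epsilon>" "z \<in> K" for w z
  by (rule slit_value(1) [OF zn(1) [OF that(2)] th [OF that(2)] g [OF _ that(2), where \<delta> = "\<epsilon> / 2 - \<bar>Im w - d\<bar>"]])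
   (use that in \<open>auto simp: sector_def\<close>)
 show "(%z. Psi z (sh j w)) \<in> A_space K" if w: "w \<in> sector d \<epsilon>" for w
 proof -
  have "(%z. Psi z (sh j w)) holomorphic_on K"
   by (rule holomorphic_on_subset [OF Psi_hol_z]) (use ns [OF w] zn in auto)
  then show ?thesis unfolding A_space_def
   by (auto intro: holomorphic_on_imp_continuous_on holomorphic_on_subset [OF _ interior_subset])
 qed
 show "(%w. Psi z (sh j w)) holomorphic_on sector d \<epsilon>" if z: "z \<in> K" for z
  by (rule holomorphic_on_compose_gen [OF sh_hol Psi_hol_h [OF zn(1) [OF z]], unfolded o_def]) (use ns [OF _ z] in auto)
 fix \<delta> :: real assume dl: "\<delta> > 0"
 have "sin (min (b * \<delta>) (pi / 2)) > 0" by (rule sin_gt_zero) (use pos dl pi_gt_zero in \<open>auto simp: min_less_iff_disj\<close>)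
 from Psi_growth [OF this] obtain C1 C2 where C: "C1 > 0" "C2 > 0"
  and bd: "\<And>z h. norm z <= norm z0 / 2 ==> sin (min (b * \<delta>) (pi / 2)) <= norm (1 - h / (z0 - z)) ==>
    norm (Psi z h) <= C1 * exp (C2 * norm h powr (real r / (real p - 1 + real r)))" by blast
 have "norm (Psi z (sh j w)) <= C1 * exp (C2 * c0 powr (real r / (real p - 1 + real r)) * exp (\<kappa> * Re w))"
  if "\<bar>Im w - d\<bar> <= \<epsilon> / 2 - \<delta>" "z \<in> K" for w z
  using bd [OF zn(2) [OF that(2)] slit_value(2) [OF zn(1) [OF that(2)] th [OF that(2)] g [OF that] dl]]
  by (simp add: norm_sh_powr mult.assoc)
 moreover have "C2 * c0 powr (real r / (real p - 1 + real r)) > 0" using C pos by simp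
 ultimately show "\<exists>C1>0. \<exists>C2>0. \<forall>w. \<bar>Im w - d\<bar> <= \<epsilon> / 2 - \<delta> --> (\<forall>z\<in>K. norm (Psi z (sh j w)) <= C1 * exp (C2 * exp (\<kappa> * Re w)))"
  using C by blast
qed

lemma coefficient_A_space: "K \<subseteq> ball 0 R0 ==> c n \<in> A_space K"
proof -
 assume K: "K \<subseteq> ball 0 R0"
 have "(%z. fps_nth (u z) n) holomorphic_on ball 0 R0" using sol by (simp add: formal_solution_def)
 moreover have "moment_pqr p q r (of_nat n) \<noteq> 0" using moments_nonzero(2) [OF r, of "of_nat n"] by simp
 ultimately have "c n holomorphic_on ball 0 R0" unfolding c_def [abs_def] by (intro holomorphic_intros)
 then show ?thesis using K interior_subset unfolding A_space_def
  by (auto intro: holomorphic_on_imp_continuous_on holomorphic_on_subset)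
qed

text \<open>The modulus of s at which the shift has modulus r1/4, the limit allowed by
  \<open>V_series\<close>.\<close>

definition "rho = (r1 / 4 / c0) powr (1 / b)"

lemma rho: "rho > 0" "exp (Re w) < rho ==> c0 * exp (b * Re w) < r1 / 4" "c0 * exp (b * ln rho) = r1 / 4"
proof -
 show p: "rho > 0" using pos by (simp add: rho_def)
 have "b * ln rho = ln (r1 / 4 / c0)" using pos by (simp add: rho_def ln_powr)
 then have "exp (b * ln rho) = r1 / 4 / c0" using pos by simp
 then show e: "c0 * exp (b * ln rho) = r1 / 4" using pos by simp
 assume "exp (Re w) < rho"
 then have "Re w < ln rho" using p by (metis exp_less_cancel_iff exp_ln)
 then have "c0 * exp (b * Re w) < c0 * exp (b * ln rho)" using pos by simp
 then show "c0 * exp (b * Re w) < r1 / 4" using e by simp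
qed

text \<open>At |s| = rho the terms are Taylor terms of \<phi> at z with increment of modulus r1/4,
  so Cauchy's inequality on that circle bounds them all by the maximum of |\<phi>| on the disc of
  radius r1/2.\<close>

lemma coefficient_bound: "\<exists>B>0. \<forall>n z. norm z <= r1 / 4 --> norm (c n z) * rho ^ n <= B"
proof -
 have p1: "r1 > 0" "r1 <= R0" using pos by auto
 have "continuous_on (cball 0 (r1 / 2)) \<phi>"
  by (rule continuous_on_subset [OF holomorphic_on_imp_continuous_on [OF phi_hol]]) (use p1 in auto)
 then have "bounded (\<phi> ` cball 0 (r1 / 2))" by (intro compact_imp_bounded compact_continuous_image) auto
 then obtain B where B: "B > 0" "\<forall>x\<in>cball 0 (r1 / 2). norm (\<phi> x) <= B" unfolding bounded_pos by auto
 have "norm (c n z) * rho ^ n <= B" if z: "norm z <= r1 / 4" for n z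
 proof (cases "(q + 1) dvd n")
  case True
  then obtain m where n: "n = (q + 1) * m" by (auto elim: dvdE)
  have zR: "z \<in> ball 0 R0" using z p1 by simp
  have sub: "cball z (r1 / 4) \<subseteq> cball 0 (r1 / 2)"
  proof
   fix x assume "x \<in> cball z (r1 / 4)"
   then show "x \<in> cball 0 (r1 / 2)" using norm_triangle_sub [of x z] z by (simp add: dist_norm norm_minus_commute)
  qed
  have "norm (c n z) * rho ^ n = norm (c n z * exp (of_nat n * of_real (ln rho)))"
   using rho(1) by (simp add: norm_mult exp_of_nat_mult norm_power)
  also have "\<dots> = norm ((deriv ^^ (r * m)) \<phi> z) / fact (r * m) * (r1 / 4) ^ (r * m)"
   unfolding n c_eq(1) [OF zR] by (simp add: norm_mult norm_divide norm_power sh_norm rho(3))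
  also have "\<dots> <= B"
  proof -
   have "norm ((deriv ^^ (r * m)) \<phi> z) <= fact (r * m) * B / (r1 / 4) ^ (r * m)"
   proof (rule Cauchy_inequality)
    have sub': "cball z (r1 / 4) \<subseteq> ball 0 R0" using sub p1 by (auto simp: subset_iff)
    show "\<phi> holomorphic_on ball z (r1 / 4)" by (rule holomorphic_on_subset [OF phi_hol]) (use sub' ball_subset_cball in blast)
    show "continuous_on (cball z (r1 / 4)) \<phi>" by (rule continuous_on_subset [OF holomorphic_on_imp_continuous_on [OF phi_hol] sub'])
    show "norm (\<phi> x) <= B" if "norm (z - x) = r1 / 4" for x
    proof -
     have "x \<in> cball z (r1 / 4)" using that by (simp add: dist_norm)
     then show ?thesis using sub B by blast
    qed
   qed (use p1 in simp)
   then show ?thesis using p1 by (simp add: field_simps)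
  qed
  finally show ?thesis .
 next
  case False
  have "z \<in> ball 0 R0" using z p1 by simp
  then show ?thesis using c_eq(2) [OF _ False] B by simp
 qed
 then show ?thesis using B by blast
qed

lemma V_class:
 assumes K: "\<And>z. z \<in> K ==> norm z <= r1 / 4"
  and th: "\<And>z. z \<in> K ==> z0 - z = rcis (norm (z0 - z)) (\<theta> z)"
  and gap: "\<And>z k. z \<in> K ==> \<epsilon> / 2 <= \<bar>sd (\<theta> z) k - d\<bar>"
 shows "borel_class \<kappa> K d \<epsilon> V c"
proof -
 obtain B where B: "B > 0" "\<And>n z. norm z <= r1 / 4 ==> norm (c n z) * rho ^ n <= B" using coefficient_bound by blast
 have ps: "borel_growth \<kappa> K d \<epsilon> (%w z. Psi z (sh j w))" for j
  by (rule Psi_sh_growth [OF K th gap])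
 have g: "borel_growth \<kappa> K d \<epsilon> V" unfolding V_def [abs_def] by (rule borel_growth_sum [OF finite_lessThan ps ps])
 have KR: "K \<subseteq> ball 0 R0"
 proof
  fix z assume "z \<in> K" then show "z \<in> ball 0 R0" using K [of z] pos by simp
 qed
 show ?thesis
  by (rule borel_classI [OF g coefficient_A_space [OF KR] rho(1) B(1)])
   (use K B(2) V_series rho(2) in auto)
qed

text \<open>Existence comes from a thin convex neighbourhood of the segment inside the slit plane.
  For uniqueness, the intersection of two convex neighbourhoods is connected, so the identity
  theorem carries the common germ at z to z + h.\<close>

lemma continued_Psi:
 assumes z: "norm z < r1" and h: "1 - h / (z0 - z) \<notin> \<real>\<^sub>\<le>\<^sub>0"
 shows "continued \<phi> z h = Psi z h"
proof -
 have zn: "norm z < norm z0" using z pos by simp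
 define S where "S = {x. 1 - (x - z) / (z0 - z) \<notin> \<real>\<^sub>\<le>\<^sub>0}"
 define F where "F x = Psi z (x - z)" for x
 have Fh: "F holomorphic_on S" unfolding F_def
  by (rule holomorphic_on_compose_gen [OF _ Psi_hol_h [OF zn], unfolded o_def]) (auto simp: S_def intro!: holomorphic_intros)
 have "S = (%x. 1 - (x - z) / (z0 - z)) -` (- \<real>\<^sub>\<le>\<^sub>0)" by (auto simp: S_def)
 moreover have "open \<dots>" by (rule open_vimage) (use near_ne(1) [OF zn] in \<open>auto intro!: continuous_intros\<close>)
 ultimately have Sop: "open S" by simp
 \<comment> \<open>The slit plane is star-shaped about z: the slit points radially away from
   z.\<close>
 have seg: "closed_segment z (z + h) \<subseteq> S"
 proof
  fix x assume "x \<in> closed_segment z (z + h)"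
  then obtain s where s: "0 <= s" "s <= 1" "x = (1 - s) *\<^sub>R z + s *\<^sub>R (z + h)" by (auto simp: closed_segment_def)
  then have xz: "x - z = of_real s * h" by (simp add: algebra_simps scaleR_conv_of_real)
  define y where "y = h / (z0 - z)"
  have "1 - of_real s * y \<notin> \<real>\<^sub>\<le>\<^sub>0"
  proof
   assume "1 - of_real s * y \<in> \<real>\<^sub>\<le>\<^sub>0"
   then have 1: "s * Im y = 0" "1 <= s * Re y" by (auto simp: complex_nonpos_Reals_iff)
   then have "s \<noteq> 0" by auto
   then have "Im y = 0" using 1 by simp
   moreover have "1 <= Re y"
   proof -
    have "0 < s" using s \<open>s \<noteq> 0\<close> by simp
    then have "0 <= Re y" using 1 by (smt (verit) mult_pos_neg)
    then have "s * Re y <= 1 * Re y" using s by (intro mult_right_mono) auto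
    then show ?thesis using 1 by simp
   qed
   ultimately have "1 - y \<in> \<real>\<^sub>\<le>\<^sub>0" by (simp add: complex_nonpos_Reals_iff)
   then show False using h by (simp add: y_def)
  qed
  then show "x \<in> S" by (simp add: S_def xz y_def)
 qed
 obtain \<epsilon> where ep: "\<epsilon> > 0" "(\<Union>x\<in>closed_segment z (z + h). cball x \<epsilon>) \<subseteq> S"
  using compact_subset_open_imp_cball_epsilon_subset [OF compact_segment Sop seg] by blast
 \<comment> \<open>The sum of a segment and a small ball is open and convex.\<close>
 define U where "U = (\<Union>x\<in>closed_segment z (z + h). \<Union>y\<in>ball 0 \<epsilon>. {x + y})"
 have U: "open U" "convex U" unfolding U_def by (auto intro!: open_sums convex_sums)
 have US: "U \<subseteq> S"
 proof
  fix x assume "x \<in> U"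
  then obtain x' y where "x' \<in> closed_segment z (z + h)" "norm y < \<epsilon>" "x = x' + y" by (auto simp: U_def)
  then have "x \<in> (\<Union>x\<in>closed_segment z (z + h). cball x \<epsilon>)" by (intro UN_I [of x']) (auto simp: dist_norm)
  then show "x \<in> S" using ep by blast
 qed
 have sU: "closed_segment z (z + h) \<subseteq> U" unfolding U_def using ep by force
 have near: "\<forall>\<^sub>F x in nhds z. F x = \<phi> x"
 proof -
  have "\<forall>\<^sub>F x in nhds z. x \<in> ball z (norm (z0 - z))" "\<forall>\<^sub>F x in nhds z. x \<in> ball 0 r1"
   by (rule eventually_nhds_in_open; use near_ne(1) [OF zn] z in simp)+
  then show ?thesis
  proof eventually_elim
   case (elim x)
   then show ?case using Psi_near [OF zn, of "x - z"] by (simp add: F_def dist_norm norm_minus_commute)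
  qed
 qed
 have ex: "\<exists>U F. open U \<and> convex U \<and> closed_segment z (z + h) \<subseteq> U \<and>
   F holomorphic_on U \<and> (\<forall>\<^sub>F x in nhds z. F x = \<phi> x) \<and> F (z + h) = Psi z h"
  using U sU holomorphic_on_subset [OF Fh US] near by (intro exI [of _ U] exI [of _ F]) (simp add: F_def)
 show ?thesis unfolding continued_def
 proof (rule the_equality, rule ex, elim exE conjE)
  fix c' U' F' assume *: "open U'" "convex U'" "closed_segment z (z + h) \<subseteq> U'" "F' holomorphic_on U'"
   "\<forall>\<^sub>F x in nhds z. F' x = \<phi> x" "F' (z + h) = c'"
  have "\<forall>\<^sub>F x in nhds z. F x = F' x" using near *(5) by eventually_elim simp
  then obtain W where W: "open W" "z \<in> W" "\<And>x. x \<in> W ==> F x = F' x" unfolding eventually_nhds by blast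
  have zs: "z \<in> closed_segment z (z + h)" "z + h \<in> closed_segment z (z + h)" by auto
  have "F (z + h) = F' (z + h)"
  proof (rule analytic_continuation_open [of "W \<inter> (U \<inter> U')" "U \<inter> U'" F F' "z + h"])
   show "open (W \<inter> (U \<inter> U'))" "open (U \<inter> U')" using W U * by auto
   show "connected (U \<inter> U')" by (intro convex_connected convex_Int U *)
   show "W \<inter> (U \<inter> U') \<noteq> {}" using W zs sU * by blast
   show "F holomorphic_on U \<inter> U'" "F' holomorphic_on U \<inter> U'"
    using holomorphic_on_subset [OF Fh] US holomorphic_on_subset [OF *(4)] by blast+
  qed (use W zs sU * in auto)
  then show "c' = Psi z h" using * by (simp add: F_def)
 qed
qed

end

section \<open>The sum in a nonsingular direction\<close>

text \<open>Cauchy's theorem in the intersection of the sector of v with the strip of the kernel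
  around Im t, as the case of \<open>path_int_independent\<close> where both pieces lie in one strip
  and the contours are straight.\<close>

lemma laplace_rotate:
 assumes k: "\<kappa> > 0" and E: "kernel_decay \<kappa> E" and v: "borel_growth \<kappa> K d \<epsilon> v" and d: "\<delta> > 0"
 shows "\<exists>T. \<forall>\<theta> \<theta>' t z. \<bar>\<theta> - d\<bar> <= \<epsilon> / 2 - \<delta> --> \<bar>\<theta> - Im t\<bar> <= pi / \<kappa> / 2 - \<delta> -->
   \<bar>\<theta>' - d\<bar> <= \<epsilon> / 2 - \<delta> --> \<bar>\<theta>' - Im t\<bar> <= pi / \<kappa> / 2 - \<delta> --> Re t < T --> z \<in> K -->
   laplace_log E \<theta> (%w. v w z) t = laplace_log E \<theta>' (%w. v w z) t"
proof -
 obtain T \<eta> C where T: "\<eta> > 0" "C > 0" and b: "\<And>w t z. \<bar>Im w - d\<bar> <= \<epsilon> / 2 - \<delta> ==> \<bar>Im w - Im t\<bar> <= pi / \<kappa> / 2 - \<delta> ==>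
   Re t < T ==> z \<in> K ==> norm (E (w - t) * v w z) <= C * exp (\<eta> * \<bar>Re t\<bar>) * exp (- (\<eta> * \<bar>Re w\<bar>))"
  using laplace_line_bound [OF k E v d] by blast
 have "laplace_log E \<theta> (%w. v w z) t = laplace_log E \<theta>' (%w. v w z) t"
  if th: "\<bar>\<theta> - d\<bar> <= \<epsilon> / 2 - \<delta>" "\<bar>\<theta> - Im t\<bar> <= pi / \<kappa> / 2 - \<delta>"
   "\<bar>\<theta>' - d\<bar> <= \<epsilon> / 2 - \<delta>" "\<bar>\<theta>' - Im t\<bar> <= pi / \<kappa> / 2 - \<delta>" and t: "Re t < T" and z: "z \<in> K" for \<theta> \<theta>' t z
 proof -
  define g where "g w = E (w - t) * v w z" for w
  define A where "A = max (d - \<epsilon> / 2) (Im t - pi / \<kappa> / 2)"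
  define B where "B = min (d + \<epsilon> / 2) (Im t + pi / \<kappa> / 2)"
  have gh: "g holomorphic_on {w. A < Im w \<and> Im w < B} \<union> {w. (-1::real) < Re w \<and> A < Im w \<and> Im w < B}"
   unfolding g_def
  proof (intro holomorphic_on_mult)
   have "E holomorphic_on sector 0 (pi / \<kappa>)" using E by (simp add: kernel_decay_def)
   then show "(%w. E (w - t)) holomorphic_on {w. A < Im w \<and> Im w < B} \<union> {w. -1 < Re w \<and> A < Im w \<and> Im w < B}"
    by (rule holomorphic_on_compose_gen [of "%w. w - t" _ E, unfolded o_def, rotated 1])
     (auto intro!: holomorphic_intros simp: A_def B_def sector_def abs_less_iff)
   have "(%w. v w z) holomorphic_on sector d \<epsilon>" using v z by (simp add: borel_growth_def)
   then show "(%w. v w z) holomorphic_on {w. A < Im w \<and> Im w < B} \<union> {w. -1 < Re w \<and> A < Im w \<and> Im w < B}"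
   proof (rule holomorphic_on_subset, intro subsetI)
    fix x assume "x \<in> {w. A < Im w \<and> Im w < B} \<union> {w. -1 < Re w \<and> A < Im w \<and> Im w < B}"
    then have "d - \<epsilon> / 2 < Im x" "Im x < d + \<epsilon> / 2" by (auto simp: A_def B_def)
    then show "x \<in> sector d \<epsilon>" unfolding sector_def mem_Collect_eq by linarith
   qed
  qed
  have rng: "A < x" "x < B" if "\<bar>x - d\<bar> <= \<epsilon> / 2 - \<delta>" "\<bar>x - Im t\<bar> <= pi / \<kappa> / 2 - \<delta>" for x
   using that d unfolding A_def B_def max_less_iff_conj min_less_iff_conj by linarith+
  have bd: "norm (g w) <= C * exp (\<eta> * \<bar>Re t\<bar>) * exp (- (\<eta> * \<bar>Re w\<bar>))"
   if "min \<theta> \<theta>' <= Im w" "Im w <= max \<theta> \<theta>'" for w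
   unfolding g_def by (rule b [OF _ _ t z]) (use that th in linarith)+
  have p: "path_int g 0 x x = path_int g 0 y y" "set_integrable lborel {..0} (%s. g (Complex s x))" "set_integrable lborel {0..} (%s. g (Complex s x))"
   if "x = \<theta> \<and> y = \<theta>' \<or> x = \<theta>' \<and> y = \<theta>" for x y
  proof -
   have rx: "A < x" "x < B" "A < y" "y < B" using that rng [OF th(1,2)] rng [OF th(3,4)] by auto
   have bx: "norm (g w) <= C * exp (\<eta> * \<bar>Re t\<bar>) * exp (- (\<eta> * \<bar>Re w\<bar>))" if "min x y <= Im w" "Im w <= max x y" for w
    by (rule bd) (use that \<open>x = \<theta> \<and> y = \<theta>' \<or> x = \<theta>' \<and> y = \<theta>\<close> in \<open>auto simp: min.commute max.commute\<close>)
   note pi = path_int_independent [OF gh order_refl order_refl _ rx rx bx bx T(1) T(1), of 0]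
   show "path_int g 0 x x = path_int g 0 y y" "set_integrable lborel {..0} (%s. g (Complex s x))" "set_integrable lborel {0..} (%s. g (Complex s x))"
    by (rule pi; simp)+
  qed
  show ?thesis
   using path_int_straight [OF p(2,3) [of \<theta> \<theta>']] path_int_straight [OF p(2,3) [of \<theta>' \<theta>]] p(1) [of \<theta> \<theta>']
   by (simp add: laplace_log_def g_def [symmetric])
 qed
 then show ?thesis by blast
qed

text \<open>Joint holomorphy is reduced to each variable separately; near a point of the domain one
  exponential majorant serves all t and z.\<close>

lemma laplace_holomorphic2:
 assumes k: "\<kappa> > 0" and E: "kernel_decay \<kappa> E" and v: "borel_growth \<kappa> (cball 0 R) d \<epsilon> v" and d: "\<delta> > 0" "\<delta> <= \<epsilon> / 2"
 shows "\<exists>T. holomorphic2_on (%t z. laplace_log E d (%w. v w z) t)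
   ({t. \<bar>Im t - d\<bar> < pi / \<kappa> / 2 - \<delta> \<and> Re t < T} \<times> ball 0 R)"
proof -
 obtain T \<eta> C where T: "\<eta> > 0" "C > 0" and b: "\<And>w t z. \<bar>Im w - d\<bar> <= \<epsilon> / 2 - \<delta> ==> \<bar>Im w - Im t\<bar> <= pi / \<kappa> / 2 - \<delta> ==>
   Re t < T ==> z \<in> cball 0 R ==> norm (E (w - t) * v w z) <= C * exp (\<eta> * \<bar>Re t\<bar>) * exp (- (\<eta> * \<bar>Re w\<bar>))"
  using laplace_line_bound [OF k E v d(1)] by blast
 define S where "S = {t. \<bar>Im t - d\<bar> < pi / \<kappa> / 2 - \<delta> \<and> Re t < T}"
 have Si: "S = {t. Im t < d + (pi / \<kappa> / 2 - \<delta>)} \<inter> {t. Im t > d - (pi / \<kappa> / 2 - \<delta>)} \<inter> {t. Re t < T}"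
  by (auto simp: S_def abs_less_iff)
 have So: "open S" unfolding Si by (intro open_Int open_halfspace_Im_lt open_halfspace_Im_gt open_halfspace_Re_lt)
 have bS: "norm (E (Complex y d - t) * v (Complex y d) z) <= C * exp (\<eta> * \<bar>Re t\<bar>) * exp (- (\<eta> * \<bar>y\<bar>))"
  if "t \<in> S" "z \<in> ball 0 R" for t z y
  using b [of "Complex y d" t z] that d by (auto simp: S_def abs_minus_commute)
 have line: "Complex y d \<in> sector d \<epsilon>" for y using d by (simp add: sector_def)
 have ms: "(%y. E (Complex y d - t) * v (Complex y d) z) \<in> borel_measurable lborel" if "t \<in> S" "z \<in> ball 0 R" for t z
  using borel_measurable_continuous_onI [OF continuous_line_product [OF E v d(1), of d t z]] that d by (auto simp: S_def abs_minus_commute)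
 have "\<exists>A B. ((%(t, z). laplace_log E d (%w. v w z) t) has_derivative (%(h, k). A * h + B * k)) (at (t0, z0))"
  if t0: "t0 \<in> S" and z0: "z0 \<in> ball 0 R" for t0 z0
 proof -
  obtain r1 where r1: "r1 > 0" "ball t0 r1 \<subseteq> S" using So t0 open_contains_ball by blast
  obtain r2 where r2: "r2 > 0" "ball z0 r2 \<subseteq> ball 0 R" using open_ball z0 open_contains_ball by blast
  define s where "s = min 1 (min r1 r2)"
  have s: "s > 0" "s <= 1" "ball t0 s \<subseteq> S" "ball z0 s \<subseteq> ball 0 R" using r1 r2 by (auto simp: s_def)
  define g where "g y = C * exp (\<eta> * (\<bar>Re t0\<bar> + 1)) * exp (- (\<eta> * \<bar>y\<bar>))" for y
  have gi: "integrable lborel g" unfolding g_def using integrable_exp_neg_abs [OF T(1)] by simp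
  have le: "norm (E (Complex y d - t) * v (Complex y d) z) <= g y" if t: "t \<in> ball t0 s" and z: "z \<in> ball z0 s" for t z y
  proof -
   have "\<bar>Re (t - t0)\<bar> <= norm (t - t0)" by (rule abs_Re_le_cmod)
   then have "\<bar>Re t\<bar> <= \<bar>Re t0\<bar> + 1" using t s(2) by (simp add: dist_norm norm_minus_commute)
   then have "C * exp (\<eta> * \<bar>Re t\<bar>) * exp (- (\<eta> * \<bar>y\<bar>)) <= g y" unfolding g_def using T by (intro mult_right_mono mult_left_mono) auto
   moreover have "t \<in> S" "z \<in> ball 0 R" using t z s by blast+
   ultimately show ?thesis using bS [of t z y] by linarith
  qed
  show ?thesis
  proof (rule has_derivative_separately_holomorphic [OF s(1)])
   fix z assume z: "z \<in> ball z0 s"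
   show "(%t. laplace_log E d (%w. v w z) t) holomorphic_on ball t0 s" unfolding laplace_log_def
   proof (rule holomorphic_on_integral)
    show "(%y. E (Complex y d - t) * v (Complex y d) z) \<in> borel_measurable lborel" if "t \<in> ball t0 s" for t
     using ms that z s by blast
    show "(%t. E (Complex y d - t) * v (Complex y d) z) holomorphic_on ball t0 s" for y
    proof (intro holomorphic_on_mult holomorphic_on_const)
     have "E holomorphic_on sector 0 (pi / \<kappa>)" using E by (simp add: kernel_decay_def)
     then show "(%t. E (Complex y d - t)) holomorphic_on ball t0 s"
     proof (rule holomorphic_on_compose_gen [of "%t. Complex y d - t" _ E, unfolded o_def, rotated 1])
      show "(%t. Complex y d - t) ` ball t0 s \<subseteq> sector 0 (pi / \<kappa>)"
       using s(3) d by (auto simp: S_def sector_def abs_minus_commute)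
     qed (intro holomorphic_intros)
    qed
    show "\<exists>\<delta>>0. \<exists>g. integrable lborel g \<and> (\<forall>y\<in>ball x \<delta> \<inter> ball t0 s. \<forall>om\<in>space lborel. norm (E (Complex om d - y) * v (Complex om d) z) <= g om)" for x
     by (rule exI [of _ 1], rule conjI, simp, rule exI [of _ g], rule conjI, rule gi) (use le z in auto)
   qed simp
  next
   fix t assume t: "t \<in> ball t0 s"
   show "(%z. laplace_log E d (%w. v w z) t) holomorphic_on ball z0 s" unfolding laplace_log_def
   proof (rule holomorphic_on_integral)
    show "(%y. E (Complex y d - t) * v (Complex y d) z) \<in> borel_measurable lborel" if "z \<in> ball z0 s" for z
     using ms that t s by blast
    show "(%z. E (Complex y d - t) * v (Complex y d) z) holomorphic_on ball z0 s" for y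
    proof (intro holomorphic_on_mult holomorphic_on_const)
     have "v (Complex y d) \<in> A_space (cball 0 R)" using v line by (simp add: borel_growth_def)
     then have "v (Complex y d) holomorphic_on ball 0 R" by (simp add: A_space_def)
     then show "v (Complex y d) holomorphic_on ball z0 s" by (rule holomorphic_on_subset) (rule s)
    qed
    show "\<exists>\<delta>>0. \<exists>g. integrable lborel g \<and> (\<forall>y\<in>ball x \<delta> \<inter> ball z0 s. \<forall>om\<in>space lborel. norm (E (Complex om d - t) * v (Complex om d) y) <= g om)" for x
     by (rule exI [of _ 1], rule conjI, simp, rule exI [of _ g], rule conjI, rule gi) (use le t in auto)
   qed simp
  next
   fix t z assume tz: "t \<in> ball t0 s" "z \<in> ball z0 s"
   show "norm (laplace_log E d (%w. v w z) t) <= (\<integral>y. g y \<partial>lborel)" unfolding laplace_log_def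
   proof (rule Bochner_Integration.integral_norm_bound_integral [OF _ gi])
    show "integrable lborel (%y. E (Complex y d - t) * v (Complex y d) z)"
    proof (rule Bochner_Integration.integrable_bound [OF gi])
     show "(%y. E (Complex y d - t) * v (Complex y d) z) \<in> borel_measurable lborel" using ms tz s by blast
     show "AE y in lborel. norm (E (Complex y d - t) * v (Complex y d) z) <= norm (g y)"
      using le [OF tz] by (auto intro!: AE_I2 order_trans [OF _ abs_ge_self])
    qed
   qed (use le [OF tz] in auto)
  qed
 qed
 then have "holomorphic2_on (%t z. laplace_log E d (%w. v w z) t) (S \<times> ball 0 R)"
  unfolding holomorphic2_on_def by auto
 then show ?thesis unfolding S_def by blast
qed

lemma holomorphic2_on_cong:
 assumes f: "holomorphic2_on f S" and S: "open S" and eq: "\<And>t z. (t, z) \<in> S ==> f t z = g t z"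
 shows "holomorphic2_on g S"
 unfolding holomorphic2_on_def
proof
 fix P assume P: "P \<in> S"
 obtain A B where D: "((%(t, z). f t z) has_derivative (%(h, k). A * h + B * k)) (at P)"
  using f P unfolding holomorphic2_on_def by blast
 have "((%(t, z). g t z) has_derivative (%(h, k). A * h + B * k)) (at P)"
  by (rule has_derivative_transform_within_open [OF D S P]) (use eq in auto)
 then show "\<exists>A B. ((%(t, z). g t z) has_derivative (%(h, k). A * h + B * k)) (at P)" by blast
qed

lemma holomorphic2_on_subset: "holomorphic2_on f S ==> T \<subseteq> S ==> holomorphic2_on f T"
 unfolding holomorphic2_on_def by blast

lemma open_bounded_sector [simp]: "open (bounded_sector d \<alpha> \<rho>)"
proof (cases "\<rho> > 0")
 case True
 have "exp x < \<rho> \<longleftrightarrow> x < ln \<rho>" for x using True by (metis exp_less_cancel_iff exp_ln)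
 then have "bounded_sector d \<alpha> \<rho> = sector d \<alpha> \<inter> {w. Re w < ln \<rho>}" by (auto simp: bounded_sector_def)
 then show ?thesis by (simp add: open_Int open_halfspace_Re_lt)
next
 case False
 then have "bounded_sector d \<alpha> \<rho> = {}" by (auto simp: bounded_sector_def) (meson exp_gt_zero less_trans not_less)
 then show ?thesis by simp
qed

section \<open>Gaps between singular directions, and the sum formula\<close>

context continuation
begin

text \<open>The singular directions form an arithmetic progression, so the nearest one to d is found
  by rounding.\<close>

lemma sd_gap:
 assumes "\<And>l. d \<noteq> sd \<theta> l"
 shows "\<exists>\<gamma>>0. \<forall>l. \<gamma> <= \<bar>sd \<theta> l - d\<bar>"
proof -
 define x where "x = (real r * \<theta> - arga - (real q + 1) * d) / (2 * pi)"
 have eq: "sd \<theta> l - d = 2 * pi / (real q + 1) * (x - of_int l)" for l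
 proof -
  define Q where "Q = real q + 1"
  have "Q \<noteq> 0" by (simp add: Q_def)
  then have "(X - 2 * pi * L - Y) / Q - d = 2 * pi / Q * ((X - Y - Q * d) / (2 * pi) - L)" for X Y L :: real
   by (simp add: field_simps)
  then show ?thesis by (simp add: sd_def singular_dir_def x_def Q_def [symmetric])
 qed
 define \<gamma> where "\<gamma> = 2 * pi / (real q + 1) * \<bar>x - of_int (round x)\<bar>"
 have "x \<noteq> of_int (round x)" using eq [of "round x"] assms [of "round x"] by auto
 then have "\<gamma> > 0" by (simp add: \<gamma>_def add_pos_pos)
 moreover have "\<gamma> <= \<bar>sd \<theta> l - d\<bar>" for l
 proof -
  have "\<bar>x - of_int (round x)\<bar> <= \<bar>x - of_int l\<bar>" by (rule round_diff_minimal)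
  then show ?thesis unfolding eq \<gamma>_def abs_mult by (simp add: divide_right_mono)
 qed
 ultimately show ?thesis by blast
qed

text \<open>Moving z from 0 turns \<open>theta z\<close>, and with it all singular directions, by a
  common small angle; half of the gap at z = 0 survives on a small disc.\<close>

lemma sd_gap_near:
 assumes "\<And>l. d \<noteq> sd (Arg z0) l"
 shows "\<exists>\<epsilon>>0. \<exists>R>0. R < R0 \<and> R <= r1 / 4 \<and> (\<forall>z\<in>cball 0 R. \<forall>l. \<epsilon> / 2 <= \<bar>sd (theta z) l - d\<bar>)"
proof -
 obtain \<gamma> where g: "\<gamma> > 0" "\<And>l. \<gamma> <= \<bar>sd (Arg z0) l - d\<bar>" using sd_gap [OF assms] by blast
 have "isCont (%z. Ln (1 - z / z0)) 0" by (intro continuous_intros) (use z00 in auto)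
 then have "isCont (%z. Im (Ln (1 - z / z0))) 0" by (rule isCont_Im)
 then obtain s where s: "s > 0" "\<And>z. norm z < s ==> \<bar>Im (Ln (1 - z / z0))\<bar> < b * \<gamma> / 2"
  unfolding continuous_at_eps_delta using g pos(2) by (auto simp: dist_norm dest!: spec [of _ "b * \<gamma> / 2"])
 define R where "R = min (s / 2) (r1 / 4)"
 have R: "R > 0" "R < s" "R <= r1 / 4" using s pos by (auto simp: R_def)
 have "\<gamma> / 2 <= \<bar>sd (theta z) l - d\<bar>" if "norm z <= R" for z l
 proof -
  define x where "x = Im (Ln (1 - z / z0))"
  have "\<bar>x\<bar> < b * \<gamma> / 2" using s(2) [of z] that R by (simp add: x_def)
  then have "\<bar>x / b\<bar> < \<gamma> / 2" using pos(2) by (simp add: abs_divide divide_less_eq mult.commute)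
  moreover have "sd (theta z) l - sd (Arg z0) l = x / b"
  proof -
   have "sd (theta z) l - sd (Arg z0) l = real r * x / (real q + 1)"
    unfolding sd_def singular_dir_def theta_def x_def diff_divide_distrib [symmetric] by (simp add: algebra_simps)
   then show ?thesis by (simp add: b_def)
  qed
  ultimately show ?thesis using g(2) [of l] by linarith
 qed
 moreover have "R < R0" using R pos by linarith
 ultimately show ?thesis using g R by (intro exI [of _ \<gamma>] exI [of _ R] conjI) auto
qed

lemma sum_formula:
 assumes "\<And>l. d \<noteq> sd (Arg z0) l"
 shows "\<exists>R>0. R < R0 \<and> summable_in_direction \<kappa> (cball 0 R) u d \<and>
     (\<exists>U \<epsilon>0 V. is_sum_in_direction \<kappa> (cball 0 R) u d U \<and>
      borel_continuation \<kappa> (moment_pqr p q r) (cball 0 R) u d \<epsilon>0 V \<and>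
      (\<forall>\<epsilon>>0. \<exists>rt>0.
        holomorphic2_on U (bounded_sector d (pi / \<kappa> - \<epsilon>) rt \<times> ball 0 R) \<and>
        (\<forall>t\<in>bounded_sector d (pi / \<kappa> - \<epsilon>) rt. \<forall>z\<in>ball 0 R.
         moment_laplace_converges e d (%s. V s z) t \<and>
         U t z = moment_laplace e d (%s. V s z) t \<and>
         ray_integrable d (%s. e (s - t) *
          (\<Sum>j<r. continued \<phi> z (shift p q r a arga j s)) / exp s) \<and>
         U t z = 1 / of_nat r * ray_integral d (%s. e (s - t) *
          (\<Sum>j<r. continued \<phi> z (shift p q r a arga j s)) / exp s))))"
proof -
 obtain \<epsilon> R where ep: "\<epsilon> > 0" and R: "R > 0" "R < R0" "R <= r1 / 4"
  and gap: "\<And>z l. z \<in> cball 0 R ==> \<epsilon> / 2 <= \<bar>sd (theta z) l - d\<bar>" using sd_gap_near [OF assms] by blast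
 define K where "K = cball (0::complex) R"
 have Kz: "norm z <= r1 / 4" "norm z < norm z0" "z \<in> ball 0 R0" "norm z < r1" if "z \<in> K" for z using that R pos by (auto simp: K_def)
 have th: "z0 - z = rcis (norm (z0 - z)) (theta z)" if "z \<in> K" for z by (rule theta_rcis [OF Kz(2) [OF that]])
 have cl: "borel_class \<kappa> K d \<epsilon> V c" by (rule V_class [OF Kz(1) th]) (use gap in \<open>auto simp: K_def\<close>)
 \<comment> \<open>The sum is claimed for directions within \<epsilon>/4 of d only; the wider sector
   leaves room \<epsilon>/4 for rotating contours.\<close>
 have cl2: "borel_class \<kappa> K d (\<epsilon> / 2) V c"
 proof (rule V_class [OF Kz(1) th])
  fix z k assume "z \<in> K" then show "\<epsilon> / 2 / 2 <= \<bar>sd (theta z) k - d\<bar>" using gap [of z k] ep by (simp add: K_def)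
 qed
 have gr: "borel_growth \<kappa> K d \<epsilon> V" using cl by (simp add: borel_class_def)
 have KR: "K \<subseteq> ball 0 R0" using Kz by blast
 \<comment> \<open>One function U must agree with the Laplace integrals in all directions near d,
   also at t for which direction d itself diverges. So the direction follows t: it is the one
   nearest to arg t among those within \<epsilon>/4 of d.\<close>
 define cd where "cd t = max (d - \<epsilon> / 4) (min (d + \<epsilon> / 4) (Im t))" for t :: complex
 define U :: "complex => complex => complex" where "U t z = laplace_log e (cd t) (%w. V w z) t" for t z
 have Ueq: "\<exists>T. \<forall>\<theta> t z. \<bar>\<theta> - d\<bar> <= \<epsilon> / 2 / 2 - \<delta> --> \<bar>\<theta> - Im t\<bar> <= pi / \<kappa> / 2 - \<delta> --> Re t < T -->
      z \<in> K --> U t z = laplace_log e \<theta> (%s. V s z) t" if dl: "\<delta> > 0" for \<delta>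
 proof -
  define \<delta>' where "\<delta>' = min \<delta> (\<epsilon> / 4)"
  have d': "\<delta>' > 0" "\<delta>' <= \<delta>" "\<delta>' <= \<epsilon> / 4" using dl ep by (auto simp: \<delta>'_def)
  obtain T where T: "\<And>\<theta> \<theta>' t z. \<bar>\<theta> - d\<bar> <= \<epsilon> / 2 - \<delta>' ==> \<bar>\<theta> - Im t\<bar> <= pi / \<kappa> / 2 - \<delta>' ==>
   \<bar>\<theta>' - d\<bar> <= \<epsilon> / 2 - \<delta>' ==> \<bar>\<theta>' - Im t\<bar> <= pi / \<kappa> / 2 - \<delta>' ==> Re t < T ==> z \<in> K ==>
   laplace_log e \<theta> (%w. V w z) t = laplace_log e \<theta>' (%w. V w z) t"
   using laplace_rotate [OF pos(1) kernel(2) gr d'(1)] by blast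
  have "U t z = laplace_log e \<theta> (%s. V s z) t"
   if *: "\<bar>\<theta> - d\<bar> <= \<epsilon> / 2 / 2 - \<delta>" "\<bar>\<theta> - Im t\<bar> <= pi / \<kappa> / 2 - \<delta>" "Re t < T" "z \<in> K" for \<theta> t z
  proof -
   have 1: "\<bar>cd t - d\<bar> <= \<epsilon> / 4" unfolding cd_def using ep by linarith
   have 2: "\<bar>cd t - Im t\<bar> <= \<bar>\<theta> - Im t\<bar>" unfolding cd_def using *(1) dl by linarith
   show ?thesis unfolding U_def
    by (rule T [OF _ _ _ _ *(3,4)]) (use 1 2 * d' in linarith)+
  qed
  then show ?thesis by blast
 qed
 have isum: "is_sum_in_direction \<kappa> K u d U"
  by (rule is_sum_I [OF cl2 KR]) (use ep Ueq in auto)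
 have summ: "summable_in_direction \<kappa> K u d"
  using sum_exists [OF cl KR ep] ep unfolding summable_in_direction_def by blast
 have uA: "(%z. fps_nth (u z) n) \<in> A_space K" for n
 proof -
  have "(%z. fps_nth (u z) n) holomorphic_on ball 0 R0" using sol by (simp add: formal_solution_def)
  then show ?thesis using KR interior_subset unfolding A_space_def
   by (auto intro: holomorphic_on_imp_continuous_on holomorphic_on_subset)
 qed
 have bc: "borel_continuation \<kappa> (moment_pqr p q r) K u d \<epsilon> V"
  by (rule borel_continuation_of_class [OF _ uA pos(1) ep]) (use cl in \<open>simp add: c_def [abs_def]\<close>)
 have "\<exists>rt>0. holomorphic2_on U (bounded_sector d (pi / \<kappa> - \<eta>) rt \<times> ball 0 R) \<and>
        (\<forall>t\<in>bounded_sector d (pi / \<kappa> - \<eta>) rt. \<forall>z\<in>ball 0 R.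
         moment_laplace_converges e d (%s. V s z) t \<and>
         U t z = moment_laplace e d (%s. V s z) t \<and>
         ray_integrable d (%s. e (s - t) *
          (\<Sum>j<r. continued \<phi> z (shift p q r a arga j s)) / exp s) \<and>
         U t z = 1 / of_nat r * ray_integral d (%s. e (s - t) *
          (\<Sum>j<r. continued \<phi> z (shift p q r a arga j s)) / exp s))" if eta: "\<eta> > 0" for \<eta>
 proof -
  define \<delta> where "\<delta> = min (\<epsilon> / 4) (\<eta> / 2)"
  have dl: "\<delta> > 0" "\<delta> <= \<epsilon> / 4" "\<delta> <= \<eta> / 2"
  proof -
   show "\<delta> > 0" unfolding \<delta>_def min_less_iff_conj using ep eta by linarith
   show "\<delta> <= \<epsilon> / 4" unfolding \<delta>_def by (rule min.cobounded1)
   show "\<delta> <= \<eta> / 2" unfolding \<delta>_def by (rule min.cobounded2)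
  qed
  have dl2: "\<delta> <= \<epsilon> / 2" using dl ep by linarith
  obtain T1 where T1: "holomorphic2_on (%t (z::complex). laplace_log e d (%w. V w z) t)
   ({t. \<bar>Im t - d\<bar> < pi / \<kappa> / 2 - \<delta> \<and> Re t < T1} \<times> ball 0 R)"
   using laplace_holomorphic2 [OF pos(1) kernel(2) gr [unfolded K_def] dl(1) dl2] by blast
  obtain T2 where T2: "\<And>\<theta> t z. \<bar>\<theta> - d\<bar> <= \<epsilon> / 2 / 2 - \<delta> ==> \<bar>\<theta> - Im t\<bar> <= pi / \<kappa> / 2 - \<delta> ==> Re t < T2 ==>
      z \<in> K ==> U t z = laplace_log e \<theta> (%s. V s z) t" using Ueq [OF dl(1)] by blast
  obtain T3 where T3: "\<And>\<theta> t z. \<bar>\<theta> - d\<bar> <= \<epsilon> / 2 - \<delta> ==> \<bar>\<theta> - Im t\<bar> <= pi / \<kappa> / 2 - \<delta> ==> Re t < T3 ==> z \<in> K ==>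
   integrable lborel (%y. e (Complex y \<theta> - t) * V (Complex y \<theta>) z)"
   using laplace_integrable [OF pos(1) kernel(2) gr dl(1)] by blast
  define rt where "rt = exp (min T1 (min T2 T3))"
  have bs: "\<bar>Im t - d\<bar> < pi / \<kappa> / 2 - \<delta>" "Re t < T1" "Re t < T2" "Re t < T3" if "t \<in> bounded_sector d (pi / \<kappa> - \<eta>) rt" for t
  proof -
   have "\<bar>Im t - d\<bar> < (pi / \<kappa> - \<eta>) / 2" using that by (simp add: bounded_sector_def sector_def)
   then show "\<bar>Im t - d\<bar> < pi / \<kappa> / 2 - \<delta>" using dl(3) unfolding diff_divide_distrib by linarith
   show "Re t < T1" "Re t < T2" "Re t < T3" using that by (auto simp: bounded_sector_def rt_def)
  qed
  have bs': "\<bar>d - Im t\<bar> <= pi / \<kappa> / 2 - \<delta>" if "t \<in> bounded_sector d (pi / \<kappa> - \<eta>) rt" for t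
   using bs(1) [OF that] by linarith
  have d0: "\<bar>d - d\<bar> <= \<epsilon> / 2 / 2 - \<delta>" "\<bar>d - d\<bar> <= \<epsilon> / 2 - \<delta>" using dl ep by auto
  have Ud: "U t z = laplace_log e d (%s. V s z) t" if "t \<in> bounded_sector d (pi / \<kappa> - \<eta>) rt" "z \<in> K" for t z
   by (rule T2 [OF d0(1) bs' [OF that(1)] bs(3) [OF that(1)] that(2)])
  have hol: "holomorphic2_on U (bounded_sector d (pi / \<kappa> - \<eta>) rt \<times> ball 0 R)"
  proof (rule holomorphic2_on_cong)
   show "holomorphic2_on (%t (z::complex). laplace_log e d (%w. V w z) t) (bounded_sector d (pi / \<kappa> - \<eta>) rt \<times> ball 0 R)"
    by (rule holomorphic2_on_subset [OF T1]) (use bs in auto)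
   show "open (bounded_sector d (pi / \<kappa> - \<eta>) rt \<times> ball (0::complex) R)" by (intro open_Times) auto
   fix t z :: complex assume "(t, z) \<in> bounded_sector d (pi / \<kappa> - \<eta>) rt \<times> ball 0 R"
   then show "laplace_log e d (%w. V w z) t = U t z" using Ud [of t z] by (simp add: K_def)
  qed
  show ?thesis
  proof (rule exI [of _ rt], rule conjI, simp add: rt_def, rule conjI, rule hol, intro ballI)
   fix t z :: complex assume t: "t \<in> bounded_sector d (pi / \<kappa> - \<eta>) rt" and zb: "z \<in> ball 0 R"
   then have z: "z \<in> K" by (simp add: K_def)
   have i: "integrable lborel (%y. e (Complex y d - t) * V (Complex y d) z)"
    by (rule T3 [OF d0(2) bs' [OF t] bs(4) [OF t] z])
   note ml = moment_laplace_eq [OF i]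
   have eq: "e (ray_point d x - t) * (\<Sum>j<r. continued \<phi> z (shift p q r a arga j (ray_point d x))) / exp (ray_point d x) * cis d
     = of_nat r * (e (ray_point d x - t) * V (ray_point d x) z / exp (ray_point d x) * cis d)" for x
   proof -
    have "continued \<phi> z (shift p q r a arga j (ray_point d x)) = Psi z (sh j (ray_point d x))" for j
     unfolding sh_def [symmetric]
    proof (rule continued_Psi [OF Kz(4) [OF z]], rule slit_value(1) [OF Kz(2) [OF z] th [OF z]])
     fix k show "\<epsilon> / 2 <= \<bar>Im (ray_point d x) - sd (theta z) (int j - int r * k)\<bar>"
      using gap [of z "int j - int r * k"] zb by (simp add: ray_point_def abs_minus_commute)
    qed (use ep in simp)
    then have "(\<Sum>j<r. continued \<phi> z (shift p q r a arga j (ray_point d x))) = of_nat r * V (ray_point d x) z"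
     using r by (simp add: V_def)
    then show ?thesis by simp
   qed
   have a: "ray_integrable d (%s. e (s - t) * (\<Sum>j<r. continued \<phi> z (shift p q r a arga j s)) / exp s)"
    using ml(1) unfolding moment_laplace_converges_def ray_integrable_def eq
    by (rule set_integrable_mult_right [OF])
   have "ray_integral d (%s. e (s - t) * (\<Sum>j<r. continued \<phi> z (shift p q r a arga j s)) / exp s) = of_nat r * moment_laplace e d (%s. V s z) t"
    unfolding moment_laplace_def ray_integral_def eq by (rule integral_mult_right)
   then have bb: "1 / of_nat r * ray_integral d (%s. e (s - t) * (\<Sum>j<r. continued \<phi> z (shift p q r a arga j s)) / exp s) = moment_laplace e d (%s. V s z) t"
    using r by simp
   have "U t z = moment_laplace e d (%s. V s z) t" unfolding Ud [OF t z] ml(2) ..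
   then show "moment_laplace_converges e d (%s. V s z) t \<and> U t z = moment_laplace e d (%s. V s z) t \<and>
     ray_integrable d (%s. e (s - t) * (\<Sum>j<r. continued \<phi> z (shift p q r a arga j s)) / exp s) \<and>
     U t z = 1 / of_nat r * ray_integral d (%s. e (s - t) * (\<Sum>j<r. continued \<phi> z (shift p q r a arga j s)) / exp s)"
    unfolding bb using ml(1) a by blast
  qed
 qed
 then show ?thesis using isum bc summ R unfolding K_def by blast
qed

end

section \<open>Stokes lines\<close>

context continuation
begin

definition "dq = 2 * pi / (real q + 1)"

text \<open>Here r \<ge> 2 enters: b dq = 2 pi / r \<le> pi. Thus within one spacing of a singular
  direction the imaginary part of the exponent stays between -pi and pi.\<close>

lemma dq: "dq > 0" "b * dq = 2 * pi / real r" "b * dq <= pi"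
proof -
 show "dq > 0" by (simp add: dq_def add_pos_pos)
 show e: "b * dq = 2 * pi / real r" by (simp add: b_def dq_def)
 have "2 * pi / real r <= 2 * pi / 2" using r by (intro divide_left_mono) auto
 then show "b * dq <= pi" unfolding e by simp
qed

lemma sd_dist: "k \<noteq> l ==> dq <= \<bar>sd \<theta> k - sd \<theta> l\<bar>"
 unfolding dq_def
proof -
 assume "k \<noteq> l"
 then have "1 <= \<bar>real_of_int (l - k)\<bar>" by linarith
 then have "2 * pi / (real q + 1) * 1 <= 2 * pi / (real q + 1) * \<bar>real_of_int (l - k)\<bar>" by (intro mult_left_mono) auto
 also have "2 * pi / (real q + 1) * \<bar>real_of_int (l - k)\<bar> = \<bar>2 * pi / (real q + 1) * real_of_int (l - k)\<bar>"
  by (simp add: abs_mult)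
 also have "2 * pi / (real q + 1) * real_of_int (l - k) = sd \<theta> k - sd \<theta> l"
  unfolding sd_def singular_dir_def diff_divide_distrib [symmetric] by (simp add: algebra_simps)
 finally show "2 * pi / (real q + 1) <= \<bar>sd \<theta> k - sd \<theta> l\<bar>" by simp
qed

lemma summable_off_singular:
 assumes z: "norm z <= r1 / 4" and th: "z0 - z = rcis (norm (z0 - z)) \<theta>" and d: "\<And>l. d \<noteq> sd \<theta> l"
 shows "summable_in_direction \<kappa> {z} u d"
proof -
 obtain \<gamma> where g: "\<gamma> > 0" "\<And>l. \<gamma> <= \<bar>sd \<theta> l - d\<bar>" using sd_gap [OF d] by auto
 have cl: "borel_class \<kappa> {z} d (2 * \<gamma>) V c" by (rule V_class [where \<theta> = "%_. \<theta>"]) (use z th g in auto)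
 have zR: "{z} \<subseteq> ball 0 R0" using z pos by simp
 have g2: "0 < 2 * \<gamma>" using g by simp
 obtain v where "borel_continuation \<kappa> (gamma_moment \<kappa>) {z} u d (2 * \<gamma>) v"
  using sum_exists [OF cl zR g2] by (elim exE conjE) (rule that)
 then show ?thesis using g2 unfolding summable_in_direction_def by blast
qed

text \<open>Raising the index l by q + 1 turns the direction by -2 pi, so q + 1 representatives
  cover all singular directions modulo 2 pi.\<close>

lemma kappa_summable_point:
 assumes z: "norm z <= r1 / 4" and th: "z0 - z = rcis (norm (z0 - z)) \<theta>"
 shows "kappa_summable \<kappa> {z} u"
 unfolding kappa_summable_def
proof (intro exI [of _ "sd \<theta> ` {0..int q}"] conjI allI impI)
 fix d assume *: "\<forall>d0\<in>sd \<theta> ` {0..int q}. \<forall>k::int. d \<noteq> d0 + 2 * pi * of_int k"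
 show "summable_in_direction \<kappa> {z} u d"
 proof (rule summable_off_singular [OF z th])
  fix l
  define m where "m = l mod (int q + 1)"
  define k where "k = l div (int q + 1)"
  have "real_of_int l = real_of_int m + (real q + 1) * real_of_int k"
  proof -
   have "l = m + (int q + 1) * k" by (simp add: m_def k_def)
   from arg_cong [OF this, of real_of_int] show ?thesis by simp
  qed
  then have "real r * \<theta> - 2 * pi * real_of_int l - arga = (real r * \<theta> - 2 * pi * real_of_int m - arga) + (2 * pi * real_of_int (- k)) * (real q + 1)"
   by (simp add: algebra_simps)
  then have "sd \<theta> l = sd \<theta> m + 2 * pi * of_int (- k) * (real q + 1) / (real q + 1)"
   unfolding sd_def singular_dir_def by (simp only: add_divide_distrib)
  also have "2 * pi * of_int (- k) * (real q + 1) / (real q + 1) = 2 * pi * of_int (- k)"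
   by (rule nonzero_mult_div_cancel_right) simp
  finally have eq: "sd \<theta> l = sd \<theta> m + 2 * pi * of_int (- k)" .
  have "m < int q + 1" "0 <= m" unfolding m_def by (rule pos_mod_bound, simp, rule pos_mod_sign, simp)
  then have "m \<in> {0..int q}" by simp
  then have "d \<noteq> sd \<theta> m + 2 * pi * of_int (- k)" using * by blast
  then show "d \<noteq> sd \<theta> l" unfolding eq .
 qed
qed simp

definition "wz z = w0 + Ln (1 - z / z0)"
text \<open>The affine coordinate in which the singular direction is the real axis and the singular
  point of the l-th term is 0.\<close>

definition "zt \<theta> l z w = of_real b * (w - \<i> * of_real (sd \<theta> (int l))) + of_real (ln (c0 / norm (z0 - z)))"

lemma exp_wz: "norm z < norm z0 ==> exp (wz z) = z - z0"
 using exp_Lam [of z 0] by (simp add: Lam_def wz_def algebra_simps)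

lemma Psi_zt:
 assumes "norm z < norm z0" "z0 - z = rcis (norm (z0 - z)) \<theta>"
 shows "Psi z (sh l w) = \<Phi> (wz z + Ln (1 - exp (zt \<theta> l z w)))"
 using sh_quotient [OF assms(2) near_ne(1) [OF assms(1)], of l w] by (simp add: Psi_def Lam_def wz_def zt_def)

lemma V_split:
 assumes "l < r"
 shows "of_nat r * V w z = (\<Sum>j\<in>{..<r} - {l}. Psi z (sh j w)) + Psi z (sh l w)"
 using r assms by (simp add: V_def sum.remove [of "{..<r}" l])

text \<open>A term j \<noteq> l is singular only in directions whose index is j modulo r, hence
  never l; these are at least one spacing away.\<close>

lemma other_terms_growth:
 assumes z: "norm z <= r1 / 4" and th: "z0 - z = rcis (norm (z0 - z)) \<theta>" and l: "l < r"
 shows "borel_growth \<kappa> {z} (sd \<theta> (int l)) (2 * dq) (%w z. x * (\<Sum>j\<in>{..<r} - {l}. Psi z (sh j w)))"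
proof -
 have *: "borel_growth \<kappa> {z} (sd \<theta> (int l)) (2 * dq) (%w z. Psi z (sh j w))" if "j \<in> {..<r} - {l}" for j
 proof (rule Psi_sh_growth [where \<theta> = "%_. \<theta>"])
  fix y k assume "y \<in> {z}"
  have "int j - int r * k \<noteq> int l"
  proof
   assume "int j - int r * k = int l"
   then have "int j = int l + int r * k" by simp
   then have "int j mod int r = int l mod int r" by simp
   then show False using that l by simp
  qed
  then show "2 * dq / 2 <= \<bar>sd \<theta> (int j - int r * k) - sd \<theta> (int l)\<bar>" using sd_dist [of "int j - int r * k" "int l" \<theta>] by simp
 qed (use z th in auto)
 obtain j where "j \<in> {..<r} - {l}" using r by (metis DiffI One_nat_def lessThan_iff less_Suc0 less_numeral_extra(1) less_trans singletonD zero_less_one neq0_conv)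
 then show ?thesis by (intro borel_growth_sum [where f = "%j w z. Psi z (sh j w)", OF _ * *]) simp_all
qed

text \<open>If h continues through \<zeta> = 0, it is single valued in \<xi> = 1 - exp \<zeta> near
  0. Written as \<xi> = exp y, a turn around the singularity leaves h unchanged but adds 2 pi \<i>
  to the argument of \<Phi>. So \<Phi> is periodic and descends to the plane without z0, and h fills
  the hole.\<close>

lemma continues_across_imp_entire:
 assumes z: "norm z < norm z0" and be: "0 < \<beta>" "\<beta> <= pi"
  and h: "h holomorphic_on {\<zeta>. \<bar>Im \<zeta>\<bar> < \<beta>}"
  and eq: "\<And>\<zeta>. \<bar>Im \<zeta>\<bar> < \<beta> ==> Re \<zeta> < T ==> h \<zeta> = \<Phi> (wz z + Ln (1 - exp \<zeta>))"
 shows "\<exists>F. F holomorphic_on UNIV \<and> (\<forall>\<^sub>F x in nhds 0. F x = \<phi> x)"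
proof -
 define S where "S = {\<zeta>. 0 < - Im \<zeta> \<and> - Im \<zeta> < \<beta>}"
 have Si: "S = {\<zeta>. Im \<zeta> < 0} \<inter> {\<zeta>. Im \<zeta> > - \<beta>}" by (auto simp: S_def)
 have S: "open S" "convex S" unfolding Si
  by (intro open_Int open_halfspace_Im_lt open_halfspace_Im_gt convex_Int convex_halfspace_Im_lt convex_halfspace_Im_gt)+
 \<comment> \<open>For -pi \<le> -\<beta> < Im \<zeta> < 0 the cut is not met, so the equality
   spreads along the lower half strip past the singular point.\<close>
 have low: "h \<zeta> = \<Phi> (wz z + Ln (1 - exp \<zeta>))" if "\<zeta> \<in> S" for \<zeta>
 proof (rule analytic_continuation_open [of "S \<inter> {\<zeta>. Re \<zeta> < T}" S h "%\<zeta>. \<Phi> (wz z + Ln (1 - exp \<zeta>))"])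
  show "open (S \<inter> {\<zeta>. Re \<zeta> < T})" "open S" "connected S"
   using S by (auto intro: open_Int open_halfspace_Re_lt convex_connected)
  have "Complex (T - 1) (- \<beta> / 2) \<in> S \<inter> {\<zeta>. Re \<zeta> < T}" using be by (simp add: S_def)
  then show "S \<inter> {\<zeta>. Re \<zeta> < T} \<noteq> {}" by blast
  show "h holomorphic_on S" by (rule holomorphic_on_subset [OF h]) (auto simp: S_def)
  have "1 - exp \<zeta> \<notin> \<real>\<^sub>\<le>\<^sub>0" if "\<zeta> \<in> S" for \<zeta>
  proof (rule one_minus_exp_notin_nonpos_Reals)
   fix k :: int
   have i: "- pi < Im \<zeta>" "Im \<zeta> < 0" using that be by (auto simp: S_def)
   consider "k \<ge> 0" | "k <= -1" by linarith
   then show "Im \<zeta> \<noteq> 2 * pi * of_int k"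
   proof cases
    case 1
    then have "2 * pi * of_int k \<ge> 0" by simp
    then show ?thesis using i by linarith
   next
    case 2
    then have "2 * pi * of_int k <= 2 * pi * (-1)" by (intro mult_left_mono) auto
    then show ?thesis using i pi_gt_zero by linarith
   qed
  qed
  then show "(%\<zeta>. \<Phi> (wz z + Ln (1 - exp \<zeta>))) holomorphic_on S"
   by (intro Phi_compose_hol holomorphic_intros) auto
 qed (use eq that in \<open>auto simp: S_def\<close>)
 have "isCont (%\<xi>. Ln (1 - \<xi>)) 0" by (intro continuous_intros) auto
 then obtain s0 where s0: "s0 > 0" "\<And>\<xi>. norm \<xi> < s0 ==> norm (Ln (1 - \<xi>)) < \<beta>"
  unfolding continuous_at_eps_delta using be by (auto simp: dist_norm)
 define s where "s = min s0 1"
 have s: "s > 0" "s <= 1" "\<And>\<xi>. norm \<xi> < s ==> \<bar>Im (Ln (1 - \<xi>))\<bar> < \<beta>"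
 proof -
  show "\<bar>Im (Ln (1 - \<xi>))\<bar> < \<beta>" if "norm \<xi> < s" for \<xi>
   using s0(2) [of \<xi>] that abs_Im_le_cmod [of "Ln (1 - \<xi>)"] by (simp add: s_def)
 qed (use s0 in \<open>auto simp: s_def\<close>)
 have re: "0 < Re (1 - \<xi>)" if "norm \<xi> < s" for \<xi> using that s(2) complex_Re_le_cmod [of \<xi>] by simp
 \<comment> \<open>h in the local coordinate \<xi> at the singularity; the principal logarithm
   selects the \<zeta> near 0.\<close>
 define H where "H \<xi> = h (Ln (1 - \<xi>))" for \<xi>
 have Hh: "H holomorphic_on ball 0 s" unfolding H_def
 proof (rule holomorphic_on_compose_gen [OF _ h, unfolded o_def])
  show "(%\<xi>. Ln (1 - \<xi>)) holomorphic_on ball 0 s"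
   by (intro holomorphic_intros) (use re in \<open>auto simp: complex_nonpos_Reals_iff\<close>, fastforce)
  show "(%\<xi>. Ln (1 - \<xi>)) ` ball 0 s \<subseteq> {\<zeta>. \<bar>Im \<zeta>\<bar> < \<beta>}" using s(3) by auto
 qed
 \<comment> \<open>For 0 < Im y < pi the point 1 - exp y lies in the lower half-plane, where
   \<open>low\<close> applies and Ln (exp y) = y. The identity theorem then frees y from this
   strip.\<close>
 have HP: "H (exp y) = \<Phi> (wz z + y)" if y: "Re y < ln s" for y
 proof (rule analytic_continuation_open [of "{y. Re y < ln s} \<inter> {y. Im y > 0} \<inter> {y. Im y < pi}" "{y. Re y < ln s}" "%y. H (exp y)" "%y. \<Phi> (wz z + y)"])
  show "open ({y. Re y < ln s} \<inter> {y. Im y > 0} \<inter> {y. Im y < pi})" "open {y. Re y < ln s}"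
   by (intro open_Int open_halfspace_Re_lt open_halfspace_Im_lt open_halfspace_Im_gt)+
  show "connected {y. Re y < ln s}" by (intro convex_connected convex_halfspace_Re_lt)
  have "Complex (ln s - 1) 1 \<in> {y. Re y < ln s} \<inter> {y. Im y > 0} \<inter> {y. Im y < pi}" using pi_gt3 by simp
  then show "{y. Re y < ln s} \<inter> {y. Im y > 0} \<inter> {y. Im y < pi} \<noteq> {}" by blast
  have nb: "norm (exp y) < s" if "Re y < ln s" for y :: complex
   using that s(1) by (metis exp_less_cancel_iff exp_ln norm_exp_eq_Re)
  show "(%y. H (exp y)) holomorphic_on {y. Re y < ln s}"
   by (rule holomorphic_on_compose_gen [OF _ Hh, unfolded o_def]) (use nb in \<open>auto intro!: holomorphic_intros simp: dist_norm\<close>)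
  show "(%y. \<Phi> (wz z + y)) holomorphic_on {y. Re y < ln s}" by (intro Phi_compose_hol holomorphic_intros)
  fix y assume "y \<in> {y. Re y < ln s} \<inter> {y. Im y > 0} \<inter> {y. Im y < pi}"
  then have y: "Re y < ln s" "0 < Im y" "Im y < pi" by auto
  define \<zeta> where "\<zeta> = Ln (1 - exp y)"
  have ne: "1 - exp y \<noteq> 0" using re [OF nb [OF y(1)]] by auto
  have "Im (exp y) > 0" using y by (simp add: Im_exp sin_gt_zero)
  then have "Im (1 - exp y) < 0" by simp
  then have "Im \<zeta> < 0" using Im_Ln_pos_le [OF ne] Im_Ln_le_pi [OF ne] unfolding \<zeta>_def by linarith
  then have "\<zeta> \<in> S" using s(3) [OF nb [OF y(1)]] by (auto simp: S_def \<zeta>_def)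
  from low [OF this] have "h \<zeta> = \<Phi> (wz z + Ln (exp y))" using ne by (simp add: \<zeta>_def)
  moreover have "Ln (exp y) = y" by (rule Ln_exp) (use y in auto)
  ultimately show "H (exp y) = \<Phi> (wz z + y)" by (simp add: H_def \<zeta>_def)
 qed (use y in auto)
 have per: "\<Phi> (y + 2 * of_real pi * \<i>) = \<Phi> y" for y
 proof (rule analytic_continuation_open [of "{y. Re y < ln s + Re (wz z)}" UNIV "%y. \<Phi> (y + 2 * of_real pi * \<i>)" \<Phi>])
  show "open {y. Re y < ln s + Re (wz z)}" by (rule open_halfspace_Re_lt)
  have "of_real (ln s + Re (wz z) - 1) \<in> {y. Re y < ln s + Re (wz z)}" by simp
  then show "{y. Re y < ln s + Re (wz z)} \<noteq> {}" by blast
  show "(%y. \<Phi> (y + 2 * of_real pi * \<i>)) holomorphic_on UNIV" by (intro Phi_compose_hol holomorphic_intros)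
  fix y assume "y \<in> {y. Re y < ln s + Re (wz z)}"
  then have "Re (y - wz z) < ln s" "Re (y + 2 * of_real pi * \<i> - wz z) < ln s" by auto
  from HP [OF this(1)] HP [OF this(2)] show "\<Phi> (y + 2 * of_real pi * \<i>) = \<Phi> y"
   by (simp add: exp_add exp_diff)
 qed (use Phi_hol in \<open>auto simp: convex_connected\<close>)
 have pern: "\<Phi> (y + of_nat n * (2 * of_real pi * \<i>)) = \<Phi> y" for y n
 proof (induction n)
  case (Suc n)
  have "y + of_nat (Suc n) * (2 * of_real pi * \<i>) = (y + of_nat n * (2 * of_real pi * \<i>)) + 2 * of_real pi * \<i>"
   by (simp add: algebra_simps)
  then have "\<Phi> (y + of_nat (Suc n) * (2 * of_real pi * \<i>)) = \<Phi> ((y + of_nat n * (2 * of_real pi * \<i>)) + 2 * of_real pi * \<i>)"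
   by (simp only:)
  also have "\<dots> = \<Phi> (y + of_nat n * (2 * of_real pi * \<i>))" by (rule per)
  finally show ?case using Suc by (simp only:)
 qed simp
 have inv: "\<Phi> x = \<Phi> y" if e: "exp x = exp y" for x y
 proof -
  obtain k :: int where k: "x = y + (of_int (2 * k) * pi) * \<i>" using e unfolding exp_eq by blast
  show ?thesis
  proof (cases "k \<ge> 0")
   case True
   then have "x = y + of_nat (nat k) * (2 * of_real pi * \<i>)" unfolding k by (simp add: mult_ac)
   then show ?thesis using pern by simp
  next
   case False
   then have "y = x + of_nat (nat (- k)) * (2 * of_real pi * \<i>)" unfolding k by (simp add: mult_ac)
   then show ?thesis using pern by simp
  qed
 qed
 \<comment> \<open>By \<open>inv\<close> the choice of the logarithm is immaterial;
   \<open>H 0\<close> is the limit at z0.\<close>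
 define F where "F x = (if x = z0 then H 0 else \<Phi> (Ln (x - z0)))" for x
 have zz: "z - z0 \<noteq> 0" using near_ne(1) [OF z] by auto
 have F1: "F x = H ((x - z0) / (z - z0))" if "x \<in> ball z0 (s * norm (z - z0))" for x
 proof (cases "x = z0")
  case False
  define \<xi> where "\<xi> = (x - z0) / (z - z0)"
  have xi: "\<xi> \<noteq> 0" "norm \<xi> < s" using False zz that by (auto simp: \<xi>_def norm_divide divide_less_eq dist_norm norm_minus_commute)
  have "Re (Ln \<xi>) < ln s" using xi s(1) by simp
  from HP [OF this] have "H \<xi> = \<Phi> (wz z + Ln \<xi>)" using xi by simp
  also have "\<dots> = \<Phi> (Ln (x - z0))"
   by (rule inv) (use xi False zz exp_wz [OF z] in \<open>simp add: exp_add \<xi>_def\<close>)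
  finally show ?thesis using False by (simp add: F_def \<xi>_def)
 qed (simp add: F_def)
 have Fd: "F field_differentiable at x" for x
 proof -
  \<comment> \<open>Three charts: a disc at z0 where F is H, the plane off the cut of Ln (x - z0),
    and the cut itself, reached by the branch Ln (z0 - x) + \<i> pi.\<close>
  have c1: "x = z0 \<or> x - z0 \<notin> \<real>\<^sub>\<le>\<^sub>0 \<or> z0 - x \<notin> \<real>\<^sub>\<le>\<^sub>0"
   by (auto simp: complex_nonpos_Reals_iff complex_eq_iff)
  have op: "open {x. f x \<notin> \<real>\<^sub>\<le>\<^sub>0}" if "continuous_on UNIV f" for f :: "complex => complex"
  proof -
   have "{x. f x \<notin> \<real>\<^sub>\<le>\<^sub>0} = f -` (- \<real>\<^sub>\<le>\<^sub>0)" by auto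
   then show ?thesis using open_vimage [OF _ that, of "- \<real>\<^sub>\<le>\<^sub>0"] by (simp add: open_Compl)
  qed
  have o: "open {x. x - z0 \<notin> \<real>\<^sub>\<le>\<^sub>0}" "open {x. z0 - x \<notin> \<real>\<^sub>\<le>\<^sub>0}"
   by (rule op, intro continuous_intros)+
  have "\<exists>A. open A \<and> x \<in> A \<and> F holomorphic_on A"
   using c1
  proof (elim disjE)
   assume x: "x = z0"
   have "(%x. H ((x - z0) / (z - z0))) holomorphic_on ball z0 (s * norm (z - z0))"
   proof (rule holomorphic_on_compose_gen [OF _ Hh, unfolded o_def])
    show "(%x. (x - z0) / (z - z0)) holomorphic_on ball z0 (s * norm (z - z0))" by (intro holomorphic_intros) (use zz in auto)
    show "(%x. (x - z0) / (z - z0)) ` ball z0 (s * norm (z - z0)) \<subseteq> ball 0 s"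
     using zz by (auto simp: norm_divide divide_less_eq dist_norm norm_minus_commute)
   qed
   then have "F holomorphic_on ball z0 (s * norm (z - z0))" by (rule holomorphic_transform) (use F1 in simp)
   then show ?thesis using x zz s by (intro exI [of _ "ball z0 (s * norm (z - z0))"]) auto
  next
   assume x: "x - z0 \<notin> \<real>\<^sub>\<le>\<^sub>0"
   have "(%x. \<Phi> (Ln (x - z0))) holomorphic_on {x. x - z0 \<notin> \<real>\<^sub>\<le>\<^sub>0}" by (intro Phi_compose_hol holomorphic_intros) auto
   then have "F holomorphic_on {x. x - z0 \<notin> \<real>\<^sub>\<le>\<^sub>0}" by (rule holomorphic_transform) (auto simp: F_def)
   then show ?thesis using x o(1) by (intro exI [of _ "{x. x - z0 \<notin> \<real>\<^sub>\<le>\<^sub>0}"]) simp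
  next
   assume x: "z0 - x \<notin> \<real>\<^sub>\<le>\<^sub>0"
   have "(%x. \<Phi> (Ln (z0 - x) + \<i> * of_real pi)) holomorphic_on {x. z0 - x \<notin> \<real>\<^sub>\<le>\<^sub>0}" by (intro Phi_compose_hol holomorphic_intros) auto
   then have "F holomorphic_on {x. z0 - x \<notin> \<real>\<^sub>\<le>\<^sub>0}"
   proof (rule holomorphic_transform)
    fix x assume "x \<in> {x. z0 - x \<notin> \<real>\<^sub>\<le>\<^sub>0}"
    then have "x \<noteq> z0" by auto
    moreover have "\<Phi> (Ln (z0 - x) + \<i> * of_real pi) = \<Phi> (Ln (x - z0))"
     by (rule inv) (use \<open>x \<noteq> z0\<close> in \<open>simp add: exp_add exp_pi_i'\<close>)
    ultimately show "\<Phi> (Ln (z0 - x) + \<i> * of_real pi) = F x" by (simp add: F_def)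
   qed
   then show ?thesis using x o(2) by (intro exI [of _ "{x. z0 - x \<notin> \<real>\<^sub>\<le>\<^sub>0}"]) simp
  qed
  then show ?thesis using holomorphic_on_imp_differentiable_at by blast
 qed
 have "F holomorphic_on UNIV" using Fd by (simp add: holomorphic_on_def)
 moreover have "\<forall>\<^sub>F x in nhds 0. F x = \<phi> x"
 proof -
  have "\<forall>\<^sub>F x in nhds 0. x \<in> ball 0 r1" by (rule eventually_nhds_in_open) (use pos in auto)
  then show ?thesis
  proof eventually_elim
   case (elim x)
   then have x: "norm x < r1" "norm x < norm z0" using pos by auto
   then have "x \<noteq> z0" by auto
   moreover have "\<Phi> (Ln (x - z0)) = \<Phi> (wz x)" by (rule inv) (use exp_wz [OF x(2)] \<open>x \<noteq> z0\<close> in simp)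
   ultimately show ?case using F0_eq [OF x(1)] by (simp add: F_def wz_def)
  qed
 qed
 ultimately show ?thesis by blast
qed

text \<open>The inverse multiplier turns an assumed Gamma-Borel continuation into a continuation of
  \<open>V\<close> across the direction. Subtracting the terms j \<noteq> l, which are regular
  there, leaves a continuation of the singular term.\<close>

lemma singular_not_summable:
 assumes z: "norm z <= r1 / 4" and th: "z0 - z = rcis (norm (z0 - z)) \<theta>" and l: "l < r"
  and s: "summable_in_direction \<kappa> {z} u (sd \<theta> (int l))"
 shows "\<exists>F. F holomorphic_on UNIV \<and> (\<forall>\<^sub>F x in nhds 0. F x = \<phi> x)"
proof -
 define d where "d = sd \<theta> (int l)"
 have zn: "norm z < norm z0" "z \<in> ball 0 R0" using z pos by auto
 obtain \<epsilon> v where ep: "\<epsilon> > 0" and v: "borel_continuation \<kappa> (gamma_moment \<kappa>) {z} u d \<epsilon> v"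
  using s unfolding summable_in_direction_def d_def by blast
 obtain P Q where PQ: "multiplier_pair \<kappa> (%x. gamma_moment \<kappa> x / moment_pqr p q r x) P Q"
  using multiplier_moment_ratio(2) [OF r, of p q] unfolding multiplier_def \<kappa>_def by blast
 have "borel_class \<kappa> {z} d \<epsilon> (P v) (%n z. gamma_moment \<kappa> (of_nat n) / moment_pqr p q r (of_nat n) * (fps_nth (u z) n / gamma_moment \<kappa> (of_nat n)))"
  by (rule multiplier_pairD(1) [OF PQ class_of_borel_continuation [OF v]])
 moreover have "gamma_moment \<kappa> (of_nat n) / moment_pqr p q r (of_nat n) * (fps_nth (u z) n / gamma_moment \<kappa> (of_nat n)) = c n z" for n z
  using moments_nonzero(1) [OF r, of "of_nat n" p q] by (simp add: c_def \<kappa>_def)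
 ultimately have Pv: "borel_class \<kappa> {z} d \<epsilon> (P v) c" by (simp only: fun_eq_iff)
 obtain \<rho> B where rh: "\<rho> > 0" and sm: "\<And>w z'. w \<in> sector d \<epsilon> ==> exp (Re w) < \<rho> ==> z' \<in> {z} ==> (%n. c n z' * exp (of_nat n * w)) sums P v w z'"
  by (rule borel_classE [OF Pv], rule that)
 \<comment> \<open>The other terms are regular up to one spacing on either side of d.\<close>
 define \<epsilon>' where "\<epsilon>' = min \<epsilon> (2 * dq)"
 have e': "\<epsilon>' > 0" "\<epsilon>' <= \<epsilon>" "\<epsilon>' <= 2 * dq" using ep dq(1) by (auto simp: \<epsilon>'_def)
 have sub: "sector d \<epsilon>' \<subseteq> sector d \<epsilon>" "sector d \<epsilon>' \<subseteq> sector d (2 * dq)"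
  using e' by (auto simp: sector_def)
 define H where "H w = of_nat r * P v w z - 1 * (\<Sum>j\<in>{..<r} - {l}. Psi z (sh j w))" for w
 have Hh: "H holomorphic_on sector d \<epsilon>'" unfolding H_def
 proof (intro holomorphic_on_diff holomorphic_on_mult holomorphic_on_const)
  show "(%w. P v w z) holomorphic_on sector d \<epsilon>'"
   using Pv sub(1) by (auto simp: borel_class_def borel_growth_def intro: holomorphic_on_subset)
  have "(%w. 1 * (\<Sum>j\<in>{..<r} - {l}. Psi z (sh j w))) holomorphic_on sector d (2 * dq)"
   using other_terms_growth [OF z th l, of 1] unfolding borel_growth_def d_def by blast
  then show "(%w. \<Sum>j\<in>{..<r} - {l}. Psi z (sh j w)) holomorphic_on sector d \<epsilon>'"
   using sub(2) by (auto intro: holomorphic_on_subset)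
 qed
 have HPsi: "H w = Psi z (sh l w)" if "w \<in> sector d \<epsilon>'" "exp (Re w) < min \<rho> rho" for w
 proof -
  have "(%n. c n z * exp (of_nat n * w)) sums P v w z" by (rule sm) (use that sub in auto)
  moreover have "(%n. c n z * exp (of_nat n * w)) sums V w z" by (rule V_series [OF z rho(2)]) (use that in auto)
  ultimately have "P v w z = V w z" by (rule sums_unique2)
  then show ?thesis using V_split [OF l, of w z] by (simp add: H_def)
 qed
 define lam where "lam = ln (c0 / norm (z0 - z))"
 \<comment> \<open>The inverse of the coordinate change \<open>zt\<close>.\<close>
 define wf where "wf \<zeta> = \<i> * of_real d + (\<zeta> - of_real lam) / of_real b" for \<zeta>
 have zw: "zt \<theta> l z (wf \<zeta>) = \<zeta>" for \<zeta> using pos(2) by (simp add: zt_def wf_def d_def lam_def)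
 have iw: "Im (wf \<zeta>) - d = Im \<zeta> / b" "Re (wf \<zeta>) = (Re \<zeta> - lam) / b" for \<zeta>
  by (simp_all add: wf_def)
 define \<beta> where "\<beta> = b * \<epsilon>' / 2"
 show ?thesis
 proof (rule continues_across_imp_entire [OF zn(1), of \<beta> "%\<zeta>. H (wf \<zeta>)" "b * ln (min \<rho> rho) + lam"])
  show "0 < \<beta>" using e' pos by (simp add: \<beta>_def)
  have "\<beta> <= b * dq" unfolding \<beta>_def using e' pos(2) by simp
  also have "\<dots> <= pi" by (rule dq)
  finally show "\<beta> <= pi" .
  have ws: "wf \<zeta> \<in> sector d \<epsilon>'" if "\<bar>Im \<zeta>\<bar> < \<beta>" for \<zeta>
   using that pos(2) by (simp add: sector_def iw \<beta>_def abs_divide divide_less_eq mult.commute)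
  show "(%\<zeta>. H (wf \<zeta>)) holomorphic_on {\<zeta>. \<bar>Im \<zeta>\<bar> < \<beta>}"
  proof (rule holomorphic_on_compose_gen [OF _ Hh, unfolded o_def])
   show "wf holomorphic_on {\<zeta>. \<bar>Im \<zeta>\<bar> < \<beta>}" unfolding wf_def by (intro holomorphic_intros) (use pos in auto)
  qed (use ws in auto)
  fix \<zeta> assume *: "\<bar>Im \<zeta>\<bar> < \<beta>" "Re \<zeta> < b * ln (min \<rho> rho) + lam"
  have "Re (wf \<zeta>) < ln (min \<rho> rho)" unfolding iw using *(2) pos(2) by (simp add: divide_less_eq mult.commute)
  then have "exp (Re (wf \<zeta>)) < min \<rho> rho" using rh rho(1) by (metis exp_less_cancel_iff exp_ln min_less_iff_conj)
  from HPsi [OF ws [OF *(1)] this] show "H (wf \<zeta>) = \<Phi> (wz z + Ln (1 - exp \<zeta>))"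
   unfolding Psi_zt [OF zn(1) th] zw .
 qed
qed

end

section \<open>The jump\<close>

text \<open>For a contour independent of t the three pieces are parameter integrals, each with its
  own majorant; the middle one has bounded length.\<close>

lemma path_int_holomorphic:
 fixes g :: "complex => complex => complex"
 assumes S: "open S" and eta: "0 < \<eta>" "0 < \<eta>'"
  and n: "\<And>w. Re w <= X ==> Im w = \<theta>1 ==> (%t. g t w) holomorphic_on S"
   "\<And>t. t \<in> S ==> continuous_on {w. Re w <= X \<and> Im w = \<theta>1} (g t)"
   "\<And>t w. t \<in> S ==> Re w <= X ==> Im w = \<theta>1 ==> norm (g t w) <= C * exp (- (\<eta> * \<bar>Re w\<bar>))"
  and m: "\<And>w. Re w = X ==> Im w \<in> closed_segment \<theta>1 \<theta>2 ==> (%t. g t w) holomorphic_on S"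
   "\<And>t. t \<in> S ==> continuous_on {w. Re w = X \<and> Im w \<in> closed_segment \<theta>1 \<theta>2} (g t)"
   "\<And>t w. t \<in> S ==> Re w = X ==> Im w \<in> closed_segment \<theta>1 \<theta>2 ==> norm (g t w) <= C''"
  and f: "\<And>w. X <= Re w ==> Im w = \<theta>2 ==> (%t. g t w) holomorphic_on S"
   "\<And>t. t \<in> S ==> continuous_on {w. X <= Re w \<and> Im w = \<theta>2} (g t)"
   "\<And>t w. t \<in> S ==> X <= Re w ==> Im w = \<theta>2 ==> norm (g t w) <= C' * exp (- (\<eta>' * \<bar>Re w\<bar>))"
 shows "(%t. path_int (g t) X \<theta>1 \<theta>2) holomorphic_on S"
proof -
 have piece: "(%t. (LINT y:A|lborel. k t y)) holomorphic_on S"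
  if A: "A \<in> sets borel" and k: "\<And>y. y \<in> A ==> (%t. k t y) holomorphic_on S" "\<And>t. t \<in> S ==> continuous_on A (k t)"
   and b: "\<And>t y. t \<in> S ==> y \<in> A ==> norm (k t y) <= B y" and Bi: "integrable lborel (%y. indicator A y * B y)"
  for A :: "real set" and k :: "complex => real => complex" and B
  unfolding set_lebesgue_integral_def
 proof (rule holomorphic_on_integral [OF S])
  show "(%y. indicator A y *\<^sub>R k t y) \<in> borel_measurable lborel" if "t \<in> S" for t
   using borel_measurable_continuous_on_indicator [OF A k(2) [OF that]] by simp
  show "(%t. indicator A y *\<^sub>R k t y) holomorphic_on S" for y
   using k(1) [of y] by (cases "y \<in> A") auto
  show "\<exists>\<delta>>0. \<exists>g. integrable lborel g \<and> (\<forall>t\<in>ball x \<delta> \<inter> S. \<forall>y\<in>space lborel. norm (indicator A y *\<^sub>R k t y) <= g y)" for x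
   by (rule exI [of _ 1], rule conjI, simp, rule exI, rule conjI, rule Bi) (use b in \<open>auto simp: indicator_def\<close>)
 qed
 have ei: "integrable lborel (%y. indicator A y * (D * exp (- (x * \<bar>y\<bar>))))" if "x > 0" "A \<in> sets borel" for A :: "real set" and D x :: real
 proof -
  have "integrable lborel (%y. D * exp (- (x * \<bar>y\<bar>)))" using integrable_exp_neg_abs [OF that(1)] by simp
  from integrable_mult_indicator [OF _ this, of A] that(2) show ?thesis by simp
 qed
 have sg: "\<theta>1 + x * (\<theta>2 - \<theta>1) \<in> closed_segment \<theta>1 \<theta>2" if "x \<in> {0..1}" for x
  using that unfolding closed_segment_def by (auto intro!: exI [of _ x] simp: algebra_simps)
 have 1: "(%t. (LINT y:{..X}|lborel. g t (Complex y \<theta>1))) holomorphic_on S"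
 proof (rule piece [where B = "%y. C * exp (- (\<eta> * \<bar>y\<bar>))"])
  show "(%t. g t (Complex y \<theta>1)) holomorphic_on S" if "y \<in> {..X}" for y by (rule n(1)) (use that in auto)
  show "continuous_on {..X} (%y. g t (Complex y \<theta>1))" if "t \<in> S" for t
   by (rule continuous_on_compose2 [OF n(2) [OF that]]) (auto intro!: continuous_intros)
  show "norm (g t (Complex y \<theta>1)) <= C * exp (- (\<eta> * \<bar>y\<bar>))" if "t \<in> S" "y \<in> {..X}" for t y
   using n(3) [OF that(1), of "Complex y \<theta>1"] that by simp
 qed (use ei [OF eta(1)] in auto)
 have 3: "(%t. (LINT y:{X..}|lborel. g t (Complex y \<theta>2))) holomorphic_on S"
 proof (rule piece [where B = "%y. C' * exp (- (\<eta>' * \<bar>y\<bar>))"])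
  show "(%t. g t (Complex y \<theta>2)) holomorphic_on S" if "y \<in> {X..}" for y by (rule f(1)) (use that in auto)
  show "continuous_on {X..} (%y. g t (Complex y \<theta>2))" if "t \<in> S" for t
   by (rule continuous_on_compose2 [OF f(2) [OF that]]) (auto intro!: continuous_intros)
  show "norm (g t (Complex y \<theta>2)) <= C' * exp (- (\<eta>' * \<bar>y\<bar>))" if "t \<in> S" "y \<in> {X..}" for t y
   using f(3) [OF that(1), of "Complex y \<theta>2"] that by simp
 qed (use ei [OF eta(2)] in auto)
 have 2: "(%t. vertical_int (g t) X \<theta>1 \<theta>2) holomorphic_on S" unfolding vertical_int_def
 proof (rule piece [where B = "%y. \<bar>\<theta>2 - \<theta>1\<bar> * C''"])
  show "(%t. \<i> * of_real (\<theta>2 - \<theta>1) * g t (Complex X (\<theta>1 + x * (\<theta>2 - \<theta>1)))) holomorphic_on S" if "x \<in> {0..1}" for x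
   by (intro holomorphic_intros m(1)) (use sg [OF that] in auto)
  show "continuous_on {0..1} (%x. \<i> * of_real (\<theta>2 - \<theta>1) * g t (Complex X (\<theta>1 + x * (\<theta>2 - \<theta>1))))" if "t \<in> S" for t
   by (intro continuous_intros continuous_on_compose2 [OF m(2) [OF that]]) (use sg in \<open>auto simp: Complex_eq intro!: continuous_intros\<close>)
  show "norm (\<i> * of_real (\<theta>2 - \<theta>1) * g t (Complex X (\<theta>1 + x * (\<theta>2 - \<theta>1)))) <= \<bar>\<theta>2 - \<theta>1\<bar> * C''" if "t \<in> S" "x \<in> {0..1}" for t x
  proof -
   have "norm (g t (Complex X (\<theta>1 + x * (\<theta>2 - \<theta>1)))) <= C''" by (rule m(3) [OF that(1)]) (use sg [OF that(2)] in auto)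
   then have "\<bar>\<theta>2 - \<theta>1\<bar> * norm (g t (Complex X (\<theta>1 + x * (\<theta>2 - \<theta>1)))) <= \<bar>\<theta>2 - \<theta>1\<bar> * C''" by (rule mult_left_mono) simp
   then show ?thesis by (simp only: norm_mult norm_ii norm_of_real mult_1_left)
  qed
  show "integrable lborel (%y. indicator {0..1::real} y * (\<bar>\<theta>2 - \<theta>1\<bar> * C''))" by simp
 qed simp
 show ?thesis unfolding path_int_def by (intro holomorphic_on_add 1 2 3)
qed

text \<open>The condition 2 \<epsilon> < dq keeps the sectors between d and d \<plusminus> 2
  \<epsilon>, on which the lateral sums are taken, away from the neighbouring singular
  directions.\<close>

locale stokes_jump = continuation +
 fixes z :: complex and \<theta> :: real and l :: nat and \<epsilon> :: real
 assumes zr: "norm z <= r1 / 4" and th: "z0 - z = rcis (norm (z0 - z)) \<theta>" and l: "l < r"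
  and eps: "0 < \<epsilon>" "2 * \<epsilon> < dq"
begin

definition "d = sd \<theta> (int l)"
definition "P = pi / \<kappa> / 2"
definition "lam = ln (c0 / norm (z0 - z))"
text \<open>The logarithm of the modulus of the singular point on the ray d, where |sh l w| = |z0 -
  z|.\<close>

definition "X0 = - lam / b"
definition "X = X0 + 1"
definition "\<zeta> w = zt \<theta> l z w"
definition "Rest w = (\<Sum>j\<in>{..<r} - {l}. Psi z (sh j w))"
text \<open>The singular term continued across the ray from one side, s = 1 from above and s = -1
  from below. Since 1 - exp \<zeta> = -(exp \<zeta> - 1), the logarithm used here is the branch that
  agrees with Ln (1 - exp \<zeta>) on side s; its cut on the ray d lies before the singular point
  instead of behind it.\<close>

definition "X\<Phi> s w = \<Phi> (wz z + Ln (exp (\<zeta> w) - 1) - of_real s * (\<i> * of_real pi))"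
definition "Vp s w = (1 / of_nat r) * (Rest w + X\<Phi> s w)"
definition "side s = {w. 0 < s * (Im w - d) \<and> s * (Im w - d) < dq}"
definition "far = {w. X0 < Re w \<and> \<bar>Im w - d\<bar> < dq}"

lemma P: "P > 0" using pos(1) by (simp add: P_def)

lemma zn: "norm z < norm z0" "norm z < r1" "z \<in> ball 0 R0" "z0 - z \<noteq> 0"
proof -
 show n: "norm z < norm z0" "norm z < r1" "z \<in> ball 0 R0" using zr pos by auto
 show "z0 - z \<noteq> 0" by (rule near_ne(1) [OF n(1)])
qed

lemma zeta: "Re (\<zeta> w) = b * (Re w - X0)" "Im (\<zeta> w) = b * (Im w - d)"
proof -
 have "b * X0 = - lam" using pos(2) by (simp add: X0_def)
 then show "Re (\<zeta> w) = b * (Re w - X0)" by (simp add: \<zeta>_def zt_def lam_def right_diff_distrib)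
 show "Im (\<zeta> w) = b * (Im w - d)" by (simp add: \<zeta>_def zt_def d_def)
qed

lemma zeta_hol: "\<zeta> holomorphic_on S"
 unfolding \<zeta>_def [abs_def] zt_def by (intro holomorphic_intros)

lemma Im_zeta: "0 < s * (Im w - d) ==> s * (Im w - d) < dq ==> 0 < s * Im (\<zeta> w) \<and> s * Im (\<zeta> w) < pi"
proof -
 assume *: "0 < s * (Im w - d)" "s * (Im w - d) < dq"
 have "s * Im (\<zeta> w) = b * (s * (Im w - d))" by (simp add: zeta)
 moreover have "b * (s * (Im w - d)) < b * dq" using * pos(2) by simp
 moreover have "0 < b * (s * (Im w - d))" using * pos(2) by simp
 ultimately show ?thesis using dq(3) by linarith
qed

text \<open>On a side 0 < |Im \<zeta>| < pi, so exp \<zeta> is not real; in \<open>far\<close> it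
  can be real only on the ray d, and there it exceeds 1.\<close>

lemma branch:
 assumes s: "s = 1 \<or> s = - 1" and w: "w \<in> side s \<union> far"
 shows "exp (\<zeta> w) - 1 \<notin> \<real>\<^sub>\<le>\<^sub>0"
proof
 assume *: "exp (\<zeta> w) - 1 \<in> \<real>\<^sub>\<le>\<^sub>0"
 then have i0: "sin (Im (\<zeta> w)) = 0" and re: "exp (Re (\<zeta> w)) * cos (Im (\<zeta> w)) <= 1"
  by (auto simp: complex_nonpos_Reals_iff Im_exp Re_exp)
 have "\<bar>Im (\<zeta> w)\<bar> < pi"
 proof -
  have "\<bar>Im w - d\<bar> < dq" using w s by (auto simp: side_def far_def)
  then have "b * \<bar>Im w - d\<bar> < b * dq" using pos(2) by (rule mult_strict_left_mono)
  moreover have "\<bar>Im (\<zeta> w)\<bar> = b * \<bar>Im w - d\<bar>" using pos(2) by (simp add: zeta abs_mult)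
  ultimately show ?thesis using dq(3) by linarith
 qed
 then have "Im (\<zeta> w) = 0" using i0 sin_eq_0_pi [of "Im (\<zeta> w)"] by (simp add: abs_less_iff)
 then have "Im w = d" using pos(2) by (simp add: zeta)
 then have "X0 < Re w" using w by (auto simp: side_def far_def)
 then have "0 < Re (\<zeta> w)" using pos(2) by (simp add: zeta)
 then show False using re \<open>Im (\<zeta> w) = 0\<close> by simp
qed

text \<open>Ln (-y) differs from Ln y by \<i> pi with the sign of Im y, and on side s that sign is
  s.\<close>

lemma Vp_eq:
 assumes s: "s = 1 \<or> s = - 1" and w: "w \<in> side s"
 shows "Vp s w = V w z"
proof -
 have i: "0 < s * Im (\<zeta> w)" "s * Im (\<zeta> w) < pi" using Im_zeta w by (auto simp: side_def)
 define y where "y = exp (\<zeta> w) - 1"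
 have "y \<noteq> 0" using branch [OF s, of w] w by (auto simp: y_def)
 have iy: "Im y = exp (Re (\<zeta> w)) * sin (Im (\<zeta> w))" by (simp add: y_def Im_exp)
 have "Ln (- y) = Ln y - of_real s * (\<i> * of_real pi)"
  using s
 proof
  assume s1: "s = 1"
  then have "Im y > 0" unfolding iy using i by (simp add: sin_gt_zero)
  then show ?thesis using Ln_minus [OF \<open>y \<noteq> 0\<close>] s1 by simp
 next
  assume s1: "s = - 1"
  then have "sin (- Im (\<zeta> w)) > 0" using i by (intro sin_gt_zero) auto
  then have "Im y < 0" unfolding iy by (simp add: mult_less_0_iff)
  then show ?thesis using Ln_minus [OF \<open>y \<noteq> 0\<close>] s1 by simp
 qed
 then have "wz z + Ln y - of_real s * (\<i> * of_real pi) = wz z + Ln (- y)" by simp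
 moreover have "- y = 1 - exp (zt \<theta> l z w)" by (simp add: y_def \<zeta>_def)
 ultimately have "X\<Phi> s w = Psi z (sh l w)"
  unfolding Psi_zt [OF zn(1) th] X\<Phi>_def y_def [symmetric] by (simp only:)
 then show ?thesis using V_split [OF l, of w z] r by (simp add: Vp_def Rest_def field_simps)
qed

lemma Rest_growth: "borel_growth \<kappa> {z} d (2 * dq) (%w x. y * Rest w)"
proof -
 have g: "borel_growth \<kappa> {z} d (2 * dq) (%w x. y * (\<Sum>j\<in>{..<r} - {l}. Psi x (sh j w)))"
  using other_terms_growth [OF zr th l] unfolding d_def .
 show ?thesis
 proof (rule borel_growthI)
  show "(%x. y * Rest w) \<in> A_space {z}" for w by (simp add: A_space_def)
  show "(%w. y * Rest w) holomorphic_on sector d (2 * dq)" for x using g by (simp add: borel_growth_def Rest_def)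
  fix \<delta> :: real assume "\<delta> > 0"
  then show "\<exists>C1>0. \<exists>C2>0. \<forall>w. \<bar>Im w - d\<bar> <= 2 * dq / 2 - \<delta> --> (\<forall>x\<in>{z}. norm (y * Rest w) <= C1 * exp (C2 * exp (\<kappa> * Re w)))"
   using g unfolding borel_growth_def Rest_def by simp
 qed
qed

lemma Vp_hol:
 assumes s: "s = 1 \<or> s = - 1"
 shows "Vp s holomorphic_on side s \<union> far"
proof -
 have "(%w. 1 * Rest w) holomorphic_on sector d (2 * dq)" using Rest_growth [of 1] by (simp add: borel_growth_def)
 moreover have "side s \<union> far \<subseteq> sector d (2 * dq)" using s by (auto simp: side_def far_def sector_def)
 ultimately have "Rest holomorphic_on side s \<union> far" by (auto intro: holomorphic_on_subset)
 moreover have "X\<Phi> s holomorphic_on side s \<union> far" unfolding X\<Phi>_def [abs_def]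
  by (intro Phi_compose_hol holomorphic_intros zeta_hol) (use branch [OF s] in auto)
 ultimately show ?thesis unfolding Vp_def [abs_def] by (intro holomorphic_on_mult holomorphic_on_const holomorphic_on_add)
qed

lemma V_side_class:
 assumes s: "s = 1 \<or> s = - 1" and x: "0 < x" "2 * x <= dq"
 shows "borel_class \<kappa> {z} (d + s * x) (2 * x) V c"
proof (rule V_class [where \<theta> = "%_. \<theta>"])
 fix y k assume "y \<in> {z}"
 show "2 * x / 2 <= \<bar>sd \<theta> k - (d + s * x)\<bar>"
 proof (cases "k = int l")
  case True
  then show ?thesis using s x by (auto simp: d_def)
 next
  case False
  from sd_dist [OF this, of \<theta>] show ?thesis using s x unfolding d_def by auto
 qed
qed (use zr th in auto)

text \<open>There is no condition on Re t: for Re w \<le> X the function is bounded and the decay of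
  the kernel at the origin suffices. Only the constants degenerate as the direction approaches the
  ray d.\<close>

lemma near_bound:
 assumes s: "s = 1 \<or> s = - 1" and dl: "0 < \<delta>"
 shows "\<exists>\<eta>>0. \<exists>C>0. \<forall>w t. Re w <= X --> \<delta> <= s * (Im w - d) --> s * (Im w - d) <= dq - \<delta> --> \<bar>Im w - Im t\<bar> <= P - \<delta> -->
  norm (e (w - t) * Vp s w) <= C * exp (\<eta> * \<bar>Re t\<bar>) * exp (- (\<eta> * \<bar>Re w\<bar>))"
proof -
 obtain A B \<eta> where AB: "A > 0" "B > 0" "\<eta> > 0"
  and bd: "\<And>w. \<bar>Im w\<bar> <= pi / \<kappa> / 2 - \<delta> ==> norm (e w) <= A * exp (- (\<eta> * \<bar>Re w\<bar>)) * exp (- (B * exp (\<kappa> * Re w)))"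
  by (rule kernel_decayE [OF kernel(2) dl], rule that)
 have bg: "borel_growth \<kappa> {z} (d + s * (dq / 2)) (2 * (dq / 2)) V" using V_side_class [OF s, of "dq / 2"] dq(1) by (simp add: borel_class_def)
 obtain C1 C2 where C: "C1 > 0" "C2 > 0"
  and vb: "\<And>w y. \<bar>Im w - (d + s * (dq / 2))\<bar> <= 2 * (dq / 2) / 2 - \<delta> ==> y \<in> {z} ==> norm (V w y) <= C1 * exp (C2 * exp (\<kappa> * Re w))"
  by (rule borel_growthE [OF bg dl], rule that)
 define D where "D = C1 * exp (C2 * exp (\<kappa> * X))"
 have D: "D > 0" using C by (simp add: D_def)
 have "norm (e (w - t) * Vp s w) <= (A * D) * exp (\<eta> * \<bar>Re t\<bar>) * exp (- (\<eta> * \<bar>Re w\<bar>))"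
  if *: "Re w <= X" "\<delta> <= s * (Im w - d)" "s * (Im w - d) <= dq - \<delta>" "\<bar>Im w - Im t\<bar> <= P - \<delta>" for w t
 proof -
  have "norm (e (w - t)) <= A * exp (- (\<eta> * \<bar>Re (w - t)\<bar>)) * exp (- (B * exp (\<kappa> * Re (w - t))))"
   by (rule bd) (use * in \<open>simp add: P_def\<close>)
  also have "\<dots> <= A * exp (- (\<eta> * \<bar>Re (w - t)\<bar>)) * 1" using AB by (intro mult_left_mono) auto
  also have "exp (- (\<eta> * \<bar>Re (w - t)\<bar>)) <= exp (\<eta> * \<bar>Re t\<bar> + - (\<eta> * \<bar>Re w\<bar>))"
  proof -
   have "\<bar>Re w\<bar> <= \<bar>Re t\<bar> + \<bar>Re (w - t)\<bar>" by simp
   then have "\<eta> * \<bar>Re w\<bar> <= \<eta> * (\<bar>Re t\<bar> + \<bar>Re (w - t)\<bar>)" using AB by (intro mult_left_mono) auto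
   then show ?thesis by (simp add: distrib_left)
  qed
  then have "A * exp (- (\<eta> * \<bar>Re (w - t)\<bar>)) * 1 <= A * exp (\<eta> * \<bar>Re t\<bar> + - (\<eta> * \<bar>Re w\<bar>))"
   using AB by simp
  also have "\<dots> = A * (exp (\<eta> * \<bar>Re t\<bar>) * exp (- (\<eta> * \<bar>Re w\<bar>)))" by (simp only: exp_add)
  finally have 1: "norm (e (w - t)) <= A * (exp (\<eta> * \<bar>Re t\<bar>) * exp (- (\<eta> * \<bar>Re w\<bar>)))" .
  have "w \<in> side s" using * dl by (auto simp: side_def)
  then have "Vp s w = V w z" by (rule Vp_eq [OF s])
  also have "norm \<dots> <= C1 * exp (C2 * exp (\<kappa> * Re w))" by (rule vb) (use * s in auto)
  also have "\<dots> <= D" unfolding D_def using C pos(1) * by (intro mult_left_mono) auto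
  finally have 2: "norm (Vp s w) <= D" .
  have "norm (e (w - t)) * norm (Vp s w) <= A * (exp (\<eta> * \<bar>Re t\<bar>) * exp (- (\<eta> * \<bar>Re w\<bar>))) * D"
   by (rule mult_mono [OF 1 2]) (use AB in auto)
  then show ?thesis by (simp add: norm_mult mult_ac)
 qed
 then show ?thesis using AB D by (intro exI [of _ \<eta>] conjI exI [of _ "A * D"]) auto
qed

text \<open>The estimate holds across the ray d. Since X = X0 + 1, Re \<zeta> \<ge> b there, so |exp
  \<zeta> - 1| \<ge> exp b - 1 keeps a distance \<mu> from the singularity in every
  direction.\<close>

lemma Vp_far_growth:
 assumes s: "s = 1 \<or> s = - 1" and dl: "0 < \<delta>"
 shows "\<exists>C1>0. \<exists>C2>0. \<forall>w. X <= Re w --> \<bar>Im w - d\<bar> <= dq - \<delta> --> norm (Vp s w) <= C1 * exp (C2 * exp (\<kappa> * Re w))"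
proof -
 define k where "k = real r / (real p - 1 + real r)"
 obtain C1 C2 where C: "C1 > 0" "C2 > 0"
  and rb: "\<And>w y. \<bar>Im w - d\<bar> <= 2 * dq / 2 - \<delta> ==> y \<in> {z} ==> norm (1 * Rest w) <= C1 * exp (C2 * exp (\<kappa> * Re w))"
  by (rule borel_growthE [OF Rest_growth dl], rule that)
 define \<mu> where "\<mu> = norm (z0 - z) * (exp b - 1)"
 have mu: "\<mu> > 0" using zn(4) pos(2) by (simp add: \<mu>_def)
 obtain D1 D2 where D: "D1 > 0" "D2 > 0" and pb0: "\<forall>w y h. Im (wz z) - 2 * pi <= Im w --> Im w <= Im (wz z) + 2 * pi --> \<mu> <= exp (Re w) --> z0 + exp w = y + h --> norm y <= norm z0 -->
  norm (\<Phi> w) <= D1 * exp (D2 * norm h powr k)"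
  using Phi_growth [OF mu, of "Im (wz z) - 2 * pi" "Im (wz z) + 2 * pi", folded k_def] by (elim exE conjE) (rule that)
 note pb = pb0 [rule_format]
 define D3 where "D3 = D2 * c0 powr k"
 have D3: "D3 > 0" using D pos by (simp add: D3_def)
 have "norm (Vp s w) <= (C1 + D1) * exp ((C2 + D3) * exp (\<kappa> * Re w))" if w: "X <= Re w" "\<bar>Im w - d\<bar> <= dq - \<delta>" for w
 proof -
  define y where "y = exp (\<zeta> w) - 1"
  have wf: "w \<in> far" using w dl by (simp add: far_def X_def)
  then have y0: "y \<noteq> 0" using branch [OF s, of w] by (auto simp: y_def)
  have ez: "sh l w / (z0 - z) = exp (\<zeta> w)" using sh_quotient [OF th zn(4)] by (simp add: \<zeta>_def zt_def)
  define w' where "w' = wz z + Ln y - of_real s * (\<i> * of_real pi)"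
  have es: "exp (- (of_real s * (\<i> * of_real pi))) = - 1" using s by (auto simp: exp_minus exp_pi_i')
  have ew: "exp w' = (z0 - z) * y"
  proof -
   have "exp w' = exp (wz z) * y * exp (- (of_real s * (\<i> * of_real pi)))"
    using y0 by (simp add: w'_def exp_diff exp_add exp_minus divide_inverse)
   then show ?thesis unfolding es exp_wz [OF zn(1)] by (simp add: algebra_simps)
  qed
  have "norm (X\<Phi> s w) <= D1 * exp (D2 * norm (sh l w) powr k)"
   unfolding X\<Phi>_def y_def [symmetric] w'_def [symmetric]
  proof (rule pb [where y = z])
   have "\<bar>Im (Ln y)\<bar> <= pi" using mpi_less_Im_Ln [OF y0] Im_Ln_le_pi [OF y0] by (simp add: abs_le_iff)
   then show "Im (wz z) - 2 * pi <= Im w'" "Im w' <= Im (wz z) + 2 * pi" using s by (auto simp: w'_def)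
   have "exp b - 1 <= norm (exp (\<zeta> w)) - norm (1 :: complex)"
    using w(1) pos(2) by (simp add: zeta X_def)
   also have "\<dots> <= norm y" unfolding y_def by (rule norm_triangle_ineq2)
   finally have "\<mu> <= norm (z0 - z) * norm y" unfolding \<mu>_def by (rule mult_left_mono) simp
   also have "\<dots> = norm (exp w')" by (simp add: ew norm_mult)
   finally show "\<mu> <= exp (Re w')" by simp
   have "(z0 - z) * y = sh l w - (z0 - z)"
    unfolding y_def ez [symmetric] using zn(4) by (simp add: field_simps)
   then show "z0 + exp w' = z + sh l w" unfolding ew by simp
  qed (use zn in simp)
  also have "D2 * norm (sh l w) powr k = D3 * exp (\<kappa> * Re w)" unfolding k_def norm_sh_powr D3_def by simp
  finally have 1: "norm (X\<Phi> s w) <= D1 * exp (D3 * exp (\<kappa> * Re w))" .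
  have 2: "norm (Rest w) <= C1 * exp (C2 * exp (\<kappa> * Re w))" using rb [of w z] w by simp
  have "norm (Vp s w) <= norm (Rest w + X\<Phi> s w)"
  proof -
   have "norm (Vp s w) = (1 / real r) * norm (Rest w + X\<Phi> s w)" by (simp add: Vp_def norm_mult norm_divide)
   also have "\<dots> <= 1 * norm (Rest w + X\<Phi> s w)" using r by (intro mult_right_mono) auto
   finally show ?thesis by simp
  qed
  also have "\<dots> <= C1 * exp (C2 * exp (\<kappa> * Re w)) + D1 * exp (D3 * exp (\<kappa> * Re w))"
   by (rule norm_triangle_le) (use 1 2 in simp)
  also have "\<dots> <= C1 * exp ((C2 + D3) * exp (\<kappa> * Re w)) + D1 * exp ((C2 + D3) * exp (\<kappa> * Re w))"
   using C D D3 by (intro add_mono mult_left_mono) auto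
  finally show ?thesis by (simp add: distrib_right)
 qed
 then show ?thesis using C D D3 by (intro exI [of _ "C1 + D1"] conjI exI [of _ "C2 + D3"]) auto
qed

lemma far_bound:
 assumes s: "s = 1 \<or> s = - 1" and dl: "0 < \<delta>"
 shows "\<exists>T. \<exists>\<eta>>0. \<exists>C>0. \<forall>w t. X <= Re w --> \<bar>Im w - d\<bar> <= dq - \<delta> --> \<bar>Im w - Im t\<bar> <= P - \<delta> --> Re t < T -->
  norm (e (w - t) * Vp s w) <= C * exp (\<eta> * \<bar>Re t\<bar>) * exp (- (\<eta> * \<bar>Re w\<bar>))"
proof -
 obtain C1 C2 where C: "C1 > 0" "C2 > 0" and vb: "\<And>w. X <= Re w ==> \<bar>Im w - d\<bar> <= dq - \<delta> ==> norm (Vp s w) <= C1 * exp (C2 * exp (\<kappa> * Re w))"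
  using Vp_far_growth [OF s dl] by blast
 obtain T \<eta> A where T: "\<eta> > 0" "A > 0" and kb: "\<And>w t x C1. \<bar>Im w - Im t\<bar> <= pi / \<kappa> / 2 - \<delta> ==> Re t < T ==>
   norm x <= C1 * exp (C2 * exp (\<kappa> * Re w)) ==> norm (e (w - t) * x) <= A * C1 * exp (\<eta> * \<bar>Re t\<bar>) * exp (- (\<eta> * \<bar>Re w\<bar>))"
  using kernel_product_bound [OF pos(1) kernel(2) dl C(2)] by blast
 have "norm (e (w - t) * Vp s w) <= (A * C1) * exp (\<eta> * \<bar>Re t\<bar>) * exp (- (\<eta> * \<bar>Re w\<bar>))"
  if "X <= Re w" "\<bar>Im w - d\<bar> <= dq - \<delta>" "\<bar>Im w - Im t\<bar> <= P - \<delta>" "Re t < T" for w t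
  by (rule kb [OF _ that(4) vb]) (use that in \<open>auto simp: P_def\<close>)
 then show ?thesis using T C by (intro exI [of _ T] exI [of _ \<eta>] conjI exI [of _ "A * C1"]) auto
qed

end

context stokes_jump
begin

definition "g s t w = e (w - t) * Vp s w"

lemma kernel_shift_hol:
 shows "(%w. e (w - t)) holomorphic_on {w. \<bar>Im w - Im t\<bar> < P}" and "(%t. e (w - t)) holomorphic_on {t. \<bar>Im w - Im t\<bar> < P}"
proof -
 have h: "e holomorphic_on sector 0 (pi / \<kappa>)" using kernel(2) by (simp add: kernel_decay_def)
 show "(%w. e (w - t)) holomorphic_on {w. \<bar>Im w - Im t\<bar> < P}" "(%t. e (w - t)) holomorphic_on {t. \<bar>Im w - Im t\<bar> < P}"
  by (rule holomorphic_on_compose_gen [OF _ h, unfolded o_def]; auto intro!: holomorphic_intros simp: sector_def P_def)+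
qed

lemma g_hol:
 assumes s: "s = 1 \<or> s = - 1"
 shows "g s t holomorphic_on (side s \<union> far) \<inter> {w. \<bar>Im w - Im t\<bar> < P}"
 unfolding g_def [abs_def]
proof (rule holomorphic_on_mult)
 show "(%w. e (w - t)) holomorphic_on (side s \<union> far) \<inter> {w. \<bar>Im w - Im t\<bar> < P}"
  by (rule holomorphic_on_subset [OF kernel_shift_hol(1)]) blast
 show "Vp s holomorphic_on (side s \<union> far) \<inter> {w. \<bar>Im w - Im t\<bar> < P}"
  by (rule holomorphic_on_subset [OF Vp_hol [OF s]]) blast
qed

text \<open>Strict inequalities suffice for the near direction \<theta>1, because
  \<open>near_bound\<close> demands nothing of |t|. The far direction \<theta>2 must keep the margin
  \<delta>, which determines how small t has to be.\<close>

definition "admissible s \<delta> t \<theta>1 \<theta>2 \<longleftrightarrow> 0 < s * (\<theta>1 - d) \<and> s * (\<theta>1 - d) < dq \<and> \<bar>\<theta>1 - Im t\<bar> < P \<and>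
  \<bar>\<theta>2 - d\<bar> <= dq - \<delta> \<and> \<bar>\<theta>2 - Im t\<bar> <= P - \<delta>"

lemma rotate:
 assumes s: "s = 1 \<or> s = - 1" and dl: "0 < \<delta>"
 shows "\<exists>T. \<forall>t \<theta>1 \<theta>1' \<theta>2 \<theta>2'. Re t < T --> admissible s \<delta> t \<theta>1 \<theta>2 --> admissible s \<delta> t \<theta>1' \<theta>2' -->
  path_int (g s t) X \<theta>1 \<theta>2 = path_int (g s t) X \<theta>1' \<theta>2' \<and>
  set_integrable lborel {..X} (%y. g s t (Complex y \<theta>1)) \<and> set_integrable lborel {X..} (%y. g s t (Complex y \<theta>2))"
proof -
 obtain T \<eta>' C' where T: "\<eta>' > 0" "C' > 0" and fb: "\<And>w t. X <= Re w ==> \<bar>Im w - d\<bar> <= dq - \<delta> ==> \<bar>Im w - Im t\<bar> <= P - \<delta> ==> Re t < T ==>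
  norm (e (w - t) * Vp s w) <= C' * exp (\<eta>' * \<bar>Re t\<bar>) * exp (- (\<eta>' * \<bar>Re w\<bar>))"
  using far_bound [OF s dl] by blast
 have "path_int (g s t) X \<theta>1 \<theta>2 = path_int (g s t) X \<theta>1' \<theta>2' \<and>
  set_integrable lborel {..X} (%y. g s t (Complex y \<theta>1)) \<and> set_integrable lborel {X..} (%y. g s t (Complex y \<theta>2))"
  if t: "Re t < T" and ad: "admissible s \<delta> t \<theta>1 \<theta>2" "admissible s \<delta> t \<theta>1' \<theta>2'" for t \<theta>1 \<theta>1' \<theta>2 \<theta>2'
 proof -
  have i1: "0 < s * (\<theta>1 - d)" "s * (\<theta>1 - d) < dq" "\<bar>\<theta>1 - Im t\<bar> < P"
   and i1': "0 < s * (\<theta>1' - d)" "s * (\<theta>1' - d) < dq" "\<bar>\<theta>1' - Im t\<bar> < P"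
   and 2: "\<bar>\<theta>2 - d\<bar> <= dq - \<delta>" "\<bar>\<theta>2 - Im t\<bar> <= P - \<delta>" "\<bar>\<theta>2' - d\<bar> <= dq - \<delta>" "\<bar>\<theta>2' - Im t\<bar> <= P - \<delta>"
   using ad unfolding admissible_def by blast+
  \<comment> \<open>The allowed near directions (one side of d) and far directions (both sides),
    each intersected with the strip of the kernel around Im t.\<close>
  define a1 where "a1 = max (d + min 0 (s * dq)) (Im t - P)"
  define b1 where "b1 = min (d + max 0 (s * dq)) (Im t + P)"
  define a2 where "a2 = max (d - dq) (Im t - P)"
  define b2 where "b2 = min (d + dq) (Im t + P)"
  have I: "a2 <= a1" "b1 <= b2" using s dq(1) by (auto simp: a1_def a2_def b1_def b2_def)
  have near_dom: "a1 < x \<and> x < b1 \<longleftrightarrow> 0 < s * (x - d) \<and> s * (x - d) < dq \<and> \<bar>x - Im t\<bar> < P" for x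
   using s dq(1) unfolding a1_def b1_def by (elim disjE) auto
  have far_dom: "a2 < x \<and> x < b2 \<longleftrightarrow> \<bar>x - d\<bar> < dq \<and> \<bar>x - Im t\<bar> < P" for x
   unfolding a2_def b2_def by auto
  have gh: "g s t holomorphic_on {w. a1 < Im w \<and> Im w < b1} \<union> {w. X0 < Re w \<and> a2 < Im w \<and> Im w < b2}"
   by (rule holomorphic_on_subset [OF g_hol [OF s]]) (auto simp: near_dom far_dom side_def far_def)
  have th1: "a1 < \<theta>1" "\<theta>1 < b1" "a1 < \<theta>1'" "\<theta>1' < b1" using near_dom i1 i1' by blast+
  have th2: "a2 < \<theta>2" "\<theta>2 < b2" "a2 < \<theta>2'" "\<theta>2' < b2"
  proof -
   have "\<bar>\<theta>2 - d\<bar> < dq \<and> \<bar>\<theta>2 - Im t\<bar> < P" "\<bar>\<theta>2' - d\<bar> < dq \<and> \<bar>\<theta>2' - Im t\<bar> < P" using 2 dl by auto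
   then show "a2 < \<theta>2" "\<theta>2 < b2" "a2 < \<theta>2'" "\<theta>2' < b2" using far_dom by blast+
  qed
  \<comment> \<open>The least margin of the two near directions. It depends on t and on the
    directions, and enters only constants, not \<open>T\<close>.\<close>
  define \<delta>1 where "\<delta>1 = min (s * (\<theta>1 - d)) (min (s * (\<theta>1' - d)) (min (dq - s * (\<theta>1 - d)) (min (dq - s * (\<theta>1' - d)) (min (P - \<bar>\<theta>1 - Im t\<bar>) (P - \<bar>\<theta>1' - Im t\<bar>)))))"
  have d1: "0 < \<delta>1" unfolding \<delta>1_def min_less_iff_conj using i1 i1' by (intro conjI) linarith+
  have d1': "\<delta>1 <= s * (\<theta>1 - d)" "\<delta>1 <= s * (\<theta>1' - d)" "\<delta>1 <= dq - s * (\<theta>1 - d)" "\<delta>1 <= dq - s * (\<theta>1' - d)" "\<delta>1 <= P - \<bar>\<theta>1 - Im t\<bar>" "\<delta>1 <= P - \<bar>\<theta>1' - Im t\<bar>"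
   unfolding \<delta>1_def by (rule min.cobounded1 | rule min.cobounded2 | rule min.coboundedI2)+
  obtain \<eta> C where N: "\<eta> > 0" "C > 0" and nb: "\<And>w t. Re w <= X ==> \<delta>1 <= s * (Im w - d) ==> s * (Im w - d) <= dq - \<delta>1 ==> \<bar>Im w - Im t\<bar> <= P - \<delta>1 ==>
   norm (e (w - t) * Vp s w) <= C * exp (\<eta> * \<bar>Re t\<bar>) * exp (- (\<eta> * \<bar>Re w\<bar>))"
   using near_bound [OF s d1] by blast
  have near: "norm (g s t w) <= C * exp (\<eta> * \<bar>Re t\<bar>) * exp (- (\<eta> * \<bar>Re w\<bar>))"
   if "Re w <= X" "min \<theta>1 \<theta>1' <= Im w" "Im w <= max \<theta>1 \<theta>1'" for w
   unfolding g_def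
  proof (rule nb [OF that(1)])
   show "\<delta>1 <= s * (Im w - d)" "s * (Im w - d) <= dq - \<delta>1"
    using s d1' that(2,3) by (elim disjE; simp; linarith)+
   show "\<bar>Im w - Im t\<bar> <= P - \<delta>1" using d1'(5,6) that(2,3) by linarith
  qed
  have far: "norm (g s t w) <= C' * exp (\<eta>' * \<bar>Re t\<bar>) * exp (- (\<eta>' * \<bar>Re w\<bar>))"
   if "X <= Re w" "min \<theta>2 \<theta>2' <= Im w" "Im w <= max \<theta>2 \<theta>2'" for w
   unfolding g_def by (rule fb [OF that(1) _ _ t]) (use 2 that(2,3) in linarith)+
  have X: "X0 < X" by (simp add: X_def)
  note pi = path_int_independent [OF gh I X th1 th2 near far N(1) T(1)]
  show ?thesis by (intro conjI pi) assumption+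
 qed
 then show ?thesis by blast
qed

text \<open>The direction in which the contour leaves the origin is the midpoint of all admissible ones.\<close>

definition "lo s = d + min 0 (s * (2 * \<epsilon>))"
definition "hi s = d + max 0 (s * (2 * \<epsilon>))"
definition "th1 s t = (max (lo s) (Im t - P) + min (hi s) (Im t + P)) / 2"
text \<open>The direction nearest to arg t among those within 2 \<epsilon> of d, on either side:
  behind \<open>X\<close> the ray d is no obstacle.\<close>

definition "th2 t = max (d - 2 * \<epsilon>) (min (d + 2 * \<epsilon>) (Im t))"
definition "up s t = path_int (g s t) X (th1 s t) (th2 t)"

lemma th1:
 assumes s: "s = 1 \<or> s = - 1" and m: "max (lo s) (Im t - P) < min (hi s) (Im t + P)"
 shows "0 < s * (th1 s t - d)" "s * (th1 s t - d) < dq" "\<bar>th1 s t - Im t\<bar> < P"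
proof -
 have "a < (a + b) / 2 \<and> (a + b) / 2 < b" if "a < b" for a b :: real using that by simp
 from this [OF m] have "max (lo s) (Im t - P) < th1 s t" "th1 s t < min (hi s) (Im t + P)" unfolding th1_def by blast+
 then have *: "lo s < th1 s t" "th1 s t < hi s" "Im t - P < th1 s t" "th1 s t < Im t + P" by auto
 then show "\<bar>th1 s t - Im t\<bar> < P" by linarith
 show "0 < s * (th1 s t - d)" "s * (th1 s t - d) < dq"
  using s *(1,2) eps unfolding lo_def hi_def by (elim disjE; simp)+
qed

text \<open>A margin kept by \<open>th2 t\<close> for all t with |Im t - d| < P. It is at least dq -
  2 \<epsilon> from the next singular directions; and |th2 t - Im t| is either 0 or less than P - 2
  \<epsilon>, so that P/2 and \<epsilon> leave room even after moving Im t by \<delta>0.\<close>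

definition "\<delta>0 = min (\<epsilon>) (min (P / 2) (dq - 2 * \<epsilon>))"

lemma delta0: "0 < \<delta>0" "\<delta>0 <= \<epsilon>" "\<delta>0 <= P / 2" "\<delta>0 <= dq - 2 * \<epsilon>"
proof -
 show "0 < \<delta>0" unfolding \<delta>0_def min_less_iff_conj using eps P by (intro conjI) linarith+
 show "\<delta>0 <= \<epsilon>" "\<delta>0 <= P / 2" "\<delta>0 <= dq - 2 * \<epsilon>" unfolding \<delta>0_def by (rule min.cobounded1 | rule min.cobounded2 | rule min.coboundedI2)+
qed

lemma th2: "\<bar>th2 t - d\<bar> <= dq - \<delta>0"
 "\<bar>Im t - d\<bar> < P ==> \<bar>Im t - Im t'\<bar> <= \<delta>0 ==> \<bar>th2 t - Im t'\<bar> <= P - \<delta>0"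
 "\<bar>x - d\<bar> <= 2 * \<epsilon> ==> \<bar>th2 t - Im t\<bar> <= \<bar>x - Im t\<bar>"
proof -
 have c: "Im t < d - 2 * \<epsilon> \<and> th2 t = d - 2 * \<epsilon> \<or> \<bar>Im t - d\<bar> <= 2 * \<epsilon> \<and> th2 t = Im t \<or> d + 2 * \<epsilon> < Im t \<and> th2 t = d + 2 * \<epsilon>"
  using eps(1) unfolding th2_def by linarith
 then show "\<bar>th2 t - d\<bar> <= dq - \<delta>0" using delta0 eps by linarith
 show "\<bar>th2 t - Im t'\<bar> <= P - \<delta>0" if "\<bar>Im t - d\<bar> < P" "\<bar>Im t - Im t'\<bar> <= \<delta>0"
  using c that delta0 by linarith
 show "\<bar>th2 t - Im t\<bar> <= \<bar>x - Im t\<bar>" if "\<bar>x - d\<bar> <= 2 * \<epsilon>" using c that by linarith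
qed

lemma straight:
 assumes s: "s = 1 \<or> s = - 1" and x: "0 < s * (x - d)" "s * (x - d) < dq"
  and i: "set_integrable lborel {..X} (%y. g s t (Complex y x))" "set_integrable lborel {X..} (%y. g s t (Complex y x))"
 shows "path_int (g s t) X x x = laplace_log e x (%w. V w z) t" "integrable lborel (%y. e (Complex y x - t) * V (Complex y x) z)"
proof -
 have eq: "g s t (Complex y x) = e (Complex y x - t) * V (Complex y x) z" for y
  using Vp_eq [OF s, of "Complex y x"] x by (simp add: g_def side_def)
 show "path_int (g s t) X x x = laplace_log e x (%w. V w z) t"
  using path_int_straight [OF i] by (simp add: eq laplace_log_def)
 show "integrable lborel (%y. e (Complex y x - t) * V (Complex y x) z)"
  using split_line_integral(1) [OF i] by (simp add: eq)
qed

text \<open>For x on side s both legs of the contour may be turned into direction x. The contour is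
  then straight and stays where \<open>Vp\<close> is V, so \<open>up\<close> is the ordinary Laplace
  integral.\<close>

lemma up_line:
 assumes s: "s = 1 \<or> s = - 1" and dl: "0 < \<delta>"
 shows "\<exists>T. \<forall>x t. 0 < s * (x - d) --> s * (x - d) < 2 * \<epsilon> --> \<bar>x - Im t\<bar> <= P - \<delta> --> Re t < T -->
  up s t = laplace_log e x (%w. V w z) t \<and> integrable lborel (%y. e (Complex y x - t) * V (Complex y x) z)"
proof -
 define \<delta>' where "\<delta>' = min \<delta> \<delta>0"
 have d': "0 < \<delta>'" "\<delta>' <= \<delta>" "\<delta>' <= \<delta>0" using dl delta0 by (auto simp: \<delta>'_def)
 obtain T where T: "\<And>t \<theta>1 \<theta>1' \<theta>2 \<theta>2'. Re t < T ==> admissible s \<delta>' t \<theta>1 \<theta>2 ==> admissible s \<delta>' t \<theta>1' \<theta>2' ==>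
  path_int (g s t) X \<theta>1 \<theta>2 = path_int (g s t) X \<theta>1' \<theta>2' \<and>
  set_integrable lborel {..X} (%y. g s t (Complex y \<theta>1)) \<and> set_integrable lborel {X..} (%y. g s t (Complex y \<theta>2))"
  using rotate [OF s d'(1)] by blast
 have "up s t = laplace_log e x (%w. V w z) t \<and> integrable lborel (%y. e (Complex y x - t) * V (Complex y x) z)"
  if x: "0 < s * (x - d)" "s * (x - d) < 2 * \<epsilon>" "\<bar>x - Im t\<bar> <= P - \<delta>" and t: "Re t < T" for x t
 proof -
  have x2: "s * (x - d) < dq" using x eps by linarith
  have xl: "lo s < x" "x < hi s" using s x(1,2) unfolding lo_def hi_def by (elim disjE; simp)+
  have xd: "\<bar>x - d\<bar> < 2 * \<epsilon>" using s x(1,2) by (elim disjE; simp)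
  have xP: "\<bar>x - Im t\<bar> < P" "\<bar>x - Im t\<bar> <= P - \<delta>'" using x(3) dl d' by linarith+
  have m: "max (lo s) (Im t - P) < min (hi s) (Im t + P)" using xl xP(1) by (auto simp: abs_less_iff)
  have "\<bar>th2 t - Im t\<bar> <= \<bar>x - Im t\<bar>" by (rule th2(3)) (use xd in simp)
  then have t2: "\<bar>th2 t - Im t\<bar> <= P - \<delta>'" "\<bar>th2 t - d\<bar> <= dq - \<delta>'" using xP th2(1) [of t] d' by linarith+
  have xd': "\<bar>x - d\<bar> <= dq - \<delta>'" using xd delta0 d' by linarith
  have "admissible s \<delta>' t x x" "admissible s \<delta>' t (th1 s t) (th2 t)"
   unfolding admissible_def using x(1) x2 xP xd' th1 [OF s m] t2 by blast+
  from T [OF t this]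
  have "path_int (g s t) X (th1 s t) (th2 t) = path_int (g s t) X x x"
   "set_integrable lborel {..X} (%y. g s t (Complex y x))" "set_integrable lborel {X..} (%y. g s t (Complex y x))" by simp_all
  then show ?thesis using straight [OF s x(1) x2, of t] unfolding up_def by (metis (no_types, lifting))
 qed
 then show ?thesis by blast
qed

lemma up_sum:
 assumes s: "s = 1 \<or> s = - 1"
 shows "is_sum_in_direction \<kappa> {z} u (d + s * \<epsilon>) (%t x. up s t)"
proof (rule is_sum_I)
 show "borel_class \<kappa> {z} (d + s * \<epsilon>) (2 * \<epsilon>) V c" by (rule V_side_class [OF s]) (use eps in auto)
 show "{z} \<subseteq> ball 0 R0" using zn by simp
 show "0 < 2 * \<epsilon>" using eps by simp
 fix \<delta> :: real assume dl: "\<delta> > 0"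
 obtain T where T: "\<And>x t. 0 < s * (x - d) ==> s * (x - d) < 2 * \<epsilon> ==> \<bar>x - Im t\<bar> <= P - \<delta> ==> Re t < T ==>
  up s t = laplace_log e x (%w. V w z) t" using up_line [OF s dl] by blast
 have "up s t = laplace_log e x (%w. V w y) t" if *: "\<bar>x - (d + s * \<epsilon>)\<bar> <= 2 * \<epsilon> / 2 - \<delta>" "\<bar>x - Im t\<bar> <= pi / \<kappa> / 2 - \<delta>" "Re t < T" "y \<in> {z}" for x t y
 proof -
  have "0 < s * (x - d)" "s * (x - d) < 2 * \<epsilon>" using s *(1) dl eps by (elim disjE; simp; linarith)+
  from T [OF this _ *(3)] show ?thesis using * by (simp add: P_def)
 qed
 then show "\<exists>T. \<forall>x t y. \<bar>x - (d + s * \<epsilon>)\<bar> <= 2 * \<epsilon> / 2 - \<delta> --> \<bar>x - Im t\<bar> <= pi / \<kappa> / 2 - \<delta> --> Re t < T -->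
      y \<in> {z} --> up s t = laplace_log e x (%w. V w y) t" by blast
qed

text \<open>The contour of \<open>up s t\<close> varies with t. Near t0 it is replaced by the one
  for t0, with the same value by \<open>rotate\<close>, and then one differentiates under the
  integral. The threshold is uniform since \<open>th2\<close> always keeps the margin
  \<delta>0.\<close>

lemma up_holomorphic:
 assumes s: "s = 1 \<or> s = - 1"
 shows "\<exists>T. \<forall>\<rho>\<le>exp T. up s holomorphic_on bounded_sector d (pi / \<kappa>) \<rho>"
proof -
 obtain T1 where T1: "\<And>t \<theta>1 \<theta>1' \<theta>2 \<theta>2'. Re t < T1 ==> admissible s \<delta>0 t \<theta>1 \<theta>2 ==> admissible s \<delta>0 t \<theta>1' \<theta>2' ==>
  path_int (g s t) X \<theta>1 \<theta>2 = path_int (g s t) X \<theta>1' \<theta>2'"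
  using rotate [OF s delta0(1)] by blast
 obtain T2 \<eta>' C' where T2: "\<eta>' > 0" "C' > 0" and fb: "\<And>w t. X <= Re w ==> \<bar>Im w - d\<bar> <= dq - \<delta>0 ==> \<bar>Im w - Im t\<bar> <= P - \<delta>0 ==> Re t < T2 ==>
  norm (e (w - t) * Vp s w) <= C' * exp (\<eta>' * \<bar>Re t\<bar>) * exp (- (\<eta>' * \<bar>Re w\<bar>))"
  using far_bound [OF s delta0(1)] by blast
 define T where "T = min T1 T2"
 have BSi: "t \<in> bounded_sector d (pi / \<kappa>) (exp T) \<longleftrightarrow> \<bar>Im t - d\<bar> < P \<and> Re t < T" for t
  by (simp add: bounded_sector_def sector_def P_def)
 have "\<exists>A. open A \<and> t0 \<in> A \<and> up s holomorphic_on A" if t0: "t0 \<in> bounded_sector d (pi / \<kappa>) (exp T)" for t0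
 proof -
  have t0': "\<bar>Im t0 - d\<bar> < P" "Re t0 < T" using t0 BSi by auto
  have mm: "max (lo s) (Im t - P) < min (hi s) (Im t + P)" if "\<bar>Im t - d\<bar> < P" for t
   using s that eps P unfolding lo_def hi_def by (elim disjE) (auto simp: abs_less_iff)
  define a where "a = th1 s t0"
  define a2 where "a2 = th2 t0"
  note a = th1 [OF s mm [OF t0'(1)], folded a_def]
  define m where "m = P - \<bar>a - Im t0\<bar>"
  have m: "m > 0" using a by (simp add: m_def)
  obtain r0 where r0: "r0 > 0" "ball t0 r0 \<subseteq> bounded_sector d (pi / \<kappa>) (exp T)"
   using open_bounded_sector t0 open_contains_ball by blast
  \<comment> \<open>Small enough that both legs frozen at t0 stay admissible: m/2 for the near leg,
    \<delta>0 for the far leg, 1 for a bound on |Re t|.\<close>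
  define r' where "r' = min (r0) (min (m / 2) (min (\<delta>0) (1)))"
  have r': "r' > 0" unfolding r'_def min_less_iff_conj using r0 m delta0 by (intro conjI) linarith+
  have r'': "r' <= r0" "r' <= m / 2" "r' <= \<delta>0" "r' <= 1" unfolding r'_def by (rule min.cobounded1 | rule min.cobounded2 | rule min.coboundedI2)+
  have tb: "\<bar>Im t - d\<bar> < P" "Re t < T" "\<bar>Im t0 - Im t\<bar> <= \<delta>0" "\<bar>a - Im t\<bar> <= P - m / 2" "\<bar>Re t\<bar> <= \<bar>Re t0\<bar> + 1" if "t \<in> ball t0 r'" for t
  proof -
   have n: "norm (t0 - t) < r'" using that by (simp add: dist_norm)
   then have "t \<in> bounded_sector d (pi / \<kappa>) (exp T)" using r0 r'' by (auto simp: dist_norm)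
   then show "\<bar>Im t - d\<bar> < P" "Re t < T" using BSi by auto
   have i: "\<bar>Im t0 - Im t\<bar> < r'" using abs_Im_le_cmod [of "t0 - t"] n by simp
   then show "\<bar>Im t0 - Im t\<bar> <= \<delta>0" using r'' by linarith
   show "\<bar>a - Im t\<bar> <= P - m / 2"
   proof -
    have "\<bar>a - Im t0\<bar> = P - m" by (simp add: m_def)
    then show ?thesis using i r''(2) by linarith
   qed
   have "\<bar>Re t0 - Re t\<bar> < r'" using abs_Re_le_cmod [of "t0 - t"] n by simp
   then show "\<bar>Re t\<bar> <= \<bar>Re t0\<bar> + 1" using r'' by linarith
  qed
  have a2: "\<bar>a2 - d\<bar> <= dq - \<delta>0" "\<bar>a2 - Im t\<bar> <= P - \<delta>0" if "t \<in> ball t0 r'" for t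
   unfolding a2_def by (rule th2) (rule th2(2) [OF t0'(1) tb(3) [OF that]])
  have ue: "path_int (g s t) X a a2 = up s t" if t: "t \<in> ball t0 r'" for t
   unfolding up_def
  proof (rule T1)
   have "\<bar>a - Im t\<bar> < P" using tb(4) [OF t] m by linarith
   then show "admissible s \<delta>0 t a a2" unfolding admissible_def using a(1,2) a2 [OF t] by blast
   have "\<bar>th2 t - Im t\<bar> <= P - \<delta>0" by (rule th2(2) [OF tb(1) [OF t]]) (use delta0 in simp)
   then show "admissible s \<delta>0 t (th1 s t) (th2 t)"
    unfolding admissible_def using th1 [OF s mm [OF tb(1) [OF t]]] th2(1) [of t] by blast
   show "Re t < T1" using tb(2) [OF t] by (simp add: T_def)
  qed
  define \<delta>1 where "\<delta>1 = min (s * (a - d)) (min (dq - s * (a - d)) (m / 2))"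
  have d1: "0 < \<delta>1" unfolding \<delta>1_def min_less_iff_conj using a m by (intro conjI) linarith+
  have d1': "\<delta>1 <= s * (a - d)" "\<delta>1 <= dq - s * (a - d)" "\<delta>1 <= m / 2" unfolding \<delta>1_def by (rule min.cobounded1 | rule min.cobounded2 | rule min.coboundedI2)+
  obtain \<eta> C where N: "\<eta> > 0" "C > 0" and nb: "\<And>w t. Re w <= X ==> \<delta>1 <= s * (Im w - d) ==> s * (Im w - d) <= dq - \<delta>1 ==> \<bar>Im w - Im t\<bar> <= P - \<delta>1 ==>
   norm (e (w - t) * Vp s w) <= C * exp (\<eta> * \<bar>Re t\<bar>) * exp (- (\<eta> * \<bar>Re w\<bar>))"
   using near_bound [OF s d1] by blast
  define M where "M = \<bar>Re t0\<bar> + 1"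
  have ad: "\<bar>a - d\<bar> < dq" using a(1,2) s by (elim disjE; simp)
  have seg: "\<bar>x - d\<bar> < dq" "\<bar>x - Im t\<bar> < P" "\<bar>x - Im t\<bar> <= P - min (m / 2) \<delta>0" if x: "x \<in> closed_segment a a2" and t: "t \<in> ball t0 r'" for x t
  proof -
   have xx: "min a a2 <= x" "x <= max a a2" using x by (auto simp: closed_segment_eq_real_ivl split: if_splits)
   show "\<bar>x - d\<bar> < dq" using xx ad a2(1) [OF t] delta0 by linarith
   show "\<bar>x - Im t\<bar> <= P - min (m / 2) \<delta>0" using xx tb(4) [OF t] a2(2) [OF t] by linarith
   moreover have "0 < min (m / 2) \<delta>0" using m delta0 by simp
   ultimately show "\<bar>x - Im t\<bar> < P" by linarith
  qed
  have gc: "continuous_on ((side s \<union> far) \<inter> {w. \<bar>Im w - Im t\<bar> < P}) (g s t)" for t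
   by (rule holomorphic_on_imp_continuous_on [OF g_hol [OF s]])
  have XX: "X0 < X" by (simp add: X_def)
  \<comment> \<open>The vertical piece starts at the near direction a, which need not keep the
    margin \<delta>0 from the strip's boundary, so \<open>fb\<close> does not cover it; boundedness
    comes from compactness.\<close>
  define K where "K = {w. Re w = X \<and> Im w \<in> closed_segment a a2}"
  have Kc: "compact K"
  proof -
   have "K = (%x. Complex X x) ` closed_segment a a2" by (auto simp: K_def complex_eq_iff image_iff)
   moreover have "compact ((%x. Complex X x) ` closed_segment a a2)"
    by (intro compact_continuous_image) (auto simp: Complex_eq intro!: continuous_intros)
   ultimately show ?thesis by simp
  qed
  have t00: "t0 \<in> ball t0 r'" using r' by simp
  have Kf: "K \<subseteq> far" using seg(1) [OF _ t00] XX by (auto simp: K_def far_def)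
  have "continuous_on K (Vp s)"
   by (rule continuous_on_subset [OF holomorphic_on_imp_continuous_on [OF Vp_hol [OF s]]]) (use Kf in auto)
  then have "bounded (Vp s ` K)" using Kc by (intro compact_imp_bounded compact_continuous_image)
  then obtain B1 where B1: "B1 > 0" "\<forall>w\<in>K. norm (Vp s w) <= B1" unfolding bounded_pos by auto
  have mp: "0 < min (m / 2) \<delta>0" using m delta0 by simp
  obtain A0 B0 \<eta>0 where AB: "A0 > 0" "B0 > 0" "\<eta>0 > 0"
   and kb: "\<And>w. \<bar>Im w\<bar> <= pi / \<kappa> / 2 - min (m / 2) \<delta>0 ==> norm (e w) <= A0 * exp (- (\<eta>0 * \<bar>Re w\<bar>)) * exp (- (B0 * exp (\<kappa> * Re w)))"
   by (rule kernel_decayE [OF kernel(2) mp], rule that)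
  have hg: "(%t. g s t w) holomorphic_on ball t0 r'" if "\<And>t. t \<in> ball t0 r' ==> \<bar>Im w - Im t\<bar> < P" for w
   unfolding g_def by (intro holomorphic_on_mult holomorphic_on_const holomorphic_on_subset [OF kernel_shift_hol(2)]) (use that in auto)
  have aP: "\<bar>a - Im t\<bar> < P" "\<bar>a2 - Im t\<bar> < P" if "t \<in> ball t0 r'" for t
   using tb(4) [OF that] m a2(2) [OF that] delta0 by linarith+
  have "(%t. path_int (g s t) X a a2) holomorphic_on ball t0 r'"
  proof (rule path_int_holomorphic [OF open_ball N(1) T2(1), where C = "C * exp (\<eta> * M)" and C' = "C' * exp (\<eta>' * M)" and C'' = "A0 * B1"])
   fix w assume w: "Re w <= X" "Im w = a"
   show "(%t. g s t w) holomorphic_on ball t0 r'" by (rule hg) (use aP w in auto)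
  next
   fix t assume t: "t \<in> ball t0 r'"
   show "continuous_on {w. Re w <= X \<and> Im w = a} (g s t)"
    by (rule continuous_on_subset [OF gc]) (use a(1,2) aP [OF t] in \<open>auto simp: side_def\<close>)
   show "continuous_on {w. Re w = X \<and> Im w \<in> closed_segment a a2} (g s t)"
    by (rule continuous_on_subset [OF gc]) (use Kf seg(2) [OF _ t] in \<open>auto simp: K_def\<close>)
   show "continuous_on {w. X <= Re w \<and> Im w = a2} (g s t)"
    by (rule continuous_on_subset [OF gc]) (use aP [OF t] a2(1) [OF t] delta0 XX in \<open>auto simp: far_def\<close>)
   have tM: "\<bar>Re t\<bar> <= M" using tb(5) [OF t] by (simp add: M_def)
   show "norm (g s t w) <= C * exp (\<eta> * M) * exp (- (\<eta> * \<bar>Re w\<bar>))" if w: "Re w <= X" "Im w = a" for w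
   proof -
    have "norm (g s t w) <= C * exp (\<eta> * \<bar>Re t\<bar>) * exp (- (\<eta> * \<bar>Re w\<bar>))"
     unfolding g_def by (rule nb [OF w(1)]) (use w d1' tb(4) [OF t] in auto)
    also have "\<dots> <= C * exp (\<eta> * M) * exp (- (\<eta> * \<bar>Re w\<bar>))"
     using N tM by (intro mult_right_mono mult_left_mono) auto
    finally show ?thesis .
   qed
   show "norm (g s t w) <= C' * exp (\<eta>' * M) * exp (- (\<eta>' * \<bar>Re w\<bar>))" if w: "X <= Re w" "Im w = a2" for w
   proof -
    have "norm (g s t w) <= C' * exp (\<eta>' * \<bar>Re t\<bar>) * exp (- (\<eta>' * \<bar>Re w\<bar>))"
     unfolding g_def by (rule fb [OF w(1)]) (use w a2 [OF t] tb(2) [OF t] in \<open>auto simp: T_def\<close>)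
    also have "\<dots> <= C' * exp (\<eta>' * M) * exp (- (\<eta>' * \<bar>Re w\<bar>))"
     using T2 tM by (intro mult_right_mono mult_left_mono) auto
    finally show ?thesis .
   qed
   show "norm (g s t w) <= A0 * B1" if w: "Re w = X" "Im w \<in> closed_segment a a2" for w
   proof -
    have "norm (e (w - t)) <= A0 * exp (- (\<eta>0 * \<bar>Re (w - t)\<bar>)) * exp (- (B0 * exp (\<kappa> * Re (w - t))))"
     by (rule kb) (use seg(3) [OF w(2) t] in \<open>simp add: P_def\<close>)
    also have "\<dots> <= A0 * 1 * 1" using AB by (intro mult_mono) auto
    finally have "norm (e (w - t)) * norm (Vp s w) <= A0 * B1"
     using B1 w AB by (intro mult_mono) (auto simp: K_def)
    then show ?thesis by (simp add: g_def norm_mult)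
   qed
  next
   fix w assume w: "Re w = X" "Im w \<in> closed_segment a a2"
   show "(%t. g s t w) holomorphic_on ball t0 r'" by (rule hg) (use seg(2) w in auto)
  next
   fix w assume w: "X <= Re w" "Im w = a2"
   show "(%t. g s t w) holomorphic_on ball t0 r'" by (rule hg) (use aP w in auto)
  qed
  then have "up s holomorphic_on ball t0 r'" by (rule holomorphic_transform) (use ue in auto)
  then show ?thesis using t00 by (intro exI [of _ "ball t0 r'"]) auto
 qed
 then have "up s field_differentiable at t" if "t \<in> bounded_sector d (pi / \<kappa>) (exp T)" for t
  using that holomorphic_on_imp_differentiable_at by blast
 then have H: "up s holomorphic_on bounded_sector d (pi / \<kappa>) (exp T)"
  unfolding holomorphic_on_def using field_differentiable_at_within by blast
 have "up s holomorphic_on bounded_sector d (pi / \<kappa>) \<rho>" if "\<rho> <= exp T" for \<rho>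
 proof (rule holomorphic_on_subset [OF H])
  show "bounded_sector d (pi / \<kappa>) \<rho> \<subseteq> bounded_sector d (pi / \<kappa>) (exp T)"
   unfolding bounded_sector_def using that order_less_le_trans by blast
 qed
 then show ?thesis by blast
qed

lemma holomorphic_A_singleton:
 assumes f: "(%w. v w x) holomorphic_on S" and S: "open S"
 shows "holomorphic_A {x} v S"
proof (rule holomorphic_A_I [OF S])
 show "v w \<in> A_space {x}" for w by (simp add: A_space_def holomorphic_on_def)
 show "(%w. v w y) holomorphic_on S" if "y \<in> {x}" for y using f that by simp
 define f where "f w = v w x" for w
 have f': "f holomorphic_on S" using f by (simp add: f_def [abs_def])
 fix w assume w: "w \<in> S"
 have "continuous (at w) f" using holomorphic_on_imp_continuous_on [OF f'] S w continuous_on_eq_continuous_at by blast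
 then obtain \<delta> where d: "\<delta> > 0" "\<And>y. dist y w < \<delta> ==> dist (f y) (f w) < 1"
  unfolding continuous_at_eps_delta by (metis zero_less_one)
 have "norm (f y) <= norm (f w) + 1" if "y \<in> ball w \<delta>" for y
 proof -
  have "dist (f y) (f w) < 1" using d(2) [of y] that by (simp add: dist_commute)
  then show ?thesis using norm_triangle_sub [of "f y" "f w"] by (simp add: dist_norm)
 qed
 then show "\<exists>\<delta>>0. \<exists>B. \<forall>y\<in>ball w \<delta> \<inter> S. \<forall>z\<in>{x}. norm (v y z) <= B"
  using d(1) by (intro exI [of _ \<delta>] conjI exI [of _ "norm (f w) + 1"]) (auto simp: f_def)
qed

lemma jump:
 shows "\<exists>\<rho>>0. is_jump \<kappa> {z} u d \<epsilon> \<rho> (%t x. up 1 t - up (- 1) t)"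
proof -
 obtain T1 where T1: "\<forall>\<rho>\<le>exp T1. up 1 holomorphic_on bounded_sector d (pi / \<kappa>) \<rho>" using up_holomorphic [of 1] by auto
 obtain T2 where T2: "\<forall>\<rho>\<le>exp T2. up (- 1) holomorphic_on bounded_sector d (pi / \<kappa>) \<rho>" using up_holomorphic [of "- 1"] by auto
 define \<rho> where "\<rho> = exp (min T1 T2)"
 have h: "up 1 holomorphic_on bounded_sector d (pi / \<kappa>) \<rho>" "up (- 1) holomorphic_on bounded_sector d (pi / \<kappa>) \<rho>"
  using T1 T2 by (auto simp: \<rho>_def)
 have "is_jump \<kappa> {z} u d \<epsilon> \<rho> (%t x. up 1 t - up (- 1) t)"
  unfolding is_jump_def
  by (rule exI [of _ "%t x. up 1 t"], rule exI [of _ "%t x. up (- 1) t"])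
   (use up_sum [of 1] up_sum [of "- 1"] holomorphic_A_singleton [where v = "%t x. up 1 t" and x = z, OF h(1) open_bounded_sector] holomorphic_A_singleton [where v = "%t x. up (- 1) t" and x = z, OF h(2) open_bounded_sector] in simp)
 then show ?thesis by (intro exI [of _ \<rho>]) (simp add: \<rho>_def)
qed

end

section \<open>The jump as a hyperfunction\<close>

lemma growth_order_cong:
 assumes g: "growth_order \<kappa> K d \<alpha> v" and eq: "\<And>w z. w \<in> sector d \<alpha> ==> z \<in> K ==> v w z = v' w z"
 shows "growth_order \<kappa> K d \<alpha> v'"
 unfolding growth_order_def
proof (intro allI impI)
 fix d' \<alpha>' assume *: "d - \<alpha> / 2 < d' - \<alpha>' / 2 \<and> d' + \<alpha>' / 2 < d + \<alpha> / 2"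
 have sub: "w \<in> sector d \<alpha>" if "w \<in> sector d' \<alpha>'" for w
  using that * unfolding sector_def mem_Collect_eq by linarith
 obtain C1 C2 where "C1 > 0" "C2 > 0" "\<forall>w\<in>sector d' \<alpha>'. \<forall>z\<in>K. norm (v w z) <= C1 * exp (C2 * exp (Re w) powr \<kappa>)"
  using g * unfolding growth_order_def by blast
 then show "\<exists>C1>0. \<exists>C2>0. \<forall>w\<in>sector d' \<alpha>'. \<forall>z\<in>K. norm (v' w z) <= C1 * exp (C2 * exp (Re w) powr \<kappa>)"
  using eq sub by (intro exI [of _ C1] conjI exI [of _ C2]) auto
qed

lemma borel_growth_mono:
 assumes "borel_growth \<kappa> K d \<epsilon> v" "\<epsilon>' <= \<epsilon>"
 shows "borel_growth \<kappa> K d \<epsilon>' v"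
proof (rule borel_growthI)
 have sub: "sector d \<epsilon>' \<subseteq> sector d \<epsilon>" using assms(2) by (auto simp: sector_def)
 show "v w \<in> A_space K" if "w \<in> sector d \<epsilon>'" for w using assms sub that by (auto simp: borel_growth_def)
 show "(%w. v w z) holomorphic_on sector d \<epsilon>'" if "z \<in> K" for z
  using assms sub that by (auto simp: borel_growth_def intro: holomorphic_on_subset)
 fix \<delta> :: real assume d: "\<delta> > 0"
 obtain C1 C2 where C: "C1 > 0" "C2 > 0" "\<And>w z. \<bar>Im w - d\<bar> <= \<epsilon> / 2 - \<delta> ==> z \<in> K ==> norm (v w z) <= C1 * exp (C2 * exp (\<kappa> * Re w))"
  by (rule borel_growthE [OF assms(1) d], rule that)
 show "\<exists>C1>0. \<exists>C2>0. \<forall>w. \<bar>Im w - d\<bar> <= \<epsilon>' / 2 - \<delta> --> (\<forall>z\<in>K. norm (v w z) <= C1 * exp (C2 * exp (\<kappa> * Re w)))"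
  using C assms(2) by (intro exI [of _ C1] conjI exI [of _ C2]) auto
qed

lemma open_slit_domain: "open (slit_domain d \<alpha> \<rho>)"
proof -
 have "slit_domain d \<alpha> \<rho> = sector d \<alpha> \<inter> ({w. Im w < d} \<union> {w. Im w > d} \<union> {w. exp (Re w) < \<rho>})"
  by (auto simp: slit_domain_def)
 moreover have "open {w. exp (Re w) < \<rho>}" by (intro open_Collect_less continuous_intros)
 ultimately show ?thesis by (simp add: open_Int open_Un open_halfspace_Im_lt open_halfspace_Im_gt)
qed

context stokes_jump
begin

definition "gc w x = continued \<phi> x (shift p q r a arga l w)"

lemma small_quotient: "exp (Re w) < rho ==> norm (sh l w / (z0 - z)) <= 1 / 2" "exp (Re w) < rho ==> norm (sh l w) <= r1 / 4"
proof -
 assume "exp (Re w) < rho"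
 from rho(2) [OF this] show sm: "norm (sh l w) <= r1 / 4" by (simp add: sh_norm)
 have "norm z0 - norm z <= norm (z0 - z)" by (rule norm_triangle_ineq2)
 then have "r1 / 2 <= norm (z0 - z)" using zr pos by linarith
 then have "norm (sh l w) * 2 <= norm (z0 - z)" using sm by linarith
 then show "norm (sh l w / (z0 - z)) <= 1 / 2" using zn(4) by (simp add: norm_divide divide_le_eq)
qed

lemma off_slit:
 assumes "\<bar>Im w - d\<bar> < dq" "Im w \<noteq> d \<or> exp (Re w) < rho"
 shows "1 - sh l w / (z0 - z) \<notin> \<real>\<^sub>\<le>\<^sub>0"
 using assms(2)
proof
 assume ne: "Im w \<noteq> d"
 obtain s :: real where s: "s = 1 \<or> s = - 1" "0 < s * (Im w - d)" "s * (Im w - d) < dq"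
 proof (cases "Im w > d")
  case True then show ?thesis using that [of 1] assms(1) by simp
 next
  case False then show ?thesis using that [of "- 1"] ne assms(1) by simp
 qed
 have i: "0 < s * Im (\<zeta> w)" "s * Im (\<zeta> w) < pi" using Im_zeta [OF s(2,3)] by auto
 have "Im (\<zeta> w) \<noteq> 2 * pi * of_int k" for k :: int
 proof
  assume eq: "Im (\<zeta> w) = 2 * pi * of_int k"
  then have "k \<noteq> 0" using i by auto
  then have "2 * pi * 1 <= 2 * pi * \<bar>real_of_int k\<bar>" by (intro mult_left_mono) auto
  moreover have "\<bar>Im (\<zeta> w)\<bar> = 2 * pi * \<bar>real_of_int k\<bar>" unfolding eq by (simp add: abs_mult)
  moreover have "\<bar>Im (\<zeta> w)\<bar> < pi" using i s(1) by (elim disjE) auto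
  ultimately show False using pi_gt_zero by linarith
 qed
 from one_minus_exp_notin_nonpos_Reals [OF this]
 show ?thesis using sh_quotient [OF th zn(4), of l w] by (simp add: \<zeta>_def zt_def)
next
 assume "exp (Re w) < rho"
 from small_quotient(1) [OF this] have "Re (sh l w / (z0 - z)) <= 1 / 2" using complex_Re_le_cmod order_trans by blast
 then show ?thesis by (simp add: complex_nonpos_Reals_iff)
qed

lemma gc_eq: "\<bar>Im w - d\<bar> < dq ==> Im w \<noteq> d \<or> exp (Re w) < rho ==> gc w z = Psi z (sh l w)"
 unfolding gc_def sh_def [symmetric] by (rule continued_Psi [OF zn(2) off_slit])

lemma slit_space_gc: "slit_space \<kappa> {z} d dq rho gc"
 unfolding slit_space_def
proof (intro conjI)
 show "0 < dq" "0 < rho" by (rule dq rho)+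
 have dom: "\<bar>Im w - d\<bar> < dq" "Im w \<noteq> d \<or> exp (Re w) < rho" if "w \<in> slit_domain d dq rho" for w
 proof -
  have "\<bar>Im w - d\<bar> < dq / 2" using that by (simp add: slit_domain_def sector_def)
  then show "\<bar>Im w - d\<bar> < dq" using dq(1) by linarith
  show "Im w \<noteq> d \<or> exp (Re w) < rho" using that by (simp add: slit_domain_def)
 qed
 have "(%w. Psi z (sh l w)) holomorphic_on slit_domain d dq rho"
  by (rule holomorphic_on_compose_gen [OF sh_hol Psi_hol_h [OF zn(1)], unfolded o_def]) (use off_slit [OF dom] in auto)
 then have "(%w. gc w z) holomorphic_on slit_domain d dq rho"
  by (rule holomorphic_transform) (use gc_eq [OF dom] in auto)
 then show "holomorphic_A {z} gc (slit_domain d dq rho)" by (rule holomorphic_A_singleton) (rule open_slit_domain)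
 define k where "k = real r / (real p - 1 + real r)"
 have k: "k > 0" using r by (simp add: k_def divide_pos_pos)
 have "(0::real) < 1 / 2" by simp
 from Psi_growth [OF this, folded k_def] obtain C1 C2 where C: "C1 > 0" "C2 > 0"
  and bd: "\<And>z h. norm z <= norm z0 / 2 ==> 1 / 2 <= norm (1 - h / (z0 - z)) ==> norm (Psi z h) <= C1 * exp (C2 * norm h powr k)" by blast
 have "norm (gc w z) <= C1 * exp (C2 * (r1 / 4) powr k)" if w: "w \<in> bounded_sector d dq rho" for w
 proof -
  have w': "exp (Re w) < rho" "\<bar>Im w - d\<bar> < dq" using w dq(1) by (auto simp: bounded_sector_def sector_def)
  have "gc w z = Psi z (sh l w)" by (rule gc_eq) (use w' in auto)
  also have "norm \<dots> <= C1 * exp (C2 * norm (sh l w) powr k)"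
  proof (rule bd)
   show "norm z <= norm z0 / 2" using zr pos by linarith
   show "1 / 2 <= norm (1 - sh l w / (z0 - z))"
    using norm_triangle_ineq2 [of 1 "sh l w / (z0 - z)"] small_quotient(1) [OF w'(1)] by simp
  qed
  also have "\<dots> <= C1 * exp (C2 * (r1 / 4) powr k)"
   using C k small_quotient(2) [OF w'(1)] by (intro mult_left_mono) (auto intro!: powr_mono2)
  finally show ?thesis .
 qed
 then show "\<exists>C. \<forall>w\<in>bounded_sector d dq rho. \<forall>x\<in>{z}. norm (gc w x) <= C" by blast
 \<comment> \<open>Each half of the slit sector has its bisector at distance dq/4 from d, which is
   its nearest singular direction and bounds it.\<close>
 have "growth_order \<kappa> {z} (d + s * (dq / 4)) (dq / 2) gc" if s: "s = 1 \<or> s = - 1" for s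
 proof (rule growth_order_cong)
  show "growth_order \<kappa> {z} (d + s * (dq / 4)) (dq / 2) (%w z. Psi z (sh l w))"
  proof (rule growth_order_borel_growth, rule Psi_sh_growth [where \<theta> = "%_. \<theta>"])
   fix y k assume "y \<in> {z}"
   show "dq / 2 / 2 <= \<bar>sd \<theta> (int l - int r * k) - (d + s * (dq / 4))\<bar>"
   proof (cases "int l - int r * k = int l")
    case True
    then show ?thesis using s dq(1) by (auto simp: d_def)
   next
    case False
    have "\<bar>s * (dq / 4)\<bar> = dq / 4" using s dq(1) by auto
    with sd_dist [OF False, of \<theta>] show ?thesis unfolding d_def by linarith
   qed
  qed (use zr th in auto)
  fix w y assume *: "w \<in> sector (d + s * (dq / 4)) (dq / 2)" "y \<in> {z}"
  have "\<bar>s * (dq / 4)\<bar> = dq / 4" using s dq(1) by auto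
  moreover have "\<bar>Im w - (d + s * (dq / 4))\<bar> < dq / 2 / 2" using *(1) by (simp add: sector_def)
  ultimately have "\<bar>Im w - d\<bar> < dq" "Im w \<noteq> d" using dq(1) by linarith+
  then show "Psi y (sh l w) = gc w y" using gc_eq [of w] *(2) by simp
 qed
 from this [of "- 1"] this [of 1]
 show "growth_order \<kappa> {z} (d - dq / 4) (dq / 2) gc" "growth_order \<kappa> {z} (d + dq / 4) (dq / 2) gc" by simp_all
qed

lemma gc_in_hyperfunction: "gc \<in> laplace_hyperfunction \<kappa> {z} d gc"
proof -
 have h0: "holomorphic_A {z} (%w x. 0) S" if "open S" for S
  by (rule holomorphic_A_singleton [OF _ that]) simp
 have "growth_order \<kappa> {z} d dq (%w x. 0)" unfolding growth_order_def
  by (intro allI impI exI [of _ 1] conjI ballI) auto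
 then have "disc_sector_space \<kappa> {z} d dq (%t x. 0) (%w x. 0)"
  unfolding disc_sector_space_def using h0 [OF open_sector] h0 [OF open_ball] dq(1) by (intro conjI exI [of _ 1]) auto
 then show ?thesis unfolding laplace_hyperfunction_def mem_Collect_eq using slit_space_gc
  by (intro exI [of _ dq] exI [of _ rho] exI [of _ "%t x. 0"]) simp
qed

text \<open>Any defining function is gc + F with F regular across d. Dividing by r and splitting off
  \<open>V\<close> leaves W = (F - Rest) / r, also regular across d: its integrals on both sides
  agree by rotation and cancel, while those of \<open>V\<close> are the two lateral sums.\<close>

lemma hyperfunction:
 "hyperfunction_value \<kappa> {z} d (laplace_hyperfunction \<kappa> {z} d gc) (%t s. e (s - t) / (of_nat r * exp s)) (%t x. up 1 t - up (- 1) t)"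
 unfolding hyperfunction_value_def
proof (intro conjI ballI allI impI)
 show "laplace_hyperfunction \<kappa> {z} d gc \<noteq> {}" using gc_in_hyperfunction by blast
 fix h \<eta> assume h: "h \<in> laplace_hyperfunction \<kappa> {z} d gc" and eta: "(0::real) < \<eta>"
 obtain \<alpha> \<rho>1 F0 F where F: "disc_sector_space \<kappa> {z} d \<alpha> F0 F" and hF: "\<forall>w\<in>slit_domain d \<alpha> \<rho>1. \<forall>x\<in>{z}. h w x - gc w x = F w x"
  using h unfolding laplace_hyperfunction_def mem_Collect_eq by (elim exE conjE) (rule that)
 have al: "\<alpha> > 0" using F by (simp add: disc_sector_space_def)
 define \<alpha>' where "\<alpha>' = min \<alpha> (2 * dq)"
 have al': "0 < \<alpha>'" "\<alpha>' <= \<alpha>" "\<alpha>' <= 2 * dq" using al dq(1) by (auto simp: \<alpha>'_def)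
 define W where "W w x = (1 / of_nat r) * F w x + (- 1 / of_nat r) * (1 * Rest w)" for w x
 have Wg: "borel_growth \<kappa> {z} d \<alpha>' W" unfolding W_def [abs_def]
  by (rule borel_growth_lin [OF borel_growth_mono [OF borel_growth_of_disc_sector [OF F] al'(2)] borel_growth_mono [OF Rest_growth al'(3)]])
 define \<delta> where "\<delta> = min (\<eta> / 4) (\<alpha>' / 4)"
 have dl: "\<delta> > 0" unfolding \<delta>_def min_less_iff_conj using eta al' by simp
 have dl': "\<delta> <= \<eta> / 4" "\<delta> <= \<alpha>' / 4" unfolding \<delta>_def by (rule min.cobounded1, rule min.cobounded2)
 obtain T1 where T1: "\<forall>x t. 0 < 1 * (x - d) --> 1 * (x - d) < 2 * \<epsilon> --> \<bar>x - Im t\<bar> <= P - \<delta> --> Re t < T1 -->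
  up 1 t = laplace_log e x (%w. V w z) t \<and> integrable lborel (%y. e (Complex y x - t) * V (Complex y x) z)"
  using up_line [OF _ dl, of 1] by auto
 obtain T2 where T2: "\<forall>x t. 0 < - 1 * (x - d) --> - 1 * (x - d) < 2 * \<epsilon> --> \<bar>x - Im t\<bar> <= P - \<delta> --> Re t < T2 -->
  up (- 1) t = laplace_log e x (%w. V w z) t \<and> integrable lborel (%y. e (Complex y x - t) * V (Complex y x) z)"
  using up_line [OF _ dl, of "- 1"] by auto
 obtain T3 where T3: "\<forall>x t y. \<bar>x - d\<bar> <= \<alpha>' / 2 - \<delta> --> \<bar>x - Im t\<bar> <= pi / \<kappa> / 2 - \<delta> --> Re t < T3 --> y \<in> {z} -->
   integrable lborel (%v. e (Complex v x - t) * W (Complex v x) y)"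
  using laplace_integrable [OF pos(1) kernel(2) Wg dl] by (elim exE) (rule that)
 obtain T4 where T4: "\<forall>x x' t y. \<bar>x - d\<bar> <= \<alpha>' / 2 - \<delta> --> \<bar>x - Im t\<bar> <= pi / \<kappa> / 2 - \<delta> -->
   \<bar>x' - d\<bar> <= \<alpha>' / 2 - \<delta> --> \<bar>x' - Im t\<bar> <= pi / \<kappa> / 2 - \<delta> --> Re t < T4 --> y \<in> {z} -->
   laplace_log e x (%w. W w y) t = laplace_log e x' (%w. W w y) t"
  using laplace_rotate [OF pos(1) kernel(2) Wg dl] by (elim exE) (rule that)
 define T where "T = min (min T1 T2) (min T3 T4)"
 \<comment> \<open>Below 2 \<epsilon> both directions stay in the lateral sectors; \<alpha>'/4 and
   \<eta>/4 leave the margin \<delta> in the sector of W and in the strip of the kernel.\<close>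
 define \<sigma> where "\<sigma> = min (2 * \<epsilon>) (min (\<alpha>' / 4) (\<eta> / 4))"
 have sg: "\<sigma> > 0" unfolding \<sigma>_def min_less_iff_conj using eta al' eps by simp
 have sg': "\<sigma> <= 2 * \<epsilon>" "\<sigma> <= \<alpha>' / 4" "\<sigma> <= \<eta> / 4" unfolding \<sigma>_def by (rule min.cobounded1 | rule min.cobounded2 | rule min.coboundedI2)+
 have main: "ray_integrable x (%w. h w z * (e (w - t) / (of_nat r * exp w))) \<and>
   ray_integral x (%w. h w z * (e (w - t) / (of_nat r * exp w))) = up s t + laplace_log e x (%w. W w z) t"
  if t: "Re t < T" "\<bar>Im t - d\<bar> < P - \<eta> / 2" and x: "\<bar>x - d\<bar> < \<sigma>" "s = 1 \<and> d < x \<or> s = - 1 \<and> x < d" for t x s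
 proof -
  have tT: "Re t < T1" "Re t < T2" "Re t < T3" using t by (auto simp: T_def)
  have xi: "\<bar>x - Im t\<bar> <= P - \<delta>" "\<bar>x - d\<bar> <= \<alpha>' / 2 - \<delta>" using t x(1) sg' dl' al' by linarith+
  have uv: "up s t = laplace_log e x (%w. V w z) t \<and> integrable lborel (%y. e (Complex y x - t) * V (Complex y x) z)"
   using x(2)
  proof
   assume "s = 1 \<and> d < x"
   then show ?thesis using T1 [rule_format, of x t] x(1) sg' xi tT by simp
  next
   assume "s = - 1 \<and> x < d"
   then show ?thesis using T2 [rule_format, of x t] x(1) sg' xi tT by simp
  qed
  have wi: "integrable lborel (%v. e (Complex v x - t) * W (Complex v x) z)"
   using T3 xi tT by (simp add: P_def)
  have eqs: "e (Complex v x - t) * (V (Complex v x) z + W (Complex v x) z) = e (Complex v x - t) * V (Complex v x) z + e (Complex v x - t) * W (Complex v x) z" for v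
   by (rule distrib_left)
  have i: "integrable lborel (%v. e (Complex v x - t) * (V (Complex v x) z + W (Complex v x) z))"
   unfolding eqs using uv wi by (intro Bochner_Integration.integrable_add) auto
  have L: "laplace_log e x (%w. V w z + W w z) t = up s t + laplace_log e x (%w. W w z) t"
   unfolding laplace_log_def eqs using uv wi by (simp add: laplace_log_def Bochner_Integration.integral_add)
  have eq: "h w z * (e (w - t) / (of_nat r * exp w)) = e (w - t) * (V w z + W w z) / exp w" if w: "w = ray_point x v" for w v
  proof -
   have iw: "Im w = x" using w by (simp add: ray_point_def)
   have "\<bar>x - d\<bar> < \<alpha> / 2" using x(1) sg' al' by linarith
   then have "w \<in> slit_domain d \<alpha> \<rho>1" using iw x(2) by (auto simp: slit_domain_def sector_def)
   then have "h w z = gc w z + F w z" using hF by (metis diff_eq_eq add.commute singletonI)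
   moreover have "gc w z = Psi z (sh l w)" by (rule gc_eq) (use iw x sg' eps in auto)
   moreover have "of_nat r * V w z = Rest w + Psi z (sh l w)" using V_split [OF l, of w z] by (simp add: Rest_def)
   moreover have "of_nat r * W w z = F w z - Rest w" using r by (simp add: W_def field_simps)
   ultimately have hw: "h w z = of_nat r * (V w z + W w z)" by (simp add: distrib_left)
   show ?thesis unfolding hw using r by simp
  qed
  have eq': "h (ray_point x v) z * (e (ray_point x v - t) / (of_nat r * exp (ray_point x v))) = e (ray_point x v - t) * (V (ray_point x v) z + W (ray_point x v) z) / exp (ray_point x v)" for v
   by (rule eq) (rule refl)
  show ?thesis
   using moment_laplace_eq [OF i]
   unfolding moment_laplace_converges_def moment_laplace_def ray_integrable_def ray_integral_def eq' L by blast
 qed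
 show "\<exists>\<rho>>0. \<forall>t\<in>bounded_sector d (pi / \<kappa> - \<eta>) \<rho>. \<exists>\<sigma>>0. \<forall>d1 d2.
    d - \<sigma> < d1 \<and> d1 < d \<and> d < d2 \<and> d2 < d + \<sigma> -->
    (\<forall>x\<in>{z}. ray_integrable d1 (%s. h s x * (e (s - t) / (of_nat r * exp s))) \<and> ray_integrable d2 (%s. h s x * (e (s - t) / (of_nat r * exp s))) \<and>
      up 1 t - up (- 1) t = ray_integral d2 (%s. h s x * (e (s - t) / (of_nat r * exp s))) - ray_integral d1 (%s. h s x * (e (s - t) / (of_nat r * exp s))))"
 proof (rule exI [of _ "exp T"], rule conjI, simp, rule ballI, rule exI [of _ \<sigma>], rule conjI, rule sg, intro allI impI ballI)
  fix t d1 d2 x assume t: "t \<in> bounded_sector d (pi / \<kappa> - \<eta>) (exp T)" and dd: "d - \<sigma> < d1 \<and> d1 < d \<and> d < d2 \<and> d2 < d + \<sigma>" and "x \<in> {z}"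
  then have x: "x = z" by simp
  have "\<bar>Im t - d\<bar> < (pi / \<kappa> - \<eta>) / 2" using t by (simp add: bounded_sector_def sector_def)
  then have t': "Re t < T" "\<bar>Im t - d\<bar> < P - \<eta> / 2" using t unfolding P_def diff_divide_distrib by (auto simp: bounded_sector_def)
  have ds: "\<bar>d1 - d\<bar> < \<sigma>" "\<bar>d2 - d\<bar> < \<sigma>" using dd by linarith+
  have m1: "ray_integrable d1 (%w. h w z * (e (w - t) / (of_nat r * exp w))) \<and>
   ray_integral d1 (%w. h w z * (e (w - t) / (of_nat r * exp w))) = up (- 1) t + laplace_log e d1 (%w. W w z) t"
   by (rule main [OF t' ds(1)]) (use dd in simp)
  have m2: "ray_integrable d2 (%w. h w z * (e (w - t) / (of_nat r * exp w))) \<and>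
   ray_integral d2 (%w. h w z * (e (w - t) / (of_nat r * exp w))) = up 1 t + laplace_log e d2 (%w. W w z) t"
   by (rule main [OF t' ds(2)]) (use dd in simp)
  have "laplace_log e d1 (%w. W w z) t = laplace_log e d2 (%w. W w z) t"
  proof (rule T4 [rule_format])
   show "\<bar>d1 - d\<bar> <= \<alpha>' / 2 - \<delta>" "\<bar>d2 - d\<bar> <= \<alpha>' / 2 - \<delta>" using ds sg' dl' al' by linarith+
   show "\<bar>d1 - Im t\<bar> <= pi / \<kappa> / 2 - \<delta>" "\<bar>d2 - Im t\<bar> <= pi / \<kappa> / 2 - \<delta>"
    using ds sg' dl' t' unfolding P_def by linarith+
   show "Re t < T4" using t' by (simp add: T_def)
  qed simp
  then show "ray_integrable d1 (%s. h s x * (e (s - t) / (of_nat r * exp s))) \<and> ray_integrable d2 (%s. h s x * (e (s - t) / (of_nat r * exp s))) \<and>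
      up 1 t - up (- 1) t = ray_integral d2 (%s. h s x * (e (s - t) / (of_nat r * exp s))) - ray_integral d1 (%s. h s x * (e (s - t) / (of_nat r * exp s)))"
   unfolding x using m1 m2 by simp
 qed
qed

end


theorem theorem2:
  fixes p q r :: nat and a z0 :: complex and arga R0 :: real
    and \<phi> :: "complex \<Rightarrow> complex" and u :: "complex \<Rightarrow> complex fps" and e :: "complex \<Rightarrow> complex"
  assumes "r > 1"
    and "a \<noteq> 0" and "a = rcis (norm a) arga"
    and "z0 \<noteq> 0"
    and "R0 > 0" and "\<phi> holomorphic_on ball 0 R0"
    and "covering_growth (real r / (real p - 1 + real r)) z0 \<phi>"
    and "formal_solution p q r a \<phi> (ball 0 R0) u"
    and "is_kernel_function (kappa_order p q r) (moment_pqr p q r) e"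
  shows
    "(\<forall>d. (\<forall>l. d \<noteq> singular_dir q r arga (Arg z0) l) \<longrightarrow>
        (\<exists>R>0. R < R0 \<and> summable_in_direction (kappa_order p q r) (cball 0 R) u d \<and>
          (\<exists>U \<epsilon>0 V. is_sum_in_direction (kappa_order p q r) (cball 0 R) u d U \<and>
            borel_continuation (kappa_order p q r) (moment_pqr p q r) (cball 0 R) u d \<epsilon>0 V \<and>
            (\<forall>\<epsilon>>0. \<exists>rt>0.
               holomorphic2_on U (bounded_sector d (pi / kappa_order p q r - \<epsilon>) rt \<times> ball 0 R) \<and>
               (\<forall>t\<in>bounded_sector d (pi / kappa_order p q r - \<epsilon>) rt. \<forall>z\<in>ball 0 R.
                  moment_laplace_converges e d (\<lambda>s. V s z) t \<and>
                  U t z = moment_laplace e d (\<lambda>s. V s z) t \<and>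
                  ray_integrable d (\<lambda>s. e (s - t) *
                    (\<Sum>j<r. continued \<phi> z (shift p q r a arga j s)) / exp s) \<and>
                  U t z = 1 / of_nat r * ray_integral d (\<lambda>s. e (s - t) *
                    (\<Sum>j<r. continued \<phi> z (shift p q r a arga j s)) / exp s)))))) \<and>
     (\<exists>r0>0. \<forall>z\<in>ball 0 r0. \<forall>\<theta>. z0 - z = rcis (norm (z0 - z)) \<theta> \<longrightarrow>
        kappa_summable (kappa_order p q r) {z} u \<and>
        ((\<nexists>F. F holomorphic_on UNIV \<and> (\<forall>\<^sub>F x in nhds 0. F x = \<phi> x)) \<longrightarrow>
          (\<forall>l<r. stokes_line (kappa_order p q r) {z} u
             (half_line (singular_dir q r arga \<theta> (int l)))))) \<and>
     (\<exists>\<epsilon>0>0. \<forall>\<epsilon>. 0 < \<epsilon> \<and> \<epsilon> < \<epsilon>0 \<longrightarrow>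
        (\<exists>rt>0. \<forall>z\<in>ball 0 rt. \<forall>\<theta>. z0 - z = rcis (norm (z0 - z)) \<theta> \<longrightarrow>
          (\<forall>l<r. \<exists>\<rho>>0. \<exists>J.
             is_jump (kappa_order p q r) {z} u (singular_dir q r arga \<theta> (int l)) \<epsilon> \<rho> J \<and>
             hyperfunction_value (kappa_order p q r) {z} (singular_dir q r arga \<theta> (int l))
               (laplace_hyperfunction (kappa_order p q r) {z} (singular_dir q r arga \<theta> (int l))
                  (\<lambda>s x. continued \<phi> x (shift p q r a arga l s)))
               (\<lambda>t s. e (s - t) / (of_nat r * exp s)) J)))"
proof -
 obtain \<Phi> w0 where Ph: "\<Phi> holomorphic_on UNIV" "z0 + exp w0 = 0" "\<forall>\<^sub>F w in nhds w0. \<Phi> w = \<phi> (z0 + exp w)"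
  and gr: "\<forall>A B R. R > 0 --> (\<exists>C1>0. \<exists>C2>0. \<forall>w. A <= Im w \<and> Im w <= B \<and> exp (Re w) \<ge> R -->
       norm (\<Phi> w) <= C1 * exp (C2 * norm (z0 + exp w) powr (real r / (real p - 1 + real r))))"
  using assms(7) unfolding covering_growth_def by (elim exE conjE) (rule that)
 interpret C: continuation p q r a z0 arga R0 \<phi> u e \<Phi> w0
  by (rule continuation.intro) (use assms Ph gr in simp_all)
 show ?thesis
 proof (rule conjI, use C.sum_formula [unfolded C.sd_def C.\<kappa>_def] in blast, rule conjI)
  show "\<exists>r0>0. \<forall>z\<in>ball 0 r0. \<forall>\<theta>. z0 - z = rcis (norm (z0 - z)) \<theta> -->
    kappa_summable (kappa_order p q r) {z} u \<and>
    ((\<nexists>F. F holomorphic_on UNIV \<and> (\<forall>\<^sub>F x in nhds 0. F x = \<phi> x)) -->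
     (\<forall>l<r. stokes_line (kappa_order p q r) {z} u
       (half_line (singular_dir q r arga \<theta> (int l)))))"
  proof (rule exI [of _ "C.r1 / 4"], intro conjI ballI allI impI)
   fix z \<theta> assume "z \<in> ball 0 (C.r1 / 4)" and th: "z0 - z = rcis (norm (z0 - z)) \<theta>"
   then have z: "norm z <= C.r1 / 4" by simp
   show ks: "kappa_summable (kappa_order p q r) {z} u"
    using C.kappa_summable_point [OF z th] by (simp add: C.\<kappa>_def)
   fix l assume "\<nexists>F. F holomorphic_on UNIV \<and> (\<forall>\<^sub>F x in nhds 0. F x = \<phi> x)" "l < r"
   then have "\<not> summable_in_direction (kappa_order p q r) {z} u (singular_dir q r arga \<theta> (int l))"
    using C.singular_not_summable [OF z th, unfolded C.sd_def C.\<kappa>_def] by blast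
   then show "stokes_line (kappa_order p q r) {z} u (half_line (singular_dir q r arga \<theta> (int l)))"
    unfolding stokes_line_def using ks by blast
  qed (use C.pos in simp)
  show "\<exists>\<epsilon>0>0. \<forall>\<epsilon>. 0 < \<epsilon> \<and> \<epsilon> < \<epsilon>0 -->
    (\<exists>rt>0. \<forall>z\<in>ball 0 rt. \<forall>\<theta>. z0 - z = rcis (norm (z0 - z)) \<theta> -->
     (\<forall>l<r. \<exists>\<rho>>0. \<exists>J.
       is_jump (kappa_order p q r) {z} u (singular_dir q r arga \<theta> (int l)) \<epsilon> \<rho> J \<and>
       hyperfunction_value (kappa_order p q r) {z} (singular_dir q r arga \<theta> (int l))
        (laplace_hyperfunction (kappa_order p q r) {z} (singular_dir q r arga \<theta> (int l))
         (%s x. continued \<phi> x (shift p q r a arga l s)))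
        (%t s. e (s - t) / (of_nat r * exp s)) J))"
  \<comment> \<open>The choice dq/2 gives 2 \<epsilon> < dq, and r1/4 is the radius in z on which
    the Borel transform is controlled, independently of \<epsilon>.\<close>
  proof (rule exI [of _ "C.dq / 2"], rule conjI, use C.dq in simp, intro allI impI, rule exI [of _ "C.r1 / 4"], rule conjI, use C.pos in simp, intro allI impI ballI)
   fix \<epsilon> z \<theta> l assume ep: "0 < \<epsilon> \<and> \<epsilon> < C.dq / 2" and z: "z \<in> ball 0 (C.r1 / 4)"
    and th: "z0 - z = rcis (norm (z0 - z)) \<theta>" and l: "l < r"
   interpret J: stokes_jump p q r a z0 arga R0 \<phi> u e \<Phi> w0 z \<theta> l \<epsilon>
    by unfold_locales (use ep z th l in auto)
   obtain \<rho> where "\<rho> > 0" "is_jump C.\<kappa> {z} u J.d \<epsilon> \<rho> (%t x. J.up 1 t - J.up (- 1) t)" using J.jump by blast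
   then show "\<exists>\<rho>>0. \<exists>J. is_jump (kappa_order p q r) {z} u (singular_dir q r arga \<theta> (int l)) \<epsilon> \<rho> J \<and>
       hyperfunction_value (kappa_order p q r) {z} (singular_dir q r arga \<theta> (int l))
        (laplace_hyperfunction (kappa_order p q r) {z} (singular_dir q r arga \<theta> (int l))
         (%s x. continued \<phi> x (shift p q r a arga l s)))
        (%t s. e (s - t) / (of_nat r * exp s)) J"
    using J.hyperfunction unfolding C.\<kappa>_def J.d_def C.sd_def J.gc_def [abs_def] by blast
  qed
 qed
qed

end
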